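(* Consider the multivariate Fay-Herriot model described in the context, and assume: (i) $0<k<\infty$ and $0<s<\infty$ are fixed (not depending on $m$); (ii) there exist positive constants $\underline d,\overline d$ not depending on $m$ such that $\underline d\, I_k\le D_i\le\overline d\, I_k$ (Loewner order) for $i=1,\dots,m$; (iii) $X^\top X$ is nonsingular and $X^\top X/m$ converges to a positive definite matrix as $m\to\infty$. Let $\widehat\Psi$ be either $\widehat\Psi_0$ or $\widehat\Psi_1$, let $\widehat\theta_a^{EB}=\widehat\theta_a(\widehat\Psi^+)$ be the corresponding empirical Bayes estimator of $\theta_a=X_a\beta+v_a$ for a given area $a$, let $\mathrm{MSEM}(\widehat\theta_a^{EB})=E[(\widehat\theta_a^{EB}-\theta_a)(\widehat\theta_a^{EB}-\theta_a)^\top]$, and define $$\mathrm{msem}(\widehat\theta_a^{EB})=G_{1a}(\widehat\Psi^+)+G_{2a}(\widehat\Psi^+)+2G_{3a}(\widehat\Psi^+)+G_{4a}(\widehat\Psi^+),$$ with $G_{1a},\dots,G_{4a}$ as in the context. Then, as $m\to\infty$, $$E[G_{1a}(\widehat\Psi^+)+G_{3a}(\widehat\Psi^+)+G_{4a}(\widehat\Psi^+)]=G_{1a}(\Psi)+O(m^{-3/2})$$ and $$E[\mathrm{msem}(\widehat\theta_a^{EB})]=\mathrm{MSEM}(\widehat\theta_a^{EB})+O(m^{-3/2}),$$ namely, $\mathrm{msem}(\widehat\theta_a^{EB})$ is a second-order unbiased estimator of $\mathrm{MSEM}(\widehat\theta_a^{EB})$.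
   Context: Model: for $i=1,\dots,m$, $y_i=X_i\beta+v_i+\varepsilon_i$, where $y_i\in\mathbb R^k$ is observed, $X_i$ is a known nonrandom $k\times s$ matrix, $\beta\in\mathbb R^s$ is a fixed unknown vector, and all the $v_i,\varepsilon_i$ are mutually independent with $v_i\sim\mathcal N_k(0,\Psi)$, $\varepsilon_i\sim\mathcal N_k(0,D_i)$. Here $\Psi$ is a fixed unknown nonsingular $k\times k$ covariance matrix and the $D_i$ are known $k\times k$ covariance matrices. The asymptotics are $m\to\infty$ along a sequence $(X_i,D_i)_{i\ge1}$ with $k,s,\beta,\Psi$ and the area index $a$ fixed. Write $y=(y_1^\top,\dots,y_m^\top)^\top$, $X=(X_1^\top,\dots,X_m^\top)^\top$ and $D=\text{block diag}(D_1,\dots,D_m)$. Generalized least squares: for a nonnegative definite matrix $\Psi$, $$\widehat\beta(\Psi)=\Big\{\sum_{i=1}^m X_i^\top(\Psi+D_i)^{-1}X_i\Big\}^{-1}\sum_{i=1}^m X_i^\top(\Psi+D_i)^{-1}y_i .$$ Ordinary least squares: $\widetilde\beta=(X^\top X)^{-1}X^\top y$. Predictor: $\widehat\theta_a(\Psi)=y_a-D_a(\Psi+D_a)^{-1}\{y_a-X_a\widehat\beta(\Psi)\}$. Estimators of $\Psi$: $$\widehat\Psi_0=\frac1m\sum_{i=1}^m\big\{(y_i-X_i\widetilde\beta)(y_i-X_i\widetilde\beta)^\top-D_i\big\},\qquad \widehat\Psi_1=\widehat\Psi_0-\mathrm{Bias}_{\widehat\Psi_0}(\widehat\Psi_0),$$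 where, for a symmetric $k\times k$ matrix $\Psi$, $$\mathrm{Bias}_{\widehat\Psi_0}(\Psi)=\frac1m\sum_{i=1}^m X_i(X^\top X)^{-1}\Big\{\sum_{j=1}^m X_j^\top(\Psi+D_j)X_j\Big\}(X^\top X)^{-1}X_i^\top-\frac1m\sum_{i=1}^m(\Psi+D_i)X_i(X^\top X)^{-1}X_i^\top-\frac1m\sum_{i=1}^m X_i(X^\top X)^{-1}X_i^\top(\Psi+D_i).$$ Nonnegative definite modification: if $\widehat\Psi=H\Lambda H^\top$ with $H$ orthogonal and $\Lambda=\mathrm{diag}(\lambda_1,\dots,\lambda_k)$, then $\widehat\Psi^+=H\Lambda^+H^\top$ with $\Lambda^+=\mathrm{diag}(\max\{0,\lambda_1\},\dots,\max\{0,\lambda_k\})$. For nonnegative definite $\Psi$ define $$G_{1a}(\Psi)=\Psi(\Psi+D_a)^{-1}D_a\quad(=(\Psi^{-1}+D_a^{-1})^{-1}\text{ if }\Psi\text{ is nonsingular}),$$ $$G_{2a}(\Psi)=D_a(\Psi+D_a)^{-1}X_a\{X^\top(I_m\otimes\Psi+D)^{-1}X\}^{-1}X_a^\top(\Psi+D_a)^{-1}D_a,$$ $$G_{3a}(\Psi)=\frac1{m^2}D_a(\Psi+D_a)^{-1}\Big[\sum_{i=1}^m(\Psi+D_i)(\Psi+D_a)^{-1}(\Psi+D_i)+\sum_{i=1}^m\mathrm{tr}\big[(\Psi+D_i)(\Psi+D_a)^{-1}\big](\Psi+D_i)\Big](\Psi+D_a)^{-1}D_a,$$ $$G_{4a}(\Psi)=-D_a(\Psi+D_a)^{-1}\,\mathrm{Bias}_{\widehat\Psi}(\Psi)\,(\Psi+D_a)^{-1}D_a,$$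 where $\mathrm{Bias}_{\widehat\Psi}(\Psi)=\mathrm{Bias}_{\widehat\Psi_0}(\Psi)$ if $\widehat\Psi=\widehat\Psi_0$ is used, and $\mathrm{Bias}_{\widehat\Psi}(\Psi)=0$ if $\widehat\Psi=\widehat\Psi_1$ is used. *)

theory Defs
  imports "HOL-Probability.Probability" "HOL-Library.Landau_Symbols"
begin

section \<open>Matrices\<close>

definition pos_semidef :: "real^'n^'n \<Rightarrow> bool" where
  "pos_semidef A \<longleftrightarrow> transpose A = A \<and> (\<forall>x. 0 \<le> x \<bullet> (A *v x))"

definition pos_def :: "real^'n^'n \<Rightarrow> bool" where
  "pos_def A \<longleftrightarrow> transpose A = A \<and> (\<forall>x. x \<noteq> 0 \<longrightarrow> 0 < x \<bullet> (A *v x))"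

definition loewner_le :: "real^'n^'n \<Rightarrow> real^'n^'n \<Rightarrow> bool" where
  "loewner_le A B \<longleftrightarrow> pos_semidef (B - A)"

definition diag_mat :: "('n \<Rightarrow> real) \<Rightarrow> real^'n^'n" where
  "diag_mat l = (\<chi> i j. if i = j then l i else 0)"

definition outer :: "real^'n \<Rightarrow> real^'n \<Rightarrow> real^'n^'n" where
  "outer x y = (\<chi> i j. x $ i * y $ j)"

text \<open>For symmetric \<open>A\<close> the matrix below exists and does not depend on the choice of the
  spectral decomposition. The value is unspecified if \<open>A\<close> is not symmetric.\<close>

definition nnd_part :: "real^'n^'n \<Rightarrow> real^'n^'n" where
  "nnd_part A = (SOME B. \<exists>H l. orthogonal_matrix H \<and>
     A = H ** diag_mat l ** transpose H \<and>
     B = H ** diag_mat (\<lambda>i. max 0 (l i)) ** transpose H)"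


section \<open>Multivariate normal random vectors\<close>

text \<open>\<open>Z\<close> is normal with mean \<open>\<mu>\<close> and covariance matrix \<open>\<Sigma>\<close> (possibly singular) if every
  linear form \<open>c \<bullet> Z\<close> is univariate normal with mean \<open>c \<bullet> \<mu>\<close> and variance \<open>c \<bullet> \<Sigma> c\<close>,
  where a normal variable of variance zero is almost surely constant. The second argument of
  \<^const>\<open>normal_density\<close> is the standard deviation.\<close>

definition multivariate_normal ::
  "'w measure \<Rightarrow> ('w \<Rightarrow> real^'n) \<Rightarrow> real^'n \<Rightarrow> real^'n^'n \<Rightarrow> bool" where
  "multivariate_normal M Z \<mu> \<Sigma> \<longleftrightarrow>
     pos_semidef \<Sigma> \<and> Z \<in> borel_measurable M \<and>
     (\<forall>c. if c \<bullet> (\<Sigma> *v c) = 0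
          then AE \<omega> in M. c \<bullet> Z \<omega> = c \<bullet> \<mu>
          else distributed M lborel (\<lambda>\<omega>. c \<bullet> Z \<omega>)
                 (normal_density (c \<bullet> \<mu>) (sqrt (c \<bullet> (\<Sigma> *v c)))))"


section \<open>Least squares and the predictor\<close>

text \<open>The areas are \<open>1, \<dots>, m\<close>. A family \<open>X\<close> of \<open>k \<times> s\<close> matrices stands for the stacked matrix
  with blocks \<open>X 1, \<dots>, X m\<close>, and a family \<open>Y\<close> of vectors for the stacked data vector. Products
  with stacked or block diagonal matrices are sums over the blocks; in particular
  \<open>gram X m\<close> is \<open>X\<^sup>T X\<close>.\<close>

definition gram :: "(nat \<Rightarrow> real^'s^'k) \<Rightarrow> nat \<Rightarrow> real^'s^'s" where
  "gram X m = (\<Sum>i\<in>{1..m}. transpose (X i) ** X i)"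

definition ols :: "(nat \<Rightarrow> real^'s^'k) \<Rightarrow> nat \<Rightarrow> (nat \<Rightarrow> real^'k) \<Rightarrow> real^'s" where
  "ols X m Y = matrix_inv (gram X m) *v (\<Sum>i\<in>{1..m}. transpose (X i) *v Y i)"

text \<open>\<open>gls_info X D m \<Psi>\<close> is \<open>X\<^sup>T (I\<^sub>m \<otimes> \<Psi> + D)\<^sup>-\<^sup>1 X\<close>; see the lemma after it.\<close>

definition gls_info ::
  "(nat \<Rightarrow> real^'s^'k) \<Rightarrow> (nat \<Rightarrow> real^'k^'k) \<Rightarrow> nat \<Rightarrow> real^'k^'k \<Rightarrow> real^'s^'s" where
  "gls_info X D m \<Psi> = (\<Sum>i\<in>{1..m}. transpose (X i) ** matrix_inv (\<Psi> + D i) ** X i)"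

text \<open>\<open>V\<close> below is the array of blocks of \<open>I\<^sub>m \<otimes> \<Psi> + D\<close>, and \<open>W\<close> that of its inverse.\<close>

lemma gls_info_block:
  fixes X :: "nat \<Rightarrow> real^'s^'k" and D :: "nat \<Rightarrow> real^'k^'k" and \<Psi> :: "real^'k^'k"
    and W V :: "nat \<Rightarrow> nat \<Rightarrow> real^'k^'k"
  defines "V \<equiv> \<lambda>i j. if i = j then \<Psi> + D i else 0"
  assumes inv: "\<And>i j. i \<in> {1..m} \<Longrightarrow> j \<in> {1..m} \<Longrightarrow>
      (\<Sum>l\<in>{1..m}. V i l ** W l j) = (if i = j then mat 1 else 0)"
  shows "(\<Sum>i\<in>{1..m}. \<Sum>j\<in>{1..m}. transpose (X i) ** W i j ** X j) = gls_info X D m \<Psi>"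
proof -
  have W: "(\<Psi> + D i) ** W i j = (if i = j then mat 1 else 0)"
    if "i \<in> {1..m}" "j \<in> {1..m}" for i j
  proof -
    have "(\<Sum>l\<in>{1..m}. V i l ** W l j) = (\<Sum>l\<in>{1..m}. if i = l then (\<Psi> + D i) ** W l j else 0)"
      by (intro sum.cong) (auto simp: V_def)
    also have "\<dots> = (\<Psi> + D i) ** W i j"
      using that by simp
    finally show ?thesis using inv[OF that] by simp
  qed
  have inv_unique: "matrix_inv A = B" if "A ** B = mat 1" for A B :: "real^'k^'k"
  proof -
    have "invertible A"
      using that matrix_left_right_inverse invertible_def by blast
    then have "matrix_inv A ** A = mat 1"
      unfolding invertible_def matrix_inv_def by (metis (mono_tags, lifting) someI_ex)
    then show ?thesis
      by (metis matrix_mul_assoc matrix_mul_lid matrix_mul_rid that)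
  qed
  have "W i j = (if i = j then matrix_inv (\<Psi> + D i) else 0)"
    if ij: "i \<in> {1..m}" "j \<in> {1..m}" for i j
  proof (cases "i = j")
    case True
    then show ?thesis using W[OF ij] inv_unique by simp
  next
    case False
    have 1: "(\<Psi> + D i) ** W i i = mat 1" using W[OF ij(1) ij(1)] by simp
    then have "W i i ** (\<Psi> + D i) = mat 1" using matrix_left_right_inverse by blast
    then have "W i j = W i i ** ((\<Psi> + D i) ** W i j)" by (simp add: matrix_mul_assoc)
    with W[OF ij] False show ?thesis by simp
  qed
  then have "(\<Sum>i\<in>{1..m}. \<Sum>j\<in>{1..m}. transpose (X i) ** W i j ** X j) =
     (\<Sum>i\<in>{1..m}. \<Sum>j\<in>{1..m}.
        if i = j then transpose (X i) ** matrix_inv (\<Psi> + D i) ** X i else 0)"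
    by (intro sum.cong refl) auto
  then show ?thesis by (simp add: gls_info_def)
qed

definition gls ::
  "(nat \<Rightarrow> real^'s^'k) \<Rightarrow> (nat \<Rightarrow> real^'k^'k) \<Rightarrow> nat \<Rightarrow> real^'k^'k \<Rightarrow> (nat \<Rightarrow> real^'k) \<Rightarrow> real^'s"
  where
  "gls X D m \<Psi> Y = matrix_inv (gls_info X D m \<Psi>) *v
     (\<Sum>i\<in>{1..m}. transpose (X i) *v (matrix_inv (\<Psi> + D i) *v Y i))"

definition theta_hat ::
  "(nat \<Rightarrow> real^'s^'k) \<Rightarrow> (nat \<Rightarrow> real^'k^'k) \<Rightarrow> nat \<Rightarrow> nat \<Rightarrow> real^'k^'k \<Rightarrow> (nat \<Rightarrow> real^'k) \<Rightarrow> real^'k"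
  where
  "theta_hat X D m a \<Psi> Y =
     Y a - D a *v (matrix_inv (\<Psi> + D a) *v (Y a - X a *v gls X D m \<Psi> Y))"


section \<open>Estimators of the covariance matrix\<close>

definition Psi0_hat ::
  "(nat \<Rightarrow> real^'s^'k) \<Rightarrow> (nat \<Rightarrow> real^'k^'k) \<Rightarrow> nat \<Rightarrow> (nat \<Rightarrow> real^'k) \<Rightarrow> real^'k^'k" where
  "Psi0_hat X D m Y = (1 / real m) *\<^sub>R
     (\<Sum>i\<in>{1..m}. outer (Y i - X i *v ols X m Y) (Y i - X i *v ols X m Y) - D i)"

definition bias0 ::
  "(nat \<Rightarrow> real^'s^'k) \<Rightarrow> (nat \<Rightarrow> real^'k^'k) \<Rightarrow> nat \<Rightarrow> real^'k^'k \<Rightarrow> real^'k^'k" where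
  "bias0 X D m \<Psi> =
     (1 / real m) *\<^sub>R (\<Sum>i\<in>{1..m}. X i ** matrix_inv (gram X m) **
        (\<Sum>j\<in>{1..m}. transpose (X j) ** (\<Psi> + D j) ** X j) **
        matrix_inv (gram X m) ** transpose (X i))
   - (1 / real m) *\<^sub>R (\<Sum>i\<in>{1..m}.
        (\<Psi> + D i) ** X i ** matrix_inv (gram X m) ** transpose (X i))
   - (1 / real m) *\<^sub>R (\<Sum>i\<in>{1..m}.
        X i ** matrix_inv (gram X m) ** transpose (X i) ** (\<Psi> + D i))"

definition Psi1_hat ::
  "(nat \<Rightarrow> real^'s^'k) \<Rightarrow> (nat \<Rightarrow> real^'k^'k) \<Rightarrow> nat \<Rightarrow> (nat \<Rightarrow> real^'k) \<Rightarrow> real^'k^'k" where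
  "Psi1_hat X D m Y = Psi0_hat X D m Y - bias0 X D m (Psi0_hat X D m Y)"

datatype estimator = Est0 | Est1

fun Psi_hat ::
  "estimator \<Rightarrow> (nat \<Rightarrow> real^'s^'k) \<Rightarrow> (nat \<Rightarrow> real^'k^'k) \<Rightarrow> nat \<Rightarrow> (nat \<Rightarrow> real^'k) \<Rightarrow> real^'k^'k"
  where
  "Psi_hat Est0 X D m Y = Psi0_hat X D m Y"
| "Psi_hat Est1 X D m Y = Psi1_hat X D m Y"

fun bias ::
  "estimator \<Rightarrow> (nat \<Rightarrow> real^'s^'k) \<Rightarrow> (nat \<Rightarrow> real^'k^'k) \<Rightarrow> nat \<Rightarrow> real^'k^'k \<Rightarrow> real^'k^'k"
  where
  "bias Est0 X D m \<Psi> = bias0 X D m \<Psi>"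
| "bias Est1 X D m \<Psi> = 0"

definition Psi_hat_plus ::
  "estimator \<Rightarrow> (nat \<Rightarrow> real^'s^'k) \<Rightarrow> (nat \<Rightarrow> real^'k^'k) \<Rightarrow> nat \<Rightarrow> (nat \<Rightarrow> real^'k) \<Rightarrow> real^'k^'k"
  where
  "Psi_hat_plus e X D m Y = nnd_part (Psi_hat e X D m Y)"

definition theta_EB ::
  "estimator \<Rightarrow> (nat \<Rightarrow> real^'s^'k) \<Rightarrow> (nat \<Rightarrow> real^'k^'k) \<Rightarrow> nat \<Rightarrow> nat \<Rightarrow> (nat \<Rightarrow> real^'k) \<Rightarrow> real^'k"
  where
  "theta_EB e X D m a Y = theta_hat X D m a (Psi_hat_plus e X D m Y) Y"


section \<open>Mean squared error matrices\<close>

definition G1 :: "(nat \<Rightarrow> real^'k^'k) \<Rightarrow> nat \<Rightarrow> real^'k^'k \<Rightarrow> real^'k^'k" where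
  "G1 D a \<Psi> = \<Psi> ** matrix_inv (\<Psi> + D a) ** D a"

definition G2 ::
  "(nat \<Rightarrow> real^'s^'k) \<Rightarrow> (nat \<Rightarrow> real^'k^'k) \<Rightarrow> nat \<Rightarrow> nat \<Rightarrow> real^'k^'k \<Rightarrow> real^'k^'k" where
  "G2 X D m a \<Psi> = D a ** matrix_inv (\<Psi> + D a) ** X a ** matrix_inv (gls_info X D m \<Psi>) **
     transpose (X a) ** matrix_inv (\<Psi> + D a) ** D a"

definition G3 :: "(nat \<Rightarrow> real^'k^'k) \<Rightarrow> nat \<Rightarrow> nat \<Rightarrow> real^'k^'k \<Rightarrow> real^'k^'k" where
  "G3 D m a \<Psi> = (1 / (real m)\<^sup>2) *\<^sub>R (D a ** matrix_inv (\<Psi> + D a) **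
     ((\<Sum>i\<in>{1..m}. (\<Psi> + D i) ** matrix_inv (\<Psi> + D a) ** (\<Psi> + D i)) +
      (\<Sum>i\<in>{1..m}. trace ((\<Psi> + D i) ** matrix_inv (\<Psi> + D a)) *\<^sub>R (\<Psi> + D i))) **
     matrix_inv (\<Psi> + D a) ** D a)"

definition G4 ::
  "estimator \<Rightarrow> (nat \<Rightarrow> real^'s^'k) \<Rightarrow> (nat \<Rightarrow> real^'k^'k) \<Rightarrow> nat \<Rightarrow> nat \<Rightarrow> real^'k^'k \<Rightarrow> real^'k^'k"
  where
  "G4 e X D m a \<Psi> =
     - (D a ** matrix_inv (\<Psi> + D a) ** bias e X D m \<Psi> ** matrix_inv (\<Psi> + D a) ** D a)"

definition msem ::
  "estimator \<Rightarrow> (nat \<Rightarrow> real^'s^'k) \<Rightarrow> (nat \<Rightarrow> real^'k^'k) \<Rightarrow> nat \<Rightarrow> nat \<Rightarrow> (nat \<Rightarrow> real^'k) \<Rightarrow> real^'k^'k"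
  where
  "msem e X D m a Y = (let P = Psi_hat_plus e X D m Y in
     G1 D a P + G2 X D m a P + 2 *\<^sub>R G3 D m a P + G4 e X D m a P)"

end

theory Submission
  imports Defs "HOL-Real_Asymp.Real_Asymp"
begin

text \<open>
  Write \<open>u i = v i + \<epsilon> i\<close> and \<open>W = (\<Psi> + D a)\<^sup>-\<^sup>1\<close>. The truncated estimator is \<open>\<Psi> + d\<close>, where \<open>d\<close> equals the
  average \<open>A\<close> of \<open>u i (u i)\<^sup>T - (\<Psi> + D i)\<close> over the areas other than \<open>a\<close>, up to a term which is
  \<open>O(1/m)\<close> in every \<open>L\<^sup>p\<close>. The expansion of \<open>(\<Psi> + d + D a)\<^sup>-\<^sup>1\<close> to second order in \<open>d\<close>, the bias of \<open>d\<close>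
  and Isserlis' formula for \<open>E (A W A)\<close> give the first claim.

  The prediction error splits as \<open>err + b\<close>, where \<open>err = \<epsilon> a - D a W u a\<close> is the error of the Bayes
  predictor for known \<open>\<Psi>\<close> and \<open>\<beta>\<close>. It is independent of all \<open>u i\<close>, while \<open>b\<close> is a function of them, so
  the mixed terms have mean zero. To leading order \<open>b\<close> is \<open>D a W A W u a\<close> plus the contribution of the
  generalized least squares error. The independence of \<open>u a\<close> and \<open>A\<close> turns the second moment of the
  former into \<open>G3\<close>, that of the latter is \<open>G2\<close>, and their mixed moment is negligible.
\<close>

section \<open>Matrices\<close>

text \<open>All remainders have to be small in expectation although they contain inverses of random
  matrices. The truncation makes this possible: since \<open>D i\<close> is bounded below,
  \<open>P + D i\<close> has an inverse bounded by one constant for every positive semidefinite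
  \<open>P\<close>. Resolvent identities with exact remainders therefore replace Taylor expansions,
  and no exceptional event is cut out; even the truncation enters only through a pointwise cubic
  bound. The factor 2 of \<open>G3\<close> has two origins: the quadratic term in the expansion of
  \<open>G1\<close> has a negative sign and expectation \<open>- G3\<close> to leading order, and
  \<open>b\<close> adds another \<open>G3\<close> to the mean squared error. \<open>G4\<close>
  cancels the mean of the linear term, which is the bias of the estimator. \<open>G2\<close> has
  order \<open>1/m\<close> already, so evaluating it at the estimator costs only order
  \<open>3/2\<close>. The design gives no separate bound for a single \<open>X i\<close>, only a sum
  of squares of order \<open>m\<close>, so linear statistics are controlled through their squared
  weights. The weights of generalized least squares depend on all the data; expanding them in
  \<open>d\<close> exposes sums with fixed weights again.\<close>

lemma norm_matrix_vector_mult_le: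
  fixes A :: "real^'n^'m"
  shows "norm (A *v x) \<le> norm A * norm x"
proof -
  have "norm (A *v x) = L2_set (\<lambda>i. norm ((A *v x) $ i)) UNIV"
    by (simp add: norm_vec_def)
  also have "\<dots> \<le> L2_set (\<lambda>i. norm (A $ i) * norm x) UNIV"
    by (intro L2_set_mono) (auto simp: matrix_vector_mul_component Cauchy_Schwarz_ineq2)
  also have "\<dots> = norm A * norm x"
    by (simp add: norm_vec_def[of A] L2_set_left_distrib)
  finally show ?thesis .
qed

lemma norm_transpose: "norm (transpose A) = norm (A :: real^'n^'m)"
proof -
  have "inner (transpose A) (transpose A) = inner A A"
    unfolding inner_vec_def transpose_def by simp (rule sum.swap)
  then show ?thesis by (simp add: norm_eq_sqrt_inner)
qed

text \<open>The norm of \<open>real^'n^'m\<close> is the Frobenius norm, and row \<open>i\<close> of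
  \<open>A ** B\<close> is \<open>transpose B\<close> applied to row \<open>i\<close> of
  \<open>A\<close>, so the bound for vectors applies row by row.\<close>

lemma norm_matrix_mult_le:
  fixes A :: "real^'n^'m" and B :: "real^'p^'n"
  shows "norm (A ** B) \<le> norm A * norm B"
proof -
  have row: "(A ** B) $ i = transpose B *v (A $ i)" for i
    by (simp add: vec_eq_iff matrix_matrix_mult_def matrix_vector_mult_def transpose_def mult.commute)
  have "norm (A ** B) = L2_set (\<lambda>i. norm ((A ** B) $ i)) UNIV"
    by (simp add: norm_vec_def)
  also have "\<dots> \<le> L2_set (\<lambda>i. norm (A $ i) * norm B) UNIV"
  proof (intro L2_set_mono)
    fix i
    show "norm ((A ** B) $ i) \<le> norm (A $ i) * norm B"
      using norm_matrix_vector_mult_le[of "transpose B" "A $ i"] row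
      by (simp only: norm_transpose mult.commute)
  qed auto
  also have "\<dots> = norm A * norm B"
    by (simp add: norm_vec_def[of A] L2_set_left_distrib)
  finally show ?thesis .
qed

text \<open>From the general theory of bounded bilinear maps the matrix product inherits
  distributivity over finite sums, continuity, measurability and the product rule for stochastic
  orders.\<close>

lemma bounded_bilinear_matrix_mult:
  "bounded_bilinear (\<lambda>(A :: real^'n^'m) (B :: real^'p^'n). A ** B)"
proof
  show "\<exists>K. \<forall>a b. norm ((a :: real^'n^'m) ** (b :: real^'p^'n)) \<le> norm a * norm b * K"
    using norm_matrix_mult_le by (intro exI[of _ 1]) auto
qed (simp_all add: vec_eq_iff matrix_matrix_mult_def algebra_simps sum.distrib sum_distrib_left)

lemma bounded_bilinear_matrix_vector_mult:
  "bounded_bilinear (\<lambda>(A :: real^'n^'m) x. A *v x)"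
proof
  show "\<exists>K. \<forall>a b. norm ((a :: real^'n^'m) *v b) \<le> norm a * norm b * K"
    using norm_matrix_vector_mult_le by (intro exI[of _ 1]) auto
qed (simp_all add: vec_eq_iff matrix_vector_mult_def algebra_simps sum.distrib sum_distrib_left)

lemma norm_outer: "norm (outer x y) = norm x * norm y"
proof -
  have "(outer x y) $ i = x $ i *\<^sub>R y" for i
    by (simp add: vec_eq_iff outer_def)
  then have "norm (outer x y) = L2_set (\<lambda>i. norm (x $ i) * norm y) UNIV"
    by (simp add: norm_vec_def[of "outer x y"])
  also have "\<dots> = norm x * norm y"
    by (simp add: norm_vec_def[of x] L2_set_left_distrib)
  finally show ?thesis .
qed

lemma bounded_bilinear_outer: "bounded_bilinear outer"
proof
  show "\<exists>K. \<forall>a b. norm (outer a b) \<le> norm a * norm b * K"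
    by (intro exI[of _ 1]) (auto simp: norm_outer)
qed (simp_all add: vec_eq_iff outer_def algebra_simps)

lemma bounded_linear_transpose: "bounded_linear (transpose :: real^'n^'m \<Rightarrow> real^'m^'n)"
proof (rule bounded_linear_intro[where K=1])
  show "norm (transpose A :: real^'m^'n) \<le> norm A * 1" for A :: "real^'n^'m"
    by (simp add: norm_transpose)
qed (simp_all add: vec_eq_iff transpose_def)

lemmas matrix_mult_diff_left = bounded_bilinear.diff_left[OF bounded_bilinear_matrix_mult]
lemmas matrix_mult_diff_right = bounded_bilinear.diff_right[OF bounded_bilinear_matrix_mult]
lemmas matrix_mult_minus_left = bounded_bilinear.minus_left[OF bounded_bilinear_matrix_mult]
lemmas matrix_mult_minus_right = bounded_bilinear.minus_right[OF bounded_bilinear_matrix_mult]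
lemmas matrix_mult_add_left = bounded_bilinear.add_left[OF bounded_bilinear_matrix_mult]
lemmas matrix_mult_add_right = bounded_bilinear.add_right[OF bounded_bilinear_matrix_mult]
lemmas matrix_mult_scale_left = bounded_bilinear.scaleR_left[OF bounded_bilinear_matrix_mult]
lemmas matrix_mult_scale_right = bounded_bilinear.scaleR_right[OF bounded_bilinear_matrix_mult]
lemmas matrix_mult_sum_left = bounded_bilinear.sum_left[OF bounded_bilinear_matrix_mult]
lemmas matrix_mult_sum_right = bounded_bilinear.sum_right[OF bounded_bilinear_matrix_mult]
lemmas matrix_mult_zero_left = bounded_bilinear.zero_left[OF bounded_bilinear_matrix_mult]
lemmas matrix_mult_zero_right = bounded_bilinear.zero_right[OF bounded_bilinear_matrix_mult]
lemmas matrix_mult_algebra =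
  matrix_mult_add_left matrix_mult_add_right matrix_mult_diff_left matrix_mult_diff_right
  matrix_mult_minus_left matrix_mult_minus_right matrix_mult_scale_left matrix_mult_scale_right
  matrix_mult_zero_left matrix_mult_zero_right

lemmas transpose_sum = linear_sum[OF bounded_linear.linear[OF bounded_linear_transpose]]
lemmas transpose_add = linear_add[OF bounded_linear.linear[OF bounded_linear_transpose]]
lemmas transpose_diff = linear_diff[OF bounded_linear.linear[OF bounded_linear_transpose]]
lemmas transpose_scaleR = linear_scale[OF bounded_linear.linear[OF bounded_linear_transpose]]

lemma inner_transpose_mult: "x \<bullet> (transpose A *v y) = (A *v x) \<bullet> (y :: real^'m)"
  for A :: "real^'n^'m"
  by (metis dot_lmul_matrix inner_commute transpose_matrix_vector)

lemma transpose_outer: "transpose (outer x y) = outer y x"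
  by (simp add: vec_eq_iff transpose_def outer_def)

lemma outer_mult:
  fixes A B :: "real^'n^'m"
  shows "outer (A *v x) (B *v y) = A ** outer x y ** transpose B"
  unfolding vec_eq_iff
proof (intro allI)
  fix i j
  have "outer (A *v x) (B *v y) $ i $ j = (\<Sum>k\<in>UNIV. \<Sum>l\<in>UNIV. (A $ i $ k * x $ k) * (B $ j $ l * y $ l))"
    by (simp add: outer_def matrix_vector_mult_def sum_product)
  also have "\<dots> = (\<Sum>l\<in>UNIV. \<Sum>k\<in>UNIV. (A $ i $ k * x $ k) * (B $ j $ l * y $ l))"
    by (rule sum.swap)
  finally show "outer (A *v x) (B *v y) $ i $ j = (A ** outer x y ** transpose B) $ i $ j"
    by (simp add: outer_def matrix_matrix_mult_def matrix_vector_mult_def transpose_def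
        sum_distrib_right sum_distrib_left mult_ac)
qed

lemma outer_vector_mult: "outer x y *v z = (y \<bullet> z) *\<^sub>R x"
  by (simp add: vec_eq_iff outer_def matrix_vector_mult_def inner_vec_def sum_distrib_left
      sum_distrib_right mult_ac)

lemma inner_outer: "outer x y \<bullet> A = x \<bullet> (A *v y)" for A :: "real^'n^'n"
  by (simp add: inner_vec_def outer_def matrix_vector_mult_def sum_distrib_left mult_ac)

text \<open>Crude by a factor of the fixed dimension; it turns a bound on the solutions of
  \<open>A *v x = axis j 1\<close> into a bound on an inverse.\<close>

lemma norm_matrix_le_columns:
  fixes A :: "real^'n^'m"
  assumes "\<And>j. norm (A *v axis j 1) \<le> K"
  shows "norm A \<le> real CARD('n) * K"
proof -
  have "norm A = norm (transpose A)" by (simp add: norm_transpose)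
  also have "\<dots> \<le> (\<Sum>j\<in>UNIV. norm (transpose A $ j))"
    unfolding norm_vec_def[of "transpose A"] by (rule L2_set_le_sum) auto
  also have "transpose A $ j = A *v axis j 1" for j
    by (simp add: vec_eq_iff transpose_def matrix_vector_mult_basis column_def)
  then have "(\<Sum>j\<in>UNIV. norm (transpose A $ j)) \<le> (\<Sum>j\<in>(UNIV::'n set). K)"
    by (intro sum_mono) (use assms in simp)
  finally show ?thesis by simp
qed

lemma norm_matrix_le_sum_entries:
  fixes A :: "real^'n^'m"
  shows "norm A \<le> (\<Sum>i\<in>UNIV. \<Sum>j\<in>UNIV. \<bar>A $ i $ j\<bar>)"
proof -
  have "norm A \<le> (\<Sum>i\<in>UNIV. norm (A $ i))"
    unfolding norm_vec_def[of A] by (rule L2_set_le_sum) auto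
  also have "\<dots> \<le> (\<Sum>i\<in>UNIV. \<Sum>j\<in>UNIV. \<bar>A $ i $ j\<bar>)"
    by (intro sum_mono norm_le_l1_cart)
  finally show ?thesis .
qed

lemma outer_diff_square:
  "outer (x - z) (x - z) = outer x x - outer z x - outer x z + outer z z"
  by (simp add: vec_eq_iff outer_def algebra_simps)

lemma symmetric_entry: "transpose C = C \<Longrightarrow> C $ i $ j = C $ j $ i"
  by (metis transpose_def vec_lambda_beta)

lemma abs_trace_le: "\<bar>trace (F :: real^'n^'n)\<bar> \<le> real CARD('n) * norm F"
proof -
  have "\<bar>trace F\<bar> \<le> (\<Sum>i\<in>(UNIV::'n set). norm F)"
    unfolding trace_def
  proof (rule order_trans[OF sum_abs sum_mono])
    fix i show "\<bar>F $ i $ i\<bar> \<le> norm F"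
      using component_le_norm_cart[of "F $ i" i] Finite_Cartesian_Product.norm_nth_le[of F i] by linarith
  qed
  then show ?thesis by simp
qed

lemma bounded_linear_trace: "bounded_linear (trace :: real^'n^'n \<Rightarrow> real)"
proof (rule bounded_linear_intro[where K="real CARD('n)"])
  show "norm (trace F) \<le> norm F * real CARD('n)" for F :: "real^'n^'n"
    using abs_trace_le[of F] by (simp add: mult.commute)
qed (simp_all add: trace_def sum.distrib sum_distrib_left)

lemma norm_mult3_le:
  fixes A B C :: "real^'n^'n"
  assumes "norm A \<le> x" "norm B \<le> y" "norm C \<le> z"
  shows "norm (A ** B ** C) \<le> x * y * z"
proof -
  have nn: "0 \<le> x" "0 \<le> y" using assms(1,2) norm_ge_zero order_trans by blast+
  have "norm (A ** B ** C) \<le> norm (A ** B) * norm C" by (rule norm_matrix_mult_le)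
  also have "\<dots> \<le> (norm A * norm B) * norm C" by (intro mult_right_mono norm_matrix_mult_le) auto
  also have "\<dots> \<le> x * y * z" using assms nn by (intro mult_mono) auto
  finally show ?thesis .
qed

lemma norm_mult2_le:
  fixes A B :: "real^'n^'n"
  assumes "norm A \<le> x" "norm B \<le> y"
  shows "norm (A ** B) \<le> x * y"
proof -
  have "0 \<le> x" using assms(1) norm_ge_zero order_trans by blast
  then have "norm A * norm B \<le> x * y" using assms by (intro mult_mono) auto
  with norm_matrix_mult_le[of A B] show ?thesis by linarith
qed

text \<open>Lets a linear function of a random matrix be written through its values at fixed
  matrices, with the random entries as coefficients.\<close>

lemma matrix_unit_expansion:
  "F = (\<Sum>b\<in>UNIV. \<Sum>c\<in>UNIV. F $ b $ c *\<^sub>R outer (axis b 1) (axis c 1))" for F :: "real^'k^'k"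
proof -
  have "(\<Sum>b\<in>UNIV. \<Sum>c\<in>UNIV. F $ b $ c *\<^sub>R outer (axis b 1) (axis c 1)) $ p $ q
     = (\<Sum>b\<in>UNIV. \<Sum>c\<in>UNIV. if b = p then (if c = q then F $ b $ c else 0) else 0)" for p q
    unfolding sum_component
    by (intro sum.cong refl) (auto simp: outer_def axis_def)
  also have "\<dots> p q = F $ p $ q" for p q
  proof -
    have "(\<Sum>c\<in>UNIV. if b = p then (if c = q then F $ b $ c else 0) else 0) = (if b = p then F $ b $ q else 0)" for b
      by (cases "b = p") simp_all
    then show ?thesis by simp
  qed
  finally show ?thesis by (simp add: vec_eq_iff)
qed

lemma quadratic_form_congruence:
  "x \<bullet> ((transpose A ** B ** A) *v x) = (A *v x) \<bullet> (B *v (A *v x))"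
  for A :: "real^'s^'k"
  by (simp add: matrix_vector_mul_assoc[symmetric] inner_transpose_mult del: transpose_matrix_vector)

subsection \<open>Inverses\<close>

lemma matrix_inv:
  fixes A :: "real^'n^'n"
  assumes "invertible A"
  shows matrix_inv_right: "A ** matrix_inv A = mat 1"
    and matrix_inv_left: "matrix_inv A ** A = mat 1"
proof -
  have "\<exists>B. A ** B = mat 1 \<and> B ** A = mat 1"
    using assms by (auto simp: invertible_def)
  from someI_ex[OF this] show "A ** matrix_inv A = mat 1" "matrix_inv A ** A = mat 1"
    by (auto simp: matrix_inv_def)
qed

lemma matrix_inv_unique:
  fixes A B :: "real^'n^'n"
  assumes "A ** B = mat 1"
  shows "matrix_inv A = B"
proof -
  have "invertible A" using assms invertible_right_inverse by blast
  then have "matrix_inv A = matrix_inv A ** (A ** B)"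
    using assms by simp
  also have "\<dots> = B" by (simp only: matrix_mul_assoc matrix_inv_left[OF \<open>invertible A\<close>] matrix_mul_lid)
  finally show ?thesis .
qed

lemma transpose_matrix_inv:
  fixes A :: "real^'n^'n"
  assumes "invertible A" "transpose A = A"
  shows "transpose (matrix_inv A) = matrix_inv A"
proof -
  have "A ** transpose (matrix_inv A) = transpose (matrix_inv A ** A)"
    by (simp add: matrix_transpose_mul assms(2))
  also have "\<dots> = mat 1" by (simp add: matrix_inv_left assms(1) transpose_mat)
  finally show ?thesis by (rule matrix_inv_unique[symmetric])
qed

text \<open>The resolvent identity; the expansions of inverses further on are iterations of
  it.\<close>

lemma matrix_inv_diff:
  fixes A B :: "real^'n^'n"
  assumes "invertible A" "invertible B"
  shows "matrix_inv A - matrix_inv B = - (matrix_inv A ** (A - B) ** matrix_inv B)"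
proof -
  have "matrix_inv A ** (A - B) ** matrix_inv B
      = (matrix_inv A ** A) ** matrix_inv B - matrix_inv A ** (B ** matrix_inv B)"
    by (simp add: matrix_mult_algebra matrix_mul_assoc)
  then show ?thesis by (simp add: matrix_inv assms)
qed

text \<open>Cauchy-Schwarz turns coercivity into \<open>c * norm x \<le> norm (A *v x)\<close>. This
  gives injectivity, and applied to the columns of the inverse it bounds each of them by
  \<open>1 / c\<close>.\<close>

lemma coercive_invertible:
  fixes A :: "real^'n^'n"
  assumes c: "c > 0" and A: "\<And>x. c * (x \<bullet> x) \<le> x \<bullet> (A *v x)"
  shows "invertible A" and "norm (matrix_inv A) \<le> real CARD('n) / c"
proof -
  have lower: "c * norm x \<le> norm (A *v x)" for x
  proof (cases "x = 0")
    case False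
    have "c * norm x * norm x \<le> norm x * norm (A *v x)"
      using A[of x] norm_cauchy_schwarz[of x "A *v x"]
      by (simp add: power2_norm_eq_inner[symmetric] power2_eq_square)
    then show ?thesis using False by (simp add: mult.commute)
  qed simp
  have "inj ((*v) A)"
  proof (rule injI)
    fix x y assume "A *v x = A *v y"
    then have "c * norm (x - y) \<le> 0" using lower[of "x - y"]
      by (simp add: matrix_vector_mult_diff_distrib)
    then show "x = y" using c by (simp add: mult_le_0_iff)
  qed
  then obtain B where "B ** A = mat 1"
    using matrix_left_invertible_injective by blast
  then show inv: "invertible A" using invertible_left_inverse by blast
  show "norm (matrix_inv A) \<le> real CARD('n) / c"
  proof (rule order_trans[OF norm_matrix_le_columns[where K="1 / c"]])
    fix j
    have "A *v (matrix_inv A *v axis j 1) = axis j 1"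
      by (simp add: matrix_vector_mul_assoc matrix_inv inv)
    then have "c * norm (matrix_inv A *v axis j 1) \<le> 1"
      using lower[of "matrix_inv A *v axis j 1"] by (simp add: norm_axis_1)
    then show "norm (matrix_inv A *v axis j 1) \<le> 1 / c"
      using c by (simp add: field_simps)
  qed simp
qed

text \<open>With \<open>x = A *v w\<close> the form on the right equals
  \<open>w \<bullet> (A *v w)\<close>, which is at least \<open>c\<close> times the squared norm of
  \<open>w\<close>, and \<open>norm x \<le> K * norm w\<close>.\<close>

lemma coercive_inverse:
  fixes A :: "real^'n^'n"
  assumes c: "c > 0" and A: "\<And>x. c * (x \<bullet> x) \<le> x \<bullet> (A *v x)" and K: "norm A \<le> K"
  shows "c / K\<^sup>2 * (x \<bullet> x) \<le> x \<bullet> (matrix_inv A *v x)"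
proof -
  define w where "w = matrix_inv A *v x"
  have x: "x = A *v w"
    by (simp add: w_def matrix_vector_mul_assoc matrix_inv coercive_invertible(1)[OF c A])
  have "norm x \<le> K * norm w"
    using norm_matrix_vector_mult_le[of A w] K unfolding x
    by (meson mult_right_mono norm_ge_zero order_trans)
  then have "(norm x)\<^sup>2 \<le> (K * norm w)\<^sup>2"
    by (intro power_mono) auto
  then have 1: "x \<bullet> x \<le> K\<^sup>2 * (w \<bullet> w)"
    by (simp add: power2_norm_eq_inner power_mult_distrib)
  \<comment> \<open>For \<open>K = 0\<close> the bound on \<open>norm x\<close> forces
    \<open>x = 0\<close>, so the division by zero does no harm.\<close>
  show ?thesis
  proof (cases "K = 0")
    case True
    with \<open>norm x \<le> K * norm w\<close> have "x = 0" by simp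
    then show ?thesis by simp
  next
    case False
    then have "c / K\<^sup>2 * (x \<bullet> x) \<le> c / K\<^sup>2 * (K\<^sup>2 * (w \<bullet> w))"
      using 1 c by (intro mult_left_mono) auto
    also have "\<dots> = c * (w \<bullet> w)" using False by simp
    also have "\<dots> \<le> x \<bullet> w" using A[of w] by (simp add: x[symmetric] inner_commute)
    finally show ?thesis by (simp add: w_def)
  qed
qed

section \<open>Borel measurability of determinant and inverse\<close>

lemma borel_measurable_matrix_entry[measurable]:
  "(\<lambda>A :: real^'n^'m. A $ p $ q) \<in> borel_measurable borel"
  by (intro borel_measurable_continuous_onI continuous_intros)

lemma borel_measurable_vec_entry[measurable]:
  "(\<lambda>x :: real^'n. x $ q) \<in> borel_measurable borel"
  by (intro borel_measurable_continuous_onI continuous_intros)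

lemma borel_measurable_det[measurable]:
  "det \<in> borel_measurable (borel :: (real^'n^'n) measure)"
  unfolding det_def by (intro borel_measurable_sum borel_measurable_prod borel_measurable_times)
    (simp_all add: borel_measurable_matrix_entry)

text \<open>Where the determinant does not vanish, Cramer's rule exhibits the inverse as a quotient
  of polynomials in the entries; on the singular matrices \<open>matrix_inv\<close> is
  constant.\<close>

lemma borel_measurable_matrix_inv[measurable]:
  "matrix_inv \<in> borel_measurable (borel :: (real^'n^'n) measure)"
proof -
  \<comment> \<open>For a singular matrix no candidate satisfies the defining predicate of
    \<open>matrix_inv\<close>, so the choice operator meets the constantly false predicate and
    returns the same matrix every time.\<close>
  define E :: "real^'n^'n" where "E = (SOME x. False)"
  have 1: "matrix_inv A = E" if "det A = 0" for A :: "real^'n^'n"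
  proof -
    have "\<not> invertible A" using that by (simp add: invertible_det_nz)
    then have "(\<lambda>A'. A ** A' = mat 1 \<and> A' ** A = mat 1) = (\<lambda>_. False)"
      by (auto simp: invertible_def)
    then show ?thesis by (simp add: matrix_inv_def E_def)
  qed
  have 2: "matrix_inv A = (\<chi> i k. det (\<chi> p q. if q = i then axis k 1 $ p else A $ p $ q) / det A)"
    if "det A \<noteq> 0" for A :: "real^'n^'n"
  proof -
    have "invertible A" using that by (simp add: invertible_det_nz)
    then have "A *v (matrix_inv A *v axis k 1) = axis k 1" for k
      by (simp add: matrix_vector_mul_assoc matrix_inv)
    then have "matrix_inv A *v axis k 1
       = (\<chi> i. det (\<chi> p q. if q = i then axis k 1 $ p else A $ p $ q) / det A)" for k
      using cramer[OF that] by blast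
    then show ?thesis
      by (simp add: vec_eq_iff matrix_vector_mult_basis column_def)
  qed
  have "matrix_inv = (\<lambda>A :: real^'n^'n. if det A = 0 then E else
     (\<chi> i k. det (\<chi> p q. if q = i then axis k 1 $ p else A $ p $ q) / det A))"
    using 1 2 by auto
  moreover have "(\<lambda>A :: real^'n^'n. if det A = 0 then E else
     (\<chi> i k. det (\<chi> p q. if q = i then axis k 1 $ p else A $ p $ q) / det A))
     \<in> borel_measurable borel"
  proof -
    have "(\<lambda>A :: real^'n^'n. det (\<chi> p q. if q = i then axis k 1 $ p else A $ p $ q) / det A)
       \<in> borel_measurable borel" for i k
    proof (rule borel_measurable_divide[OF _ borel_measurable_det])
      have "(\<lambda>A :: real^'n^'n. if q = i then axis k 1 $ p else A $ p $ q) \<in> borel_measurable borel"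
        for p q
        by (cases "q = i") (simp_all add: borel_measurable_matrix_entry)
      then show "(\<lambda>A :: real^'n^'n. det (\<chi> p q. if q = i then axis k 1 $ p else A $ p $ q))
        \<in> borel_measurable borel"
        unfolding det_def vec_lambda_beta
        by (intro borel_measurable_sum borel_measurable_prod borel_measurable_times) simp_all
    qed
    then have "(\<lambda>A :: real^'n^'n.
     (\<chi> i k. det (\<chi> p q. if q = i then axis k 1 $ p else A $ p $ q) / det A))
     \<in> borel_measurable borel"
      by (intro borel_measurable_euclidean_space[THEN iffD2])
         (auto simp: Basis_vec_def inner_axis)
    then show ?thesis by measurable
  qed
  ultimately show ?thesis by simp
qed

subsection \<open>The spectral theorem and the nonnegative definite part\<close>

text \<open>A maximizer of the Rayleigh quotient on the unit sphere of \<open>S\<close> is an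
  eigenvector. An invariant subspace instead of the whole space is what the induction for the
  eigenbasis calls for.\<close>

lemma selfadjoint_eigenvector:
  fixes f :: "'a::euclidean_space \<Rightarrow> 'a"
  assumes f: "linear f" and sa: "\<And>x y. f x \<bullet> y = x \<bullet> f y"
    and S: "subspace S" "f ` S \<subseteq> S" "S \<noteq> {0}"
  obtains x l where "x \<in> S" "norm x = 1" "f x = l *\<^sub>R x"
proof -
  define K where "K = S \<inter> sphere 0 1"
  have cont: "continuous_on A f" for A
    by (rule linear_continuous_on) (rule linear_conv_bounded_linear[THEN iffD1, OF f])
  have "compact K"
    unfolding K_def using closed_subspace[OF S(1)] by (simp add: closed_Int_compact)
  moreover have "K \<noteq> {}"
  proof -
    obtain z where z: "z \<in> S" "z \<noteq> 0" using S subspace_0 by blast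
    then have "(1 / norm z) *\<^sub>R z \<in> K" using S(1) by (simp add: K_def subspace_scale)
    then show ?thesis by auto
  qed
  moreover have "continuous_on K (\<lambda>x. x \<bullet> f x)"
    by (intro continuous_intros cont)
  ultimately obtain x where x: "x \<in> K" and max: "\<And>z. z \<in> K \<Longrightarrow> z \<bullet> f z \<le> x \<bullet> f x"
    using continuous_attains_sup[of K "\<lambda>x. x \<bullet> f x"] by blast
  have xS: "x \<in> S" and nx: "norm x = 1" using x by (auto simp: K_def)
  then have xx: "x \<bullet> x = 1" by (simp add: norm_eq_sqrt_inner)
  define l where "l = x \<bullet> f x"
  have bound: "z \<bullet> f z \<le> l * (z \<bullet> z)" if z: "z \<in> S" for z
  proof (cases "z = 0")
    case False
    have "(1 / norm z) *\<^sub>R z \<in> K" using S(1) False z by (simp add: K_def subspace_scale)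
    from max[OF this] show ?thesis using False
      by (simp add: l_def linear_scale[OF f] field_simps power2_norm_eq_inner[symmetric] power2_eq_square)
  qed (simp add: linear_0[OF f])
  \<comment> \<open>First-order condition at the maximum: \<open>f x\<close> has no component in
    \<open>S\<close> orthogonal to \<open>x\<close>.\<close>
  have orth: "f x \<bullet> y = 0" if y: "y \<in> S" "y \<bullet> x = 0" for y
  proof -
    define b c where "b = f x \<bullet> y" and "c = y \<bullet> f y - l * (y \<bullet> y)"
    have quad: "2 * t * b + t\<^sup>2 * c \<le> 0" for t
    proof -
      have "x + t *\<^sub>R y \<in> S" using xS y S(1) by (simp add: subspace_add subspace_scale)
      from bound[OF this] show ?thesis
        using y xx sa[of x y]
        by (simp add: linear_add[OF f] linear_scale[OF f] inner_add_left inner_add_right b_def c_def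
            l_def power2_eq_square algebra_simps inner_commute)
    qed
    \<comment> \<open>With \<open>t = b / k\<close> and \<open>k\<close> above
      \<open>\<bar>c\<bar>\<close> the linear term outweighs the quadratic one unless
      \<open>b = 0\<close>.\<close>
    define k where "k = \<bar>c\<bar> + 1"
    have k: "k > 0" "\<bar>c\<bar> < k" by (auto simp: k_def)
    have "2 * b\<^sup>2 / k \<le> b\<^sup>2 * (- c) / k\<^sup>2"
      using quad[of "b / k"] by (simp add: power2_eq_square field_simps)
    also have "\<dots> \<le> b\<^sup>2 * k / k\<^sup>2"
      using k by (intro divide_right_mono mult_left_mono) auto
    finally have "2 * b\<^sup>2 / k \<le> b\<^sup>2 / k"
      using k by (simp add: power2_eq_square)
    then have "2 * b\<^sup>2 \<le> b\<^sup>2" using k by (simp add: divide_le_cancel)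
    then have "b\<^sup>2 \<le> 0" by linarith
    then show ?thesis by (simp add: b_def)
  qed
  define w where "w = f x - l *\<^sub>R x"
  have wS: "w \<in> S" using S xS by (auto simp: w_def intro!: subspace_diff subspace_scale)
  have wx: "w \<bullet> x = 0" by (simp add: w_def inner_diff_left xx l_def sa)
  have "w \<bullet> w = f x \<bullet> w - l * (x \<bullet> w)"
    unfolding w_def by (simp add: inner_diff_left)
  then have "w \<bullet> w = 0" using orth[OF wS wx] wx by (simp add: inner_commute)
  then have "f x = l *\<^sub>R x" by (simp add: w_def)
  with xS nx show thesis using that by blast
qed

text \<open>Induction on the dimension: the orthogonal complement of an eigenvector within
  \<open>S\<close> is again invariant, by self-adjointness.\<close>

lemma selfadjoint_eigenbasis:
  fixes f :: "'a::euclidean_space \<Rightarrow> 'a"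
  assumes f: "linear f" and sa: "\<And>x y. f x \<bullet> y = x \<bullet> f y"
    and S: "subspace S" "f ` S \<subseteq> S"
  shows "\<exists>B\<subseteq>S. finite B \<and> card B = dim S \<and> pairwise orthogonal B \<and>
           (\<forall>b\<in>B. norm b = 1 \<and> (\<exists>l. f b = l *\<^sub>R b))"
  using S
proof (induction "dim S" arbitrary: S)
  case 0
  then show ?case by (intro exI[of _ "{}"]) auto
next
  case (Suc n)
  then have "S \<noteq> {0}" by auto
  with selfadjoint_eigenvector[OF f sa Suc.prems] obtain x l where
    x: "x \<in> S" "norm x = 1" "f x = l *\<^sub>R x" by metis
  define T where "T = {y \<in> S. \<forall>z\<in>span {x}. orthogonal z y}"
  have T_alt: "T = {y \<in> S. x \<bullet> y = 0}"
    by (auto simp: T_def span_singleton orthogonal_def inner_commute)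
  have "dim T + dim (span {x}) = dim S"
    unfolding T_def by (rule dim_subspace_orthogonal_to_vectors)
      (use Suc.prems x in \<open>auto simp: span_minimal\<close>)
  moreover have "dim (span {x}) = 1" using x by (auto simp: dim_singleton)
  ultimately have dT: "n = dim T" using Suc.hyps by simp
  have sT: "subspace T"
    using Suc.prems(1) unfolding T_alt subspace_def by (auto simp: inner_add_right)
  have fT: "f ` T \<subseteq> T"
    using Suc.prems x unfolding T_alt by (auto simp flip: sa)
  from Suc.hyps(1)[OF dT sT fT] obtain B where B: "B \<subseteq> T" "finite B" "card B = dim T"
    "pairwise orthogonal B" "\<forall>b\<in>B. norm b = 1 \<and> (\<exists>l. f b = l *\<^sub>R b)" by blast
  have "x \<notin> T" using x by (auto simp: T_alt norm_eq_1)
  with B(1) have "x \<notin> B" by auto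
  then show ?case
    using B x dT Suc.hyps(2)
    by (intro exI[of _ "insert x B"])
       (auto simp: pairwise_insert T_alt orthogonal_def inner_commute)
qed

lemma symmetric_matrix_diagonalization:
  fixes A :: "real^'n^'n"
  assumes A: "transpose A = A"
  obtains H l where "orthogonal_matrix H" "A = H ** diag_mat l ** transpose H"
proof -
  have sa: "(A *v x) \<bullet> y = x \<bullet> (A *v y)" for x y
    using inner_transpose_mult[of x A y] A by simp
  obtain B where B: "finite B" "card B = CARD('n)" "pairwise orthogonal B"
    "\<And>b. b \<in> B \<Longrightarrow> norm b = 1 \<and> (\<exists>l. A *v b = l *\<^sub>R b)"
    using selfadjoint_eigenbasis[of "(*v) A" UNIV] sa by auto
  obtain g :: "'n \<Rightarrow> real^'n" where g: "bij_betw g UNIV B"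
    using B finite_same_card_bij[of "UNIV :: 'n set" B] by auto
  have gB: "g i \<in> B" for i using g by (auto simp: bij_betw_def)
  obtain l where l: "\<And>i. A *v g i = l i *\<^sub>R g i"
    using B(4)[OF gB] by metis
  define H :: "real^'n^'n" where "H = (\<chi> i j. g j $ i)"
  have gg: "g i \<bullet> g j = (if i = j then 1 else 0)" for i j
    using B(3) B(4)[OF gB, of i] gB[of i] gB[of j] g
    by (auto simp: pairwise_def orthogonal_def norm_eq_1 bij_betw_def inj_def)
  have "transpose H ** H = mat 1"
    using gg by (simp add: vec_eq_iff matrix_matrix_mult_def transpose_def H_def inner_vec_def mat_def)
  then have orth: "orthogonal_matrix H"
    by (simp add: orthogonal_matrix)
  then have HT: "H ** transpose H = mat 1" by (simp add: orthogonal_matrix_def)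
  have "(A ** H) $ i $ j = (H ** diag_mat l) $ i $ j" for i j
  proof -
    have "(A ** H) $ i $ j = (A *v g j) $ i"
      by (simp add: matrix_matrix_mult_def matrix_vector_mult_def H_def)
    also have "\<dots> = l j * g j $ i" by (simp add: l)
    also have "\<dots> = (H ** diag_mat l) $ i $ j"
      by (simp add: matrix_matrix_mult_def H_def diag_mat_def if_distrib mult.commute cong: if_cong)
    finally show ?thesis .
  qed
  then have "A ** H = H ** diag_mat l" by (simp add: vec_eq_iff)
  then have "A = H ** diag_mat l ** transpose H"
    by (metis HT matrix_mul_assoc matrix_mul_rid)
  with orth show thesis using that by blast
qed

lemma convex_pos_semidef: "convex {B :: real^'n^'n. pos_semidef B}"
  unfolding convex_def pos_semidef_def
  by (auto simp: transpose_add transpose_scaleR matrix_vector_mult_add_rdistrib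
      scaleR_matrix_vector_assoc[symmetric] inner_add_right)

lemma closed_pos_semidef: "closed {B :: real^'n^'n. pos_semidef B}"
proof -
  have "{B :: real^'n^'n. pos_semidef B} =
     {B. transpose B = B} \<inter> (\<Inter>x. {B. 0 \<le> x \<bullet> (B *v x)})"
    by (auto simp: pos_semidef_def)
  moreover have "closed {B :: real^'n^'n. transpose B = B}"
    by (intro closed_Collect_eq continuous_intros linear_continuous_on bounded_linear_transpose)
  moreover have "closed {B :: real^'n^'n. 0 \<le> x \<bullet> (B *v x)}" for x
    by (intro closed_Collect_le continuous_intros linear_continuous_on
        bounded_bilinear.bounded_linear_left[OF bounded_bilinear_matrix_vector_mult])
  ultimately show ?thesis by (auto intro!: closed_Int closed_INT)
qed

lemma pos_semidef_0: "pos_semidef 0"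
  by (simp add: pos_semidef_def transpose_def vec_eq_iff)

lemma spectral_sum:
  fixes H :: "real^'n^'n"
  shows "H ** diag_mat n ** transpose H = (\<Sum>i\<in>UNIV. n i *\<^sub>R outer (column i H) (column i H))"
  by (simp add: vec_eq_iff matrix_matrix_mult_def diag_mat_def transpose_def outer_def column_def
      if_distrib mult_ac cong: if_cong)

text \<open>Cutting off the negative eigenvalues is the metric projection, in Frobenius norm, onto
  the closed convex cone of positive semidefinite matrices. This determines the value chosen in
  \<open>nnd_part\<close>, and it yields measurability and the Lipschitz constant 1 without
  perturbation theory for eigenvalues. The proof verifies the variational inequality of the
  projection.\<close>

lemma nnd_part_eq_closest_point:
  fixes A :: "real^'n^'n"
  assumes A: "transpose A = A"
  shows "nnd_part A = closest_point {B. pos_semidef B} A"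
proof -
  let ?P = "\<lambda>B. \<exists>H l. orthogonal_matrix H \<and>
     A = H ** diag_mat l ** transpose H \<and>
     B = H ** diag_mat (\<lambda>i. max 0 (l i)) ** transpose H"
  have "\<exists>B. ?P B"
    using symmetric_matrix_diagonalization[OF A] by metis
  from someI_ex[OF this, folded nnd_part_def] obtain H l where H: "orthogonal_matrix H"
    "A = H ** diag_mat l ** transpose H"
    "nnd_part A = H ** diag_mat (\<lambda>i. max 0 (l i)) ** transpose H" by blast
  let ?h = "\<lambda>i. column i H" and ?B = "nnd_part A"
  have Bsum: "?B = (\<Sum>i\<in>UNIV. max 0 (l i) *\<^sub>R outer (?h i) (?h i))"
    unfolding H(3) by (rule spectral_sum)
  have hh: "?h i \<bullet> ?h j = (if i = j then 1 else 0)" for i j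
    using H(1) by (auto simp: orthogonal_matrix_orthonormal_columns norm_eq_1 orthogonal_def)
  have Bh: "?B *v ?h j = max 0 (l j) *\<^sub>R ?h j" for j
    unfolding Bsum
    by (simp add: bounded_bilinear.sum_left[OF bounded_bilinear_matrix_vector_mult]
        scaleR_matrix_vector_assoc[symmetric] outer_vector_mult hh if_distrib[of "\<lambda>c. c *\<^sub>R _"]
        if_distrib[of "\<lambda>c. _ *\<^sub>R c"] sum.delta' cong: if_cong)
  have BP: "pos_semidef ?B"
    unfolding pos_semidef_def
  proof
    show "transpose ?B = ?B"
      unfolding Bsum by (simp add: transpose_sum transpose_scaleR transpose_outer)
    have "x \<bullet> (?B *v x) = (\<Sum>i\<in>UNIV. max 0 (l i) * (?h i \<bullet> x)\<^sup>2)" for x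
      unfolding Bsum
      by (simp add: bounded_bilinear.sum_left[OF bounded_bilinear_matrix_vector_mult]
        scaleR_matrix_vector_assoc[symmetric] outer_vector_mult inner_sum_right
        inner_commute[of x] power2_eq_square mult.assoc)
    then show "\<forall>x. 0 \<le> x \<bullet> (?B *v x)"
      by (auto intro!: sum_nonneg)
  qed
  have diff: "A - ?B = (\<Sum>i\<in>UNIV. min 0 (l i) *\<^sub>R outer (?h i) (?h i))"
  proof -
    have "A = (\<Sum>i\<in>UNIV. l i *\<^sub>R outer (?h i) (?h i))"
      by (subst H(2)) (rule spectral_sum)
    then have "A - ?B = (\<Sum>i\<in>UNIV. l i *\<^sub>R outer (?h i) (?h i))
        - (\<Sum>i\<in>UNIV. max 0 (l i) *\<^sub>R outer (?h i) (?h i))"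
      using Bsum by (rule arg_cong2)
    also have "\<dots> = (\<Sum>i\<in>UNIV. l i *\<^sub>R outer (?h i) (?h i) - max 0 (l i) *\<^sub>R outer (?h i) (?h i))"
      by (simp add: sum_subtractf)
    also have "\<dots> = (\<Sum>i\<in>UNIV. min 0 (l i) *\<^sub>R outer (?h i) (?h i))"
      by (intro sum.cong refl) (auto simp: min_def max_def simp flip: scaleR_diff_left)
    finally show ?thesis .
  qed
  have "dist A ?B \<le> dist A C" if C: "pos_semidef C" for C
  proof -
    \<comment> \<open>In the eigenbasis each direction contributes a nonpositive number times a
      value of the form of \<open>C\<close>, because \<open>min 0 (l i) * max 0 (l i)\<close>
      vanishes.\<close>
    have "(A - ?B) \<bullet> (C - ?B) = (\<Sum>i\<in>UNIV. min 0 (l i) * (?h i \<bullet> (C *v ?h i) - max 0 (l i)))"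
      unfolding diff
      by (simp add: inner_sum_left inner_outer matrix_vector_mult_diff_rdistrib inner_diff_right Bh hh
          right_diff_distrib sum_subtractf)
    also have "\<dots> = (\<Sum>i\<in>UNIV. min 0 (l i) * (?h i \<bullet> (C *v ?h i)))"
      by (intro sum.cong refl) (auto simp: min_def max_def)
    also have "\<dots> \<le> 0"
      using C by (intro sum_nonpos mult_nonpos_nonneg) (auto simp: pos_semidef_def)
    finally have 1: "(A - ?B) \<bullet> (C - ?B) \<le> 0" .
    have "(A - C) \<bullet> (A - C)
        = (A - ?B) \<bullet> (A - ?B) - 2 * ((A - ?B) \<bullet> (C - ?B)) + (C - ?B) \<bullet> (C - ?B)"
      by (simp add: inner_diff_left inner_diff_right inner_commute)
    with 1 inner_ge_zero[of "C - ?B"] have "(A - ?B) \<bullet> (A - ?B) \<le> (A - C) \<bullet> (A - C)"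
      by linarith
    then show ?thesis by (simp add: dist_norm norm_eq_sqrt_inner)
  qed
  then show ?thesis
    using BP by (intro closest_point_unique) (auto simp: convex_pos_semidef closed_pos_semidef)
qed

lemma pos_semidef_closest_point: "pos_semidef (closest_point {B. pos_semidef B} A)"
  using closest_point_in_set[of "{B. pos_semidef B}" A] closed_pos_semidef pos_semidef_0 by blast

lemma norm_closest_point_pos_semidef_diff_le:
  "norm (closest_point {B. pos_semidef B} A - closest_point {B. pos_semidef B} C) \<le> norm (A - C)"
  using closest_point_lipschitz[of "{B. pos_semidef B}" A C] convex_pos_semidef closed_pos_semidef
    pos_semidef_0 by (auto simp: dist_norm)

lemma borel_measurable_closest_point_pos_semidef[measurable]:
  "closest_point {B :: real^'n^'n. pos_semidef B} \<in> borel_measurable borel"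
  using convex_pos_semidef closed_pos_semidef pos_semidef_0
  by (intro borel_measurable_continuous_onI continuous_on_closest_point) auto

subsection \<open>Positive semidefinite matrices\<close>

text \<open>The form attains a positive minimum on the compact unit sphere, and homogeneity extends
  the bound.\<close>

lemma pos_def_coercive:
  fixes A :: "real^'n^'n"
  assumes "pos_def A"
  obtains c where "c > 0" "\<And>x. c * (x \<bullet> x) \<le> x \<bullet> (A *v x)"
proof -
  have "compact (sphere (0 :: real^'n) 1)" "sphere (0 :: real^'n) 1 \<noteq> {}"
    "continuous_on (sphere (0 :: real^'n) 1) (\<lambda>x. x \<bullet> (A *v x))"
    by (auto intro!: continuous_on_inner continuous_on_id
        linear_continuous_on[OF matrix_vector_mul_bounded_linear])
  then obtain z where z: "norm z = 1" "\<And>y. norm y = 1 \<Longrightarrow> z \<bullet> (A *v z) \<le> y \<bullet> (A *v y)"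
    using continuous_attains_inf[of "sphere (0 :: real^'n) 1" "\<lambda>x. x \<bullet> (A *v x)"] by auto
  show thesis
  proof
    have "z \<noteq> 0" using z(1) by auto
    then show "0 < z \<bullet> (A *v z)" using assms unfolding pos_def_def by blast
    show "z \<bullet> (A *v z) * (x \<bullet> x) \<le> x \<bullet> (A *v x)" for x
    proof (cases "x = 0")
      case False
      then show ?thesis using z(2)[of "(1 / norm x) *\<^sub>R x"]
        by (simp add: matrix_vector_mult_scaleR field_simps power2_norm_eq_inner[symmetric]
            power2_eq_square)
    qed simp
  qed
qed

text \<open>A vector on which a nonnegative form vanishes lies in the kernel: the form at
  \<open>x - t *\<^sub>R (A *v x)\<close> would be negative for small positive \<open>t\<close>
  unless \<open>A *v x = 0\<close>.\<close>

lemma pos_semidef_invertible_imp_pos_def: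
  fixes A :: "real^'n^'n"
  assumes A: "pos_semidef A" "invertible A"
  shows "pos_def A"
  unfolding pos_def_def
proof (intro conjI allI impI)
  show tA: "transpose A = A" using A by (simp add: pos_semidef_def)
  have sa: "(A *v x) \<bullet> y = x \<bullet> (A *v y)" for x y
    using inner_transpose_mult[of x A y] tA by simp
  fix x :: "real^'n" assume x: "x \<noteq> 0"
  show "0 < x \<bullet> (A *v x)"
  proof (rule ccontr)
    assume "\<not> 0 < x \<bullet> (A *v x)"
    then have 0: "x \<bullet> (A *v x) = 0" using A(1) by (auto simp: pos_semidef_def not_less intro: antisym)
    define y where "y = A *v x"
    define b c where "b = y \<bullet> y" and "c = y \<bullet> (A *v y)"
    have c0: "c \<ge> 0" using A by (simp add: pos_semidef_def c_def)
    have quad: "0 \<le> t\<^sup>2 * c - 2 * t * b" for t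
    proof -
      have "0 \<le> (x - t *\<^sub>R y) \<bullet> (A *v (x - t *\<^sub>R y))" using A by (simp add: pos_semidef_def)
      also have "\<dots> = t\<^sup>2 * c - 2 * t * b"
        using 0 sa[of x y]
        by (simp add: matrix_vector_mult_diff_distrib matrix_vector_mult_scaleR inner_diff_left
            inner_diff_right b_def c_def y_def power2_eq_square inner_commute algebra_simps)
      finally show ?thesis .
    qed
    \<comment> \<open>The value \<open>t = b / (c + 1)\<close> stays close to the minimizer
      \<open>b / c\<close> and remains defined for \<open>c = 0\<close>.\<close>
    have "0 \<le> (b / (c + 1))\<^sup>2 * c - 2 * (b / (c + 1)) * b" by (rule quad)
    also have "(b / (c + 1))\<^sup>2 * c \<le> b\<^sup>2 / (c + 1)"
    proof -
      have "(b / (c + 1))\<^sup>2 * c = b\<^sup>2 / (c + 1) * (c / (c + 1))"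
        by (simp add: power_divide power2_eq_square)
      also have "\<dots> \<le> b\<^sup>2 / (c + 1) * 1"
        using c0 by (intro mult_left_mono) auto
      finally show ?thesis by simp
    qed
    finally have "0 \<le> - (b\<^sup>2 / (c + 1))" by (simp add: power2_eq_square)
    then have "b\<^sup>2 \<le> 0" using c0 by (simp add: divide_le_0_iff) 
    then have "A *v x = 0" by (simp add: b_def y_def)
    then have "matrix_inv A *v (A *v x) = 0" by simp
    then show False using x by (simp only: matrix_vector_mul_assoc matrix_inv_left[OF A(2)]) simp
  qed
qed

text \<open>The diagonal is bounded by \<open>d\<close>; the form at the sum and at the difference
  of two basis vectors bounds an off-diagonal entry by the mean of two diagonal ones. Counting the
  entries costs a factor that is harmless in fixed dimension.\<close>

lemma pos_semidef_norm_le: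
  fixes A :: "real^'n^'n"
  assumes A: "pos_semidef A" and d: "loewner_le A (d *\<^sub>R mat 1)" "d \<ge> 0"
  shows "norm A \<le> (real CARD('n))\<^sup>2 * d"
proof -
  have "transpose A $ j $ i = A $ j $ i" for i j
    using A by (simp add: pos_semidef_def)
  then have tA: "A $ i $ j = A $ j $ i" for i j
    by (simp add: transpose_def)
  have ax: "axis i 1 \<bullet> (A *v axis j 1) = A $ i $ j" for i j
    by (simp add: matrix_vector_mult_basis column_def inner_axis')
  have diag: "A $ i $ i \<le> d" for i
  proof -
    have "0 \<le> axis i 1 \<bullet> ((d *\<^sub>R mat 1 - A) *v axis i 1)"
      using d by (simp add: loewner_le_def pos_semidef_def)
    then show ?thesis
      by (simp add: matrix_vector_mult_diff_rdistrib inner_diff_right matrix_vector_mult_basis column_def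
          scaleR_matrix_vector_assoc[symmetric] inner_axis' mat_def)
  qed
  have ent: "\<bar>A $ i $ j\<bar> \<le> d" for i j
  proof -
    have "0 \<le> (axis i 1 + s *\<^sub>R axis j 1) \<bullet> (A *v (axis i 1 + s *\<^sub>R axis j 1))" for s
      using A by (simp add: pos_semidef_def)
    then have q: "0 \<le> A $ i $ i + 2 * s * A $ i $ j + s\<^sup>2 * A $ j $ j" for s
      using tA[of i j]
      by (simp add: matrix_vector_right_distrib matrix_vector_mult_scaleR inner_add_left inner_add_right
          ax power2_eq_square algebra_simps)
    show ?thesis using q[of 1] q[of "-1"] diag[of i] diag[of j] by auto
  qed
  have "norm A \<le> (\<Sum>i\<in>UNIV. \<Sum>j\<in>UNIV. \<bar>A $ i $ j\<bar>)" by (rule norm_matrix_le_sum_entries)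
  also have "\<dots> \<le> (\<Sum>i\<in>(UNIV::'n set). \<Sum>j\<in>(UNIV::'n set). d)" by (intro sum_mono ent)
  finally show ?thesis by (simp add: power2_eq_square)
qed

section \<open>Integrals of vectors and matrices\<close>

lemma integrable_componentwise:
  fixes f :: "'w \<Rightarrow> 'b::euclidean_space"
  assumes "\<And>b. b \<in> Basis \<Longrightarrow> integrable M (\<lambda>\<omega>. f \<omega> \<bullet> b)"
  shows "integrable M f"
proof -
  have "integrable M (\<lambda>\<omega>. \<Sum>b\<in>Basis. (f \<omega> \<bullet> b) *\<^sub>R b)"
    by (intro Bochner_Integration.integrable_sum integrable_scaleR_left assms)
  then show ?thesis by (simp add: euclidean_representation)
qed

lemma integrable_matI:
  fixes F :: "'w \<Rightarrow> real^'n^'m"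
  assumes "\<And>i j. integrable M (\<lambda>\<omega>. F \<omega> $ i $ j)"
  shows "integrable M F"
  by (rule integrable_componentwise) (auto simp: Basis_vec_def inner_axis intro: assms)

lemma integrable_bounded_linear_image:
  fixes f :: "'b::euclidean_space \<Rightarrow> 'c::euclidean_space"
  assumes "bounded_linear f" "integrable M g"
  shows "integrable M (\<lambda>\<omega>. f (g \<omega>))" "(\<integral>\<omega>. f (g \<omega>) \<partial>M) = f (\<integral>\<omega>. g \<omega> \<partial>M)"
  by (rule integrable_bounded_linear[OF assms]) (rule integral_bounded_linear[OF assms])

lemma bounded_linear_matrix_entry: "bounded_linear (\<lambda>F :: real^'n^'m. F $ i $ j)"
  using bounded_linear_compose[OF bounded_linear_vec_nth[of j] bounded_linear_vec_nth[of i]] by simp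

lemma integral_matrix_entry:
  fixes F :: "'w \<Rightarrow> real^'n^'m"
  assumes "integrable M F"
  shows "integrable M (\<lambda>\<omega>. F \<omega> $ i $ j)" "(\<integral>\<omega>. F \<omega> \<partial>M) $ i $ j = (\<integral>\<omega>. F \<omega> $ i $ j \<partial>M)"
  using integrable_bounded_linear_image[OF bounded_linear_matrix_entry assms] by auto

lemma bounded_linear_sandwich:
  fixes B :: "real^'n^'m" and C :: "real^'q^'p"
  shows "bounded_linear (\<lambda>F. B ** F ** C)"
  using bounded_linear_compose[OF bounded_bilinear.bounded_linear_left[OF bounded_bilinear_matrix_mult, of C]
      bounded_bilinear.bounded_linear_right[OF bounded_bilinear_matrix_mult, of B]]
  by simp

lemmas integral_sandwich = integrable_bounded_linear_image[OF bounded_linear_sandwich]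
lemmas integral_mult_left_matrix =
  integrable_bounded_linear_image[OF bounded_bilinear.bounded_linear_right[OF bounded_bilinear_matrix_mult]]
lemmas integral_mult_right_matrix =
  integrable_bounded_linear_image[OF bounded_bilinear.bounded_linear_left[OF bounded_bilinear_matrix_mult]]

section \<open>Measurability of operations on random matrices\<close>

lemma bounded_bilinear_measurable:
  fixes prod :: "'a::euclidean_space \<Rightarrow> 'b::euclidean_space \<Rightarrow> 'c::euclidean_space"
  assumes "bounded_bilinear prod" and "f \<in> borel_measurable M" "g \<in> borel_measurable M"
  shows "(\<lambda>\<omega>. prod (f \<omega>) (g \<omega>)) \<in> borel_measurable M"
  by (rule borel_measurable_continuous_Pair[OF assms(2,3)])
     (intro bounded_bilinear.continuous_on[OF assms(1)] continuous_intros)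

lemma bounded_linear_measurable:
  fixes f :: "'a::euclidean_space \<Rightarrow> 'c::euclidean_space"
  assumes "bounded_linear f" and "g \<in> borel_measurable M"
  shows "(\<lambda>\<omega>. f (g \<omega>)) \<in> borel_measurable M"
  by (rule measurable_compose[OF assms(2)])
     (intro borel_measurable_continuous_onI linear_continuous_on assms)

lemma borel_measurable_matrix_mult[measurable]:
  fixes F :: "'w \<Rightarrow> real^'n^'m" and G :: "'w \<Rightarrow> real^'p^'n"
  assumes "F \<in> borel_measurable N" "G \<in> borel_measurable N"
  shows "(\<lambda>\<omega>. F \<omega> ** G \<omega>) \<in> borel_measurable N"
  by (rule bounded_bilinear_measurable[OF bounded_bilinear_matrix_mult assms])

lemma borel_measurable_matrix_vector[measurable]:
  fixes F :: "'w \<Rightarrow> real^'n^'m"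
  assumes "F \<in> borel_measurable N" "G \<in> borel_measurable N"
  shows "(\<lambda>\<omega>. F \<omega> *v G \<omega>) \<in> borel_measurable N"
  by (rule bounded_bilinear_measurable[OF bounded_bilinear_matrix_vector_mult assms])

lemma borel_measurable_outer[measurable]:
  fixes F :: "'w \<Rightarrow> real^'n"
  assumes "F \<in> borel_measurable N" "G \<in> borel_measurable N"
  shows "(\<lambda>\<omega>. outer (F \<omega>) (G \<omega>)) \<in> borel_measurable N"
  by (rule bounded_bilinear_measurable[OF bounded_bilinear_outer assms])

lemma borel_measurable_trace[measurable]:
  fixes F :: "'w \<Rightarrow> real^'n^'n"
  assumes "F \<in> borel_measurable N"
  shows "(\<lambda>\<omega>. trace (F \<omega>)) \<in> borel_measurable N"
  unfolding trace_def
  by (intro borel_measurable_sum measurable_compose[OF assms borel_measurable_matrix_entry])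

lemma norm_average_le:
  fixes F :: "nat \<Rightarrow> 'b::real_normed_vector"
  assumes "\<And>i. i \<ge> 1 \<Longrightarrow> norm (F i) \<le> c" "m > 0"
  shows "norm ((1 / real m) *\<^sub>R (\<Sum>i\<in>{1..m}. F i)) \<le> c"
proof -
  have "norm (\<Sum>i\<in>{1..m}. F i) \<le> (\<Sum>i\<in>{1..m}. c)" by (rule sum_norm_le) (use assms in auto)
  then show ?thesis using assms(2) by (simp add: field_simps)
qed

section \<open>Stochastic orders in all moments\<close>

lemma O_cong_eventually:
  assumes "f \<in> O[F](g)" "\<forall>\<^sub>F m in F. f' m = f m"
  shows "f' \<in> O[F](g)"
  using assms by (subst landau_o.big.in_cong[where g=f]) auto

lemma O_norm_add:
  assumes "(\<lambda>m. norm (f m)) \<in> O[F](g)" "(\<lambda>m. norm (f' m)) \<in> O[F](g :: 'x \<Rightarrow> real)"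
  shows "(\<lambda>m. norm (f m + f' m)) \<in> O[F](g)"
proof (rule landau_o.big_trans)
  show "(\<lambda>m. norm (f m + f' m)) \<in> O[F](\<lambda>m. norm (f m) + norm (f' m))"
    by (intro landau_o.big_mono always_eventually allI) (simp add: norm_triangle_ineq)
  show "(\<lambda>m. norm (f m) + norm (f' m)) \<in> O[F](g)"
    by (rule sum_in_bigo[OF assms])
qed

lemma O_norm_sandwich:
  fixes f :: "nat \<Rightarrow> real^'k^'k" and B C :: "real^'k^'k"
  assumes "(\<lambda>m. norm (f m)) \<in> O(g)"
  shows "(\<lambda>m. norm (B ** f m ** C)) \<in> O(g)"
proof (rule landau_o.big_trans[OF _ assms])
  show "(\<lambda>m. norm (B ** f m ** C)) \<in> O(\<lambda>m. norm (f m))"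
  proof (rule bigoI[where c="norm B * norm C"], intro always_eventually allI)
    fix m
    show "norm (norm (B ** f m ** C)) \<le> norm B * norm C * norm (norm (f m))"
      using norm_mult3_le[of B "norm B" "f m" "norm (f m)" C "norm C"] by (simp add: mult_ac)
  qed
qed

lemma O_norm_inverse_square:
  "(\<lambda>m. norm ((1 / (real m)\<^sup>2) *\<^sub>R (C :: real^'k^'k))) \<in> O(\<lambda>m. real m powr (-3/2))"
proof (rule bigoI[where c="norm C"])
  show "\<forall>\<^sub>F m in sequentially. norm (norm ((1 / (real m)\<^sup>2) *\<^sub>R C)) \<le> norm C * norm (real m powr (-3/2))"
    using eventually_ge_at_top[of 1]
  proof eventually_elim
    case (elim m)
    have "1 / (real m)\<^sup>2 = real m powr (-2)"
      using elim by (simp add: powr_minus powr_numeral inverse_eq_divide)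
    also have "\<dots> \<le> real m powr (-3/2)" using elim by (intro powr_mono) auto
    finally have "norm C * (1 / (real m)\<^sup>2) \<le> norm C * real m powr (-3/2)" by (intro mult_left_mono) auto
    then show ?case by (simp add: abs_mult)
  qed
qed

lemma powr_minus1: "m > 0 \<Longrightarrow> real m powr (- 1) = 1 / real m"
  by (simp add: powr_minus inverse_eq_divide)

text \<open>Asking for the order \<open>m\<^sup>-\<^sup>r\<close> in all \<open>L\<^sup>p\<close> at once makes the notion closed under products.\<close>

definition moment_order ::
  "'w measure \<Rightarrow> real \<Rightarrow> (nat \<Rightarrow> 'w \<Rightarrow> 'b::euclidean_space) \<Rightarrow> bool" where
  "moment_order M r Z \<longleftrightarrow> (\<forall>\<^sub>F m in sequentially. Z m \<in> borel_measurable M) \<and>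
     (\<forall>p::nat. \<exists>C. \<forall>\<^sub>F m in sequentially. integrable M (\<lambda>\<omega>. norm (Z m \<omega>) ^ p) \<and>
        (\<integral>\<omega>. norm (Z m \<omega>) ^ p \<partial>M) \<le> C * (real m powr (- r)) ^ p)"

lemma moment_order_measurable:
  "moment_order M r Z \<Longrightarrow> \<forall>\<^sub>F m in sequentially. Z m \<in> borel_measurable M"
  by (simp add: moment_order_def)

lemma moment_orderD:
  assumes "moment_order M r Z"
  obtains C where "\<forall>\<^sub>F m in sequentially. integrable M (\<lambda>\<omega>. norm (Z m \<omega>) ^ p) \<and>
        (\<integral>\<omega>. norm (Z m \<omega>) ^ p \<partial>M) \<le> C * (real m powr (- r)) ^ p" "C \<ge> 0"
proof -
  obtain C where C: "\<forall>\<^sub>F m in sequentially. integrable M (\<lambda>\<omega>. norm (Z m \<omega>) ^ p) \<and>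
        (\<integral>\<omega>. norm (Z m \<omega>) ^ p \<partial>M) \<le> C * (real m powr (- r)) ^ p"
    using assms unfolding moment_order_def by blast
  have "\<forall>\<^sub>F m in sequentially. integrable M (\<lambda>\<omega>. norm (Z m \<omega>) ^ p) \<and>
        (\<integral>\<omega>. norm (Z m \<omega>) ^ p \<partial>M) \<le> \<bar>C\<bar> * (real m powr (- r)) ^ p"
    using C
  proof eventually_elim
    case (elim m)
    have "C * (real m powr (- r)) ^ p \<le> \<bar>C\<bar> * (real m powr (- r)) ^ p"
      by (intro mult_right_mono) auto
    with elim show ?case by linarith
  qed
  then show thesis using that[of "\<bar>C\<bar>"] by simp
qed

text \<open>The bound is required at every sample point but only for large \<open>m\<close>, because
  the design matrix is known to be invertible only eventually.\<close>

lemma moment_order_dominated: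
  assumes Z: "moment_order M r Z"
    and W: "\<forall>\<^sub>F m in sequentially. W m \<in> borel_measurable M"
    and le: "\<forall>\<^sub>F m in sequentially. \<forall>\<omega>. norm (W m \<omega>) \<le> K * norm (Z m \<omega>)"
  shows "moment_order M r W"
  unfolding moment_order_def
proof (intro conjI allI)
  show "\<forall>\<^sub>F m in sequentially. W m \<in> borel_measurable M" by (rule W)
  fix p
  obtain C where C: "\<forall>\<^sub>F m in sequentially. integrable M (\<lambda>\<omega>. norm (Z m \<omega>) ^ p) \<and>
        (\<integral>\<omega>. norm (Z m \<omega>) ^ p \<partial>M) \<le> C * (real m powr (- r)) ^ p" "C \<ge> 0"
    by (rule moment_orderD[OF Z])
  have "\<forall>\<^sub>F m in sequentially. integrable M (\<lambda>\<omega>. norm (W m \<omega>) ^ p) \<and>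
        (\<integral>\<omega>. norm (W m \<omega>) ^ p \<partial>M) \<le> \<bar>K\<bar> ^ p * C * (real m powr (- r)) ^ p"
    using W le C(1) moment_order_measurable[OF Z]
  proof eventually_elim
    case (elim m)
    note [measurable] = elim(1) elim(4)
    have b: "norm (W m \<omega>) ^ p \<le> \<bar>K\<bar> ^ p * norm (Z m \<omega>) ^ p" for \<omega>
    proof -
      have "norm (W m \<omega>) \<le> \<bar>K\<bar> * norm (Z m \<omega>)"
        using elim(2) by (meson abs_ge_self mult_right_mono norm_ge_zero order_trans)
      then have "norm (W m \<omega>) ^ p \<le> (\<bar>K\<bar> * norm (Z m \<omega>)) ^ p" by (intro power_mono) auto
      then show ?thesis by (simp add: power_mult_distrib)
    qed
    have i1: "integrable M (\<lambda>\<omega>. \<bar>K\<bar> ^ p * norm (Z m \<omega>) ^ p)" using elim(3) by simp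
    have i2: "integrable M (\<lambda>\<omega>. norm (W m \<omega>) ^ p)"
      by (rule Bochner_Integration.integrable_bound[OF i1]) (use b in auto)
    have "(\<integral>\<omega>. norm (W m \<omega>) ^ p \<partial>M) \<le> (\<integral>\<omega>. \<bar>K\<bar> ^ p * norm (Z m \<omega>) ^ p \<partial>M)"
      by (rule integral_mono[OF i2 i1]) (use b in auto)
    also have "\<dots> = \<bar>K\<bar> ^ p * (\<integral>\<omega>. norm (Z m \<omega>) ^ p \<partial>M)" by simp
    also have "\<dots> \<le> \<bar>K\<bar> ^ p * (C * (real m powr (- r)) ^ p)"
      using elim(3) by (intro mult_left_mono) auto
    finally show ?case using i2 by (simp add: mult.assoc)
  qed
  then show "\<exists>C. \<forall>\<^sub>F m in sequentially. integrable M (\<lambda>\<omega>. norm (W m \<omega>) ^ p) \<and>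
        (\<integral>\<omega>. norm (W m \<omega>) ^ p \<partial>M) \<le> C * (real m powr (- r)) ^ p" by blast
qed

lemma moment_order_cong:
  assumes Z: "moment_order M r Z" and eq: "\<forall>\<^sub>F m in sequentially. \<forall>\<omega>. W m \<omega> = Z m \<omega>"
  shows "moment_order M r W"
proof (rule moment_order_dominated[OF Z, where K=1])
  show "\<forall>\<^sub>F m in sequentially. W m \<in> borel_measurable M"
    using moment_order_measurable[OF Z] eq
  proof eventually_elim
    case (elim m)
    then have "W m = Z m" by auto
    with elim show ?case by simp
  qed
  show "\<forall>\<^sub>F m in sequentially. \<forall>\<omega>. norm (W m \<omega>) \<le> 1 * norm (Z m \<omega>)"
    using eq by eventually_elim simp
qed

lemma moment_order_weaken:
  assumes Z: "moment_order M r Z" and s: "s \<le> r"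
  shows "moment_order M s Z"
  unfolding moment_order_def
proof (intro conjI allI)
  show "\<forall>\<^sub>F m in sequentially. Z m \<in> borel_measurable M" by (rule moment_order_measurable[OF Z])
  fix p
  obtain C where C: "\<forall>\<^sub>F m in sequentially. integrable M (\<lambda>\<omega>. norm (Z m \<omega>) ^ p) \<and>
        (\<integral>\<omega>. norm (Z m \<omega>) ^ p \<partial>M) \<le> C * (real m powr (- r)) ^ p" "C \<ge> 0"
    by (rule moment_orderD[OF Z])
  have "\<forall>\<^sub>F m in sequentially. integrable M (\<lambda>\<omega>. norm (Z m \<omega>) ^ p) \<and>
        (\<integral>\<omega>. norm (Z m \<omega>) ^ p \<partial>M) \<le> C * (real m powr (- s)) ^ p"
    using C(1) eventually_ge_at_top[of 1]
  proof eventually_elim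
    case (elim m)
    have "C * (real m powr (- r)) ^ p \<le> C * (real m powr (- s)) ^ p"
      using C(2) elim s by (intro mult_left_mono power_mono powr_mono) auto
    with elim show ?case by linarith
  qed
  then show "\<exists>C. \<forall>\<^sub>F m in sequentially. integrable M (\<lambda>\<omega>. norm (Z m \<omega>) ^ p) \<and>
        (\<integral>\<omega>. norm (Z m \<omega>) ^ p \<partial>M) \<le> C * (real m powr (- s)) ^ p" by blast
qed

lemma moment_order_add:
  assumes Z: "moment_order M r Z" and W: "moment_order M r W"
  shows "moment_order M r (\<lambda>m \<omega>. Z m \<omega> + W m \<omega>)"
  unfolding moment_order_def
proof (intro conjI allI)
  show "\<forall>\<^sub>F m in sequentially. (\<lambda>\<omega>. Z m \<omega> + W m \<omega>) \<in> borel_measurable M"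
    using moment_order_measurable[OF Z] moment_order_measurable[OF W]
    by eventually_elim simp
  fix p
  obtain C where C: "\<forall>\<^sub>F m in sequentially. integrable M (\<lambda>\<omega>. norm (Z m \<omega>) ^ p) \<and>
        (\<integral>\<omega>. norm (Z m \<omega>) ^ p \<partial>M) \<le> C * (real m powr (- r)) ^ p" "C \<ge> 0"
    by (rule moment_orderD[OF Z])
  obtain E where E: "\<forall>\<^sub>F m in sequentially. integrable M (\<lambda>\<omega>. norm (W m \<omega>) ^ p) \<and>
        (\<integral>\<omega>. norm (W m \<omega>) ^ p \<partial>M) \<le> E * (real m powr (- r)) ^ p" "E \<ge> 0"
    by (rule moment_orderD[OF W])
  have "\<forall>\<^sub>F m in sequentially. integrable M (\<lambda>\<omega>. norm (Z m \<omega> + W m \<omega>) ^ p) \<and>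
        (\<integral>\<omega>. norm (Z m \<omega> + W m \<omega>) ^ p \<partial>M) \<le> 2 ^ p * (C + E) * (real m powr (- r)) ^ p"
    using C(1) E(1) moment_order_measurable[OF Z] moment_order_measurable[OF W]
  proof eventually_elim
    case (elim m)
    note [measurable] = elim(3) elim(4)
    have b: "norm (Z m \<omega> + W m \<omega>) ^ p \<le> 2 ^ p * (norm (Z m \<omega>) ^ p + norm (W m \<omega>) ^ p)" for \<omega>
    proof -
      let ?a = "norm (Z m \<omega>)" and ?b = "norm (W m \<omega>)"
      have "norm (Z m \<omega> + W m \<omega>) ^ p \<le> (2 * max ?a ?b) ^ p"
        by (intro power_mono) (auto intro: order_trans[OF norm_triangle_ineq])
      also have "\<dots> = 2 ^ p * (max ?a ?b) ^ p" by (simp add: power_mult_distrib)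
      also have "\<dots> \<le> 2 ^ p * (?a ^ p + ?b ^ p)"
        by (intro mult_left_mono) (auto simp: max_def)
      finally show ?thesis .
    qed
    have i1: "integrable M (\<lambda>\<omega>. 2 ^ p * (norm (Z m \<omega>) ^ p + norm (W m \<omega>) ^ p))"
      using elim(1,2) by simp
    have i2: "integrable M (\<lambda>\<omega>. norm (Z m \<omega> + W m \<omega>) ^ p)"
      by (rule Bochner_Integration.integrable_bound[OF i1]) (use b in \<open>auto simp: abs_of_nonneg add_nonneg_nonneg\<close>)
    have "(\<integral>\<omega>. norm (Z m \<omega> + W m \<omega>) ^ p \<partial>M)
        \<le> (\<integral>\<omega>. 2 ^ p * (norm (Z m \<omega>) ^ p + norm (W m \<omega>) ^ p) \<partial>M)"
      by (rule integral_mono[OF i2 i1]) (use b in auto)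
    also have "\<dots> = 2 ^ p * ((\<integral>\<omega>. norm (Z m \<omega>) ^ p \<partial>M) + (\<integral>\<omega>. norm (W m \<omega>) ^ p \<partial>M))"
      using elim(1,2) by simp
    also have "\<dots> \<le> 2 ^ p * (C * (real m powr (- r)) ^ p + E * (real m powr (- r)) ^ p)"
      using elim(1,2) by (intro mult_left_mono add_mono) auto
    finally show ?case using i2 by (simp add: algebra_simps)
  qed
  then show "\<exists>C. \<forall>\<^sub>F m in sequentially. integrable M (\<lambda>\<omega>. norm (Z m \<omega> + W m \<omega>) ^ p) \<and>
        (\<integral>\<omega>. norm (Z m \<omega> + W m \<omega>) ^ p \<partial>M) \<le> C * (real m powr (- r)) ^ p" by blast
qed

text \<open>Orders add up. A weighted Young inequality takes the place of Cauchy-Schwarz: the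
  \<open>p\<close>-th moment of the product is bounded by the moments of order \<open>2 * p\<close>
  of the two factors.\<close>

lemma moment_order_bilinear:
  fixes prod :: "'a::euclidean_space \<Rightarrow> 'b::euclidean_space \<Rightarrow> 'c::euclidean_space"
  assumes bb: "bounded_bilinear prod"
    and Z: "moment_order M r Z" and W: "moment_order M s W"
  shows "moment_order M (r + s) (\<lambda>m \<omega>. prod (Z m \<omega>) (W m \<omega>))"
  unfolding moment_order_def
proof (intro conjI allI)
  show "\<forall>\<^sub>F m in sequentially. (\<lambda>\<omega>. prod (Z m \<omega>) (W m \<omega>)) \<in> borel_measurable M"
    using moment_order_measurable[OF Z] moment_order_measurable[OF W]
    by eventually_elim (rule bounded_bilinear_measurable[OF bb])
  obtain K where K: "K > 0" "\<And>a b. norm (prod a b) \<le> norm a * norm b * K"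
    using bounded_bilinear.pos_bounded[OF bb] by blast
  fix p
  obtain C where C: "\<forall>\<^sub>F m in sequentially. integrable M (\<lambda>\<omega>. norm (Z m \<omega>) ^ (2*p)) \<and>
        (\<integral>\<omega>. norm (Z m \<omega>) ^ (2*p) \<partial>M) \<le> C * (real m powr (- r)) ^ (2*p)" "C \<ge> 0"
    by (rule moment_orderD[OF Z])
  obtain E where E: "\<forall>\<^sub>F m in sequentially. integrable M (\<lambda>\<omega>. norm (W m \<omega>) ^ (2*p)) \<and>
        (\<integral>\<omega>. norm (W m \<omega>) ^ (2*p) \<partial>M) \<le> E * (real m powr (- s)) ^ (2*p)" "E \<ge> 0"
    by (rule moment_orderD[OF W])
  have "\<forall>\<^sub>F m in sequentially. integrable M (\<lambda>\<omega>. norm (prod (Z m \<omega>) (W m \<omega>)) ^ p) \<and>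
        (\<integral>\<omega>. norm (prod (Z m \<omega>) (W m \<omega>)) ^ p \<partial>M) \<le> K ^ p * (C + E) * (real m powr (- (r + s))) ^ p"
    using C(1) E(1) moment_order_measurable[OF Z] moment_order_measurable[OF W]
      eventually_gt_at_top[of 0]
  proof eventually_elim
    case (elim m)
    have [measurable]: "(\<lambda>\<omega>. prod (Z m \<omega>) (W m \<omega>)) \<in> borel_measurable M"
      by (rule bounded_bilinear_measurable[OF bb elim(3,4)])
    \<comment> \<open>These are the nominal sizes of the \<open>p\<close>-th powers of the two
      factors; the weights \<open>\<beta> / \<alpha>\<close> and \<open>\<alpha> / \<beta>\<close>
      give both squares the size \<open>\<alpha> * \<beta>\<close> of the product.\<close>
    define \<alpha> \<beta> where "\<alpha> = (real m powr (- r)) ^ p" and "\<beta> = (real m powr (- s)) ^ p"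
    have ab: "\<alpha> > 0" "\<beta> > 0" using elim(5) by (auto simp: \<alpha>_def \<beta>_def)
    have \<alpha>\<beta>: "\<alpha> * \<beta> = (real m powr (- (r + s))) ^ p"
      by (simp add: \<alpha>_def \<beta>_def power_mult_distrib[symmetric] powr_add[symmetric])
    let ?g = "\<lambda>\<omega>. K ^ p * (\<beta> / \<alpha> * norm (Z m \<omega>) ^ (2*p) + \<alpha> / \<beta> * norm (W m \<omega>) ^ (2*p))"
    have b: "norm (prod (Z m \<omega>) (W m \<omega>)) ^ p \<le> ?g \<omega>" for \<omega>
    proof -
      let ?a = "norm (Z m \<omega>) ^ p" and ?b = "norm (W m \<omega>) ^ p"
      have "norm (prod (Z m \<omega>) (W m \<omega>)) ^ p \<le> (norm (Z m \<omega>) * norm (W m \<omega>) * K) ^ p"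
        by (intro power_mono K) auto
      also have "\<dots> = K ^ p * (?a * ?b)" by (simp add: power_mult_distrib)
      also have "\<dots> \<le> K ^ p * (\<beta> / \<alpha> * ?a\<^sup>2 + \<alpha> / \<beta> * ?b\<^sup>2)"
      proof (intro mult_left_mono)
        have "0 \<le> (\<beta> * ?a - \<alpha> * ?b)\<^sup>2" by simp
        then have "2 * (\<alpha> * \<beta>) * (?a * ?b) \<le> \<beta>\<^sup>2 * ?a\<^sup>2 + \<alpha>\<^sup>2 * ?b\<^sup>2"
          by (simp add: power2_eq_square algebra_simps)
        moreover have "0 \<le> (\<alpha> * \<beta>) * (?a * ?b)" using ab by simp
        ultimately have "(\<alpha> * \<beta>) * (?a * ?b) \<le> \<beta>\<^sup>2 * ?a\<^sup>2 + \<alpha>\<^sup>2 * ?b\<^sup>2" by linarith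
        also have "\<dots> = (\<alpha> * \<beta>) * (\<beta> / \<alpha> * ?a\<^sup>2 + \<alpha> / \<beta> * ?b\<^sup>2)"
          using ab by (simp add: field_simps power2_eq_square)
        finally show "?a * ?b \<le> \<beta> / \<alpha> * ?a\<^sup>2 + \<alpha> / \<beta> * ?b\<^sup>2"
          using ab by (simp add: mult_le_cancel_left_pos)
      qed (use K in auto)
      finally show ?thesis by (simp add: power_mult[symmetric] mult.commute)
    qed
    have i1: "integrable M ?g" using elim(1,2) by simp
    have i2: "integrable M (\<lambda>\<omega>. norm (prod (Z m \<omega>) (W m \<omega>)) ^ p)"
    proof (rule Bochner_Integration.integrable_bound[OF i1])
      have "norm (norm (prod (Z m \<omega>) (W m \<omega>)) ^ p) \<le> norm (?g \<omega>)" for \<omega>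
        using b[of \<omega>] by (metis abs_ge_self norm_ge_zero norm_power order_trans real_norm_def abs_of_nonneg)
      then show "AE \<omega> in M. norm (norm (prod (Z m \<omega>) (W m \<omega>)) ^ p) \<le> norm (?g \<omega>)" by simp
    qed simp
    have "(\<integral>\<omega>. norm (prod (Z m \<omega>) (W m \<omega>)) ^ p \<partial>M) \<le> (\<integral>\<omega>. ?g \<omega> \<partial>M)"
      by (rule integral_mono[OF i2 i1]) (use b in auto)
    also have "\<dots> = K ^ p * (\<beta> / \<alpha> * (\<integral>\<omega>. norm (Z m \<omega>) ^ (2*p) \<partial>M)
        + \<alpha> / \<beta> * (\<integral>\<omega>. norm (W m \<omega>) ^ (2*p) \<partial>M))"
      using elim(1,2) by simp
    also have "\<dots> \<le> K ^ p * (\<beta> / \<alpha> * (C * \<alpha>\<^sup>2) + \<alpha> / \<beta> * (E * \<beta>\<^sup>2))"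
      using elim(1,2) ab K(1)
      by (intro mult_left_mono add_mono) (auto simp: \<alpha>_def \<beta>_def power_mult[symmetric] mult.commute)
    also have "\<dots> = K ^ p * (C + E) * (\<alpha> * \<beta>)"
      using ab by (simp add: field_simps power2_eq_square)
    finally show ?case using i2 by (simp add: \<alpha>\<beta>)
  qed
  then show "\<exists>C. \<forall>\<^sub>F m in sequentially. integrable M (\<lambda>\<omega>. norm (prod (Z m \<omega>) (W m \<omega>)) ^ p) \<and>
        (\<integral>\<omega>. norm (prod (Z m \<omega>) (W m \<omega>)) ^ p \<partial>M) \<le> C * (real m powr (- (r + s))) ^ p" by blast
qed

lemma moment_order_linear:
  fixes f :: "'a::euclidean_space \<Rightarrow> 'c::euclidean_space"
  assumes f: "bounded_linear f" and Z: "moment_order M r Z"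
  shows "moment_order M r (\<lambda>m \<omega>. f (Z m \<omega>))"
proof -
  obtain K where K: "\<And>x. norm (f x) \<le> norm x * K" using bounded_linear.bounded[OF f] by blast
  show ?thesis
  proof (rule moment_order_dominated[OF Z, where K=K])
    show "\<forall>\<^sub>F m in sequentially. (\<lambda>\<omega>. f (Z m \<omega>)) \<in> borel_measurable M"
      using moment_order_measurable[OF Z] by eventually_elim (rule bounded_linear_measurable[OF f])
  qed (use K in \<open>auto simp: mult.commute\<close>)
qed

lemmas moment_order_uminus = moment_order_linear[OF bounded_linear_minus[OF bounded_linear_ident]]
lemmas moment_order_mult = moment_order_bilinear[OF bounded_bilinear_mult]
lemmas moment_order_scaleR2 = moment_order_bilinear[OF bounded_bilinear_scaleR]
lemmas moment_order_matrix_mult = moment_order_bilinear[OF bounded_bilinear_matrix_mult]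
lemmas moment_order_matrix_vector = moment_order_bilinear[OF bounded_bilinear_matrix_vector_mult]
lemmas moment_order_outer = moment_order_bilinear[OF bounded_bilinear_outer]

lemma moment_order_diff:
  assumes "moment_order M r Z" "moment_order M r W"
  shows "moment_order M r (\<lambda>m \<omega>. Z m \<omega> - W m \<omega>)"
  using moment_order_add[OF assms(1) moment_order_uminus[OF assms(2)]] by simp

lemma moment_order_deterministic:
  assumes M: "prob_space M"
    and c: "\<forall>\<^sub>F m in sequentially. norm (c m) \<le> C * real m powr (- r)"
  shows "moment_order M r (\<lambda>m \<omega>. c m)"
  unfolding moment_order_def
proof (intro conjI allI)
  interpret prob_space M by (rule M)
  fix p
  have "\<forall>\<^sub>F m in sequentially. integrable M (\<lambda>\<omega>. norm (c m) ^ p) \<and>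
        (\<integral>\<omega>. norm (c m) ^ p \<partial>M) \<le> C ^ p * (real m powr (- r)) ^ p"
    using c
  proof eventually_elim
    case (elim m)
    then have "norm (c m) ^ p \<le> (C * real m powr (- r)) ^ p" by (intro power_mono) auto
    then show ?case by (simp add: prob_space power_mult_distrib)
  qed
  then show "\<exists>C. \<forall>\<^sub>F m in sequentially. integrable M (\<lambda>\<omega>. norm (c m) ^ p) \<and>
        (\<integral>\<omega>. norm (c m) ^ p \<partial>M) \<le> C * (real m powr (- r)) ^ p" by blast
qed simp

lemma moment_order_const:
  assumes "prob_space M"
  shows "moment_order M 0 (\<lambda>m \<omega>. c)"
proof (rule moment_order_deterministic[OF assms])
  show "\<forall>\<^sub>F m in sequentially. norm c \<le> norm c * real m powr (- 0)"
    using eventually_gt_at_top[of 0] by eventually_elim simp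
qed

lemma moment_order_0:
  assumes "prob_space M"
  shows "moment_order M r (\<lambda>m \<omega>. 0)"
  by (rule moment_order_deterministic[OF assms, where C=0]) auto

lemma moment_order_sum:
  assumes "prob_space M" and "\<And>i. i \<in> I \<Longrightarrow> moment_order M r (Z i)"
  shows "moment_order M r (\<lambda>m \<omega>. \<Sum>i\<in>I. Z i m \<omega>)"
  using assms(2)
proof (induction I rule: infinite_finite_induct)
  case (insert x F)
  then show ?case using moment_order_add[of M r "Z x" "\<lambda>m \<omega>. \<Sum>i\<in>F. Z i m \<omega>"] by simp
qed (simp_all add: moment_order_0[OF assms(1)])

lemma moment_order_fixed:
  assumes "Z \<in> borel_measurable M" "\<And>p::nat. integrable M (\<lambda>\<omega>. norm (Z \<omega>) ^ p)"
  shows "moment_order M 0 (\<lambda>m. Z)"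
  unfolding moment_order_def
proof (intro conjI allI)
  fix p
  have "\<forall>\<^sub>F m in sequentially. integrable M (\<lambda>\<omega>. norm (Z \<omega>) ^ p) \<and>
        (\<integral>\<omega>. norm (Z \<omega>) ^ p \<partial>M) \<le> (\<integral>\<omega>. norm (Z \<omega>) ^ p \<partial>M) * (real m powr (- 0)) ^ p"
    using eventually_gt_at_top[of 0] by eventually_elim (use assms in simp)
  then show "\<exists>C. \<forall>\<^sub>F m in sequentially. integrable M (\<lambda>\<omega>. norm (Z \<omega>) ^ p) \<and>
        (\<integral>\<omega>. norm (Z \<omega>) ^ p \<partial>M) \<le> C * (real m powr (- 0)) ^ p" by blast
qed (use assms in auto)

lemma moment_order_components:
  fixes Z :: "nat \<Rightarrow> 'w \<Rightarrow> 'b::euclidean_space"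
  assumes "prob_space M" and Z: "\<And>b. b \<in> Basis \<Longrightarrow> moment_order M r (\<lambda>m \<omega>. Z m \<omega> \<bullet> b)"
  shows "moment_order M r Z"
proof -
  have "moment_order M r (\<lambda>m \<omega>. \<Sum>b\<in>Basis. (Z m \<omega> \<bullet> b) *\<^sub>R b)"
    by (intro moment_order_sum assms moment_order_linear[OF bounded_linear_scaleR_left Z])
  then show ?thesis by (simp add: euclidean_representation)
qed

lemma moment_order_vec:
  fixes Z :: "nat \<Rightarrow> 'w \<Rightarrow> real^'n"
  assumes "prob_space M" and Z: "\<And>i. moment_order M r (\<lambda>m \<omega>. Z m \<omega> $ i)"
  shows "moment_order M r Z"
  by (rule moment_order_components[OF assms(1)]) (auto simp: Basis_vec_def inner_axis intro: Z)

lemma moment_order_mat: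
  fixes Z :: "nat \<Rightarrow> 'w \<Rightarrow> real^'n^'k"
  assumes "prob_space M" and Z: "\<And>i j. moment_order M r (\<lambda>m \<omega>. Z m \<omega> $ i $ j)"
  shows "moment_order M r Z"
  by (rule moment_order_components[OF assms(1)]) (auto simp: Basis_vec_def inner_axis intro: Z)

lemma moment_order_nth:
  fixes Z :: "nat \<Rightarrow> 'w \<Rightarrow> real^'n"
  assumes "moment_order M r Z"
  shows "moment_order M r (\<lambda>m \<omega>. Z m \<omega> $ i)"
  by (rule moment_order_linear[OF bounded_linear_vec_nth assms])

lemma moment_order_norm:
  assumes "moment_order M r Z"
  shows "moment_order M r (\<lambda>m \<omega>. norm (Z m \<omega>))"
proof (rule moment_order_dominated[OF assms, where K=1])
  show "\<forall>\<^sub>F m in sequentially. (\<lambda>\<omega>. norm (Z m \<omega>)) \<in> borel_measurable M"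
    using moment_order_measurable[OF assms] by eventually_elim simp
qed auto

lemma moment_order_integrable:
  assumes "moment_order M r Z"
  shows "\<forall>\<^sub>F m in sequentially. integrable M (Z m)"
proof -
  obtain C where C: "\<forall>\<^sub>F m in sequentially. integrable M (\<lambda>\<omega>. norm (Z m \<omega>) ^ 1) \<and>
        (\<integral>\<omega>. norm (Z m \<omega>) ^ 1 \<partial>M) \<le> C * (real m powr (- r)) ^ 1" "C \<ge> 0"
    by (rule moment_orderD[OF assms])
  show ?thesis using C(1) moment_order_measurable[OF assms]
  proof eventually_elim
    case (elim m)
    then have "integrable M (\<lambda>\<omega>. norm (Z m \<omega>))" by simp
    then show ?case using elim(2) by (simp add: integrable_norm_iff)
  qed
qed

text \<open>The case \<open>p = 1\<close>; here stochastic orders become the error terms of the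
  theorem.\<close>

lemma moment_order_expectation:
  assumes "moment_order M r Z"
  shows "(\<lambda>m. norm (\<integral>\<omega>. Z m \<omega> \<partial>M)) \<in> O(\<lambda>m. real m powr (- r))"
proof -
  obtain C where C: "\<forall>\<^sub>F m in sequentially. integrable M (\<lambda>\<omega>. norm (Z m \<omega>) ^ 1) \<and>
        (\<integral>\<omega>. norm (Z m \<omega>) ^ 1 \<partial>M) \<le> C * (real m powr (- r)) ^ 1" "C \<ge> 0"
    by (rule moment_orderD[OF assms])
  have "\<forall>\<^sub>F m in sequentially. norm (norm (\<integral>\<omega>. Z m \<omega> \<partial>M)) \<le> C * norm (real m powr (- r))"
    using C(1)
  proof eventually_elim
    case (elim m)
    have "(\<integral>\<omega>. norm (Z m \<omega>) \<partial>M) \<le> C * real m powr (- r)" using elim by simp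
    then have "norm (\<integral>\<omega>. Z m \<omega> \<partial>M) \<le> C * real m powr (- r)"
      by (rule order_trans[OF integral_norm_bound])
    then show ?case by simp
  qed
  then show ?thesis by (rule bigoI)
qed

section \<open>Weighted sums of independent centered variables\<close>

lemma power_le_fact_exp:
  fixes y :: real
  assumes "0 \<le> y"
  shows "y ^ p \<le> fact p * exp y"
proof -
  obtain t where t: "exp y = (\<Sum>m<Suc p. (y ^ m) / fact m) + (exp t / fact (Suc p)) * y ^ Suc p"
    using Maclaurin_exp_le[of y "Suc p"] by blast
  have "y ^ p / fact p \<le> (\<Sum>m<Suc p. (y ^ m) / fact m)"
    using assms by (intro member_le_sum) auto
  also have "\<dots> \<le> exp y"
    unfolding t using assms by (intro le_add_same_cancel1[THEN iffD2] mult_nonneg_nonneg) auto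
  finally show ?thesis by (simp add: field_simps)
qed

lemma exp_le_quadratic:
  fixes x :: real
  shows "exp x \<le> 1 + x + x\<^sup>2 * exp \<bar>x\<bar>"
proof -
  obtain t where t: "\<bar>t\<bar> \<le> \<bar>x\<bar>" "exp x = (\<Sum>m<2. (x ^ m) / fact m) + (exp t / fact 2) * x ^ 2"
    using Maclaurin_exp_le[of x 2] by blast
  have "exp t \<le> exp \<bar>x\<bar>" using t(1) by simp
  then have "exp t / fact 2 \<le> exp \<bar>x\<bar>" using exp_gt_zero[of t] unfolding fact_2 by linarith
  then have "exp t / fact 2 * x ^ 2 \<le> exp \<bar>x\<bar> * x\<^sup>2"
    by (intro mult_right_mono) auto
  then show ?thesis using t(2) by (simp add: numeral_2_eq_2 mult.commute)
qed

text \<open>Half of the exponential rate is spent on the linear form. With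
  \<open>y = c / 2 * \<bar>x\<bar>\<close> the quadratic remainder is at most
  \<open>a\<^sup>2 * y\<^sup>2 * exp y\<close>, and \<open>y\<^sup>2 \<le> 2 * exp y\<close> uses
  the other half. The linear term disappears by centering.\<close>

lemma (in prob_space) centered_mgf_le:
  fixes x :: "'a \<Rightarrow> real"
  assumes c: "c > 0" and x: "integrable M x" "expectation x = 0"
    and ex: "integrable M (\<lambda>\<omega>. exp (c * \<bar>x \<omega>\<bar>))" "expectation (\<lambda>\<omega>. exp (c * \<bar>x \<omega>\<bar>)) \<le> K"
    and a: "\<bar>a\<bar> \<le> 1"
  shows "integrable M (\<lambda>\<omega>. exp (c / 2 * a * x \<omega>))"
    and "expectation (\<lambda>\<omega>. exp (c / 2 * a * x \<omega>)) \<le> exp (2 * K * a\<^sup>2)"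
proof -
  have [measurable]: "x \<in> borel_measurable M" using x by auto
  show i: "integrable M (\<lambda>\<omega>. exp (c / 2 * a * x \<omega>))"
  proof (rule Bochner_Integration.integrable_bound[OF ex(1)])
    have "c / 2 * a * x \<omega> \<le> c * \<bar>x \<omega>\<bar>" for \<omega>
    proof -
      have "c / 2 * a * x \<omega> \<le> \<bar>c / 2 * a * x \<omega>\<bar>" by simp
      also have "\<dots> = c / 2 * \<bar>a\<bar> * \<bar>x \<omega>\<bar>" using c by (simp add: abs_mult)
      also have "\<dots> \<le> c * 1 * \<bar>x \<omega>\<bar>" using c a by (intro mult_right_mono mult_mono) auto
      finally show ?thesis by simp
    qed
    then show "AE \<omega> in M. norm (exp (c / 2 * a * x \<omega>)) \<le> norm (exp (c * \<bar>x \<omega>\<bar>))" by simp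
  qed measurable
  have le: "exp (c / 2 * a * x \<omega>) \<le> 1 + c / 2 * a * x \<omega> + 2 * a\<^sup>2 * exp (c * \<bar>x \<omega>\<bar>)" for \<omega>
  proof -
    define y where "y = c / 2 * \<bar>x \<omega>\<bar>"
    have y: "y \<ge> 0" using c by (simp add: y_def)
    have "exp (c / 2 * a * x \<omega>) \<le> 1 + c / 2 * a * x \<omega> + (c / 2 * a * x \<omega>)\<^sup>2 * exp \<bar>c / 2 * a * x \<omega>\<bar>"
      by (rule exp_le_quadratic)
    also have "(c / 2 * a * x \<omega>)\<^sup>2 = a\<^sup>2 * y ^ 2" by (simp add: y_def power_mult_distrib power_divide)
    also have "a\<^sup>2 * y ^ 2 * exp \<bar>c / 2 * a * x \<omega>\<bar> \<le> a\<^sup>2 * (fact 2 * exp y) * exp y"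
    proof (intro mult_mono power_le_fact_exp mult_nonneg_nonneg order_refl)
      have "\<bar>c / 2 * a * x \<omega>\<bar> = \<bar>a\<bar> * y" using c by (simp add: abs_mult y_def)
      also have "\<dots> \<le> 1 * y" using a y by (intro mult_right_mono) auto
      finally show "exp \<bar>c / 2 * a * x \<omega>\<bar> \<le> exp y" by simp
    qed (use y in auto)
    also have "a\<^sup>2 * (fact 2 * exp y) * exp y = 2 * a\<^sup>2 * exp (y + y)"
      by (simp add: mult_exp_exp)
    also have "y + y = c * \<bar>x \<omega>\<bar>" by (simp add: y_def)
    finally show ?thesis by simp
  qed
  have "expectation (\<lambda>\<omega>. exp (c / 2 * a * x \<omega>))
      \<le> expectation (\<lambda>\<omega>. 1 + c / 2 * a * x \<omega> + 2 * a\<^sup>2 * exp (c * \<bar>x \<omega>\<bar>))"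
    by (rule integral_mono[OF i]) (use x ex le in auto)
  also have "\<dots> = 1 + 2 * a\<^sup>2 * expectation (\<lambda>\<omega>. exp (c * \<bar>x \<omega>\<bar>))"
    using x ex by (simp add: prob_space)
  also have "\<dots> \<le> 1 + 2 * a\<^sup>2 * K"
    using ex(2) by (intro add_left_mono mult_left_mono) auto
  also have "\<dots> \<le> exp (2 * K * a\<^sup>2)"
    using exp_ge_add_one_self[of "2 * K * a\<^sup>2"] by (simp add: mult_ac)
  finally show "expectation (\<lambda>\<omega>. exp (c / 2 * a * x \<omega>)) \<le> exp (2 * K * a\<^sup>2)" .
qed

text \<open>Chernoff's method: by independence the exponential moment of the sum at rate
  \<open>c / 2\<close> is at most \<open>exp (2 * K)\<close>, whatever the number of summands, and
  powers are dominated by exponentials. All moments follow at once, without expanding a power of the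
  sum.\<close>

lemma (in prob_space) weighted_sum_moment_le_unit:
  fixes x :: "nat \<Rightarrow> 'a \<Rightarrow> real"
  assumes c: "c > 0" and I: "finite I" and ind: "indep_vars (\<lambda>_. borel) x I"
    and x: "\<And>i. i \<in> I \<Longrightarrow> integrable M (x i)" "\<And>i. i \<in> I \<Longrightarrow> expectation (x i) = 0"
    and ex: "\<And>i. i \<in> I \<Longrightarrow> integrable M (\<lambda>\<omega>. exp (c * \<bar>x i \<omega>\<bar>))"
      "\<And>i. i \<in> I \<Longrightarrow> expectation (\<lambda>\<omega>. exp (c * \<bar>x i \<omega>\<bar>)) \<le> K"
    and K: "K \<ge> 0" and a: "(\<Sum>i\<in>I. (a i)\<^sup>2) \<le> 1"
  shows "integrable M (\<lambda>\<omega>. \<bar>\<Sum>i\<in>I. a i * x i \<omega>\<bar> ^ p)"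
    and "expectation (\<lambda>\<omega>. \<bar>\<Sum>i\<in>I. a i * x i \<omega>\<bar> ^ p) \<le> 2 * fact p * (2 / c) ^ p * exp (2 * K)"
proof -
  have x_meas: "x i \<in> borel_measurable M" if "i \<in> I" for i using x(1)[OF that] by auto
  define z where "z \<omega> = (\<Sum>i\<in>I. a i * x i \<omega>)" for \<omega>
  have [measurable]: "z \<in> borel_measurable M"
    unfolding z_def using x_meas by (intro borel_measurable_sum borel_measurable_times) auto
  have a1: "\<bar>a i\<bar> \<le> 1" if "i \<in> I" for i
  proof -
    have "(a i)\<^sup>2 \<le> (\<Sum>i\<in>I. (a i)\<^sup>2)" using I that by (intro member_le_sum) auto
    with a have "(a i)\<^sup>2 \<le> 1" by linarith
    then show ?thesis by (simp add: abs_square_le_1)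
  qed
  \<comment> \<open>Both signs are treated because \<open>exp (c / 2 * \<bar>z\<bar>)\<close> is
    bounded by the sum of the two exponentials.\<close>
  have mgf: "integrable M (\<lambda>\<omega>. exp (s * c / 2 * z \<omega>)) \<and> expectation (\<lambda>\<omega>. exp (s * c / 2 * z \<omega>)) \<le> exp (2 * K)"
    if s: "s = 1 \<or> s = -1" for s
  proof -
    have sa: "\<bar>s * a i\<bar> \<le> 1" if "i \<in> I" for i using a1[OF that] s by auto
    note m = centered_mgf_le[OF c x(1) x(2) ex(1) ex(2) sa]
    have prod: "exp (s * c / 2 * z \<omega>) = (\<Prod>i\<in>I. exp (c / 2 * (s * a i) * x i \<omega>))" for \<omega>
      using I by (simp add: z_def sum_distrib_left exp_sum[symmetric] mult_ac sum_divide_distrib)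
    have ind': "indep_vars (\<lambda>_. borel) (\<lambda>i \<omega>. exp (c / 2 * (s * a i) * x i \<omega>)) I"
      by (rule indep_vars_compose2[OF ind]) measurable
    have h1: "integrable M (\<lambda>\<omega>. \<Prod>i\<in>I. exp (c / 2 * (s * a i) * x i \<omega>))"
      by (rule indep_vars_integrable[OF I ind']) (use m in auto)
    have h2: "expectation (\<lambda>\<omega>. \<Prod>i\<in>I. exp (c / 2 * (s * a i) * x i \<omega>))
       = (\<Prod>i\<in>I. expectation (\<lambda>\<omega>. exp (c / 2 * (s * a i) * x i \<omega>)))"
      by (rule indep_vars_lebesgue_integral[OF I ind']) (use m in auto)
    have h3: "(\<Prod>i\<in>I. expectation (\<lambda>\<omega>. exp (c / 2 * (s * a i) * x i \<omega>))) \<le> (\<Prod>i\<in>I. exp (2 * K * (s * a i)\<^sup>2))"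
      using m by (intro prod_mono) auto
    have h4: "(\<Prod>i\<in>I. exp (2 * K * (s * a i)\<^sup>2)) = exp (2 * K * (\<Sum>i\<in>I. (a i)\<^sup>2))"
      using I s by (auto simp: exp_sum[symmetric] sum_distrib_left power_mult_distrib)
    have h5: "exp (2 * K * (\<Sum>i\<in>I. (a i)\<^sup>2)) \<le> exp (2 * K)"
      using a K by (simp add: mult_left_le)
    show ?thesis unfolding prod
    proof (intro conjI)
      show "expectation (\<lambda>\<omega>. \<Prod>i\<in>I. exp (c / 2 * (s * a i) * x i \<omega>)) \<le> exp (2 * K)"
        using h2 h3 h4 h5 by linarith
    qed (rule h1)
  qed
  have le: "\<bar>z \<omega>\<bar> ^ p \<le> fact p * (2 / c) ^ p * (exp (1 * c / 2 * z \<omega>) + exp (-1 * c / 2 * z \<omega>))" for \<omega>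
  proof -
    have "(c / 2 * \<bar>z \<omega>\<bar>) ^ p \<le> fact p * exp (c / 2 * \<bar>z \<omega>\<bar>)"
      using c by (intro power_le_fact_exp) auto
    also have "exp (c / 2 * \<bar>z \<omega>\<bar>) \<le> exp (1 * c / 2 * z \<omega>) + exp (-1 * c / 2 * z \<omega>)"
      by (cases "z \<omega> \<ge> 0") (auto simp: add_increasing add_increasing2)
    finally have "(2 / c) ^ p * (c / 2 * \<bar>z \<omega>\<bar>) ^ p
      \<le> (2 / c) ^ p * (fact p * (exp (1 * c / 2 * z \<omega>) + exp (-1 * c / 2 * z \<omega>)))"
      using c by (intro mult_left_mono) auto
    then show ?thesis using c
      by (simp add: power_mult_distrib[symmetric] mult_ac)
  qed
  let ?g = "\<lambda>\<omega>. fact p * (2 / c) ^ p * (exp (1 * c / 2 * z \<omega>) + exp (-1 * c / 2 * z \<omega>))"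
  have i1: "integrable M ?g"
    using mgf[of 1] mgf[of "-1"] by (intro integrable_mult_right integrable_add) auto
  have i2: "integrable M (\<lambda>\<omega>. \<bar>z \<omega>\<bar> ^ p)"
  proof (rule Bochner_Integration.integrable_bound[OF i1])
    have "norm (\<bar>z \<omega>\<bar> ^ p) \<le> norm (?g \<omega>)" for \<omega>
      using order_trans[OF le abs_ge_self, of \<omega>] by simp
    then show "AE \<omega> in M. norm (\<bar>z \<omega>\<bar> ^ p) \<le> norm (?g \<omega>)" by simp
  qed measurable
  then show "integrable M (\<lambda>\<omega>. \<bar>\<Sum>i\<in>I. a i * x i \<omega>\<bar> ^ p)" by (simp add: z_def)
  have "expectation (\<lambda>\<omega>. \<bar>z \<omega>\<bar> ^ p) \<le> expectation ?g"
    by (rule integral_mono[OF i2 i1 le])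
  also have "\<dots> = fact p * (2 / c) ^ p *
      (expectation (\<lambda>\<omega>. exp (1 * c / 2 * z \<omega>)) + expectation (\<lambda>\<omega>. exp (-1 * c / 2 * z \<omega>)))"
    using mgf[of 1] mgf[of "-1"] by (subst integral_mult_right_zero, subst Bochner_Integration.integral_add) auto
  also have "\<dots> \<le> fact p * (2 / c) ^ p * (exp (2 * K) + exp (2 * K))"
    using mgf[of 1] mgf[of "-1"] c by (intro mult_left_mono add_mono) auto
  finally show "expectation (\<lambda>\<omega>. \<bar>\<Sum>i\<in>I. a i * x i \<omega>\<bar> ^ p) \<le> 2 * fact p * (2 / c) ^ p * exp (2 * K)"
    by (simp add: z_def mult_ac)
qed

lemma (in prob_space) weighted_sum_moment_le:
  fixes x :: "nat \<Rightarrow> 'a \<Rightarrow> real"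
  assumes c: "c > 0" and I: "finite I" and ind: "indep_vars (\<lambda>_. borel) x I"
    and x: "\<And>i. i \<in> I \<Longrightarrow> integrable M (x i)" "\<And>i. i \<in> I \<Longrightarrow> expectation (x i) = 0"
    and ex: "\<And>i. i \<in> I \<Longrightarrow> integrable M (\<lambda>\<omega>. exp (c * \<bar>x i \<omega>\<bar>))"
      "\<And>i. i \<in> I \<Longrightarrow> expectation (\<lambda>\<omega>. exp (c * \<bar>x i \<omega>\<bar>)) \<le> K"
    and K: "K \<ge> 0" and a: "(\<Sum>i\<in>I. (a i)\<^sup>2) \<le> s\<^sup>2" and s: "s > 0"
  shows "integrable M (\<lambda>\<omega>. \<bar>\<Sum>i\<in>I. a i * x i \<omega>\<bar> ^ p)"
    and "expectation (\<lambda>\<omega>. \<bar>\<Sum>i\<in>I. a i * x i \<omega>\<bar> ^ p) \<le> (2 * fact p * (2 / c) ^ p * exp (2 * K)) * s ^ p"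
proof -
  have a': "(\<Sum>i\<in>I. (a i / s)\<^sup>2) \<le> 1"
    using a s by (simp add: power_divide sum_divide_distrib[symmetric])
  note u = weighted_sum_moment_le_unit[OF c I ind x ex K a', of p]
  have eq: "\<bar>\<Sum>i\<in>I. a i * x i \<omega>\<bar> ^ p = s ^ p * \<bar>\<Sum>i\<in>I. a i / s * x i \<omega>\<bar> ^ p" for \<omega>
  proof -
    have "(\<Sum>i\<in>I. a i * x i \<omega>) = s * (\<Sum>i\<in>I. a i / s * x i \<omega>)"
      using s by (simp add: sum_distrib_left)
    then show ?thesis using s by (simp add: abs_mult power_mult_distrib)
  qed
  show "integrable M (\<lambda>\<omega>. \<bar>\<Sum>i\<in>I. a i * x i \<omega>\<bar> ^ p)" unfolding eq using u(1) by simp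
  have "s ^ p * expectation (\<lambda>\<omega>. \<bar>\<Sum>i\<in>I. a i / s * x i \<omega>\<bar> ^ p)
     \<le> s ^ p * (2 * fact p * (2 / c) ^ p * exp (2 * K))"
    using u(2) s by (intro mult_left_mono) auto
  then show "expectation (\<lambda>\<omega>. \<bar>\<Sum>i\<in>I. a i * x i \<omega>\<bar> ^ p) \<le> (2 * fact p * (2 / c) ^ p * exp (2 * K)) * s ^ p"
    unfolding eq by (simp add: mult_ac)
qed

text \<open>Source of the stochastic orders of linear and quadratic statistics: the order is read
  off the sum of squared weights.\<close>

lemma moment_order_weighted_sum:
  fixes x :: "nat \<Rightarrow> 'a \<Rightarrow> real"
  assumes M: "prob_space M" and c: "c > 0"
    and I: "\<And>m. finite (I m)" "\<And>m. I m \<subseteq> J" and ind: "prob_space.indep_vars M (\<lambda>_. borel) x J"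
    and x: "\<And>i. i \<in> J \<Longrightarrow> integrable M (x i)" "\<And>i. i \<in> J \<Longrightarrow> (\<integral>\<omega>. x i \<omega> \<partial>M) = 0"
    and ex: "\<And>i. i \<in> J \<Longrightarrow> integrable M (\<lambda>\<omega>. exp (c * \<bar>x i \<omega>\<bar>))"
      "\<And>i. i \<in> J \<Longrightarrow> (\<integral>\<omega>. exp (c * \<bar>x i \<omega>\<bar>) \<partial>M) \<le> K"
    and w: "\<forall>\<^sub>F m in sequentially. (\<Sum>i\<in>I m. (w m i)\<^sup>2) \<le> B * (real m powr (- r))\<^sup>2"
  shows "moment_order M r (\<lambda>m \<omega>. \<Sum>i\<in>I m. w m i * x i \<omega>)"
  unfolding moment_order_def
proof (intro conjI allI)
  interpret prob_space M by (rule M)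
  have "x i \<in> borel_measurable M" if "i \<in> I m" for i m using x(1) I(2) that by blast
  then show "\<forall>\<^sub>F m in sequentially. (\<lambda>\<omega>. \<Sum>i\<in>I m. w m i * x i \<omega>) \<in> borel_measurable M"
    by (intro always_eventually allI borel_measurable_sum borel_measurable_times) auto
  fix p
  define C where "C = 2 * fact p * (2 / c) ^ p * exp (2 * \<bar>K\<bar>)"
  \<comment> \<open>The extra 1 makes the scale positive, since the rescaled weights are divided by
    it.\<close>
  define b where "b = sqrt (\<bar>B\<bar> + 1)"
  have b: "b > 0" "b\<^sup>2 = \<bar>B\<bar> + 1" by (auto simp: b_def intro: add_nonneg_pos)
  have "\<forall>\<^sub>F m in sequentially. integrable M (\<lambda>\<omega>. norm (\<Sum>i\<in>I m. w m i * x i \<omega>) ^ p) \<and>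
        (\<integral>\<omega>. norm (\<Sum>i\<in>I m. w m i * x i \<omega>) ^ p \<partial>M) \<le> C * b ^ p * (real m powr (- r)) ^ p"
    using w eventually_gt_at_top[of 0]
  proof eventually_elim
    case (elim m)
    have pos: "b * real m powr (- r) > 0" using elim b by simp
    have "B * (real m powr (- r))\<^sup>2 \<le> b\<^sup>2 * (real m powr (- r))\<^sup>2"
      unfolding b(2) by (intro mult_right_mono) auto
    with elim(1) have le: "(\<Sum>i\<in>I m. (w m i)\<^sup>2) \<le> (b * real m powr (- r))\<^sup>2"
      by (simp add: power_mult_distrib)
    have h1: "indep_vars (\<lambda>_. borel) x (I m)" using ind I(2) by (rule indep_vars_subset)
    have h2: "expectation (\<lambda>\<omega>. exp (c * \<bar>x i \<omega>\<bar>)) \<le> \<bar>K\<bar>" if "i \<in> I m" for i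
      using ex(2)[of i] I(2)[of m] that by (auto intro: order_trans[OF _ abs_ge_self])
    have h3: "integrable M (x i)" "expectation (x i) = 0"
      "integrable M (\<lambda>\<omega>. exp (c * \<bar>x i \<omega>\<bar>))" if "i \<in> I m" for i
      using x ex(1) I(2)[of m] that by auto
    note h = weighted_sum_moment_le[OF c I(1) h1 h3 h2 abs_ge_zero le pos, of p]
    show ?case using h(1) h(2) by (simp add: C_def power_mult_distrib mult.assoc)
  qed
  then show "\<exists>C. \<forall>\<^sub>F m in sequentially. integrable M (\<lambda>\<omega>. norm (\<Sum>i\<in>I m. w m i * x i \<omega>) ^ p) \<and>
        (\<integral>\<omega>. norm (\<Sum>i\<in>I m. w m i * x i \<omega>) ^ p \<partial>M) \<le> C * (real m powr (- r)) ^ p" by blast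
qed

section \<open>Centered normal variables\<close>

definition centered_normal :: "'w measure \<Rightarrow> ('w \<Rightarrow> real) \<Rightarrow> real \<Rightarrow> bool" where
  "centered_normal M g s \<longleftrightarrow> g \<in> borel_measurable M \<and> 0 \<le> s \<and>
     (if s = 0 then AE \<omega> in M. g \<omega> = 0 else distributed M lborel g (normal_density 0 (sqrt s)))"

lemma multivariate_normal_imp_centered_normal:
  fixes Z :: "'w \<Rightarrow> real^'n"
  assumes "multivariate_normal M Z 0 S"
  shows "centered_normal M (\<lambda>\<omega>. c \<bullet> Z \<omega>) (c \<bullet> (S *v c))"
proof -
  have [measurable]: "Z \<in> borel_measurable M" using assms by (simp add: multivariate_normal_def)
  have "(\<lambda>\<omega>. c \<bullet> Z \<omega>) \<in> borel_measurable M" by measurable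
  then show ?thesis
    using assms by (auto simp: multivariate_normal_def centered_normal_def pos_semidef_def split: if_splits)
qed

context prob_space
begin

lemma centered_normal_moments:
  assumes g: "centered_normal M g s"
  shows "integrable M (\<lambda>\<omega>. \<bar>g \<omega>\<bar> ^ p)" and "integrable M (\<lambda>\<omega>. g \<omega> ^ p)"
    and "expectation g = 0" and "expectation (\<lambda>\<omega>. (g \<omega>)\<^sup>2) = s"
    and "expectation (\<lambda>\<omega>. g \<omega> ^ 4) = 3 * s\<^sup>2"
proof -
  have [measurable]: "g \<in> borel_measurable M" using g by (simp add: centered_normal_def)
  have all: "integrable M (\<lambda>\<omega>. \<bar>g \<omega>\<bar> ^ p) \<and> expectation g = 0 \<and>
    expectation (\<lambda>\<omega>. (g \<omega>)\<^sup>2) = s \<and> expectation (\<lambda>\<omega>. g \<omega> ^ 4) = 3 * s\<^sup>2"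
  proof (cases "s = 0")
    case True
    then have ae: "AE \<omega> in M. g \<omega> = 0" using g by (simp add: centered_normal_def)
    have "integrable M (\<lambda>\<omega>. \<bar>g \<omega>\<bar> ^ p) \<longleftrightarrow> integrable M (\<lambda>\<omega>. 0 ^ p :: real)"
      using ae by (intro integrable_cong_AE) auto
    moreover have "expectation g = expectation (\<lambda>\<omega>. 0)"
      "expectation (\<lambda>\<omega>. (g \<omega>)\<^sup>2) = expectation (\<lambda>\<omega>. 0)"
      "expectation (\<lambda>\<omega>. g \<omega> ^ 4) = expectation (\<lambda>\<omega>. 0)"
      using ae by (intro integral_cong_AE; auto)+
    ultimately show ?thesis using True by simp
  next
    case False
    then have s: "s > 0" and d: "distributed M lborel g (normal_density 0 (sqrt s))"
      using g by (auto simp: centered_normal_def)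
    have "integrable M (\<lambda>\<omega>. \<bar>g \<omega>\<bar> ^ p)"
      using integrable_normal_moment_abs[of "sqrt s" 0 p] distributed_integrable[OF d, of "\<lambda>x. \<bar>x\<bar> ^ p"] s
      by simp
    moreover have "expectation g = 0"
      using integral_normal_moment_odd[of "sqrt s" 0 0] distributed_integral[OF d, of "\<lambda>x. x"] s by simp
    moreover have "expectation (\<lambda>\<omega>. (g \<omega>)\<^sup>2) = s"
      using integral_normal_moment_even[of "sqrt s" 0 1] distributed_integral[OF d, of "\<lambda>x. x\<^sup>2"] s
      by simp
    moreover have "expectation (\<lambda>\<omega>. g \<omega> ^ 4) = 3 * s\<^sup>2"
      using integral_normal_moment_even[of "sqrt s" 0 2] distributed_integral[OF d, of "\<lambda>x. x ^ 4"] s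
      by (simp add: fact_numeral field_simps power2_eq_square)
    ultimately show ?thesis by simp
  qed
  from all show "integrable M (\<lambda>\<omega>. \<bar>g \<omega>\<bar> ^ p)" "expectation g = 0" "expectation (\<lambda>\<omega>. (g \<omega>)\<^sup>2) = s"
    "expectation (\<lambda>\<omega>. g \<omega> ^ 4) = 3 * s\<^sup>2" by blast+
  show "integrable M (\<lambda>\<omega>. g \<omega> ^ p)"
    by (rule Bochner_Integration.integrable_bound[OF all[THEN conjunct1]]) (simp_all add: power_abs)
qed

text \<open>Completing the square turns the integrand into \<open>1 / q\<close> times another normal
  density, so the expectation is \<open>1 / q\<close> with
  \<open>q = sqrt (1 - 2 * \<kappa> * s)\<close>. The bound on \<open>\<kappa> * s\<close> keeps
  \<open>q\<close> above \<open>1 / 2\<close>.\<close>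

lemma centered_normal_exp_square:
  assumes g: "centered_normal M g s" and \<kappa>: "\<kappa> * s \<le> 1 / 4" "\<kappa> \<ge> 0"
  shows "integrable M (\<lambda>\<omega>. exp (\<kappa> * (g \<omega>)\<^sup>2))" and "expectation (\<lambda>\<omega>. exp (\<kappa> * (g \<omega>)\<^sup>2)) \<le> 2"
proof -
  have [measurable]: "g \<in> borel_measurable M" using g by (simp add: centered_normal_def)
  have "integrable M (\<lambda>\<omega>. exp (\<kappa> * (g \<omega>)\<^sup>2)) \<and> expectation (\<lambda>\<omega>. exp (\<kappa> * (g \<omega>)\<^sup>2)) \<le> 2"
  proof (cases "s = 0")
    case True
    then have ae: "AE \<omega> in M. g \<omega> = 0" using g by (simp add: centered_normal_def)
    have "integrable M (\<lambda>\<omega>. exp (\<kappa> * (g \<omega>)\<^sup>2)) \<longleftrightarrow> integrable M (\<lambda>\<omega>. 1 :: real)"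
      using ae by (intro integrable_cong_AE) auto
    moreover have "expectation (\<lambda>\<omega>. exp (\<kappa> * (g \<omega>)\<^sup>2)) = expectation (\<lambda>\<omega>. 1)"
      using ae by (intro integral_cong_AE) auto
    ultimately show ?thesis by (simp add: prob_space)
  next
    case False
    then have s: "s > 0" and d: "distributed M lborel g (normal_density 0 (sqrt s))"
      using g by (auto simp: centered_normal_def)
    define q where "q = sqrt (1 - 2 * \<kappa> * s)"
    have q2: "q\<^sup>2 = 1 - 2 * \<kappa> * s" using \<kappa> by (simp add: q_def)
    have "1 / 2 \<le> q"
      unfolding q_def by (rule real_le_rsqrt) (use \<kappa> in \<open>simp add: power2_eq_square\<close>)
    then have q: "q > 0" "1 / q \<le> 2" by (auto simp: field_simps)
    have eq: "normal_density 0 (sqrt s) x * exp (\<kappa> * x\<^sup>2) = 1 / q * normal_density 0 (sqrt s / q) x" for x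
    proof -
      have "normal_density 0 (sqrt s) x * exp (\<kappa> * x\<^sup>2)
          = 1 / sqrt (2 * pi * s) * exp (- x\<^sup>2 / (2 * s) + \<kappa> * x\<^sup>2)"
        using s by (simp add: normal_density_def exp_add[symmetric])
      also have "- x\<^sup>2 / (2 * s) + \<kappa> * x\<^sup>2 = - x\<^sup>2 * q\<^sup>2 / (2 * s)"
        unfolding q2 using s by (simp add: field_simps)
      also have "- x\<^sup>2 * q\<^sup>2 / (2 * s) = - (x - 0)\<^sup>2 / (2 * (sqrt s / q)\<^sup>2)"
        using s q by (simp add: power_divide)
      also have "sqrt (2 * pi * s) = q * sqrt (2 * pi * (sqrt s / q)\<^sup>2)"
        using s q by (simp add: power_divide real_sqrt_divide real_sqrt_mult)
      finally show ?thesis by (simp add: normal_density_def)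
    qed
    have "integrable lborel (\<lambda>x. normal_density 0 (sqrt s) x * exp (\<kappa> * x\<^sup>2))"
      unfolding eq using s q by (intro integrable_mult_right integrable_normal_density) auto
    moreover have "(\<integral>x. normal_density 0 (sqrt s) x * exp (\<kappa> * x\<^sup>2) \<partial>lborel) = 1 / q"
      unfolding eq using s q by (subst integral_mult_right_zero, subst integral_normal_density) auto
    ultimately show ?thesis
      using distributed_integrable[OF d, of "\<lambda>x. exp (\<kappa> * x\<^sup>2)"]
        distributed_integral[OF d, of "\<lambda>x. exp (\<kappa> * x\<^sup>2)"] q by simp
  qed
  then show "integrable M (\<lambda>\<omega>. exp (\<kappa> * (g \<omega>)\<^sup>2))" "expectation (\<lambda>\<omega>. exp (\<kappa> * (g \<omega>)\<^sup>2)) \<le> 2"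
    by auto
qed

text \<open>The argument 1 suffices, as frequencies are absorbed into the coefficients of linear
  forms.\<close>

lemma centered_normal_char:
  assumes g: "centered_normal M g s"
  shows "char (distr M borel g) 1 = complex_of_real (exp (- s / 2))"
proof -
  have gm[measurable]: "g \<in> borel_measurable M" using g by (simp add: centered_normal_def)
  show ?thesis
  proof (cases "s = 0")
    case True
    then have ae: "AE \<omega> in M. g \<omega> = 0" using g by (simp add: centered_normal_def)
    have "char (distr M borel g) 1 = (CLINT \<omega>|M. iexp (g \<omega>))"
      by (simp add: char_def integral_distr)
    also have "\<dots> = (CLINT \<omega>|M. 1)"
      using ae by (intro integral_cong_AE) auto
    finally show ?thesis using True by (simp add: prob_space)
  next
    case False
    then have s: "s > 0" and d: "distributed M lborel g (normal_density 0 (sqrt s))"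
      using g by (auto simp: centered_normal_def)
    then have "distributed M lborel (\<lambda>\<omega>. g \<omega> / sqrt s) std_normal_density"
      using normal_standard_normal_convert[of "sqrt s" g 0] by simp
    then have "distr M lborel (\<lambda>\<omega>. g \<omega> / sqrt s) = std_normal_distribution"
      by (rule distributed_distr_eq_density)
    then have "char (distr M lborel (\<lambda>\<omega>. g \<omega> / sqrt s)) (sqrt s) = complex_of_real (exp (- s / 2))"
      using s by (simp add: char_std_normal_distribution)
    moreover have "char (distr M lborel (\<lambda>\<omega>. g \<omega> / sqrt s)) (sqrt s) = char (distr M borel g) 1"
      using s by (simp add: char_def integral_distr)
    ultimately show ?thesis by simp
  qed
qed

end

section \<open>Mixed moments of a centered normal vector\<close>

text \<open>A signed sum over the eight sign patterns of \<open>y\<close>, \<open>z\<close>,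
  \<open>w\<close>. Only monomials odd in each of these three survive, which in degree four is
  \<open>x * y * z * w\<close> alone, with coefficient \<open>8 * 24 = 192\<close>.\<close>

lemma product_polarization:
  fixes x y z w :: real
  shows "x * y * z * w = 1/192 *
    ((x + y + z + w)^4 - (x + y + z - w)^4 - (x + y - z + w)^4 + (x + y - z - w)^4
     - (x - y + z + w)^4 + (x - y + z - w)^4 + (x - y - z + w)^4 - (x - y - z - w)^4)"
  by algebra

context prob_space
begin

lemma centered_normal_covariance:
  fixes Z :: "'a \<Rightarrow> real^'n" and S :: "real^'n^'n"
  assumes Z: "\<And>c. centered_normal M (\<lambda>\<omega>. c \<bullet> Z \<omega>) (c \<bullet> (S *v c))" and S: "transpose S = S"
  shows "integrable M (\<lambda>\<omega>. (a \<bullet> Z \<omega>) * (b \<bullet> Z \<omega>))"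
    and "expectation (\<lambda>\<omega>. (a \<bullet> Z \<omega>) * (b \<bullet> Z \<omega>)) = a \<bullet> (S *v b)"
proof -
  have sym: "b \<bullet> (S *v a) = a \<bullet> (S *v b)"
    using inner_transpose_mult[of b S a] S by (simp add: inner_commute)
  note m = centered_normal_moments(2)[OF Z, of _ 2] centered_normal_moments(4)[OF Z]
  have eq: "(a \<bullet> Z \<omega>) * (b \<bullet> Z \<omega>) = 1/4 * (((a + b) \<bullet> Z \<omega>)\<^sup>2 - ((a - b) \<bullet> Z \<omega>)\<^sup>2)" for \<omega>
    by (simp add: inner_add_left inner_diff_left power2_eq_square algebra_simps)
  show "integrable M (\<lambda>\<omega>. (a \<bullet> Z \<omega>) * (b \<bullet> Z \<omega>))"
    unfolding eq using m(1)[of "a + b"] m(1)[of "a - b"] by (intro integrable_mult_right Bochner_Integration.integrable_diff)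
  have "expectation (\<lambda>\<omega>. (a \<bullet> Z \<omega>) * (b \<bullet> Z \<omega>))
     = 1/4 * ((a + b) \<bullet> (S *v (a + b)) - (a - b) \<bullet> (S *v (a - b)))"
    unfolding eq using m(1)[of "a + b"] m(1)[of "a - b"]
    by (simp add: Bochner_Integration.integral_diff m(2))
  also have "\<dots> = a \<bullet> (S *v b)"
    by (simp add: matrix_vector_right_distrib matrix_vector_mult_diff_distrib inner_add_left
        inner_add_right inner_diff_left inner_diff_right sym)
  finally show "expectation (\<lambda>\<omega>. (a \<bullet> Z \<omega>) * (b \<bullet> Z \<omega>)) = a \<bullet> (S *v b)" .
qed

text \<open>By polarization of \<open>E (c \<bullet> Z)\<^sup>4 = 3 (c \<bullet> S c)\<^sup>2\<close>.\<close>

lemma centered_normal_fourth_moment: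
  fixes Z :: "'a \<Rightarrow> real^'n" and S :: "real^'n^'n"
  assumes Z: "\<And>c. centered_normal M (\<lambda>\<omega>. c \<bullet> Z \<omega>) (c \<bullet> (S *v c))" and S: "transpose S = S"
  shows "integrable M (\<lambda>\<omega>. (a \<bullet> Z \<omega>) * (b \<bullet> Z \<omega>) * (c \<bullet> Z \<omega>) * (d \<bullet> Z \<omega>))"
    and "expectation (\<lambda>\<omega>. (a \<bullet> Z \<omega>) * (b \<bullet> Z \<omega>) * (c \<bullet> Z \<omega>) * (d \<bullet> Z \<omega>)) =
      (a \<bullet> (S *v b)) * (c \<bullet> (S *v d)) + (a \<bullet> (S *v c)) * (b \<bullet> (S *v d))
       + (a \<bullet> (S *v d)) * (b \<bullet> (S *v c))"
proof -
  have sym: "v \<bullet> (S *v u) = u \<bullet> (S *v v)" for u v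
    using inner_transpose_mult[of v S u] S by (simp add: inner_commute)
  have m: "has_bochner_integral M (\<lambda>\<omega>. (v \<bullet> Z \<omega>) ^ 4) (3 * (v \<bullet> (S *v v))\<^sup>2)" for v
    using centered_normal_moments(2)[OF Z, of v 4] centered_normal_moments(5)[OF Z, of v]
    by (simp add: has_bochner_integral_iff)
  have eq: "(a \<bullet> Z \<omega>) * (b \<bullet> Z \<omega>) * (c \<bullet> Z \<omega>) * (d \<bullet> Z \<omega>) = 1/192 *
    (((a + b + c + d) \<bullet> Z \<omega>)^4 - ((a + b + c - d) \<bullet> Z \<omega>)^4 - ((a + b - c + d) \<bullet> Z \<omega>)^4
     + ((a + b - c - d) \<bullet> Z \<omega>)^4
     - ((a - b + c + d) \<bullet> Z \<omega>)^4 + ((a - b + c - d) \<bullet> Z \<omega>)^4 + ((a - b - c + d) \<bullet> Z \<omega>)^4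
     - ((a - b - c - d) \<bullet> Z \<omega>)^4)" for \<omega>
    by (simp only: inner_add_left inner_diff_left) (rule product_polarization)
  define q where "q v = v \<bullet> (S *v v)" for v
  have "has_bochner_integral M (\<lambda>\<omega>. (a \<bullet> Z \<omega>) * (b \<bullet> Z \<omega>) * (c \<bullet> Z \<omega>) * (d \<bullet> Z \<omega>))
    (1/192 * (3 * (q (a + b + c + d))\<^sup>2 - 3 * (q (a + b + c - d))\<^sup>2 - 3 * (q (a + b - c + d))\<^sup>2
     + 3 * (q (a + b - c - d))\<^sup>2
     - 3 * (q (a - b + c + d))\<^sup>2 + 3 * (q (a - b + c - d))\<^sup>2 + 3 * (q (a - b - c + d))\<^sup>2
     - 3 * (q (a - b - c - d))\<^sup>2))"
    unfolding eq q_def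
    by (intro has_bochner_integral_mult_right has_bochner_integral_add has_bochner_integral_diff m)
  moreover have "1/192 * (3 * (q (a + b + c + d))\<^sup>2 - 3 * (q (a + b + c - d))\<^sup>2
     - 3 * (q (a + b - c + d))\<^sup>2 + 3 * (q (a + b - c - d))\<^sup>2
     - 3 * (q (a - b + c + d))\<^sup>2 + 3 * (q (a - b + c - d))\<^sup>2 + 3 * (q (a - b - c + d))\<^sup>2
     - 3 * (q (a - b - c - d))\<^sup>2) =
      (a \<bullet> (S *v b)) * (c \<bullet> (S *v d)) + (a \<bullet> (S *v c)) * (b \<bullet> (S *v d))
       + (a \<bullet> (S *v d)) * (b \<bullet> (S *v c))"
    unfolding q_def
    by (simp only: matrix_vector_right_distrib matrix_vector_mult_diff_distrib inner_add_left
        inner_add_right inner_diff_left inner_diff_right sym[of b a] sym[of c a] sym[of d a]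
        sym[of c b] sym[of d b] sym[of d c]) algebra
  ultimately show "integrable M (\<lambda>\<omega>. (a \<bullet> Z \<omega>) * (b \<bullet> Z \<omega>) * (c \<bullet> Z \<omega>) * (d \<bullet> Z \<omega>))"
    "expectation (\<lambda>\<omega>. (a \<bullet> Z \<omega>) * (b \<bullet> Z \<omega>) * (c \<bullet> Z \<omega>) * (d \<bullet> Z \<omega>)) =
      (a \<bullet> (S *v b)) * (c \<bullet> (S *v d)) + (a \<bullet> (S *v c)) * (b \<bullet> (S *v d))
       + (a \<bullet> (S *v d)) * (b \<bullet> (S *v c))"
    by (simp_all add: has_bochner_integral_iff)
qed

section \<open>Orthogonality from characteristic functions\<close>

text \<open>The weight \<open>1 + h\<close> is nonnegative, so Levy's uniqueness theorem applies to the weighted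
  distribution; several coordinates are then treated one at a time.\<close>

lemma fourier_orthogonal_indicator:
  fixes h U :: "'a \<Rightarrow> real"
  assumes [measurable]: "h \<in> borel_measurable M" "U \<in> borel_measurable M"
    and h1: "\<And>\<omega>. \<bar>h \<omega>\<bar> \<le> 1"
    and c: "\<And>s. expectation (\<lambda>\<omega>. h \<omega> * cos (s * U \<omega>)) = 0"
    and s: "\<And>s. expectation (\<lambda>\<omega>. h \<omega> * sin (s * U \<omega>)) = 0"
    and B[measurable]: "B \<in> sets borel"
  shows "expectation (\<lambda>\<omega>. h \<omega> * indicator B (U \<omega>)) = 0"
proof -
  define N where "N = density M (\<lambda>\<omega>. ennreal (1 + h \<omega>))"
  have nn: "0 \<le> 1 + h \<omega>" for \<omega> using h1[of \<omega>] by linarith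
  have bd: "integrable M (\<lambda>\<omega>. h \<omega> * g \<omega>)" if "g \<in> borel_measurable M" "\<And>\<omega>. norm (g \<omega>) \<le> 1" for g :: "'a \<Rightarrow> real"
    using that h1 by (intro integrable_const_bound[of _ 1]) (auto simp: abs_mult mult_le_one)
  have ih: "integrable M h" using bd[of "\<lambda>_. 1"] by simp
  have Eh: "expectation h = 0" using c[of 0] by simp
  have mass: "emeasure N (space N) = 1"
  proof -
    have "emeasure N (space N) = (\<integral>\<^sup>+\<omega>. ennreal (1 + h \<omega>) \<partial>M)"
      by (simp add: N_def emeasure_density cong: nn_integral_cong)
    also have "\<dots> = ennreal (expectation (\<lambda>\<omega>. 1 + h \<omega>))"
      by (rule nn_integral_eq_integral) (use ih nn in auto)
    also have "\<dots> = 1" using ih Eh by (simp add: prob_space)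
    finally show ?thesis .
  qed
  then interpret N: prob_space N by (intro prob_spaceI)
  have [measurable_cong]: "sets N = sets M" by (simp add: N_def)
  have "distr N borel U = distr M borel U"
  proof (rule Levy_uniqueness)
    show "real_distribution (distr N borel U)" by (rule N.real_distribution_distr) measurable
    show "real_distribution (distr M borel U)" by (rule real_distribution_distr) measurable
    show "char (distr N borel U) = char (distr M borel U)"
    proof
      fix t
      have i1: "complex_integrable M (\<lambda>\<omega>. iexp (t * U \<omega>))"
        by (rule integrable_const_bound[of _ 1]) auto
      have i2: "complex_integrable M (\<lambda>\<omega>. h \<omega> *\<^sub>R iexp (t * U \<omega>))"
        using h1 by (intro integrable_const_bound[of _ 1]) auto
      have "(CLINT \<omega>|M. h \<omega> *\<^sub>R iexp (t * U \<omega>)) = 0"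
      proof (rule complex_eqI)
        have "Re (CLINT \<omega>|M. h \<omega> *\<^sub>R iexp (t * U \<omega>)) = expectation (\<lambda>\<omega>. h \<omega> * cos (t * U \<omega>))"
          by (subst integral_Re[OF i2, symmetric]) (simp add: Re_exp)
        then show "Re (CLINT \<omega>|M. h \<omega> *\<^sub>R iexp (t * U \<omega>)) = Re 0" using c by simp
        have "Im (CLINT \<omega>|M. h \<omega> *\<^sub>R iexp (t * U \<omega>)) = expectation (\<lambda>\<omega>. h \<omega> * sin (t * U \<omega>))"
          by (subst integral_Im[OF i2, symmetric]) (simp add: Im_exp)
        then show "Im (CLINT \<omega>|M. h \<omega> *\<^sub>R iexp (t * U \<omega>)) = Im 0" using s by simp
      qed
      moreover have "char (distr N borel U) t = (CLINT \<omega>|M. (1 + h \<omega>) *\<^sub>R iexp (t * U \<omega>))"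
        unfolding char_def N_def
        by (subst integral_distr, simp, simp) (subst integral_density; use nn in simp)
      moreover have "\<dots> = (CLINT \<omega>|M. iexp (t * U \<omega>)) + (CLINT \<omega>|M. h \<omega> *\<^sub>R iexp (t * U \<omega>))"
        using i1 i2 by (simp add: scaleR_add_left)
      ultimately show "char (distr N borel U) t = char (distr M borel U) t"
        by (simp add: char_def integral_distr)
    qed
  qed
  then have "integral\<^sup>L (distr N borel U) (indicator B :: real \<Rightarrow> real) = integral\<^sup>L (distr M borel U) (indicator B)"
    by simp
  then have "integral\<^sup>L N (\<lambda>\<omega>. indicator B (U \<omega>)) = expectation (\<lambda>\<omega>. indicator B (U \<omega>) :: real)"
    by (subst (asm) (1 2) integral_distr) simp_all
  also have "integral\<^sup>L N (\<lambda>\<omega>. indicator B (U \<omega>)) = expectation (\<lambda>\<omega>. (1 + h \<omega>) * indicator B (U \<omega>))"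
    unfolding N_def by (subst integral_density) (use nn in auto)
  also have "\<dots> = expectation (\<lambda>\<omega>. indicator B (U \<omega>) + h \<omega> * indicator B (U \<omega>))"
    by (simp add: distrib_right)
  also have "\<dots> = expectation (\<lambda>\<omega>. indicator B (U \<omega>)) + expectation (\<lambda>\<omega>. h \<omega> * indicator B (U \<omega>))"
    by (intro Bochner_Integration.integral_add integrable_const_bound[of _ 1] bd)
       (auto simp: indicator_def)
  finally show ?thesis by simp
qed

text \<open>Induction on the coordinates in \<open>K\<close>. The cosine and sine of an arbitrary
  linear form stay in the statement, so that the induction hypothesis can be used with the frequency
  of coordinate \<open>k\<close> shifted by \<open>t\<close>. Product-to-sum formulas then give the
  hypotheses of the one-dimensional lemma, which inserts the indicator for \<open>k\<close>.\<close>

lemma fourier_orthogonal_box: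
  fixes h :: "'a \<Rightarrow> real" and U :: "'i \<Rightarrow> 'a \<Rightarrow> real"
  assumes J: "finite J" and h[measurable]: "h \<in> borel_measurable M"
    and U[measurable]: "\<And>j. j \<in> J \<Longrightarrow> U j \<in> borel_measurable M"
    and h1: "\<And>\<omega>. \<bar>h \<omega>\<bar> \<le> 1"
    and c: "\<And>d. expectation (\<lambda>\<omega>. h \<omega> * cos (\<Sum>j\<in>J. d j * U j \<omega>)) = 0"
    and s: "\<And>d. expectation (\<lambda>\<omega>. h \<omega> * sin (\<Sum>j\<in>J. d j * U j \<omega>)) = 0"
    and K: "K \<subseteq> J" and B: "\<And>j. j \<in> J \<Longrightarrow> B j \<in> sets borel"
  shows "expectation (\<lambda>\<omega>. h \<omega> * (\<Prod>j\<in>K. indicator (B j) (U j \<omega>)) * cos (\<Sum>j\<in>J. d j * U j \<omega>)) = 0 \<and>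
    expectation (\<lambda>\<omega>. h \<omega> * (\<Prod>j\<in>K. indicator (B j) (U j \<omega>)) * sin (\<Sum>j\<in>J. d j * U j \<omega>)) = 0"
  using finite_subset[OF K J] K
proof (induction K arbitrary: d rule: finite_induct)
  case empty
  then show ?case using c s by simp
next
  case (insert k K)
  then have kJ: "k \<in> J" and KJ: "K \<subseteq> J" by auto
  note [measurable] = B
  define p where "p \<omega> = h \<omega> * (\<Prod>j\<in>K. indicator (B j) (U j \<omega>))" for \<omega>
  define L where "L \<omega> = (\<Sum>j\<in>J. d j * U j \<omega>)" for \<omega>
  have pm[measurable]: "p \<in> borel_measurable M"
    unfolding p_def
  proof (intro borel_measurable_times h borel_measurable_prod)
    fix j assume "j \<in> K"
    then have [measurable]: "U j \<in> borel_measurable M" "B j \<in> sets borel" using KJ B U by auto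
    show "(\<lambda>\<omega>. indicator (B j) (U j \<omega>) :: real) \<in> borel_measurable M" by measurable
  qed
  have Lm[measurable]: "L \<in> borel_measurable M"
    unfolding L_def using U by (intro borel_measurable_sum borel_measurable_times) auto
  have Um[measurable]: "U k \<in> borel_measurable M" by (rule U[OF kJ])
  have p1: "\<bar>p \<omega>\<bar> \<le> 1" for \<omega>
  proof -
    have "\<bar>\<Prod>j\<in>K. indicator (B j) (U j \<omega>) :: real\<bar> \<le> 1"
      unfolding abs_prod by (intro prod_le_1) (auto simp: indicator_def)
    then show ?thesis using h1[of \<omega>] unfolding p_def abs_mult by (intro mult_le_one) auto
  qed
  have bd: "integrable M (\<lambda>\<omega>. p \<omega> * g \<omega>)" if "g \<in> borel_measurable M" "\<And>\<omega>. \<bar>g \<omega>\<bar> \<le> 1" for g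
    using that p1 by (intro integrable_const_bound[of _ 1]) (auto simp: abs_mult mult_le_one)
  have shift: "(\<Sum>j\<in>J. (d(k := d k + t)) j * U j \<omega>) = L \<omega> + t * U k \<omega>" for t \<omega>
  proof -
    have "(\<Sum>j\<in>J. (d(k := d k + t)) j * U j \<omega>) = (\<Sum>j\<in>J. d j * U j \<omega> + (if j = k then t * U k \<omega> else 0))"
      by (intro sum.cong) (auto simp: algebra_simps)
    also have "\<dots> = L \<omega> + t * U k \<omega>" using J kJ by (simp add: sum.distrib L_def)
    finally show ?thesis .
  qed
  have C: "expectation (\<lambda>\<omega>. p \<omega> * cos (L \<omega> + t * U k \<omega>)) = 0"
    and S: "expectation (\<lambda>\<omega>. p \<omega> * sin (L \<omega> + t * U k \<omega>)) = 0" for t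
    using insert.IH[OF KJ, of "d(k := d k + t)"] unfolding shift p_def by auto
  have iC: "integrable M (\<lambda>\<omega>. p \<omega> * cos (L \<omega> + t * U k \<omega>))"
    and iS: "integrable M (\<lambda>\<omega>. p \<omega> * sin (L \<omega> + t * U k \<omega>))" for t
    by (intro bd; simp)+
  have int: "expectation (\<lambda>\<omega>. 1/2 * (p \<omega> * f \<omega> + \<sigma> * (p \<omega> * g \<omega>))) = 0"
    if "integrable M (\<lambda>\<omega>. p \<omega> * f \<omega>)" "integrable M (\<lambda>\<omega>. p \<omega> * g \<omega>)"
      "expectation (\<lambda>\<omega>. p \<omega> * f \<omega>) = 0" "expectation (\<lambda>\<omega>. p \<omega> * g \<omega>) = 0" for f g and \<sigma> :: real
    using that by simp
  have cc: "p \<omega> * cos (L \<omega>) * cos (t * U k \<omega>)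
      = 1/2 * (p \<omega> * cos (L \<omega> + t * U k \<omega>) + 1 * (p \<omega> * cos (L \<omega> + (- t) * U k \<omega>)))" for t \<omega>
    by (simp add: cos_add cos_diff algebra_simps)
  have cs: "p \<omega> * cos (L \<omega>) * sin (t * U k \<omega>)
      = 1/2 * (p \<omega> * sin (L \<omega> + t * U k \<omega>) + (-1) * (p \<omega> * sin (L \<omega> + (- t) * U k \<omega>)))" for t \<omega>
    by (simp add: sin_add sin_diff algebra_simps)
  have sc: "p \<omega> * sin (L \<omega>) * cos (t * U k \<omega>)
      = 1/2 * (p \<omega> * sin (L \<omega> + t * U k \<omega>) + 1 * (p \<omega> * sin (L \<omega> + (- t) * U k \<omega>)))" for t \<omega>
    by (simp add: sin_add sin_diff algebra_simps)
  have ss: "p \<omega> * sin (L \<omega>) * sin (t * U k \<omega>)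
      = 1/2 * (p \<omega> * cos (L \<omega> + (- t) * U k \<omega>) + (-1) * (p \<omega> * cos (L \<omega> + t * U k \<omega>)))" for t \<omega>
    by (simp add: cos_add cos_diff algebra_simps)
  have "expectation (\<lambda>\<omega>. (p \<omega> * cos (L \<omega>)) * indicator (B k) (U k \<omega>)) = 0"
  proof (rule fourier_orthogonal_indicator)
    show "\<bar>p \<omega> * cos (L \<omega>)\<bar> \<le> 1" for \<omega>
      using p1[of \<omega>] by (auto simp: abs_mult mult_le_one)
    show "expectation (\<lambda>\<omega>. p \<omega> * cos (L \<omega>) * cos (t * U k \<omega>)) = 0" for t
      unfolding cc by (rule int; rule iC iS C S)
    show "expectation (\<lambda>\<omega>. p \<omega> * cos (L \<omega>) * sin (t * U k \<omega>)) = 0" for t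
      unfolding cs by (rule int; rule iC iS C S)
  qed (use kJ B in auto)
  moreover have "expectation (\<lambda>\<omega>. (p \<omega> * sin (L \<omega>)) * indicator (B k) (U k \<omega>)) = 0"
  proof (rule fourier_orthogonal_indicator)
    show "\<bar>p \<omega> * sin (L \<omega>)\<bar> \<le> 1" for \<omega>
      using p1[of \<omega>] by (auto simp: abs_mult mult_le_one)
    show "expectation (\<lambda>\<omega>. p \<omega> * sin (L \<omega>) * cos (t * U k \<omega>)) = 0" for t
      unfolding sc by (rule int; rule iC iS C S)
    show "expectation (\<lambda>\<omega>. p \<omega> * sin (L \<omega>) * sin (t * U k \<omega>)) = 0" for t
      unfolding ss by (rule int; rule iC iS C S)
  qed (use kJ B in auto)
  ultimately show ?case
    using insert.hyps by (simp add: p_def L_def mult_ac)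
qed

text \<open>Boxes generate the product sigma-algebra and are closed under intersection, so the
  weighted and the unweighted law of the vector coincide; integrating \<open>f\<close> against both
  gives the claim.\<close>

lemma fourier_orthogonal_bounded:
  fixes h :: "'a \<Rightarrow> real" and U :: "'i \<Rightarrow> 'a \<Rightarrow> real"
  assumes J: "finite J" and h[measurable]: "h \<in> borel_measurable M"
    and U: "\<And>j. j \<in> J \<Longrightarrow> U j \<in> borel_measurable M"
    and h1: "\<And>\<omega>. \<bar>h \<omega>\<bar> \<le> 1"
    and c: "\<And>d. expectation (\<lambda>\<omega>. h \<omega> * cos (\<Sum>j\<in>J. d j * U j \<omega>)) = 0"
    and s: "\<And>d. expectation (\<lambda>\<omega>. h \<omega> * sin (\<Sum>j\<in>J. d j * U j \<omega>)) = 0"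
    and f[measurable]: "f \<in> borel_measurable (PiM J (\<lambda>_. borel))"
    and fi: "integrable M (\<lambda>\<omega>. f (\<lambda>j\<in>J. U j \<omega>))"
  shows "expectation (\<lambda>\<omega>. h \<omega> * f (\<lambda>j\<in>J. U j \<omega>)) = (0::real)"
proof -
  define V where "V \<omega> = (\<lambda>j\<in>J. U j \<omega>)" for \<omega>
  define N where "N = density M (\<lambda>\<omega>. ennreal (1 + h \<omega>))"
  have nn: "0 \<le> 1 + h \<omega>" for \<omega> using h1[of \<omega>] by linarith
  have V[measurable]: "V \<in> measurable M (PiM J (\<lambda>_. borel))"
    unfolding V_def by (rule measurable_restrict) (rule U)
  have [measurable_cong]: "sets N = sets M" by (simp add: N_def)
  have "distr N (PiM J (\<lambda>_. borel)) V = distr M (PiM J (\<lambda>_. borel)) V"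
  proof (rule measure_eqI_PiM_finite[OF J])
    fix B :: "'i \<Rightarrow> real set" assume B: "\<And>j. j \<in> J \<Longrightarrow> B j \<in> sets borel"
    have [measurable]: "Pi\<^sub>E J B \<in> sets (PiM J (\<lambda>_. borel))"
      by (rule sets_PiM_I_finite[OF J B])
    have ind: "indicator (V -` Pi\<^sub>E J B \<inter> space M) \<omega> = (\<Prod>j\<in>J. indicator (B j) (U j \<omega>) :: real)"
      if "\<omega> \<in> space M" for \<omega>
    proof (cases "V \<omega> \<in> Pi\<^sub>E J B")
      case True
      then have "U j \<omega> \<in> B j" if "j \<in> J" for j using that by (auto simp: V_def PiE_iff)
      then show ?thesis using True \<open>\<omega> \<in> space M\<close> by (simp add: indicator_def)
    next
      case False
      then obtain j where "j \<in> J" "U j \<omega> \<notin> B j" by (auto simp: V_def PiE_iff)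
      then have "(\<Prod>j\<in>J. indicator (B j) (U j \<omega>) :: real) = 0"
        using J by (intro prod_zero) (auto intro!: bexI[of _ j])
      then show ?thesis using False by (simp add: indicator_def)
    qed
    define A where "A = V -` Pi\<^sub>E J B \<inter> space M"
    have [measurable]: "A \<in> sets M" unfolding A_def by measurable
    have z: "expectation (\<lambda>\<omega>. h \<omega> * indicator A \<omega>) = 0"
    proof -
      \<comment> \<open>Frequency zero makes the cosine 1 and leaves only the product of
        indicators.\<close>
      have "expectation (\<lambda>\<omega>. h \<omega> * indicator A \<omega>)
         = expectation (\<lambda>\<omega>. h \<omega> * (\<Prod>j\<in>J. indicator (B j) (U j \<omega>)) * cos (\<Sum>j\<in>J. 0 * U j \<omega>))"
        by (intro Bochner_Integration.integral_cong) (auto simp: A_def ind)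
      also have "\<dots> = 0"
        using fourier_orthogonal_box[where B=B and d="\<lambda>_. 0", OF J h U h1 c s order_refl B] by blast
      finally show ?thesis .
    qed
    have iA: "integrable M (indicator A :: 'a \<Rightarrow> real)"
      by (intro integrable_const_bound[of _ 1]) (auto simp: indicator_def)
    have ihA: "integrable M (\<lambda>\<omega>. h \<omega> * indicator A \<omega>)"
      using h1 by (intro integrable_const_bound[of _ 1]) (auto simp: indicator_def)
    have "emeasure N A = (\<integral>\<^sup>+\<omega>. ennreal ((1 + h \<omega>) * indicator A \<omega>) \<partial>M)"
      unfolding N_def using nn
      by (subst emeasure_density) (auto intro!: nn_integral_cong simp: indicator_def)
    also have "\<dots> = ennreal (expectation (\<lambda>\<omega>. (1 + h \<omega>) * indicator A \<omega>))"
    proof (rule nn_integral_eq_integral)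
      show "integrable M (\<lambda>\<omega>. (1 + h \<omega>) * indicator A \<omega>)" using iA ihA by (simp add: distrib_right)
      show "AE \<omega> in M. 0 \<le> (1 + h \<omega>) * indicator A \<omega>"
        using nn by (intro AE_I2 mult_nonneg_nonneg) auto
    qed
    also have "expectation (\<lambda>\<omega>. (1 + h \<omega>) * indicator A \<omega>) = expectation (indicator A)"
      using iA ihA z by (simp add: distrib_right)
    also have "ennreal (expectation (indicator A)) = emeasure M A"
      by (simp add: emeasure_eq_measure)
    finally show "emeasure (distr N (PiM J (\<lambda>_. borel)) V) (Pi\<^sub>E J B)
      = emeasure (distr M (PiM J (\<lambda>_. borel)) V) (Pi\<^sub>E J B)"
      by (simp add: emeasure_distr A_def N_def)
  next
    show "range (\<lambda>_::nat. space (PiM J (\<lambda>_. borel :: real measure))) \<subseteq> prod_algebra J (\<lambda>_. borel)"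
      using J by (auto simp: space_PiM intro!: prod_algebraI_finite)
    show "emeasure (distr N (PiM J (\<lambda>_. borel)) V) (space (PiM J (\<lambda>_. borel))) \<noteq> \<infinity>"
    proof -
      have "(\<integral>\<^sup>+\<omega>. ennreal (1 + h \<omega>) \<partial>M) \<le> (\<integral>\<^sup>+\<omega>. ennreal 2 \<partial>M)"
        using h1 by (intro nn_integral_mono ennreal_leI) (simp add: abs_le_iff)
      also have "\<dots> = 2" by (simp add: emeasure_space_1)
      finally have "emeasure N (space N) \<le> 2"
        by (simp add: N_def emeasure_density cong: nn_integral_cong)
      also have "\<dots> < \<infinity>" by simp
      finally have "emeasure N (space N) < \<infinity>" .
      moreover have "emeasure (distr N (PiM J (\<lambda>_. borel)) V) (space (PiM J (\<lambda>_. borel))) \<le> emeasure N (space N)"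
        by (subst emeasure_distr) (auto intro: emeasure_space)
      ultimately show ?thesis by auto
    qed
  qed auto
  then have "integral\<^sup>L (distr N (PiM J (\<lambda>_. borel)) V) f = integral\<^sup>L (distr M (PiM J (\<lambda>_. borel)) V) f"
    by simp
  then have "integral\<^sup>L N (\<lambda>\<omega>. f (V \<omega>)) = expectation (\<lambda>\<omega>. f (V \<omega>))"
    by (subst (asm) (1 2) integral_distr) simp_all
  also have "integral\<^sup>L N (\<lambda>\<omega>. f (V \<omega>)) = expectation (\<lambda>\<omega>. (1 + h \<omega>) * f (V \<omega>))"
    unfolding N_def by (subst integral_density) (use nn in auto)
  also have "\<dots> = expectation (\<lambda>\<omega>. f (V \<omega>) + h \<omega> * f (V \<omega>))"
    by (simp add: distrib_right)
  also have "\<dots> = expectation (\<lambda>\<omega>. f (V \<omega>)) + expectation (\<lambda>\<omega>. h \<omega> * f (V \<omega>))"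
  proof (rule Bochner_Integration.integral_add)
    show fV: "integrable M (\<lambda>\<omega>. f (V \<omega>))" using fi by (simp add: V_def)
    show "integrable M (\<lambda>\<omega>. h \<omega> * f (V \<omega>))"
    proof (rule Bochner_Integration.integrable_bound[OF fV])
      show "AE \<omega> in M. norm (h \<omega> * f (V \<omega>)) \<le> norm (f (V \<omega>))"
        using h1 by (intro AE_I2) (simp add: abs_mult mult_left_le_one_le)
    qed measurable
  qed
  finally have "expectation (\<lambda>\<omega>. h \<omega> * f (V \<omega>)) = 0" by simp
  then show ?thesis by (simp only: V_def)
qed

text \<open>The preceding result applies to the bounded weights \<open>sin (t * \<xi>)\<close>. As
  \<open>n\<close> grows, \<open>n * sin (\<xi> / n)\<close> converges to \<open>\<xi>\<close> and
  is dominated by \<open>\<bar>\<xi>\<bar>\<close>, so the unbounded weight follows by dominated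
  convergence.\<close>

lemma fourier_orthogonal:
  fixes \<xi> :: "'a \<Rightarrow> real" and U :: "'i \<Rightarrow> 'a \<Rightarrow> real"
  assumes J: "finite J" and \<xi>[measurable]: "\<xi> \<in> borel_measurable M"
    and U: "\<And>j. j \<in> J \<Longrightarrow> U j \<in> borel_measurable M"
    and c: "\<And>t d. expectation (\<lambda>\<omega>. sin (t * \<xi> \<omega>) * cos (\<Sum>j\<in>J. d j * U j \<omega>)) = 0"
    and s: "\<And>t d. expectation (\<lambda>\<omega>. sin (t * \<xi> \<omega>) * sin (\<Sum>j\<in>J. d j * U j \<omega>)) = 0"
    and f[measurable]: "f \<in> borel_measurable (PiM J (\<lambda>_. borel))"
    and fi: "integrable M (\<lambda>\<omega>. f (\<lambda>j\<in>J. U j \<omega>))"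
      "integrable M (\<lambda>\<omega>. \<xi> \<omega> * f (\<lambda>j\<in>J. U j \<omega>))"
  shows "expectation (\<lambda>\<omega>. \<xi> \<omega> * f (\<lambda>j\<in>J. U j \<omega>)) = (0::real)"
proof -
  define V where "V \<omega> = (\<lambda>j\<in>J. U j \<omega>)" for \<omega>
  have V[measurable]: "V \<in> measurable M (PiM J (\<lambda>_. borel))"
    unfolding V_def by (rule measurable_restrict) (rule U)
  have z: "expectation (\<lambda>\<omega>. sin (t * \<xi> \<omega>) * f (V \<omega>)) = 0" for t
    unfolding V_def by (rule fourier_orthogonal_bounded[OF J _ U _ c s f fi(1)]) auto
  let ?s = "\<lambda>n \<omega>. real (Suc n) * sin (1 / real (Suc n) * \<xi> \<omega>) * f (V \<omega>)"
  have "(\<lambda>n. expectation (?s n)) \<longlonglongrightarrow> expectation (\<lambda>\<omega>. \<xi> \<omega> * f (V \<omega>))"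
  proof (rule integral_dominated_convergence[where w="\<lambda>\<omega>. \<bar>\<xi> \<omega> * f (V \<omega>)\<bar>"])
    show "integrable M (\<lambda>\<omega>. \<bar>\<xi> \<omega> * f (V \<omega>)\<bar>)" using fi(2) by (simp add: V_def)
    show "AE \<omega> in M. (\<lambda>n. ?s n \<omega>) \<longlonglongrightarrow> \<xi> \<omega> * f (V \<omega>)"
    proof (intro AE_I2 tendsto_mult_right)
      fix \<omega>
      show "(\<lambda>n. real (Suc n) * sin (1 / real (Suc n) * \<xi> \<omega>)) \<longlonglongrightarrow> \<xi> \<omega>"
        by real_asymp
    qed
    show "AE \<omega> in M. norm (?s n \<omega>) \<le> \<bar>\<xi> \<omega> * f (V \<omega>)\<bar>" for n
    proof (intro AE_I2)
      fix \<omega>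
      have "\<bar>sin (1 / real (Suc n) * \<xi> \<omega>)\<bar> \<le> \<bar>1 / real (Suc n) * \<xi> \<omega>\<bar>" by (rule abs_sin_x_le_abs_x)
      then have "real (Suc n) * \<bar>sin (1 / real (Suc n) * \<xi> \<omega>)\<bar> \<le> real (Suc n) * \<bar>1 / real (Suc n) * \<xi> \<omega>\<bar>"
        by (intro mult_left_mono) auto
      also have "\<dots> = \<bar>\<xi> \<omega>\<bar>" by (simp add: abs_mult)
      finally show "norm (?s n \<omega>) \<le> \<bar>\<xi> \<omega> * f (V \<omega>)\<bar>"
        by (simp add: abs_mult mult_right_mono)
    qed
  qed measurable
  moreover have "expectation (?s n) = 0" for n
    using z[of "1 / real (Suc n)"] by (simp add: mult.assoc)
  ultimately have "expectation (\<lambda>\<omega>. \<xi> \<omega> * f (V \<omega>)) = 0" by (simp add: LIMSEQ_const_iff)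
  then show ?thesis by (simp only: V_def)
qed

end

lemma (in prob_space) indep_vars_disjoint_functions:
  assumes "indep_vars (\<lambda>_. N) X I" and AB: "A \<inter> B = {}" "A \<subseteq> I" "B \<subseteq> I"
    and f: "f \<in> measurable (PiM A (\<lambda>_. N)) N1" and g: "g \<in> measurable (PiM B (\<lambda>_. N)) N2"
  shows "indep_var N1 (\<lambda>\<omega>. f (\<lambda>i\<in>A. X i \<omega>)) N2 (\<lambda>\<omega>. g (\<lambda>i\<in>B. X i \<omega>))"
  using indep_var_compose[OF indep_var_restrict[OF assms(1) AB] f g] by (simp add: comp_def)

section \<open>The Fay--Herriot model\<close>

text \<open>The hypotheses enter in quantitative form: \<open>lam\<close> and \<open>dl\<close> are
  coercivity constants of \<open>\<Psi>\<close> and of the \<open>D i\<close>, \<open>dK\<close>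
  bounds the norms of the \<open>D i\<close>, and \<open>design\<close> states for large
  \<open>m\<close> what convergence of the normalized design matrix implies, a lower bound for the
  form of \<open>gram X m\<close> and a bound for its trace.\<close>

locale fay_herriot = prob_space M
  for M :: "'w measure" +
  fixes X :: "nat \<Rightarrow> real^'s^'k" and D :: "nat \<Rightarrow> real^'k^'k" and \<beta> :: "real^'s" and \<Psi> :: "real^'k^'k"
    and v \<epsilon> y :: "nat \<Rightarrow> 'w \<Rightarrow> real^'k" and a :: nat and lam dl dK cG KG :: real
  assumes Psi_sym: "transpose \<Psi> = \<Psi>" and lam: "lam > 0" "\<And>x. lam * (x \<bullet> x) \<le> x \<bullet> (\<Psi> *v x)"
    and D_sym: "\<And>i. i \<ge> 1 \<Longrightarrow> transpose (D i) = D i"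
    and dl: "dl > 0" "\<And>i x. i \<ge> 1 \<Longrightarrow> dl * (x \<bullet> x) \<le> x \<bullet> (D i *v x)"
    and dK: "\<And>i. i \<ge> 1 \<Longrightarrow> norm (D i) \<le> dK"
    and v_normal: "\<And>i. i \<ge> 1 \<Longrightarrow> multivariate_normal M (v i) 0 \<Psi>"
    and eps_normal: "\<And>i. i \<ge> 1 \<Longrightarrow> multivariate_normal M (\<epsilon> i) 0 (D i)"
    and indep: "indep_vars (\<lambda>_. borel) (case_sum v \<epsilon>) ({1..} <+> {1..})"
    and y: "\<And>i \<omega>. i \<ge> 1 \<Longrightarrow> y i \<omega> = X i *v \<beta> + v i \<omega> + \<epsilon> i \<omega>"
    and cG: "cG > 0"
    and design: "\<forall>\<^sub>F m in sequentially. (\<forall>x. cG * real m * (x \<bullet> x) \<le> x \<bullet> (gram X m *v x)) \<and>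
        (\<Sum>i\<in>{1..m}. (norm (X i))\<^sup>2) \<le> KG * real m"
    and a: "a \<ge> 1"
begin

subsection \<open>Deterministic bounds\<close>

definition Sg :: "nat \<Rightarrow> real^'k^'k" where "Sg i = \<Psi> + D i"

definition W :: "real^'k^'k" where "W = matrix_inv (Sg a)"

definition wK :: real where "wK = real CARD('k) / dl"

lemma Psi_psd: "pos_semidef \<Psi>"
  unfolding pos_semidef_def
proof (intro conjI allI)
  fix x :: "real^'k"
  have "0 \<le> lam * (x \<bullet> x)" using lam(1) by simp
  then show "0 \<le> x \<bullet> (\<Psi> *v x)" using lam(2)[of x] by linarith
qed (rule Psi_sym)

lemma dK_nonneg: "0 \<le> dK"
  using dK[of 1] norm_ge_zero[of "D 1"] by linarith

lemma plus_D_coercive: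
  assumes "pos_semidef P" "i \<ge> 1"
  shows "dl * (x \<bullet> x) \<le> x \<bullet> ((P + D i) *v x)"
proof -
  have "0 \<le> x \<bullet> (P *v x)" using assms by (simp add: pos_semidef_def)
  then show ?thesis using dl(2)[OF assms(2), of x]
    by (simp add: matrix_vector_mult_add_rdistrib inner_add_right)
qed

text \<open>The bound on the inverse does not depend on \<open>P\<close>, because \<open>D i\<close>
  alone already dominates \<open>dl\<close> times the identity. For the truncated estimator this
  makes a random inverse a bounded random variable.\<close>

lemma
  assumes "pos_semidef P" "i \<ge> 1"
  shows plus_D_invertible: "invertible (P + D i)"
    and norm_inv_plus_D: "norm (matrix_inv (P + D i)) \<le> wK"
    and inv_plus_D_sym: "transpose (matrix_inv (P + D i)) = matrix_inv (P + D i)"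
    and norm_plus_D: "norm (P + D i) \<le> norm P + dK"
proof -
  show i: "invertible (P + D i)" "norm (matrix_inv (P + D i)) \<le> wK"
    using coercive_invertible[OF dl(1) plus_D_coercive[OF assms]] by (auto simp: wK_def)
  show "transpose (matrix_inv (P + D i)) = matrix_inv (P + D i)"
    using assms D_sym by (intro transpose_matrix_inv i) (simp add: transpose_add pos_semidef_def)
  show "norm (P + D i) \<le> norm P + dK"
    using dK[OF assms(2)] norm_triangle_ineq[of P "D i"] by linarith
qed

lemmas Sg_invertible = plus_D_invertible[OF Psi_psd, folded Sg_def]
lemmas norm_inv_Sg = norm_inv_plus_D[OF Psi_psd, folded Sg_def]
lemmas inv_Sg_sym = inv_plus_D_sym[OF Psi_psd, folded Sg_def]
lemmas norm_Sg = norm_plus_D[OF Psi_psd, folded Sg_def]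

lemma Sg_sym: "i \<ge> 1 \<Longrightarrow> transpose (Sg i) = Sg i"
  by (simp add: Sg_def transpose_add Psi_sym D_sym)

lemma wK_nonneg: "0 \<le> wK" using dl by (simp add: wK_def)

lemma W_sym: "transpose W = W" using inv_Sg_sym[OF a] by (simp add: W_def)

lemma W_Sg: "W ** Sg a = mat 1" "Sg a ** W = mat 1"
  using matrix_inv[OF Sg_invertible[OF a]] by (auto simp: W_def)

definition gK :: real where "gK = real CARD('s) / cG"

lemma gram_inverse:
  "\<forall>\<^sub>F m in sequentially. invertible (gram X m) \<and> norm (matrix_inv (gram X m)) \<le> gK / real m"
  using design eventually_gt_at_top[of 0]
proof eventually_elim
  case (elim m)
  then have "cG * real m > 0" using cG by simp
  from coercive_invertible[OF this, of "gram X m"] elim show ?case by (auto simp: gK_def)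
qed

lemma gram_sym: "transpose (gram X m) = gram X m"
  by (simp add: gram_def transpose_sum matrix_transpose_mul)

definition iK :: real where "iK = real CARD('s) / (dl * cG)"

text \<open>Each \<open>matrix_inv (P + D i)\<close> is coercive with constant
  \<open>dl / K\<^sup>2\<close>, hence the information dominates this multiple of
  \<open>gram X m\<close>. The growth in \<open>norm P\<close> is polynomial, which moments of all
  orders absorb. Uniformity in \<open>P\<close> matters because the random estimator is inserted for
  it.\<close>

lemma gls_info_inverse:
  "\<forall>\<^sub>F m in sequentially. \<forall>P. pos_semidef P \<longrightarrow> invertible (gls_info X D m P) \<and>
     norm (matrix_inv (gls_info X D m P)) \<le> iK * (norm P + dK + 1)\<^sup>2 / real m"
  using design eventually_gt_at_top[of 0]
proof eventually_elim
  case (elim m)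
  show ?case
  proof (intro allI impI)
    fix P :: "real^'k^'k" assume P: "pos_semidef P"
    define K where "K = norm P + dK + 1"
    have K: "K > 0" using dK_nonneg by (simp add: K_def add_nonneg_pos)
    define c where "c = dl / K\<^sup>2 * (cG * real m)"
    have c: "c > 0" using dl cG K elim by (simp add: c_def)
    have "c * (x \<bullet> x) \<le> x \<bullet> (gls_info X D m P *v x)" for x
    proof -
      have "c * (x \<bullet> x) = dl / K\<^sup>2 * (cG * real m * (x \<bullet> x))" by (simp add: c_def)
      also have "\<dots> \<le> dl / K\<^sup>2 * (x \<bullet> (gram X m *v x))"
        using elim dl by (intro mult_left_mono) auto
      also have "\<dots> = (\<Sum>i\<in>{1..m}. dl / K\<^sup>2 * ((X i *v x) \<bullet> (X i *v x)))"
        unfolding gram_def using quadratic_form_congruence[of x "X i" "mat 1" for i]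
        by (simp add: bounded_bilinear.sum_left[OF bounded_bilinear_matrix_vector_mult]
            inner_sum_right sum_distrib_left)
      also have "\<dots> \<le> (\<Sum>i\<in>{1..m}. (X i *v x) \<bullet> (matrix_inv (P + D i) *v (X i *v x)))"
      proof (intro sum_mono coercive_inverse[OF dl(1)])
        fix i assume "i \<in> {1..m}"
        then have i: "i \<ge> 1" by simp
        show "dl * (z \<bullet> z) \<le> z \<bullet> ((P + D i) *v z)" for z by (rule plus_D_coercive[OF P i])
        show "norm (P + D i) \<le> K" using norm_plus_D[OF P i] by (simp add: K_def)
      qed
      also have "\<dots> = x \<bullet> (gls_info X D m P *v x)"
        unfolding gls_info_def quadratic_form_congruence[symmetric]
        by (simp add: bounded_bilinear.sum_left[OF bounded_bilinear_matrix_vector_mult] inner_sum_right)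
      finally show ?thesis .
    qed
    from coercive_invertible[OF c this]
    have "invertible (gls_info X D m P)" "norm (matrix_inv (gls_info X D m P)) \<le> real CARD('s) / c" .
    moreover have "real CARD('s) / c = iK * K\<^sup>2 / real m"
      using K by (simp add: c_def iK_def field_simps)
    ultimately show "invertible (gls_info X D m P) \<and>
     norm (matrix_inv (gls_info X D m P)) \<le> iK * (norm P + dK + 1)\<^sup>2 / real m"
      by (simp add: K_def)
  qed
qed

lemma gls_info_sym: "pos_semidef P \<Longrightarrow> transpose (gls_info X D m P) = gls_info X D m P"
  unfolding gls_info_def transpose_sum
  by (intro sum.cong refl) (simp add: matrix_transpose_mul inv_plus_D_sym matrix_mul_assoc)

lemma sum_norm_X_sq: "\<forall>\<^sub>F m in sequentially. (\<Sum>i\<in>{1..m}. (norm (X i))\<^sup>2) \<le> KG * real m"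
  using design by eventually_elim auto

subsection \<open>The errors\<close>

definition u :: "nat \<Rightarrow> 'w \<Rightarrow> real^'k" where "u i \<omega> = v i \<omega> + \<epsilon> i \<omega>"

lemma v_measurable[measurable]: "i \<ge> 1 \<Longrightarrow> v i \<in> borel_measurable M"
  and eps_measurable[measurable]: "i \<ge> 1 \<Longrightarrow> \<epsilon> i \<in> borel_measurable M"
  using v_normal eps_normal by (auto simp: multivariate_normal_def)

lemma u_measurable[measurable]: "i \<ge> 1 \<Longrightarrow> u i \<in> borel_measurable M"
  unfolding u_def by measurable

lemma indep_v_eps:
  assumes "i \<ge> 1"
  shows "indep_var borel (v i) borel (\<epsilon> i)"
proof -
  have "indep_var borel (\<lambda>\<omega>. (\<lambda>z. z (Inl i)) (\<lambda>l\<in>{Inl i}. case_sum v \<epsilon> l \<omega>))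
      borel (\<lambda>\<omega>. (\<lambda>z. z (Inr i)) (\<lambda>l\<in>{Inr i}. case_sum v \<epsilon> l \<omega>))"
    by (rule indep_vars_disjoint_functions[OF indep]) (use assms in auto)
  then show ?thesis by simp
qed

lemma indep_u: "indep_vars (\<lambda>_. borel) u {1..}"
proof -
  let ?K = "\<lambda>j :: nat. {Inl j, Inr j} :: (nat + nat) set"
  have "indep_vars (\<lambda>j. PiM (?K j) (\<lambda>_. borel)) (\<lambda>j \<omega>. \<lambda>l\<in>?K j. case_sum v \<epsilon> l \<omega>) {1..}"
    by (rule indep_vars_restrict[OF indep]) (auto simp: disjoint_family_on_def)
  then have "indep_vars (\<lambda>_. borel)
      (\<lambda>j \<omega>. (\<lambda>z. z (Inl j) + z (Inr j)) (\<lambda>l\<in>?K j. case_sum v \<epsilon> l \<omega>)) {1..}"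
    by (rule indep_vars_compose2) simp
  then show ?thesis
    by (rule indep_vars_cong[THEN iffD1, rotated -1]) (auto simp: u_def)
qed

text \<open>A sum of two independent nondegenerate normal forms; \<open>c = 0\<close> is set apart
  because the convolution rule asks for positive variances.\<close>

lemma u_normal:
  assumes "i \<ge> 1"
  shows "centered_normal M (\<lambda>\<omega>. c \<bullet> u i \<omega>) (c \<bullet> (Sg i *v c))"
proof (cases "c = 0")
  case True
  then show ?thesis by (simp add: centered_normal_def)
next
  case False
  then have cc: "c \<bullet> c > 0" by simp
  have pv: "0 < c \<bullet> (\<Psi> *v c)"
    by (rule less_le_trans[OF _ lam(2)]) (use lam(1) cc in simp)
  have pe: "0 < c \<bullet> (D i *v c)"
    by (rule less_le_trans[OF _ dl(2)[OF assms]]) (use dl(1) cc in simp)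
  have d1: "distributed M lborel (\<lambda>\<omega>. c \<bullet> v i \<omega>) (normal_density 0 (sqrt (c \<bullet> (\<Psi> *v c))))"
    using multivariate_normal_imp_centered_normal[OF v_normal[OF assms], of c] pv
    by (simp add: centered_normal_def)
  have d2: "distributed M lborel (\<lambda>\<omega>. c \<bullet> \<epsilon> i \<omega>) (normal_density 0 (sqrt (c \<bullet> (D i *v c))))"
    using multivariate_normal_imp_centered_normal[OF eps_normal[OF assms], of c] pe
    by (simp add: centered_normal_def)
  have "indep_var borel ((\<lambda>z. c \<bullet> z) \<circ> v i) borel ((\<lambda>z. c \<bullet> z) \<circ> \<epsilon> i)"
    by (rule indep_var_compose[OF indep_v_eps[OF assms]]) measurable
  then have "indep_var borel (\<lambda>\<omega>. c \<bullet> v i \<omega>) borel (\<lambda>\<omega>. c \<bullet> \<epsilon> i \<omega>)" by (simp add: comp_def)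
  from add_indep_normal[OF this _ _ d1 d2] pv pe
  have "distributed M lborel (\<lambda>\<omega>. c \<bullet> v i \<omega> + c \<bullet> \<epsilon> i \<omega>)
      (normal_density 0 (sqrt (c \<bullet> (\<Psi> *v c) + c \<bullet> (D i *v c))))"
    by simp
  moreover have "c \<bullet> (Sg i *v c) = c \<bullet> (\<Psi> *v c) + c \<bullet> (D i *v c)"
    by (simp add: Sg_def matrix_vector_mult_add_rdistrib inner_add_right)
  moreover have "(\<lambda>\<omega>. c \<bullet> u i \<omega>) \<in> borel_measurable M"
    using u_measurable[OF assms] by measurable
  ultimately show ?thesis using pv pe by (simp add: centered_normal_def u_def inner_add_right)
qed

lemma u_component_normal:
  assumes "i \<ge> 1"
  shows "centered_normal M (\<lambda>\<omega>. u i \<omega> $ b) (Sg i $ b $ b)"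
  using u_normal[OF assms, of "axis b 1"]
  by (simp add: inner_axis' matrix_vector_mult_basis column_def)

lemma Sg_entry_le: "i \<ge> 1 \<Longrightarrow> \<bar>Sg i $ b $ c\<bar> \<le> norm \<Psi> + dK"
  using norm_Sg[of i] component_le_norm_cart[of "Sg i $ b" c] Finite_Cartesian_Product.norm_nth_le[of "Sg i" b]
  by linarith

text \<open>A rate of exponential moments common to all areas and components: the variances of the
  components are at most \<open>norm \<Psi> + dK\<close>, so \<open>\<kappa>\<close> times such a
  variance is at most \<open>1 / 4\<close>. The 1 keeps the denominator positive.\<close>

definition \<kappa> :: real where "\<kappa> = 1 / (4 * (norm \<Psi> + dK + 1))"

lemma kappa_pos: "\<kappa> > 0"
  using dK_nonneg by (simp add: \<kappa>_def add_nonneg_pos)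

lemma u_exp_square:
  assumes "i \<ge> 1"
  shows "integrable M (\<lambda>\<omega>. exp (\<kappa> * (u i \<omega> $ b)\<^sup>2))" and "expectation (\<lambda>\<omega>. exp (\<kappa> * (u i \<omega> $ b)\<^sup>2)) \<le> 2"
proof -
  have "norm \<Psi> + dK \<ge> 0" using dK_nonneg by simp
  moreover have "Sg i $ b $ b \<le> norm \<Psi> + dK" using Sg_entry_le[OF assms, of b b] by linarith
  ultimately have "\<kappa> * Sg i $ b $ b \<le> 1 / 4"
    by (simp add: \<kappa>_def field_simps)
  from centered_normal_exp_square[OF u_component_normal[OF assms] this] kappa_pos
  show "integrable M (\<lambda>\<omega>. exp (\<kappa> * (u i \<omega> $ b)\<^sup>2))" "expectation (\<lambda>\<omega>. exp (\<kappa> * (u i \<omega> $ b)\<^sup>2)) \<le> 2"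
    by auto
qed

lemma exp_bound_dominated:
  fixes x g :: "'w \<Rightarrow> real"
  assumes "x \<in> borel_measurable M" "integrable M g" "expectation g \<le> K" "\<And>\<omega>. exp (\<kappa> * \<bar>x \<omega>\<bar>) \<le> g \<omega>"
  shows "integrable M (\<lambda>\<omega>. exp (\<kappa> * \<bar>x \<omega>\<bar>))" "expectation (\<lambda>\<omega>. exp (\<kappa> * \<bar>x \<omega>\<bar>)) \<le> K"
proof -
  note [measurable] = assms(1)
  show i: "integrable M (\<lambda>\<omega>. exp (\<kappa> * \<bar>x \<omega>\<bar>))"
  proof (rule Bochner_Integration.integrable_bound[OF assms(2)])
    have "norm (exp (\<kappa> * \<bar>x \<omega>\<bar>)) \<le> norm (g \<omega>)" for \<omega>
      using order_trans[OF assms(4) abs_ge_self, of \<omega>] by simp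
    then show "AE \<omega> in M. norm (exp (\<kappa> * \<bar>x \<omega>\<bar>)) \<le> norm (g \<omega>)" by simp
  qed measurable
  show "expectation (\<lambda>\<omega>. exp (\<kappa> * \<bar>x \<omega>\<bar>)) \<le> K"
    using integral_mono[OF i assms(2) assms(4)] assms(3) by linarith
qed

lemma u_component_exp:
  assumes "i \<ge> 1"
  shows "integrable M (\<lambda>\<omega>. exp (\<kappa> * \<bar>u i \<omega> $ b\<bar>))"
    and "expectation (\<lambda>\<omega>. exp (\<kappa> * \<bar>u i \<omega> $ b\<bar>)) \<le> 2 * exp \<kappa>"
proof -
  have "exp (\<kappa> * \<bar>u i \<omega> $ b\<bar>) \<le> exp \<kappa> * exp (\<kappa> * (u i \<omega> $ b)\<^sup>2)" for \<omega>
  proof -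
    have "0 \<le> (\<bar>u i \<omega> $ b\<bar> - 1)\<^sup>2" by simp
    then have "2 * \<bar>u i \<omega> $ b\<bar> \<le> 1 + (u i \<omega> $ b)\<^sup>2" unfolding power2_diff by simp
    then have "\<bar>u i \<omega> $ b\<bar> \<le> 1 + (u i \<omega> $ b)\<^sup>2" by simp
    then have "\<kappa> * \<bar>u i \<omega> $ b\<bar> \<le> \<kappa> * (1 + (u i \<omega> $ b)\<^sup>2)" using kappa_pos by (intro mult_left_mono) auto
    then show ?thesis by (simp add: exp_add[symmetric] distrib_left)
  qed
  moreover have "(\<lambda>\<omega>. u i \<omega> $ b) \<in> borel_measurable M" using u_measurable[OF assms] by measurable
  moreover have "expectation (\<lambda>\<omega>. exp \<kappa> * exp (\<kappa> * (u i \<omega> $ b)\<^sup>2)) \<le> 2 * exp \<kappa>"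
    using u_exp_square(2)[OF assms, of b] by simp
  ultimately show "integrable M (\<lambda>\<omega>. exp (\<kappa> * \<bar>u i \<omega> $ b\<bar>))"
    "expectation (\<lambda>\<omega>. exp (\<kappa> * \<bar>u i \<omega> $ b\<bar>)) \<le> 2 * exp \<kappa>"
    using exp_bound_dominated[of "\<lambda>\<omega>. u i \<omega> $ b" "\<lambda>\<omega>. exp \<kappa> * exp (\<kappa> * (u i \<omega> $ b)\<^sup>2)"] u_exp_square(1)[OF assms]
    by auto
qed

lemma u_component_mean:
  assumes "i \<ge> 1"
  shows "integrable M (\<lambda>\<omega>. u i \<omega> $ b)" "expectation (\<lambda>\<omega>. u i \<omega> $ b) = 0"
  using centered_normal_moments(2)[OF u_component_normal[OF assms], of b 1]
    centered_normal_moments(3)[OF u_component_normal[OF assms]] by auto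

lemma u_component_indep: "indep_vars (\<lambda>_. borel) (\<lambda>i \<omega>. u i \<omega> $ b) {1..}"
  by (rule indep_vars_compose2[OF indep_u]) measurable

lemma u_component_abs_power_integrable: "i \<ge> 1 \<Longrightarrow> integrable M (\<lambda>\<omega>. \<bar>u i \<omega> $ b\<bar> ^ p)"
  by (rule centered_normal_moments(1)[OF u_component_normal])

lemma u_second_moment:
  assumes "i \<ge> 1"
  shows "integrable M (\<lambda>\<omega>. u i \<omega> $ b * u i \<omega> $ c)" "expectation (\<lambda>\<omega>. u i \<omega> $ b * u i \<omega> $ c) = Sg i $ b $ c"
  using centered_normal_covariance[OF u_normal[OF assms] Sg_sym[OF assms], of "axis b 1" "axis c 1"]
  by (simp_all add: inner_axis' matrix_vector_mult_basis column_def)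

definition Z :: "nat \<Rightarrow> 'w \<Rightarrow> real^'k^'k" where "Z i \<omega> = outer (u i \<omega>) (u i \<omega>) - Sg i"

lemma Z_entry: "Z i \<omega> $ b $ c = u i \<omega> $ b * u i \<omega> $ c - Sg i $ b $ c"
  by (simp add: Z_def outer_def)

lemma Z_mean:
  assumes "i \<ge> 1"
  shows "integrable M (\<lambda>\<omega>. Z i \<omega> $ b $ c)" "expectation (\<lambda>\<omega>. Z i \<omega> $ b $ c) = 0"
  unfolding Z_entry using u_second_moment[OF assms] by (auto simp: prob_space)

text \<open>As \<open>\<bar>x * y\<bar>\<close> is at most the larger square, the exponential moment
  of a product reduces to those of single squares. The moment bounds for weighted sums were stated
  for exponential tails with such quadratic statistics in view.\<close>

lemma Z_exp:
  assumes "i \<ge> 1"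
  shows "integrable M (\<lambda>\<omega>. exp (\<kappa> * \<bar>Z i \<omega> $ b $ c\<bar>))"
    and "expectation (\<lambda>\<omega>. exp (\<kappa> * \<bar>Z i \<omega> $ b $ c\<bar>)) \<le> 4 * exp (\<kappa> * (norm \<Psi> + dK))"
proof -
  let ?E = "exp (\<kappa> * (norm \<Psi> + dK))"
  let ?g = "\<lambda>\<omega>. ?E * (exp (\<kappa> * (u i \<omega> $ b)\<^sup>2) + exp (\<kappa> * (u i \<omega> $ c)\<^sup>2))"
  have bd: "exp (\<kappa> * \<bar>Z i \<omega> $ b $ c\<bar>) \<le> ?g \<omega>" for \<omega>
  proof -
    let ?x = "u i \<omega> $ b" and ?y = "u i \<omega> $ c"
    have "\<bar>?x * ?y\<bar> \<le> max (?x\<^sup>2) (?y\<^sup>2)"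
    proof -
      have "\<bar>?x * ?y\<bar> \<le> max \<bar>?x\<bar> \<bar>?y\<bar> * max \<bar>?x\<bar> \<bar>?y\<bar>" unfolding abs_mult by (intro mult_mono) auto
      also have "\<dots> \<le> max (?x\<^sup>2) (?y\<^sup>2)"
        by (auto simp: max_def power2_eq_square abs_mult[symmetric])
      finally show ?thesis .
    qed
    then have "\<bar>Z i \<omega> $ b $ c\<bar> \<le> (norm \<Psi> + dK) + max (?x\<^sup>2) (?y\<^sup>2)"
      unfolding Z_entry using Sg_entry_le[OF assms, of b c] by linarith
    then have "\<kappa> * \<bar>Z i \<omega> $ b $ c\<bar> \<le> \<kappa> * ((norm \<Psi> + dK) + max (?x\<^sup>2) (?y\<^sup>2))"
      using kappa_pos by (intro mult_left_mono) auto
    then have "exp (\<kappa> * \<bar>Z i \<omega> $ b $ c\<bar>) \<le> ?E * exp (\<kappa> * max (?x\<^sup>2) (?y\<^sup>2))"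
      by (simp add: exp_add[symmetric] distrib_left)
    also have "exp (\<kappa> * max (?x\<^sup>2) (?y\<^sup>2)) \<le> exp (\<kappa> * ?x\<^sup>2) + exp (\<kappa> * ?y\<^sup>2)"
      by (auto simp: max_def)
    finally show ?thesis by simp
  qed
  have "(\<lambda>\<omega>. Z i \<omega> $ b $ c) \<in> borel_measurable M" using Z_mean(1)[OF assms] by auto
  moreover have "integrable M ?g" using u_exp_square(1)[OF assms] by (intro integrable_mult_right Bochner_Integration.integrable_add)
  moreover have "expectation ?g \<le> 4 * ?E"
  proof -
    have "expectation ?g = ?E * (expectation (\<lambda>\<omega>. exp (\<kappa> * (u i \<omega> $ b)\<^sup>2)) + expectation (\<lambda>\<omega>. exp (\<kappa> * (u i \<omega> $ c)\<^sup>2)))"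
      using u_exp_square(1)[OF assms] by simp
    also have "\<dots> \<le> ?E * (2 + 2)" using u_exp_square(2)[OF assms] by (intro mult_left_mono add_mono) auto
    finally show ?thesis by simp
  qed
  ultimately show "integrable M (\<lambda>\<omega>. exp (\<kappa> * \<bar>Z i \<omega> $ b $ c\<bar>))"
    "expectation (\<lambda>\<omega>. exp (\<kappa> * \<bar>Z i \<omega> $ b $ c\<bar>)) \<le> 4 * exp (\<kappa> * (norm \<Psi> + dK))"
    using exp_bound_dominated[of "\<lambda>\<omega>. Z i \<omega> $ b $ c" ?g] bd by auto
qed

lemma Z_indep: "indep_vars (\<lambda>_. borel) (\<lambda>i \<omega>. Z i \<omega> $ b $ c) {1..}"
proof -
  have "indep_vars (\<lambda>_. borel) (\<lambda>i \<omega>. (\<lambda>z. z $ b * z $ c - Sg i $ b $ c) (u i \<omega>)) {1..}"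
    by (rule indep_vars_compose2[OF indep_u]) measurable
  then show ?thesis by (simp add: Z_entry)
qed

subsection \<open>Orders of linear and quadratic statistics\<close>

lemma prob_space_M: "prob_space M" by (rule prob_space_axioms)

lemma order_linear_form:
  fixes B :: "nat \<Rightarrow> nat \<Rightarrow> real^'k^'n"
  assumes I: "\<And>m. finite (I m)" "\<And>m. I m \<subseteq> {1..}"
    and B: "\<forall>\<^sub>F m in sequentially. (\<Sum>i\<in>I m. (norm (B m i))\<^sup>2) \<le> C * (real m powr (- r))\<^sup>2"
  shows "moment_order M r (\<lambda>m \<omega>. \<Sum>i\<in>I m. B m i *v u i \<omega>)"
proof (rule moment_order_vec[OF prob_space_M])
  fix p
  have "moment_order M r (\<lambda>m \<omega>. \<Sum>b\<in>UNIV. \<Sum>i\<in>I m. B m i $ p $ b * u i \<omega> $ b)"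
  proof (rule moment_order_sum[OF prob_space_M])
    fix b
    show "moment_order M r (\<lambda>m \<omega>. \<Sum>i\<in>I m. B m i $ p $ b * u i \<omega> $ b)"
    proof (rule moment_order_weighted_sum[OF prob_space_M kappa_pos I u_component_indep])
      show "\<forall>\<^sub>F m in sequentially. (\<Sum>i\<in>I m. (B m i $ p $ b)\<^sup>2) \<le> C * (real m powr (- r))\<^sup>2"
        using B
      proof eventually_elim
        case (elim m)
        have "(\<Sum>i\<in>I m. (B m i $ p $ b)\<^sup>2) \<le> (\<Sum>i\<in>I m. (norm (B m i))\<^sup>2)"
        proof (intro sum_mono)
          fix i
          have "\<bar>B m i $ p $ b\<bar> \<le> norm (B m i)"
            using component_le_norm_cart[of "B m i $ p" b] Finite_Cartesian_Product.norm_nth_le[of "B m i" p]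
            by linarith
          then show "(B m i $ p $ b)\<^sup>2 \<le> (norm (B m i))\<^sup>2"
            by (metis abs_ge_zero power2_abs power_mono)
        qed
        with elim show ?case by linarith
      qed
    qed (use u_component_mean u_component_exp in auto)
  qed
  moreover have "(\<Sum>i\<in>I m. B m i *v u i \<omega>) $ p = (\<Sum>b\<in>UNIV. \<Sum>i\<in>I m. B m i $ p $ b * u i \<omega> $ b)" for m \<omega>
    unfolding sum_component matrix_vector_mult_def by (simp add: sum.swap[of _ UNIV])
  ultimately show "moment_order M r (\<lambda>m \<omega>. (\<Sum>i\<in>I m. B m i *v u i \<omega>) $ p)" by simp
qed

text \<open>The divisor remains \<open>m\<close> although area \<open>a\<close> is left out; for
  \<open>m \<ge> a\<close> the full average then differs by exactly \<open>Z a\<close> divided by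
  \<open>m\<close>.\<close>

definition A :: "nat \<Rightarrow> 'w \<Rightarrow> real^'k^'k" where
  "A m \<omega> = (1 / real m) *\<^sub>R (\<Sum>i\<in>{1..m} - {a}. Z i \<omega>)"

lemma order_A: "moment_order M (1/2) A"
proof (rule moment_order_mat[OF prob_space_M])
  fix b c
  have "moment_order M (1/2) (\<lambda>m \<omega>. \<Sum>i\<in>{1..m} - {a}. 1 / real m * Z i \<omega> $ b $ c)"
  proof (rule moment_order_weighted_sum[OF prob_space_M kappa_pos _ _ Z_indep])
    show "\<forall>\<^sub>F m in sequentially. (\<Sum>i\<in>{1..m} - {a}. (1 / real m)\<^sup>2) \<le> 1 * (real m powr - (1/2))\<^sup>2"
      using eventually_gt_at_top[of 0]
    proof eventually_elim
      case (elim m)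
      have "(\<Sum>i\<in>{1..m} - {a}. (1 / real m)\<^sup>2) \<le> (\<Sum>i\<in>{1..m}. (1 / real m)\<^sup>2)"
        by (intro sum_mono2) auto
      also have "\<dots> = 1 / real m" using elim by (simp add: power2_eq_square)
      also have "\<dots> = (real m powr - (1/2))\<^sup>2"
        using elim by (simp add: powr_minus powr_half_sqrt power_divide inverse_eq_divide)
      finally show ?case by simp
    qed
  qed (use Z_mean Z_exp in auto)
  then show "moment_order M (1/2) (\<lambda>m \<omega>. A m \<omega> $ b $ c)"
    by (simp add: A_def sum_distrib_left sum_divide_distrib)
qed

lemma order_u: "i \<ge> 1 \<Longrightarrow> moment_order M 0 (\<lambda>m. u i)"
  by (rule moment_order_vec[OF prob_space_M], rule moment_order_fixed)
     (use u_component_mean u_component_abs_power_integrable in auto)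

lemma order_Z: "i \<ge> 1 \<Longrightarrow> moment_order M 0 (\<lambda>m. Z i)"
  unfolding Z_def
  using moment_order_diff[OF moment_order_outer[OF order_u order_u, of i i] moment_order_weaken[OF moment_order_const[OF prob_space_M]], of "Sg i"]
  by simp

section \<open>The covariance estimators\<close>

abbreviation Y :: "'w \<Rightarrow> nat \<Rightarrow> real^'k" where "Y \<omega> \<equiv> \<lambda>i. y i \<omega>"

lemma y_eq_u: "i \<ge> 1 \<Longrightarrow> y i \<omega> = X i *v \<beta> + u i \<omega>"
  by (simp add: y u_def)

section \<open>The least squares error and its effect on the residuals\<close>

definition del :: "nat \<Rightarrow> 'w \<Rightarrow> real^'s" where
  "del m \<omega> = (\<Sum>i\<in>{1..m}. (matrix_inv (gram X m) ** transpose (X i)) *v u i \<omega>)"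

lemma ols_eq:
  assumes "invertible (gram X m)"
  shows "ols X m (Y \<omega>) = \<beta> + del m \<omega>"
proof -
  have "(\<Sum>i\<in>{1..m}. transpose (X i) *v y i \<omega>)
      = gram X m *v \<beta> + (\<Sum>i\<in>{1..m}. transpose (X i) *v u i \<omega>)"
    unfolding gram_def bounded_bilinear.sum_left[OF bounded_bilinear_matrix_vector_mult] sum.distrib[symmetric]
    by (intro sum.cong refl)
       (simp add: y_eq_u matrix_vector_right_distrib matrix_vector_mul_assoc del: transpose_matrix_vector)
  then show ?thesis
    unfolding ols_def del_def
    by (simp add: matrix_vector_right_distrib matrix_vector_mul_assoc matrix_inv[OF assms]
        bounded_bilinear.sum_right[OF bounded_bilinear_matrix_vector_mult] del: transpose_matrix_vector)
qed

definition T :: "nat \<Rightarrow> 'w \<Rightarrow> real^'k^'k" where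
  "T m \<omega> = (1 / real m) *\<^sub>R (\<Sum>i\<in>{1..m}. outer (X i *v del m \<omega>) (u i \<omega>))"

definition R :: "nat \<Rightarrow> 'w \<Rightarrow> real^'k^'k" where
  "R m \<omega> = (1 / real m) *\<^sub>R (\<Sum>i\<in>{1..m}. outer (X i *v del m \<omega>) (X i *v del m \<omega>))"

definition \<Delta>0 :: "nat \<Rightarrow> 'w \<Rightarrow> real^'k^'k" where
  "\<Delta>0 m \<omega> = A m \<omega> + ((1 / real m) *\<^sub>R Z a \<omega> - T m \<omega> - transpose (T m \<omega>) + R m \<omega>)"

text \<open>The residual of area \<open>i\<close> is \<open>u i\<close> minus
  \<open>X i *v del m\<close>. Expanding its outer product is exact: \<open>T\<close> collects the
  cross terms, \<open>R\<close> the squares of the fitted errors.\<close>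

lemma Psi0_hat_eq:
  assumes "invertible (gram X m)" "m \<ge> a"
  shows "Psi0_hat X D m (Y \<omega>) = \<Psi> + \<Delta>0 m \<omega>"
proof -
  have m: "m > 0" using assms a by simp
  have "outer (y i \<omega> - X i *v ols X m (Y \<omega>)) (y i \<omega> - X i *v ols X m (Y \<omega>)) - D i
     = \<Psi> + (Z i \<omega> - outer (X i *v del m \<omega>) (u i \<omega>) - transpose (outer (X i *v del m \<omega>) (u i \<omega>))
        + outer (X i *v del m \<omega>) (X i *v del m \<omega>))" if "i \<in> {1..m}" for i
  proof -
    have "y i \<omega> - X i *v ols X m (Y \<omega>) = u i \<omega> - X i *v del m \<omega>"
      using that by (simp add: ols_eq[OF assms(1)] y_eq_u matrix_vector_right_distrib)
    then show ?thesis by (simp add: outer_diff_square Z_def Sg_def transpose_outer)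
  qed
  then have "Psi0_hat X D m (Y \<omega>) = (1 / real m) *\<^sub>R (\<Sum>i\<in>{1..m}.
      \<Psi> + (Z i \<omega> - outer (X i *v del m \<omega>) (u i \<omega>) - transpose (outer (X i *v del m \<omega>) (u i \<omega>))
        + outer (X i *v del m \<omega>) (X i *v del m \<omega>)))"
    unfolding Psi0_hat_def by simp
  also have "\<dots> = \<Psi> + ((1 / real m) *\<^sub>R (\<Sum>i\<in>{1..m}. Z i \<omega>) - T m \<omega> - transpose (T m \<omega>) + R m \<omega>)"
    using m by (simp add: sum.distrib sum_subtractf scaleR_add_right scaleR_diff_right T_def R_def
        transpose_sum transpose_scaleR sum_constant_scaleR del: sum_constant)
  also have "(\<Sum>i\<in>{1..m}. Z i \<omega>) = Z a \<omega> + (\<Sum>i\<in>{1..m} - {a}. Z i \<omega>)"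
    using a assms(2) by (intro sum.remove) auto
  finally show ?thesis by (simp add: \<Delta>0_def A_def scaleR_add_right)
qed

text \<open>Exponent bookkeeping: weights of size \<open>m powr q\<close> times
  \<open>norm (X i)\<close> have a sum of squares of order \<open>m powr (2 * q + 1)\<close>, which
  is the square of \<open>m powr (- r)\<close>.\<close>

lemma sum_weighted_X_sq:
  fixes B :: "nat \<Rightarrow> nat \<Rightarrow> 'b::real_normed_vector"
  assumes c: "c \<ge> 0" and B: "\<forall>\<^sub>F m in sequentially. \<forall>i\<in>{1..m}. norm (B m i) \<le> c * real m powr q * norm (X i)"
    and r: "r = - q - 1 / 2"
  shows "\<forall>\<^sub>F m in sequentially. (\<Sum>i\<in>{1..m}. (norm (B m i))\<^sup>2) \<le> (c\<^sup>2 * KG) * (real m powr (- r))\<^sup>2"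
  using B sum_norm_X_sq eventually_gt_at_top[of 0]
proof eventually_elim
  case (elim m)
  have "(\<Sum>i\<in>{1..m}. (norm (B m i))\<^sup>2) \<le> (\<Sum>i\<in>{1..m}. (c * real m powr q * norm (X i))\<^sup>2)"
    using elim(1) by (intro sum_mono power_mono) auto
  also have "\<dots> = (c * real m powr q)\<^sup>2 * (\<Sum>i\<in>{1..m}. (norm (X i))\<^sup>2)"
    by (simp add: power_mult_distrib sum_distrib_left)
  also have "\<dots> \<le> (c * real m powr q)\<^sup>2 * (KG * real m)"
    using elim(2) by (intro mult_left_mono) auto
  also have "\<dots> = (c\<^sup>2 * KG) * ((real m powr q)\<^sup>2 * real m powr 1)"
    using elim(3) by (simp add: power_mult_distrib mult_ac)
  also have "(real m powr q)\<^sup>2 * real m powr 1 = (real m powr (- r))\<^sup>2"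
    by (simp only: r power2_eq_square powr_add[symmetric]) (simp add: add.commute)
  finally show ?case .
qed

lemma order_del: "moment_order M (1/2) del"
  unfolding del_def[abs_def]
proof (rule order_linear_form)
  have "\<forall>\<^sub>F m in sequentially. \<forall>i\<in>{1..m}.
      norm (matrix_inv (gram X m) ** transpose (X i)) \<le> gK * real m powr (-1) * norm (X i)"
    using gram_inverse eventually_gt_at_top[of 0]
  proof eventually_elim
    case (elim m)
    show ?case
    proof
      fix i
      have "norm (matrix_inv (gram X m) ** transpose (X i)) \<le> norm (matrix_inv (gram X m)) * norm (X i)"
        using norm_matrix_mult_le[of "matrix_inv (gram X m)" "transpose (X i)"] by (simp add: norm_transpose)
      also have "\<dots> \<le> gK * real m powr (-1) * norm (X i)"
        using elim by (intro mult_right_mono) (auto simp: powr_minus1)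
      finally show "norm (matrix_inv (gram X m) ** transpose (X i)) \<le> gK * real m powr (-1) * norm (X i)" .
    qed
  qed
  from sum_weighted_X_sq[OF _ this, of "1/2"]
  show "\<forall>\<^sub>F m in sequentially. (\<Sum>i\<in>{1..m}. (norm (matrix_inv (gram X m) ** transpose (X i)))\<^sup>2)
     \<le> (gK\<^sup>2 * KG) * (real m powr - (1/2))\<^sup>2"
    using cG by (simp add: gK_def)
qed auto

text \<open>Bounding each summand would only give order \<open>1/2\<close>. Pulling
  \<open>del\<close> out of the sum leaves centered linear forms with weights of size
  \<open>norm (X i) / m\<close>, and both factors then have order \<open>1/2\<close>.\<close>

lemma order_T: "moment_order M 1 T"
proof (rule moment_order_mat[OF prob_space_M])
  fix b c
  have 1: "moment_order M (1/2) (\<lambda>m \<omega>. \<Sum>i\<in>{1..m}. (1 / real m * X i $ b $ p) * u i \<omega> $ c)" for p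
  proof (rule moment_order_weighted_sum[OF prob_space_M kappa_pos _ _ u_component_indep])
    have "\<forall>\<^sub>F m in sequentially. \<forall>i\<in>{1..m}. norm (1 / real m * X i $ b $ p) \<le> 1 * real m powr (-1) * norm (X i)"
      using eventually_gt_at_top[of 0]
    proof eventually_elim
      case (elim m)
      show ?case
      proof
        fix i
        have "\<bar>X i $ b $ p\<bar> \<le> norm (X i)"
          using component_le_norm_cart[of "X i $ b" p] Finite_Cartesian_Product.norm_nth_le[of "X i" b] by linarith
        then show "norm (1 / real m * X i $ b $ p) \<le> 1 * real m powr (-1) * norm (X i)"
          using elim by (simp add: powr_minus1 divide_right_mono)
      qed
    qed
    from sum_weighted_X_sq[OF _ this, of "1/2"]
    show "\<forall>\<^sub>F m in sequentially. (\<Sum>i\<in>{1..m}. (1 / real m * X i $ b $ p)\<^sup>2) \<le> (1\<^sup>2 * KG) * (real m powr - (1/2))\<^sup>2"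
      by (simp add: power_divide)
  qed (use u_component_mean u_component_exp in auto)
  have "moment_order M (1/2 + 1/2) (\<lambda>m \<omega>. \<Sum>p\<in>UNIV. del m \<omega> $ p * (\<Sum>i\<in>{1..m}. (1 / real m * X i $ b $ p) * u i \<omega> $ c))"
    by (intro moment_order_sum[OF prob_space_M] moment_order_mult moment_order_nth order_del 1)
  moreover have "T m \<omega> $ b $ c = (\<Sum>p\<in>UNIV. del m \<omega> $ p * (\<Sum>i\<in>{1..m}. (1 / real m * X i $ b $ p) * u i \<omega> $ c))" for m \<omega>
  proof -
    have "T m \<omega> $ b $ c = (\<Sum>i\<in>{1..m}. \<Sum>p\<in>UNIV. del m \<omega> $ p * ((1 / real m * X i $ b $ p) * u i \<omega> $ c))"
      by (simp add: T_def outer_def matrix_vector_mult_def sum_distrib_left sum_distrib_right mult_ac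
          sum_divide_distrib)
    also have "\<dots> = (\<Sum>p\<in>UNIV. \<Sum>i\<in>{1..m}. del m \<omega> $ p * ((1 / real m * X i $ b $ p) * u i \<omega> $ c))"
      by (rule sum.swap)
    finally show ?thesis by (simp add: sum_distrib_left)
  qed
  ultimately show "moment_order M 1 (\<lambda>m \<omega>. T m \<omega> $ b $ c)" by simp
qed

lemma order_R: "moment_order M 1 R"
proof (rule moment_order_dominated)
  show "moment_order M 1 (\<lambda>m \<omega>. norm (del m \<omega>) * norm (del m \<omega>))"
    using moment_order_mult[OF moment_order_norm[OF order_del] moment_order_norm[OF order_del]] by simp
  show "\<forall>\<^sub>F m in sequentially. R m \<in> borel_measurable M"
    using moment_order_measurable[OF order_del]
  proof eventually_elim
    case (elim m)
    note [measurable] = elim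
    show ?case unfolding R_def by measurable
  qed
  show "\<forall>\<^sub>F m in sequentially. \<forall>\<omega>. norm (R m \<omega>) \<le> KG * norm (norm (del m \<omega>) * norm (del m \<omega>))"
    using sum_norm_X_sq eventually_gt_at_top[of 0]
  proof eventually_elim
    case (elim m)
    show ?case
    proof
      fix \<omega>
      have "norm (\<Sum>i\<in>{1..m}. outer (X i *v del m \<omega>) (X i *v del m \<omega>))
          \<le> (\<Sum>i\<in>{1..m}. (norm (X i))\<^sup>2 * (norm (del m \<omega>))\<^sup>2)"
      proof (rule sum_norm_le)
        fix i
        have "norm (X i *v del m \<omega>) ^ 2 \<le> (norm (X i) * norm (del m \<omega>)) ^ 2"
          by (intro power_mono norm_matrix_vector_mult_le) auto
        then show "norm (outer (X i *v del m \<omega>) (X i *v del m \<omega>)) \<le> (norm (X i))\<^sup>2 * (norm (del m \<omega>))\<^sup>2"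
          by (simp add: norm_outer power2_eq_square mult_ac)
      qed
      also have "\<dots> \<le> KG * real m * (norm (del m \<omega>))\<^sup>2"
        unfolding sum_distrib_right[symmetric] using elim(1) by (intro mult_right_mono) auto
      finally show "norm (R m \<omega>) \<le> KG * norm (norm (del m \<omega>) * norm (del m \<omega>))"
        using elim(2) by (simp add: R_def power2_eq_square field_simps)
    qed
  qed
qed

lemma order_inverse_m: "moment_order M 1 (\<lambda>m \<omega>. 1 / real m)"
proof (rule moment_order_deterministic[OF prob_space_M])
  show "\<forall>\<^sub>F m in sequentially. norm (1 / real m) \<le> 1 * real m powr - 1"
    using eventually_gt_at_top[of 0] by eventually_elim (simp add: powr_minus1)
qed

definition \<Delta>0r :: "nat \<Rightarrow> 'w \<Rightarrow> real^'k^'k" where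
  "\<Delta>0r m \<omega> = (1 / real m) *\<^sub>R Z a \<omega> - T m \<omega> - transpose (T m \<omega>) + R m \<omega>"

lemma order_\<Delta>0r: "moment_order M 1 \<Delta>0r"
  unfolding \<Delta>0r_def[abs_def]
proof (intro moment_order_add moment_order_diff order_T order_R moment_order_linear[OF bounded_linear_transpose])
  show "moment_order M 1 (\<lambda>m \<omega>. (1 / real m) *\<^sub>R Z a \<omega>)"
    using moment_order_scaleR2[OF order_inverse_m order_Z[OF a]] by simp
qed

lemma \<Delta>0_split: "\<Delta>0 m \<omega> = A m \<omega> + \<Delta>0r m \<omega>"
  by (simp add: \<Delta>0_def \<Delta>0r_def)

lemma order_\<Delta>0: "moment_order M (1/2) \<Delta>0"
  unfolding \<Delta>0_split[abs_def] by (intro moment_order_add order_A moment_order_weaken[OF order_\<Delta>0r]) simp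

subsection \<open>The bias of the unweighted estimator\<close>

lemma integral_outer_u:
  assumes "i \<ge> 1" "j \<ge> 1"
  shows "integrable M (\<lambda>\<omega>. outer (u i \<omega>) (u j \<omega>))"
    and "(\<integral>\<omega>. outer (u i \<omega>) (u j \<omega>) \<partial>M) = (if i = j then Sg i else 0)"
proof -
  have e: "integrable M (\<lambda>\<omega>. u i \<omega> $ b * u j \<omega> $ c) \<and>
    expectation (\<lambda>\<omega>. u i \<omega> $ b * u j \<omega> $ c) = (if i = j then Sg i else 0) $ b $ c" for b c
  proof (cases "i = j")
    case True
    then show ?thesis using u_second_moment assms by simp
  next
    case False
    have "indep_var borel (\<lambda>\<omega>. (\<lambda>z. z i $ b) (\<lambda>l\<in>{i}. u l \<omega>)) borel (\<lambda>\<omega>. (\<lambda>z. z j $ c) (\<lambda>l\<in>{j}. u l \<omega>))"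
      by (rule indep_vars_disjoint_functions[OF indep_u]) (use False assms in auto)
    then have "indep_var borel (\<lambda>\<omega>. u i \<omega> $ b) borel (\<lambda>\<omega>. u j \<omega> $ c)" by simp
    from indep_var_lebesgue_integral[OF this] indep_var_integrable[OF this] u_component_mean assms False
    show ?thesis by simp
  qed
  show i: "integrable M (\<lambda>\<omega>. outer (u i \<omega>) (u j \<omega>))"
    by (rule integrable_matI) (use e in \<open>simp add: outer_def\<close>)
  show "(\<integral>\<omega>. outer (u i \<omega>) (u j \<omega>) \<partial>M) = (if i = j then Sg i else 0)"
    unfolding vec_eq_iff integral_matrix_entry(2)[OF i] using e by (simp add: outer_def)
qed

text \<open>Independence and centering leave only pairs with equal index, so the double sum
  collapses to the common areas.\<close>

lemma integral_outer_linear_forms: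
  fixes B C :: "nat \<Rightarrow> real^'k^'n"
  assumes "finite I" "finite J" "I \<subseteq> {1..}" "J \<subseteq> {1..}"
  shows "integrable M (\<lambda>\<omega>. outer (\<Sum>i\<in>I. B i *v u i \<omega>) (\<Sum>j\<in>J. C j *v u j \<omega>))"
    and "(\<integral>\<omega>. outer (\<Sum>i\<in>I. B i *v u i \<omega>) (\<Sum>j\<in>J. C j *v u j \<omega>) \<partial>M)
       = (\<Sum>i\<in>I \<inter> J. B i ** Sg i ** transpose (C i))"
proof -
  have eq: "outer (\<Sum>i\<in>I. B i *v u i \<omega>) (\<Sum>j\<in>J. C j *v u j \<omega>)
     = (\<Sum>i\<in>I. \<Sum>j\<in>J. B i ** outer (u i \<omega>) (u j \<omega>) ** transpose (C j))" for \<omega>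
    unfolding bounded_bilinear.sum_left[OF bounded_bilinear_outer]
    by (intro sum.cong refl) (simp add: bounded_bilinear.sum_right[OF bounded_bilinear_outer] outer_mult)
  have i: "integrable M (\<lambda>\<omega>. B i ** outer (u i \<omega>) (u j \<omega>) ** transpose (C j))" if "i \<in> I" "j \<in> J" for i j
    using that assms by (intro integral_sandwich(1) integral_outer_u(1)) auto
  show "integrable M (\<lambda>\<omega>. outer (\<Sum>i\<in>I. B i *v u i \<omega>) (\<Sum>j\<in>J. C j *v u j \<omega>))"
    unfolding eq by (intro Bochner_Integration.integrable_sum i)
  have "(\<integral>\<omega>. outer (\<Sum>i\<in>I. B i *v u i \<omega>) (\<Sum>j\<in>J. C j *v u j \<omega>) \<partial>M)
     = (\<Sum>i\<in>I. \<Sum>j\<in>J. (\<integral>\<omega>. B i ** outer (u i \<omega>) (u j \<omega>) ** transpose (C j) \<partial>M))"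
    unfolding eq using i by (simp add: Bochner_Integration.integral_sum Bochner_Integration.integrable_sum)
  also have "\<dots> = (\<Sum>i\<in>I. \<Sum>j\<in>J. if i = j then B i ** Sg i ** transpose (C i) else 0)"
  proof (intro sum.cong refl)
    fix i j assume "i \<in> I" "j \<in> J"
    then have ij: "i \<ge> 1" "j \<ge> 1" using assms by auto
    show "(\<integral>\<omega>. B i ** outer (u i \<omega>) (u j \<omega>) ** transpose (C j) \<partial>M)
       = (if i = j then B i ** Sg i ** transpose (C i) else 0)"
      unfolding integral_sandwich(2)[OF integral_outer_u(1)[OF ij]] integral_outer_u(2)[OF ij]
      by (simp add: matrix_mult_zero_left matrix_mult_zero_right)
  qed
  also have "\<dots> = (\<Sum>i\<in>I. if i \<in> J then B i ** Sg i ** transpose (C i) else 0)"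
    using assms by (intro sum.cong refl) (simp add: sum.delta')
  also have "\<dots> = (\<Sum>i\<in>I \<inter> J. B i ** Sg i ** transpose (C i))"
    using assms by (simp add: sum.inter_restrict)
  finally show "(\<integral>\<omega>. outer (\<Sum>i\<in>I. B i *v u i \<omega>) (\<Sum>j\<in>J. C j *v u j \<omega>) \<partial>M)
       = (\<Sum>i\<in>I \<inter> J. B i ** Sg i ** transpose (C i))" .
qed

lemma Z_integral:
  assumes "i \<ge> 1"
  shows "integrable M (Z i)" "(\<integral>\<omega>. Z i \<omega> \<partial>M) = 0"
proof -
  show iZ: "integrable M (Z i)" by (rule integrable_matI) (rule Z_mean(1)[OF assms])
  show "(\<integral>\<omega>. Z i \<omega> \<partial>M) = 0"
    unfolding vec_eq_iff integral_matrix_entry(2)[OF iZ] using Z_mean(2)[OF assms] by simp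
qed

lemma A_mean: "integrable M (A m)" "(\<integral>\<omega>. A m \<omega> \<partial>M) = 0"
proof -
  show "integrable M (A m)"
    unfolding A_def[abs_def] by (intro integrable_scaleR_right Bochner_Integration.integrable_sum Z_integral) auto
  have "(\<integral>\<omega>. (\<Sum>i\<in>{1..m} - {a}. Z i \<omega>) \<partial>M) = 0"
    using Z_integral by (subst Bochner_Integration.integral_sum) auto
  then show "(\<integral>\<omega>. A m \<omega> \<partial>M) = 0" unfolding A_def by simp
qed

text \<open>At the true \<open>\<Psi>\<close> the formula for \<open>bias0\<close> is exact:
  \<open>R\<close> contributes its first term, \<open>T\<close> and its transpose the other two, and
  the centered averages contribute nothing.\<close>

lemma \<Delta>0_mean:
  assumes G: "invertible (gram X m)" and m: "m > 0"
  shows "integrable M (\<Delta>0 m)" "(\<integral>\<omega>. \<Delta>0 m \<omega> \<partial>M) = bias0 X D m \<Psi>"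
proof -
  let ?G = "matrix_inv (gram X m)"
  have Gs: "transpose ?G = ?G" by (rule transpose_matrix_inv[OF G gram_sym])
  let ?B = "\<lambda>i j. X i ** (?G ** transpose (X j))"
  have Xdel: "X i *v del m \<omega> = (\<Sum>j\<in>{1..m}. ?B i j *v u j \<omega>)" for i \<omega>
    by (simp add: del_def bounded_bilinear.sum_right[OF bounded_bilinear_matrix_vector_mult]
        matrix_vector_mul_assoc)
  have u1: "u i \<omega> = (\<Sum>j\<in>{i}. mat 1 *v u j \<omega>)" for i \<omega> by simp
  have t: "integrable M (\<lambda>\<omega>. outer (X i *v del m \<omega>) (u i \<omega>))"
    "(\<integral>\<omega>. outer (X i *v del m \<omega>) (u i \<omega>) \<partial>M) = X i ** ?G ** transpose (X i) ** Sg i" if "i \<in> {1..m}" for i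
  proof -
    note l = integral_outer_linear_forms[of "{1..m}" "{i}" "?B i" "\<lambda>_. mat 1"]
    show "integrable M (\<lambda>\<omega>. outer (X i *v del m \<omega>) (u i \<omega>))"
      using l(1) that unfolding Xdel by simp
    show "(\<integral>\<omega>. outer (X i *v del m \<omega>) (u i \<omega>) \<partial>M) = X i ** ?G ** transpose (X i) ** Sg i"
      using l(2) that unfolding Xdel
      by (simp add: transpose_mat matrix_mul_assoc)
  qed
  have r: "integrable M (\<lambda>\<omega>. outer (X i *v del m \<omega>) (X i *v del m \<omega>))"
    "(\<integral>\<omega>. outer (X i *v del m \<omega>) (X i *v del m \<omega>) \<partial>M)
      = X i ** ?G ** (\<Sum>j\<in>{1..m}. transpose (X j) ** Sg j ** X j) ** ?G ** transpose (X i)" for i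
  proof -
    note l = integral_outer_linear_forms[of "{1..m}" "{1..m}" "?B i" "?B i"]
    show "integrable M (\<lambda>\<omega>. outer (X i *v del m \<omega>) (X i *v del m \<omega>))"
      using l(1) unfolding Xdel by simp
    have "(\<integral>\<omega>. outer (X i *v del m \<omega>) (X i *v del m \<omega>) \<partial>M)
       = (\<Sum>j\<in>{1..m}. ?B i j ** Sg j ** transpose (?B i j))"
      using l(2) unfolding Xdel by simp
    also have "\<dots> = X i ** ?G ** (\<Sum>j\<in>{1..m}. transpose (X j) ** Sg j ** X j) ** ?G ** transpose (X i)"
      by (simp add: matrix_transpose_mul Gs matrix_mult_sum_left matrix_mult_sum_right matrix_mul_assoc)
    finally show "(\<integral>\<omega>. outer (X i *v del m \<omega>) (X i *v del m \<omega>) \<partial>M)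
      = X i ** ?G ** (\<Sum>j\<in>{1..m}. transpose (X j) ** Sg j ** X j) ** ?G ** transpose (X i)" .
  qed
  have iT: "integrable M (T m)" and iR: "integrable M (R m)"
    unfolding T_def[abs_def] R_def[abs_def]
    by (intro integrable_scaleR_right Bochner_Integration.integrable_sum t r; simp)+
  have iTt: "integrable M (\<lambda>\<omega>. transpose (T m \<omega>))"
    and ITt: "(\<integral>\<omega>. transpose (T m \<omega>) \<partial>M) = transpose (\<integral>\<omega>. T m \<omega> \<partial>M)"
    using integrable_bounded_linear_image[OF bounded_linear_transpose iT] by auto
  have IT: "(\<integral>\<omega>. T m \<omega> \<partial>M) = (1 / real m) *\<^sub>R (\<Sum>i\<in>{1..m}. X i ** ?G ** transpose (X i) ** Sg i)"
    unfolding T_def using t by (simp add: Bochner_Integration.integral_sum)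
  have IR: "(\<integral>\<omega>. R m \<omega> \<partial>M) = (1 / real m) *\<^sub>R (\<Sum>i\<in>{1..m}. X i ** ?G ** (\<Sum>j\<in>{1..m}. transpose (X j) ** Sg j ** X j) ** ?G ** transpose (X i))"
    unfolding R_def using r by (simp add: Bochner_Integration.integral_sum)
  note i = A_mean(1)[of m] Z_integral(1)[OF a] iT iTt iR
  show "integrable M (\<Delta>0 m)" unfolding \<Delta>0_def[abs_def] using i by simp
  have "transpose (\<Sum>i\<in>{1..m}. X i ** ?G ** transpose (X i) ** Sg i)
    = (\<Sum>i\<in>{1..m}. Sg i ** X i ** ?G ** transpose (X i))"
    unfolding transpose_sum
    by (intro sum.cong refl) (simp add: matrix_transpose_mul Gs Sg_sym matrix_mul_assoc)
  moreover have "(\<integral>\<omega>. \<Delta>0 m \<omega> \<partial>M) = (\<integral>\<omega>. R m \<omega> \<partial>M) - transpose (\<integral>\<omega>. T m \<omega> \<partial>M) - (\<integral>\<omega>. T m \<omega> \<partial>M)"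
    unfolding \<Delta>0_def using i Z_integral(2)[OF a] A_mean(2)[of m] ITt by simp
  ultimately show "(\<integral>\<omega>. \<Delta>0 m \<omega> \<partial>M) = bias0 X D m \<Psi>"
    unfolding bias0_def IT IR Sg_def by (simp add: transpose_scaleR)
qed

definition bK :: real where "bK = (\<bar>KG\<bar> * gK)\<^sup>2 + 2 * (\<bar>KG\<bar> * gK)"

text \<open>Stated for arbitrary \<open>D'\<close> since it serves twice, with the true
  \<open>D\<close> for the bias itself and with zero for its linear part. The first summand of
  \<open>bK\<close> comes from the term with two inverse Gram matrices, the second from the two
  terms with one.\<close>

lemma bias0_bound:
  "\<forall>\<^sub>F m in sequentially. \<forall>D' P q. (\<forall>i\<in>{1..m}. norm (P + D' i) \<le> q) \<longrightarrow>
     norm (bias0 X D' m P) \<le> bK * q / real m"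
  using gram_inverse sum_norm_X_sq eventually_gt_at_top[of 0]
proof eventually_elim
  case (elim m)
  let ?G = "matrix_inv (gram X m)"
  have G: "norm ?G \<le> gK / real m" and m: "m > 0" using elim by auto
  have gK0: "gK \<ge> 0" using cG by (simp add: gK_def)
  have S: "(\<Sum>i\<in>{1..m}. (norm (X i))\<^sup>2) \<le> \<bar>KG\<bar> * real m"
    using elim(2) by (smt (verit, best) mult_right_mono of_nat_0_le_iff)
  show ?case
  proof (intro allI impI)
    fix D' :: "nat \<Rightarrow> real^'k^'k" and P q assume q: "\<forall>i\<in>{1..m}. norm (P + D' i) \<le> q"
    have "1 \<in> {1..m}" using m by simp
    then have q0: "q \<ge> 0" using q norm_ge_zero order_trans by blast
    let ?H = "\<Sum>j\<in>{1..m}. transpose (X j) ** (P + D' j) ** X j"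
    have H: "norm ?H \<le> \<bar>KG\<bar> * real m * q"
    proof -
      have "norm ?H \<le> (\<Sum>j\<in>{1..m}. (norm (X j))\<^sup>2 * q)"
      proof (rule sum_norm_le)
        fix j assume j: "j \<in> {1..m}"
        have "norm (transpose (X j) ** (P + D' j) ** X j) \<le> norm (X j) * norm (P + D' j) * norm (X j)"
          by (rule order_trans[OF norm_matrix_mult_le mult_right_mono])
             (use norm_matrix_mult_le[of "transpose (X j)" "P + D' j"] in \<open>auto simp: norm_transpose\<close>)
        also have "\<dots> \<le> norm (X j) * q * norm (X j)"
          using q j by (intro mult_right_mono mult_left_mono) auto
        finally show "norm (transpose (X j) ** (P + D' j) ** X j) \<le> (norm (X j))\<^sup>2 * q"
          by (simp add: power2_eq_square mult_ac)
      qed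
      also have "\<dots> \<le> \<bar>KG\<bar> * real m * q"
        unfolding sum_distrib_right[symmetric] using S q0 by (intro mult_right_mono) auto
      finally show ?thesis .
    qed
    have XGX: "norm (X i ** ?G ** transpose (X i)) \<le> (norm (X i))\<^sup>2 * (gK / real m)" for i
    proof -
      have "norm (X i ** ?G ** transpose (X i)) \<le> norm (X i) * norm ?G * norm (X i)"
        using norm_matrix_mult_le[of "X i ** ?G" "transpose (X i)"]
          mult_right_mono[OF norm_matrix_mult_le[of "X i" ?G] norm_ge_zero[of "X i"]]
        by (simp add: norm_transpose)
      also have "\<dots> \<le> norm (X i) * (gK / real m) * norm (X i)"
        using G by (intro mult_right_mono mult_left_mono) auto
      finally show ?thesis by (simp add: power2_eq_square mult_ac)
    qed
    have t1: "norm (X i ** ?G ** ?H ** ?G ** transpose (X i)) \<le> (norm (X i))\<^sup>2 * ((gK / real m)\<^sup>2 * (\<bar>KG\<bar> * real m * q))" for i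
    proof -
      have "norm (X i ** ?G ** ?H ** ?G ** transpose (X i)) \<le> norm (X i ** ?G ** ?H ** ?G) * norm (X i)"
        using norm_matrix_mult_le[of "X i ** ?G ** ?H ** ?G" "transpose (X i)"] by (simp add: norm_transpose)
      also have "\<dots> \<le> (norm (X i) * norm ?G * norm ?H * norm ?G) * norm (X i)"
        by (intro mult_right_mono order_trans[OF norm_matrix_mult_le] mult_right_mono norm_matrix_mult_le) auto
      also have "\<dots> \<le> (norm (X i) * (gK / real m) * (\<bar>KG\<bar> * real m * q) * (gK / real m)) * norm (X i)"
        using G H q0 gK0 by (intro mult_right_mono mult_mono mult_nonneg_nonneg) auto
      also have "\<dots> = (norm (X i))\<^sup>2 * ((gK / real m)\<^sup>2 * (\<bar>KG\<bar> * real m * q))"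
        by (simp only: power2_eq_square mult.assoc mult.commute mult.left_commute)
      finally show ?thesis .
    qed
    have t2: "norm ((P + D' i) ** X i ** ?G ** transpose (X i)) \<le> (norm (X i))\<^sup>2 * (gK / real m * q)" if "i \<in> {1..m}" for i
    proof -
      have "norm ((P + D' i) ** (X i ** ?G ** transpose (X i))) \<le> q * ((norm (X i))\<^sup>2 * (gK / real m))"
        by (rule order_trans[OF norm_matrix_mult_le mult_mono]) (use q that XGX[of i] q0 in auto)
      then show ?thesis by (simp add: matrix_mul_assoc mult_ac)
    qed
    have t3: "norm (X i ** ?G ** transpose (X i) ** (P + D' i)) \<le> (norm (X i))\<^sup>2 * (gK / real m * q)" if "i \<in> {1..m}" for i
    proof -
      have "norm ((X i ** ?G ** transpose (X i)) ** (P + D' i)) \<le> ((norm (X i))\<^sup>2 * (gK / real m)) * q"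
        by (rule order_trans[OF norm_matrix_mult_le mult_mono]) (use q that XGX[of i] q0 gK0 in auto)
      then show ?thesis by (simp add: matrix_mul_assoc mult_ac)
    qed
    have sum_bound: "norm ((1 / real m) *\<^sub>R (\<Sum>i\<in>{1..m}. F i)) \<le> 1 / real m * (\<bar>KG\<bar> * real m * c)"
      if "\<And>i. i \<in> {1..m} \<Longrightarrow> norm (F i) \<le> (norm (X i))\<^sup>2 * c" "c \<ge> 0" for F :: "nat \<Rightarrow> real^'k^'k" and c
    proof -
      have "norm (\<Sum>i\<in>{1..m}. F i) \<le> (\<Sum>i\<in>{1..m}. (norm (X i))\<^sup>2 * c)" by (rule sum_norm_le) (use that in auto)
      also have "\<dots> \<le> \<bar>KG\<bar> * real m * c"
        unfolding sum_distrib_right[symmetric] using S that(2) by (intro mult_right_mono) auto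
      finally have "1 / real m * norm (\<Sum>i\<in>{1..m}. F i) \<le> 1 / real m * (\<bar>KG\<bar> * real m * c)"
        by (intro mult_left_mono) auto
      then show ?thesis by simp
    qed
    have "norm (bias0 X D' m P) \<le>
        1 / real m * (\<bar>KG\<bar> * real m * ((gK / real m)\<^sup>2 * (\<bar>KG\<bar> * real m * q)))
      + 1 / real m * (\<bar>KG\<bar> * real m * (gK / real m * q)) + 1 / real m * (\<bar>KG\<bar> * real m * (gK / real m * q))"
      unfolding bias0_def
    proof (intro order_trans[OF norm_triangle_ineq4] add_mono)
      show "norm ((1 / real m) *\<^sub>R (\<Sum>i\<in>{1..m}. X i ** ?G ** ?H ** ?G ** transpose (X i)))
        \<le> 1 / real m * (\<bar>KG\<bar> * real m * ((gK / real m)\<^sup>2 * (\<bar>KG\<bar> * real m * q)))"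
        by (rule sum_bound[OF t1]) (use q0 in auto)
      show "norm ((1 / real m) *\<^sub>R (\<Sum>i\<in>{1..m}. (P + D' i) ** X i ** ?G ** transpose (X i)))
        \<le> 1 / real m * (\<bar>KG\<bar> * real m * (gK / real m * q))"
        by (rule sum_bound[OF t2]) (use q0 gK0 in auto)
      show "norm ((1 / real m) *\<^sub>R (\<Sum>i\<in>{1..m}. X i ** ?G ** transpose (X i) ** (P + D' i)))
        \<le> 1 / real m * (\<bar>KG\<bar> * real m * (gK / real m * q))"
        by (rule sum_bound[OF t3]) (use q0 gK0 in auto)
    qed
    also have "\<dots> = bK * q / real m"
      using m by (simp add: bK_def power2_eq_square field_simps)
    finally show "norm (bias0 X D' m P) \<le> bK * q / real m" .
  qed
qed

text \<open>\<open>bias0\<close> is affine in its matrix argument, and replacing all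
  \<open>D i\<close> by zero produces its linear part.\<close>

lemma bias0_diff: "bias0 X D m P - bias0 X D m P' = bias0 X (\<lambda>_. 0) m (P - P')"
proof -
  have H: "(\<Sum>j\<in>{1..m}. transpose (X j) ** (P - P' + 0) ** X j)
     = (\<Sum>j\<in>{1..m}. transpose (X j) ** (P + D j) ** X j) - (\<Sum>j\<in>{1..m}. transpose (X j) ** (P' + D j) ** X j)"
    unfolding sum_subtractf[symmetric] by (intro sum.cong refl) (simp add: matrix_mult_algebra)
  have H2: "(\<Sum>i\<in>{1..m}. (P - P' + 0) ** X i ** G ** transpose (X i))
     = (\<Sum>i\<in>{1..m}. (P + D i) ** X i ** G ** transpose (X i))
      - (\<Sum>i\<in>{1..m}. (P' + D i) ** X i ** G ** transpose (X i))" for G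
    unfolding sum_subtractf[symmetric] by (intro sum.cong refl) (simp add: matrix_mult_algebra)
  have H3: "(\<Sum>i\<in>{1..m}. X i ** G ** transpose (X i) ** (P - P' + 0))
     = (\<Sum>i\<in>{1..m}. X i ** G ** transpose (X i) ** (P + D i))
      - (\<Sum>i\<in>{1..m}. X i ** G ** transpose (X i) ** (P' + D i))" for G
    unfolding sum_subtractf[symmetric] by (intro sum.cong refl) (simp add: matrix_mult_algebra)
  show ?thesis
    unfolding bias0_def H H2 H3
    by (simp add: matrix_mult_algebra sum_subtractf scaleR_diff_right)
qed

subsection \<open>The two estimators and their nonnegative definite parts\<close>

lemma bias0_measurable:
  assumes "F \<in> borel_measurable N"
  shows "(\<lambda>\<omega>. bias0 X D' m (F \<omega>)) \<in> borel_measurable N"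
proof -
  note [measurable] = assms
  show ?thesis unfolding bias0_def by measurable
qed

abbreviation lin :: "nat \<Rightarrow> real^'k^'k \<Rightarrow> real^'k^'k" where "lin m \<equiv> bias0 X (\<lambda>_. 0) m"

lemma bias0_add: "bias0 X D m (P + F) = bias0 X D m P + lin m F"
  using bias0_diff[of m "P + F" P] by (simp add: algebra_simps)

lemma order_lin:
  assumes "moment_order M r F"
  shows "moment_order M (1 + r) (\<lambda>m \<omega>. lin m (F m \<omega>))"
proof (rule moment_order_dominated)
  show "moment_order M (1 + r) (\<lambda>m \<omega>. 1 / real m * norm (F m \<omega>))"
    by (intro moment_order_mult order_inverse_m moment_order_norm assms)
  show "\<forall>\<^sub>F m in sequentially. (\<lambda>\<omega>. lin m (F m \<omega>)) \<in> borel_measurable M"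
    using moment_order_measurable[OF assms] by eventually_elim (rule bias0_measurable)
  show "\<forall>\<^sub>F m in sequentially. \<forall>\<omega>. norm (lin m (F m \<omega>)) \<le> bK * norm (1 / real m * norm (F m \<omega>))"
    using bias0_bound
  proof eventually_elim
    case (elim m)
    show ?case
    proof
      fix \<omega>
      have "norm (lin m (F m \<omega>)) \<le> bK * norm (F m \<omega>) / real m" using elim by auto
      then show "norm (lin m (F m \<omega>)) \<le> bK * norm (1 / real m * norm (F m \<omega>))" by simp
    qed
  qed
qed

lemma order_bias0_Psi: "moment_order M 1 (\<lambda>m \<omega>. bias0 X D m \<Psi>)"
proof (rule moment_order_deterministic[OF prob_space_M])
  show "\<forall>\<^sub>F m in sequentially. norm (bias0 X D m \<Psi>) \<le> bK * (norm \<Psi> + dK) * real m powr - 1"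
    using bias0_bound eventually_gt_at_top[of 0]
  proof eventually_elim
    case (elim m)
    have "norm (bias0 X D m \<Psi>) \<le> bK * (norm \<Psi> + dK) / real m"
      using elim(1) norm_plus_D[OF Psi_psd] by auto
    then show ?case using elim(2) by (simp add: powr_minus1)
  qed
qed

text \<open>Inserting \<open>\<Psi> + \<Delta>0\<close> into the affine map \<open>bias0\<close>
  separates the bias at the truth from a term linear in \<open>\<Delta>0\<close>.\<close>

definition \<Delta> :: "estimator \<Rightarrow> nat \<Rightarrow> 'w \<Rightarrow> real^'k^'k" where
  "\<Delta> e m \<omega> = (case e of Est0 \<Rightarrow> \<Delta>0 m \<omega> | Est1 \<Rightarrow> \<Delta>0 m \<omega> - (bias0 X D m \<Psi> + lin m (\<Delta>0 m \<omega>)))"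

lemma Psi_hat_eq:
  assumes "invertible (gram X m)" "m \<ge> a"
  shows "Psi_hat e X D m (Y \<omega>) = \<Psi> + \<Delta> e m \<omega>"
  using Psi0_hat_eq[OF assms] by (cases e) (simp_all add: \<Delta>_def Psi1_hat_def bias0_add)

text \<open>The bias correction changes the estimator only at order 1, so both estimators share the
  leading term \<open>A\<close>.\<close>

lemma order_\<Delta>_A: "moment_order M 1 (\<lambda>m \<omega>. \<Delta> e m \<omega> - A m \<omega>)"
proof (cases e)
  case Est0
  then show ?thesis using order_\<Delta>0r by (simp add: \<Delta>_def \<Delta>0_split)
next
  case Est1
  have "moment_order M 1 (\<lambda>m \<omega>. \<Delta>0r m \<omega> - (bias0 X D m \<Psi> + lin m (\<Delta>0 m \<omega>)))"
    by (intro moment_order_diff moment_order_add order_\<Delta>0r order_bias0_Psi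
        moment_order_weaken[OF order_lin[OF order_\<Delta>0]]) simp
  then show ?thesis using Est1 by (simp add: \<Delta>_def \<Delta>0_split algebra_simps)
qed

lemma order_\<Delta>: "moment_order M (1/2) (\<Delta> e)"
proof -
  have "moment_order M (1/2) (\<lambda>m \<omega>. A m \<omega> + (\<Delta> e m \<omega> - A m \<omega>))"
    by (intro moment_order_add order_A moment_order_weaken[OF order_\<Delta>_A]) simp
  then show ?thesis by simp
qed

text \<open>Without correction the mean is exactly the bias. With it, the bias is subtracted at the
  estimate instead of the truth, and the discrepancy is the mean of
  \<open>lin m (\<Delta>0 m)\<close>, of order \<open>1 + 1/2\<close>.\<close>

lemma \<Delta>_mean:
  "(\<lambda>m. norm ((\<integral>\<omega>. \<Delta> e m \<omega> \<partial>M) - bias e X D m \<Psi>)) \<in> O(\<lambda>m. real m powr (-3/2))"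
proof (cases e)
  case Est0
  have "\<forall>\<^sub>F m in sequentially. norm ((\<integral>\<omega>. \<Delta> e m \<omega> \<partial>M) - bias e X D m \<Psi>) = 0"
    using gram_inverse eventually_gt_at_top[of 0]
    by eventually_elim (use Est0 \<Delta>0_mean in \<open>simp add: \<Delta>_def\<close>)
  then show ?thesis by (rule O_cong_eventually[rotated]) simp
next
  case Est1
  note o = order_lin[OF order_\<Delta>0]
  have "(\<lambda>m. norm (\<integral>\<omega>. lin m (\<Delta>0 m \<omega>) \<partial>M)) \<in> O(\<lambda>m. real m powr (-3/2))"
    using moment_order_expectation[OF o] by simp
  moreover have "\<forall>\<^sub>F m in sequentially. norm ((\<integral>\<omega>. \<Delta> e m \<omega> \<partial>M) - bias e X D m \<Psi>)
      = norm (\<integral>\<omega>. lin m (\<Delta>0 m \<omega>) \<partial>M)"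
    using gram_inverse eventually_gt_at_top[of 0] moment_order_integrable[OF o]
  proof eventually_elim
    case (elim m)
    then have "(\<integral>\<omega>. \<Delta> e m \<omega> \<partial>M) = - (\<integral>\<omega>. lin m (\<Delta>0 m \<omega>) \<partial>M)"
      using \<Delta>0_mean[of m] Est1 by (simp add: \<Delta>_def prob_space)
    then show ?case using Est1 by simp
  qed
  ultimately show ?thesis by (rule O_cong_eventually)
qed

section \<open>Symmetry of the estimators and truncation as a projection\<close>

lemma transpose_bias0:
  assumes "invertible (gram X m)" "transpose P = P" "\<And>i. i \<in> {1..m} \<Longrightarrow> transpose (D i) = D i"
  shows "transpose (bias0 X D m P) = bias0 X D m P"
proof -
  let ?G = "matrix_inv (gram X m)"
  have G: "transpose ?G = ?G" by (rule transpose_matrix_inv[OF assms(1) gram_sym])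
  have H: "transpose (\<Sum>j\<in>{1..m}. transpose (X j) ** (P + D j) ** X j) = (\<Sum>j\<in>{1..m}. transpose (X j) ** (P + D j) ** X j)"
    unfolding transpose_sum
    by (intro sum.cong refl) (simp add: matrix_transpose_mul transpose_add assms matrix_mul_assoc)
  have 1: "transpose (\<Sum>i\<in>{1..m}. X i ** ?G ** S ** ?G ** transpose (X i))
    = (\<Sum>i\<in>{1..m}. X i ** ?G ** S ** ?G ** transpose (X i))" if "transpose S = S" for S
    unfolding transpose_sum
    by (intro sum.cong refl) (simp add: matrix_transpose_mul that G matrix_mul_assoc)
  have 2: "transpose (\<Sum>i\<in>{1..m}. (P + D i) ** X i ** ?G ** transpose (X i))
     = (\<Sum>i\<in>{1..m}. X i ** ?G ** transpose (X i) ** (P + D i))"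
    unfolding transpose_sum
    by (intro sum.cong refl) (simp add: matrix_transpose_mul transpose_add assms G matrix_mul_assoc)
  have 3: "transpose (\<Sum>i\<in>{1..m}. X i ** ?G ** transpose (X i) ** (P + D i))
     = (\<Sum>i\<in>{1..m}. (P + D i) ** X i ** ?G ** transpose (X i))"
    unfolding transpose_sum
    by (intro sum.cong refl) (simp add: matrix_transpose_mul transpose_add assms G matrix_mul_assoc)
  show ?thesis
    unfolding bias0_def transpose_diff transpose_scaleR 1[OF H] 2 3
    by (simp only: diff_diff_add add.commute)
qed

lemma transpose_Psi_hat:
  assumes "invertible (gram X m)"
  shows "transpose (Psi_hat e X D m yy) = Psi_hat e X D m yy"
proof -
  have 0: "transpose (Psi0_hat X D m yy) = Psi0_hat X D m yy"
    unfolding Psi0_hat_def transpose_scaleR transpose_sum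
    by (intro arg_cong2[of _ _ _ _ scaleR] sum.cong refl) (simp add: transpose_diff transpose_outer D_sym)
  show ?thesis
    using 0 transpose_bias0[OF assms 0 D_sym] by (cases e) (simp_all add: Psi1_hat_def transpose_diff)
qed

text \<open>The projection is measurable and defined for every \<open>m\<close>; for large
  \<open>m\<close>, when the estimator is symmetric and equals \<open>\<Psi> + \<Delta> e m\<close>,
  this is the truncated estimator.\<close>

definition P :: "estimator \<Rightarrow> nat \<Rightarrow> 'w \<Rightarrow> real^'k^'k" where
  "P e m \<omega> = closest_point {B. pos_semidef B} (\<Psi> + \<Delta> e m \<omega>)"

definition d :: "estimator \<Rightarrow> nat \<Rightarrow> 'w \<Rightarrow> real^'k^'k" where
  "d e m \<omega> = P e m \<omega> - \<Psi>"

lemma Psi_hat_plus_eq: "\<forall>\<^sub>F m in sequentially. \<forall>\<omega>. Psi_hat_plus e X D m (Y \<omega>) = P e m \<omega>"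
  using gram_inverse eventually_ge_at_top[of a]
proof eventually_elim
  case (elim m)
  show ?case
  proof
    fix \<omega>
    show "Psi_hat_plus e X D m (Y \<omega>) = P e m \<omega>"
      using nnd_part_eq_closest_point[OF transpose_Psi_hat[of m e "Y \<omega>"]] Psi_hat_eq[of m e \<omega>] elim
      by (simp add: Psi_hat_plus_def P_def)
  qed
qed

lemma P_psd: "pos_semidef (P e m \<omega>)"
  unfolding P_def by (rule pos_semidef_closest_point)

lemma P_eq: "P e m \<omega> = \<Psi> + d e m \<omega>" by (simp add: d_def)

lemma closest_point_Psi: "closest_point {B. pos_semidef B} \<Psi> = \<Psi>"
  using Psi_psd by (intro closest_point_self) simp

text \<open>\<open>\<Psi>\<close> is its own projection, and the projection does not increase
  distances.\<close>

lemma norm_d_le: "norm (d e m \<omega>) \<le> norm (\<Delta> e m \<omega>)"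
  using norm_closest_point_pos_semidef_diff_le[of "\<Psi> + \<Delta> e m \<omega>" \<Psi>]
  by (simp add: d_def P_def closest_point_Psi)

text \<open>A symmetric perturbation no larger than the coercivity constant of \<open>\<Psi>\<close>
  cannot leave the cone.\<close>

lemma coercive_perturbation_psd:
  assumes "transpose F = F" "norm F \<le> lam"
  shows "pos_semidef (\<Psi> + F)"
  unfolding pos_semidef_def
proof (intro conjI allI)
  show "transpose (\<Psi> + F) = \<Psi> + F" by (simp add: transpose_add Psi_sym assms)
  fix x
  have "\<bar>x \<bullet> (F *v x)\<bar> \<le> norm x * (norm F * norm x)"
    by (rule order_trans[OF Cauchy_Schwarz_ineq2 mult_left_mono[OF norm_matrix_vector_mult_le]]) simp
  also have "\<dots> \<le> norm x * (lam * norm x)"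
    using assms(2) by (intro mult_left_mono mult_right_mono) auto
  also have "\<dots> = lam * (x \<bullet> x)" by (simp add: power2_norm_eq_inner[symmetric] power2_eq_square)
  finally show "0 \<le> x \<bullet> ((\<Psi> + F) *v x)"
    using lam(2)[of x] by (simp add: matrix_vector_mult_add_rdistrib inner_add_right)
qed

text \<open>The truncation is inactive unless \<open>norm \<Delta> > lam\<close>; the cubic bound makes it negligible.\<close>

lemma norm_d_diff_le:
  "\<forall>\<^sub>F m in sequentially. \<forall>\<omega>. norm (d e m \<omega> - \<Delta> e m \<omega>) \<le>
      2 / lam\<^sup>2 * norm (norm (\<Delta> e m \<omega>) * (norm (\<Delta> e m \<omega>) * norm (\<Delta> e m \<omega>)))"
  using gram_inverse eventually_ge_at_top[of a]
proof eventually_elim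
  case (elim m)
  show ?case
  proof
    fix \<omega>
    let ?n = "norm (\<Delta> e m \<omega>)"
    have sym: "transpose (\<Delta> e m \<omega>) = \<Delta> e m \<omega>"
      using transpose_Psi_hat[of m e "Y \<omega>"] Psi_hat_eq[of m e \<omega>] elim
      by (simp add: transpose_add Psi_sym)
    show "norm (d e m \<omega> - \<Delta> e m \<omega>) \<le> 2 / lam\<^sup>2 * norm (?n * (?n * ?n))"
    proof (cases "?n \<le> lam")
      case True
      then have "pos_semidef (\<Psi> + \<Delta> e m \<omega>)" by (rule coercive_perturbation_psd[OF sym])
      then have "P e m \<omega> = \<Psi> + \<Delta> e m \<omega>" unfolding P_def by (intro closest_point_self) simp
      then show ?thesis using lam(1) by (simp add: d_def)
    next
      case False
      have "norm (d e m \<omega> - \<Delta> e m \<omega>) \<le> 2 * ?n"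
        using norm_triangle_ineq4[of "d e m \<omega>" "\<Delta> e m \<omega>"] norm_d_le[of e m \<omega>] by linarith
      also have "\<dots> \<le> 2 * ?n * (?n / lam)\<^sup>2"
        using False lam(1) by (simp add: mult_le_cancel_left1 one_le_power)
      finally show ?thesis by (simp add: power_divide power2_eq_square mult_ac)
    qed
  qed
qed

lemma d_measurable: "\<forall>\<^sub>F m in sequentially. d e m \<in> borel_measurable M"
  using moment_order_measurable[OF order_\<Delta>[of e]]
proof eventually_elim
  case (elim m)
  note [measurable] = elim
  show ?case unfolding d_def P_def by measurable
qed

lemma P_measurable: "\<forall>\<^sub>F m in sequentially. P e m \<in> borel_measurable M"
  using d_measurable[of e]
proof eventually_elim
  case (elim m)
  note [measurable] = elim
  show ?case unfolding P_eq[abs_def] by measurable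
qed

lemma order_d: "moment_order M (1/2) (d e)"
  by (rule moment_order_dominated[OF order_\<Delta>[of e] d_measurable, where K=1]) (simp add: norm_d_le)

lemma order_d_\<Delta>: "moment_order M (3/2) (\<lambda>m \<omega>. d e m \<omega> - \<Delta> e m \<omega>)"
proof (rule moment_order_dominated[OF _ _ norm_d_diff_le])
  note n = moment_order_norm[OF order_\<Delta>[of e]]
  show "moment_order M (3/2) (\<lambda>m \<omega>. norm (\<Delta> e m \<omega>) * (norm (\<Delta> e m \<omega>) * norm (\<Delta> e m \<omega>)))"
    using moment_order_mult[OF n moment_order_mult[OF n n]] by simp
  show "\<forall>\<^sub>F m in sequentially. (\<lambda>\<omega>. d e m \<omega> - \<Delta> e m \<omega>) \<in> borel_measurable M"
    using d_measurable[of e] moment_order_measurable[OF order_\<Delta>[of e]] by eventually_elim simp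
qed

lemma order_d_A: "moment_order M 1 (\<lambda>m \<omega>. d e m \<omega> - A m \<omega>)"
proof -
  have "moment_order M 1 (\<lambda>m \<omega>. (d e m \<omega> - \<Delta> e m \<omega>) + (\<Delta> e m \<omega> - A m \<omega>))"
    by (intro moment_order_add order_\<Delta>_A moment_order_weaken[OF order_d_\<Delta>]) simp
  then show ?thesis by simp
qed

lemma d_mean:
  "(\<lambda>m. norm ((\<integral>\<omega>. d e m \<omega> \<partial>M) - bias e X D m \<Psi>)) \<in> O(\<lambda>m. real m powr (-3/2))"
proof -
  have "(\<lambda>m. norm ((\<integral>\<omega>. d e m \<omega> - \<Delta> e m \<omega> \<partial>M) + ((\<integral>\<omega>. \<Delta> e m \<omega> \<partial>M) - bias e X D m \<Psi>)))
     \<in> O(\<lambda>m. real m powr (-3/2))"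
    using moment_order_expectation[OF order_d_\<Delta>[of e]] \<Delta>_mean[of e] by (intro O_norm_add) simp_all
  moreover have "\<forall>\<^sub>F m in sequentially. norm ((\<integral>\<omega>. d e m \<omega> \<partial>M) - bias e X D m \<Psi>)
     = norm ((\<integral>\<omega>. d e m \<omega> - \<Delta> e m \<omega> \<partial>M) + ((\<integral>\<omega>. \<Delta> e m \<omega> \<partial>M) - bias e X D m \<Psi>))"
    using moment_order_integrable[OF order_d[of e]] moment_order_integrable[OF order_\<Delta>[of e]]
    by eventually_elim simp
  ultimately show ?thesis by (rule O_cong_eventually)
qed

subsection \<open>Inverses of the estimated covariances\<close>

definition V :: "estimator \<Rightarrow> nat \<Rightarrow> nat \<Rightarrow> 'w \<Rightarrow> real^'k^'k" where
  "V e i m \<omega> = matrix_inv (P e m \<omega> + D i)"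

lemma norm_V: "i \<ge> 1 \<Longrightarrow> norm (V e i m \<omega>) \<le> wK"
  unfolding V_def by (rule norm_inv_plus_D[OF P_psd])

lemma V_measurable: "\<forall>\<^sub>F m in sequentially. \<forall>i. V e i m \<in> borel_measurable M"
  using P_measurable[of e]
proof eventually_elim
  case (elim m)
  note [measurable] = elim
  show ?case unfolding V_def by measurable
qed

lemma order_bounded:
  assumes "\<forall>\<^sub>F m in sequentially. F m \<in> borel_measurable M" "\<And>m \<omega>. norm (F m \<omega>) \<le> c"
  shows "moment_order M 0 F"
proof (rule moment_order_dominated[OF moment_order_const[OF prob_space_M, of "1::real"] assms(1)])
  show "\<forall>\<^sub>F m in sequentially. \<forall>\<omega>. norm (F m \<omega>) \<le> c * norm (1 :: real)"
    using assms(2) by simp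
qed

lemma order_V: "i \<ge> 1 \<Longrightarrow> moment_order M 0 (V e i)"
  by (rule order_bounded[where c=wK]) (use V_measurable[of e] norm_V in \<open>auto elim: eventually_mono\<close>)

lemma V_diff:
  assumes "i \<ge> 1"
  shows "V e i m \<omega> - matrix_inv (Sg i) = - (V e i m \<omega> ** d e m \<omega> ** matrix_inv (Sg i))"
proof -
  have "P e m \<omega> + D i - Sg i = d e m \<omega>" by (simp add: d_def Sg_def)
  then show ?thesis
    using matrix_inv_diff[OF plus_D_invertible[OF P_psd[of e m \<omega>] assms] Sg_invertible[OF assms]]
    by (simp add: V_def)
qed

lemma V_diff_W: "V e a m \<omega> - W = - (V e a m \<omega> ** d e m \<omega> ** W)"
  using V_diff[OF a] by (simp add: W_def)

lemma order_V_W: "moment_order M (1/2) (\<lambda>m \<omega>. V e a m \<omega> - W)"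
  unfolding V_diff_W
  using moment_order_uminus[OF moment_order_matrix_mult[OF moment_order_matrix_mult[OF order_V[OF a] order_d]
      moment_order_const[OF prob_space_M, of W]]]
  by simp

lemmas order_const = moment_order_const[OF prob_space_M]

lemma order_const_left:
  fixes F :: "nat \<Rightarrow> 'w \<Rightarrow> real^'p^'n" and C :: "real^'n^'m"
  shows "moment_order M r F \<Longrightarrow> moment_order M r (\<lambda>m \<omega>. C ** F m \<omega>)"
  using moment_order_matrix_mult[OF order_const, of r F C] by simp

lemma order_const_right:
  fixes F :: "nat \<Rightarrow> 'w \<Rightarrow> real^'p^'n" and C :: "real^'q^'p"
  shows "moment_order M r F \<Longrightarrow> moment_order M r (\<lambda>m \<omega>. F m \<omega> ** C)"
  using moment_order_matrix_mult[OF _ order_const, of r F C] by simp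

lemma order_const_left_vec:
  fixes F :: "nat \<Rightarrow> 'w \<Rightarrow> real^'n" and C :: "real^'n^'m"
  shows "moment_order M r F \<Longrightarrow> moment_order M r (\<lambda>m \<omega>. C *v F m \<omega>)"
  using moment_order_matrix_vector[OF order_const, of r F C] by simp

subsection \<open>The second moment of the leading term\<close>

text \<open>The value of \<open>E (Z i ** W ** Z i)\<close>. Of the three pairings in the fourth
  moment two give \<open>Sg i ** W ** Sg i\<close>, and centering by \<open>Sg i\<close> removes one
  of these.\<close>

definition H :: "nat \<Rightarrow> real^'k^'k" where
  "H i = Sg i ** W ** Sg i + trace (Sg i ** W) *\<^sub>R Sg i"

lemma u_fourth_moment:
  assumes "i \<ge> 1"
  shows "integrable M (\<lambda>\<omega>. u i \<omega> $ b * u i \<omega> $ c * u i \<omega> $ p * u i \<omega> $ q)"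
    "expectation (\<lambda>\<omega>. u i \<omega> $ b * u i \<omega> $ c * u i \<omega> $ p * u i \<omega> $ q) =
      Sg i $ b $ c * Sg i $ p $ q + Sg i $ b $ p * Sg i $ c $ q + Sg i $ b $ q * Sg i $ c $ p"
  using centered_normal_fourth_moment[OF u_normal[OF assms] Sg_sym[OF assms], of "axis b 1" "axis c 1" "axis p 1" "axis q 1"]
  by (simp_all add: inner_axis' matrix_vector_mult_basis column_def)

lemma integral_Z_W_Z:
  assumes i: "i \<ge> 1"
  shows "integrable M (\<lambda>\<omega>. Z i \<omega> ** W ** Z i \<omega>)" "(\<integral>\<omega>. Z i \<omega> ** W ** Z i \<omega> \<partial>M) = H i"
proof -
  let ?S = "Sg i"
  have entry: "(outer (u i \<omega>) (u i \<omega>) ** W ** outer (u i \<omega>) (u i \<omega>)) $ b $ c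
     = (\<Sum>q\<in>UNIV. \<Sum>p\<in>UNIV. W $ p $ q * (u i \<omega> $ b * u i \<omega> $ p * u i \<omega> $ q * u i \<omega> $ c))" for b c \<omega>
    by (simp add: matrix_matrix_mult_def outer_def sum_distrib_left sum_distrib_right mult_ac)
  have Ss: "?S $ x $ y = ?S $ y $ x" and Ws: "W $ x $ y = W $ y $ x" for x y
    using symmetric_entry[OF Sg_sym[OF i]] symmetric_entry[OF W_sym] by auto
  have i1: "integrable M (\<lambda>\<omega>. outer (u i \<omega>) (u i \<omega>) ** W ** outer (u i \<omega>) (u i \<omega>))"
    by (rule integrable_matI, unfold entry)
       (intro Bochner_Integration.integrable_sum integrable_mult_right u_fourth_moment(1)[OF i])
  have e1: "(\<integral>\<omega>. outer (u i \<omega>) (u i \<omega>) ** W ** outer (u i \<omega>) (u i \<omega>) \<partial>M)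
      = ?S ** W ** ?S + H i"
    unfolding vec_eq_iff integral_matrix_entry(2)[OF i1]
  proof (intro allI)
    fix b c
    have "expectation (\<lambda>\<omega>. (outer (u i \<omega>) (u i \<omega>) ** W ** outer (u i \<omega>) (u i \<omega>)) $ b $ c)
      = (\<Sum>q\<in>UNIV. \<Sum>p\<in>UNIV. W $ p $ q * (?S $ b $ p * ?S $ q $ c + ?S $ b $ q * ?S $ p $ c + ?S $ b $ c * ?S $ p $ q))"
      unfolding entry
      by (subst Bochner_Integration.integral_sum,
          intro Bochner_Integration.integrable_sum integrable_mult_right u_fourth_moment(1)[OF i],
          intro sum.cong refl, subst Bochner_Integration.integral_sum,
          intro integrable_mult_right u_fourth_moment(1)[OF i])
         (simp add: u_fourth_moment(2)[OF i])
    also have "\<dots> = (\<Sum>q\<in>UNIV. \<Sum>p\<in>UNIV. W $ p $ q * (?S $ b $ p * ?S $ q $ c))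
       + (\<Sum>q\<in>UNIV. \<Sum>p\<in>UNIV. W $ p $ q * (?S $ b $ q * ?S $ p $ c))
       + (\<Sum>q\<in>UNIV. \<Sum>p\<in>UNIV. W $ p $ q * (?S $ b $ c * ?S $ p $ q))"
      by (simp add: distrib_left sum.distrib)
    also have "(\<Sum>q\<in>UNIV. \<Sum>p\<in>UNIV. W $ p $ q * (?S $ b $ p * ?S $ q $ c)) = (?S ** W ** ?S) $ b $ c"
      by (simp add: matrix_matrix_mult_def sum_distrib_left sum_distrib_right mult_ac)
    also have "(\<Sum>q\<in>UNIV. \<Sum>p\<in>UNIV. W $ p $ q * (?S $ b $ q * ?S $ p $ c)) = (?S ** W ** ?S) $ b $ c"
      by (subst sum.swap) (simp add: matrix_matrix_mult_def sum_distrib_left sum_distrib_right mult_ac Ws)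
    also have "(\<Sum>q\<in>UNIV. \<Sum>p\<in>UNIV. W $ p $ q * (?S $ b $ c * ?S $ p $ q)) = trace (?S ** W) * ?S $ b $ c"
      by (simp add: trace_def matrix_matrix_mult_def sum_distrib_left sum_distrib_right mult_ac Ss)
    finally show "expectation (\<lambda>\<omega>. (outer (u i \<omega>) (u i \<omega>) ** W ** outer (u i \<omega>) (u i \<omega>)) $ b $ c)
        = (?S ** W ** ?S + H i) $ b $ c"
      by (simp add: H_def)
  qed
  \<comment> \<open>In expectation the two linear terms and the constant together contribute
    \<open>- 2 + 1\<close> times \<open>?S ** W ** ?S\<close>.\<close>
  have Zeq: "Z i \<omega> ** W ** Z i \<omega> = outer (u i \<omega>) (u i \<omega>) ** W ** outer (u i \<omega>) (u i \<omega>)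
      - (?S ** W) ** outer (u i \<omega>) (u i \<omega>) - outer (u i \<omega>) (u i \<omega>) ** (W ** ?S) + ?S ** W ** ?S" for \<omega>
    by (simp add: Z_def matrix_mult_algebra matrix_mul_assoc)
  note o = integral_outer_u[OF i i]
  note l = integral_mult_left_matrix[OF o(1), of "?S ** W"] and r = integral_mult_right_matrix[OF o(1), of "W ** ?S"]
  show "integrable M (\<lambda>\<omega>. Z i \<omega> ** W ** Z i \<omega>)"
    unfolding Zeq using i1 l(1) r(1) by simp
  show "(\<integral>\<omega>. Z i \<omega> ** W ** Z i \<omega> \<partial>M) = H i"
    unfolding Zeq using i1 l r e1 o(2) by (simp add: prob_space matrix_mul_assoc)
qed

lemma integral_Z_W_Z_distinct:
  assumes "i \<ge> 1" "j \<ge> 1" "i \<noteq> j"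
  shows "integrable M (\<lambda>\<omega>. Z i \<omega> ** C ** Z j \<omega>)" "(\<integral>\<omega>. Z i \<omega> ** C ** Z j \<omega> \<partial>M) = 0"
proof -
  have z: "integrable M (\<lambda>\<omega>. Z i \<omega> $ b $ p * Z j \<omega> $ q $ c) \<and> expectation (\<lambda>\<omega>. Z i \<omega> $ b $ p * Z j \<omega> $ q $ c) = 0"
    for b p q c
  proof -
    have "indep_var borel (\<lambda>\<omega>. (\<lambda>z. z i $ b * z i $ p - Sg i $ b $ p) (\<lambda>l\<in>{i}. u l \<omega>))
      borel (\<lambda>\<omega>. (\<lambda>z. z j $ q * z j $ c - Sg j $ q $ c) (\<lambda>l\<in>{j}. u l \<omega>))"
      by (rule indep_vars_disjoint_functions[OF indep_u]) (use assms in auto)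
    then have "indep_var borel (\<lambda>\<omega>. Z i \<omega> $ b $ p) borel (\<lambda>\<omega>. Z j \<omega> $ q $ c)" by (simp add: Z_entry)
    from indep_var_lebesgue_integral[OF this] indep_var_integrable[OF this] Z_mean assms
    show ?thesis by simp
  qed
  have entry: "(Z i \<omega> ** C ** Z j \<omega>) $ b $ c = (\<Sum>q\<in>UNIV. \<Sum>p\<in>UNIV. C $ p $ q * (Z i \<omega> $ b $ p * Z j \<omega> $ q $ c))" for b c \<omega>
    by (simp add: matrix_matrix_mult_def sum_distrib_left sum_distrib_right mult_ac)
  show i1: "integrable M (\<lambda>\<omega>. Z i \<omega> ** C ** Z j \<omega>)"
    by (rule integrable_matI, unfold entry)
       (intro Bochner_Integration.integrable_sum integrable_mult_right, use z in blast)
  show "(\<integral>\<omega>. Z i \<omega> ** C ** Z j \<omega> \<partial>M) = 0"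
    unfolding vec_eq_iff integral_matrix_entry(2)[OF i1]
  proof (intro allI)
    fix b c
    have "expectation (\<lambda>\<omega>. (Z i \<omega> ** C ** Z j \<omega>) $ b $ c)
      = (\<Sum>q\<in>UNIV. \<Sum>p\<in>UNIV. C $ p $ q * expectation (\<lambda>\<omega>. Z i \<omega> $ b $ p * Z j \<omega> $ q $ c))"
      unfolding entry using z by simp
    then show "expectation (\<lambda>\<omega>. (Z i \<omega> ** C ** Z j \<omega>) $ b $ c) = (0 :: real^'k^'k) $ b $ c" using z by simp
  qed
qed

lemma integral_A_W_A:
  "integrable M (\<lambda>\<omega>. A m \<omega> ** W ** A m \<omega>)"
  "(\<integral>\<omega>. A m \<omega> ** W ** A m \<omega> \<partial>M) = (1 / (real m)\<^sup>2) *\<^sub>R (\<Sum>i\<in>{1..m} - {a}. H i)"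
proof -
  let ?I = "{1..m} - {a}"
  have "(\<Sum>i\<in>?I. Z i \<omega>) ** W ** (\<Sum>j\<in>?I. Z j \<omega>) = (\<Sum>i\<in>?I. \<Sum>j\<in>?I. Z i \<omega> ** W ** Z j \<omega>)" for \<omega>
    unfolding matrix_mult_sum_left matrix_mult_sum_right by (rule refl sum.swap)
  then have eq: "A m \<omega> ** W ** A m \<omega> = (1 / (real m)\<^sup>2) *\<^sub>R (\<Sum>i\<in>?I. \<Sum>j\<in>?I. Z i \<omega> ** W ** Z j \<omega>)" for \<omega>
    by (simp add: A_def matrix_mult_scale_left matrix_mult_scale_right power2_eq_square)
  have int: "integrable M (\<lambda>\<omega>. Z i \<omega> ** W ** Z j \<omega>)"
    and val: "(\<integral>\<omega>. Z i \<omega> ** W ** Z j \<omega> \<partial>M) = (if i = j then H i else 0)" if "i \<in> ?I" "j \<in> ?I" for i j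
    using integral_Z_W_Z[of i] integral_Z_W_Z_distinct[of i j W] that by (cases "i = j"; simp)+
  show "integrable M (\<lambda>\<omega>. A m \<omega> ** W ** A m \<omega>)"
    unfolding eq by (intro integrable_scaleR_right Bochner_Integration.integrable_sum int)
  have "(\<integral>\<omega>. (\<Sum>i\<in>?I. \<Sum>j\<in>?I. Z i \<omega> ** W ** Z j \<omega>) \<partial>M)
      = (\<Sum>i\<in>?I. \<integral>\<omega>. (\<Sum>j\<in>?I. Z i \<omega> ** W ** Z j \<omega>) \<partial>M)"
    by (intro Bochner_Integration.integral_sum Bochner_Integration.integrable_sum int)
  also have "\<dots> = (\<Sum>i\<in>?I. \<Sum>j\<in>?I. \<integral>\<omega>. Z i \<omega> ** W ** Z j \<omega> \<partial>M)"
    by (intro sum.cong refl Bochner_Integration.integral_sum int)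
  also have "\<dots> = (\<Sum>i\<in>?I. \<Sum>j\<in>?I. if i = j then H i else 0)"
    by (intro sum.cong refl val)
  also have "\<dots> = (\<Sum>i\<in>?I. H i)" by simp
  finally show "(\<integral>\<omega>. A m \<omega> ** W ** A m \<omega> \<partial>M) = (1 / (real m)\<^sup>2) *\<^sub>R (\<Sum>i\<in>?I. H i)"
    unfolding eq by simp
qed

subsection \<open>Expansion of the first term\<close>

text \<open>Writing \<open>F\<close> as \<open>(F + D a) - D a\<close> leaves the argument only
  inside the inverse, so that expanding \<open>G1\<close> amounts to expanding one inverse.\<close>

lemma G1_eq:
  assumes "pos_semidef F"
  shows "G1 D a F = D a - D a ** matrix_inv (F + D a) ** D a"
proof -
  let ?I = "matrix_inv (F + D a)"
  have "(F + D a) ** ?I ** D a = D a" by (simp add: matrix_inv[OF plus_D_invertible[OF assms a]])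
  moreover have "(F + D a) ** ?I ** D a = F ** ?I ** D a + D a ** ?I ** D a" by (simp add: matrix_mult_algebra)
  ultimately show ?thesis by (simp add: G1_def algebra_simps)
qed

text \<open>Three uses of the resolvent identity. The remainder is exact and contains
  \<open>V\<close> itself, which is bounded, so it is cubic in \<open>d\<close> without any
  smallness condition on \<open>d\<close>.\<close>

lemma V_expand:
  "V e a m \<omega> = W - W ** d e m \<omega> ** W + W ** d e m \<omega> ** W ** d e m \<omega> ** W
     - V e a m \<omega> ** d e m \<omega> ** W ** d e m \<omega> ** W ** d e m \<omega> ** W"
proof -
  let ?V = "V e a m \<omega>" and ?x = "d e m \<omega> ** W"
  have 1: "?V = W - ?V ** ?x" using V_diff_W[of e m \<omega>] by (simp add: algebra_simps matrix_mul_assoc)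
  have 2: "?V ** F = W ** F - ?V ** ?x ** F" for F :: "real^'k^'k"
    by (subst 1) (simp add: matrix_mult_algebra)
  have "?V = W - (W ** ?x - (W ** ?x ** ?x - ?V ** ?x ** ?x ** ?x))"
    using 1 2[of ?x] 2[of "?x ** ?x"] by (simp add: matrix_mul_assoc)
  then show ?thesis by (simp add: matrix_mul_assoc algebra_simps)
qed

definition Lf :: "real^'k^'k" where "Lf = D a ** W"
definition Rt :: "real^'k^'k" where "Rt = W ** D a"

definition rem1 :: "estimator \<Rightarrow> nat \<Rightarrow> 'w \<Rightarrow> real^'k^'k" where
  "rem1 e m \<omega> = D a ** (V e a m \<omega> ** d e m \<omega> ** W ** d e m \<omega> ** W ** d e m \<omega>) ** Rt
     - Lf ** (d e m \<omega> ** W ** d e m \<omega> - A m \<omega> ** W ** A m \<omega>) ** Rt"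

text \<open>The quadratic term is negative: on average the estimator lowers \<open>G1\<close> by
  about \<open>G3\<close>, which has to be added back. The linear term carries the bias that
  \<open>G4\<close> compensates.\<close>

lemma G1_expand:
  "G1 D a (P e m \<omega>) - G1 D a \<Psi>
     = Lf ** d e m \<omega> ** Rt - Lf ** (A m \<omega> ** W ** A m \<omega>) ** Rt + rem1 e m \<omega>"
proof -
  have "G1 D a (P e m \<omega>) - G1 D a \<Psi> = D a ** W ** D a - D a ** V e a m \<omega> ** D a"
    by (simp add: G1_eq P_psd Psi_psd V_def W_def Sg_def)
  also have "\<dots> = Lf ** d e m \<omega> ** Rt - Lf ** (d e m \<omega> ** W ** d e m \<omega>) ** Rt
      + D a ** (V e a m \<omega> ** d e m \<omega> ** W ** d e m \<omega> ** W ** d e m \<omega>) ** Rt"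
    by (subst V_expand) (simp add: Lf_def Rt_def matrix_mult_algebra matrix_mul_assoc)
  finally show ?thesis by (simp add: rem1_def matrix_mult_algebra)
qed

lemmas order_matrix_mult = moment_order_matrix_mult

lemma order_dWd: "moment_order M (3/2) (\<lambda>m \<omega>. d e m \<omega> ** W ** d e m \<omega> - A m \<omega> ** W ** A m \<omega>)"
proof -
  have 1: "moment_order M (1 + 1/2) (\<lambda>m \<omega>. ((d e m \<omega> - A m \<omega>) ** W) ** d e m \<omega>)"
    by (intro order_matrix_mult order_const_right order_d_A order_d)
  have 2: "moment_order M (1/2 + 1) (\<lambda>m \<omega>. (A m \<omega> ** W) ** (d e m \<omega> - A m \<omega>))"
    by (intro order_matrix_mult order_const_right order_d_A order_A)
  have "moment_order M (3/2) (\<lambda>m \<omega>. ((d e m \<omega> - A m \<omega>) ** W) ** d e m \<omega> + (A m \<omega> ** W) ** (d e m \<omega> - A m \<omega>))"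
    by (rule moment_order_add) (use 1 2 in simp_all)
  then show ?thesis by (simp add: matrix_mult_algebra)
qed

lemma order_rem1: "moment_order M (3/2) (rem1 e)"
  unfolding rem1_def[abs_def]
proof (rule moment_order_diff[OF order_const_right[OF order_const_left]
      order_const_right[OF order_const_left[OF order_dWd]]])
  have "moment_order M (0 + 1/2 + 1/2 + 1/2)
      (\<lambda>m \<omega>. V e a m \<omega> ** d e m \<omega> ** W ** d e m \<omega> ** W ** d e m \<omega>)"
    by (intro order_matrix_mult order_const_right order_V order_d a)
  then show "moment_order M (3/2) (\<lambda>m \<omega>. V e a m \<omega> ** d e m \<omega> ** W ** d e m \<omega> ** W ** d e m \<omega>)"
    by simp
qed

subsection \<open>The third and fourth terms\<close>

text \<open>The summand of \<open>G3\<close> as a function of the covariance; its value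
  \<open>H i\<close> at the truth is what links \<open>G3\<close> to the second moment of
  \<open>A\<close>.\<close>

definition h :: "nat \<Rightarrow> real^'k^'k \<Rightarrow> real^'k^'k" where
  "h i F = (F + D i) ** matrix_inv (F + D a) ** (F + D i)
     + trace ((F + D i) ** matrix_inv (F + D a)) *\<^sub>R (F + D i)"

lemma h_Psi: "h i \<Psi> = H i"
  by (simp add: h_def H_def Sg_def W_def)

lemma G3_eq: "G3 D m a F = (1 / real m) *\<^sub>R
   (D a ** matrix_inv (F + D a) ** ((1 / real m) *\<^sub>R (\<Sum>i\<in>{1..m}. h i F)) ** matrix_inv (F + D a) ** D a)"
  by (simp add: G3_def h_def sum.distrib matrix_mult_algebra power2_eq_square)

text \<open>A common upper bound for the norms of \<open>P + D i\<close> and \<open>Sg i\<close> and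
  for 1. Its polynomials serve as random Lipschitz constants and have bounded moments of all
  orders.\<close>

definition NN :: "estimator \<Rightarrow> nat \<Rightarrow> 'w \<Rightarrow> real" where
  "NN e m \<omega> = norm (P e m \<omega>) + dK + norm \<Psi> + 1"

lemma order_P: "moment_order M 0 (P e)"
  unfolding P_eq[abs_def]
  by (intro moment_order_add order_const moment_order_weaken[OF order_d]) simp

lemma order_NN: "moment_order M 0 (NN e)"
  unfolding NN_def[abs_def]
  by (intro moment_order_add order_const moment_order_norm order_P)

lemma NN_ge: "norm (P e m \<omega>) + dK \<le> NN e m \<omega>" "norm \<Psi> + dK \<le> NN e m \<omega>" "1 \<le> NN e m \<omega>"
  "norm (P e m \<omega>) + dK + 1 \<le> NN e m \<omega>"
  using dK_nonneg norm_ge_zero[of "P e m \<omega>"] norm_ge_zero[of \<Psi>] by (simp_all add: NN_def)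

lemma norm_W: "norm W \<le> wK" using norm_inv_Sg[OF a] by (simp add: W_def)

lemma norm_V_diff:
  assumes "i \<ge> 1"
  shows "norm (V e i m \<omega> - matrix_inv (Sg i)) \<le> wK * norm (d e m \<omega>) * wK"
  unfolding V_diff[OF assms] norm_minus_cancel
  by (rule norm_mult3_le[OF norm_V[OF assms] order_refl norm_inv_Sg[OF assms]])

definition hK :: real where "hK = (1 + real CARD('k)) * (2 * wK + wK\<^sup>2)"

text \<open>Differences are taken one factor at a time, each isolating a factor \<open>d\<close>. As
  \<open>P\<close> is unbounded, the Lipschitz constant is a polynomial in
  \<open>NN\<close>.\<close>

lemma norm_h_diff:
  assumes i: "i \<ge> 1"
  shows "norm (h i (P e m \<omega>) - H i) \<le> hK * (NN e m \<omega> * NN e m \<omega> * norm (d e m \<omega>))"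
proof -
  let ?V = "V e a m \<omega>" and ?d = "d e m \<omega>" and ?S = "Sg i" and ?T = "P e m \<omega> + D i"
  let ?N = "NN e m \<omega>" and ?n = "norm (d e m \<omega>)" and ?k = "real CARD('k)"
  have Td: "?T = ?S + ?d" by (simp add: P_eq Sg_def)
  have N: "norm ?T \<le> ?N" "norm ?S \<le> ?N" and N1: "?N \<ge> 1"
    using norm_plus_D[OF P_psd[of e m \<omega>] i] norm_Sg[OF i] NN_ge(1,2,3)[of e m \<omega>] by linarith+
  have VW: "norm (?V - W) \<le> wK * ?n * wK" using norm_V_diff[OF a] by (simp add: W_def)
  note V = norm_V[OF a, of e m \<omega>]
  have eq1: "?T ** ?V ** ?T - ?S ** W ** ?S = ?d ** ?V ** ?T + ?S ** (?V - W) ** ?T + ?S ** W ** ?d"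
    by (simp add: Td matrix_mult_algebra)
  have eq2: "?T ** ?V - ?S ** W = ?d ** ?V + ?S ** (?V - W)"
    by (simp add: Td matrix_mult_algebra)
  have b1: "norm (?T ** ?V ** ?T - ?S ** W ** ?S) \<le> ?n * wK * ?N + ?N * (wK * ?n * wK) * ?N + ?N * wK * ?n"
    unfolding eq1
    by (intro order_trans[OF norm_triangle_ineq] add_mono norm_mult3_le order_refl V VW N norm_W)
  have b2: "norm (?T ** ?V - ?S ** W) \<le> ?n * wK + ?N * (wK * ?n * wK)"
    unfolding eq2
    by (intro order_trans[OF norm_triangle_ineq] add_mono norm_mult2_le order_refl V VW N)
  have b3: "norm (trace (?T ** ?V) *\<^sub>R ?T - trace (?S ** W) *\<^sub>R ?S)
      \<le> (?k * (?n * wK + ?N * (wK * ?n * wK))) * ?N + (?k * (?N * wK)) * ?n"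
  proof -
    have "trace (?T ** ?V) *\<^sub>R ?T - trace (?S ** W) *\<^sub>R ?S
       = trace (?T ** ?V - ?S ** W) *\<^sub>R ?T + trace (?S ** W) *\<^sub>R ?d"
    proof -
      have "?d = ?T - ?S" using Td by simp
      then show ?thesis
        by (simp only: linear_diff[OF bounded_linear.linear[OF bounded_linear_trace]]
            scaleR_diff_left scaleR_diff_right) simp
    qed
    also have "norm \<dots> \<le> \<bar>trace (?T ** ?V - ?S ** W)\<bar> * norm ?T + \<bar>trace (?S ** W)\<bar> * ?n"
      by (rule order_trans[OF norm_triangle_ineq]) simp
    also have "\<dots> \<le> (?k * (?n * wK + ?N * (wK * ?n * wK))) * ?N + (?k * (?N * wK)) * ?n"
    proof (intro add_mono mult_mono)
      show "\<bar>trace (?T ** ?V - ?S ** W)\<bar> \<le> ?k * (?n * wK + ?N * (wK * ?n * wK))"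
        by (rule order_trans[OF abs_trace_le mult_left_mono[OF b2]]) simp
      show "\<bar>trace (?S ** W)\<bar> \<le> ?k * (?N * wK)"
        by (rule order_trans[OF abs_trace_le mult_left_mono[OF norm_mult2_le[OF N(2) norm_W]]]) simp
    qed (use N N1 wK_nonneg in auto)
    finally show ?thesis .
  qed
  have "norm (h i (P e m \<omega>) - H i) \<le> norm (?T ** ?V ** ?T - ?S ** W ** ?S)
      + norm (trace (?T ** ?V) *\<^sub>R ?T - trace (?S ** W) *\<^sub>R ?S)"
  proof -
    have "h i (P e m \<omega>) - H i = (?T ** ?V ** ?T - ?S ** W ** ?S)
      + (trace (?T ** ?V) *\<^sub>R ?T - trace (?S ** W) *\<^sub>R ?S)"
      by (simp add: h_def H_def V_def)
    then show ?thesis by (metis norm_triangle_ineq)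
  qed
  also have "\<dots> \<le> (1 + ?k) * ((2 * (?N * wK) + ?N * ?N * wK\<^sup>2) * ?n)"
    using b1 b3 by (simp add: algebra_simps power2_eq_square)
  also have "\<dots> \<le> (1 + ?k) * ((2 * (?N * ?N * wK) + ?N * ?N * wK\<^sup>2) * ?n)"
    using N1 wK_nonneg by (intro mult_left_mono mult_right_mono add_mono) auto
  also have "\<dots> = hK * (?N * ?N * ?n)" by (simp add: hK_def algebra_simps)
  finally show ?thesis .
qed

definition Hb :: "nat \<Rightarrow> real^'k^'k" where "Hb m = (1 / real m) *\<^sub>R (\<Sum>i\<in>{1..m}. H i)"

definition Hd :: "estimator \<Rightarrow> nat \<Rightarrow> 'w \<Rightarrow> real^'k^'k" where
  "Hd e m \<omega> = (1 / real m) *\<^sub>R (\<Sum>i\<in>{1..m}. h i (P e m \<omega>) - H i)"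

lemma Hb_Hd: "(1 / real m) *\<^sub>R (\<Sum>i\<in>{1..m}. h i (P e m \<omega>)) = Hd e m \<omega> + Hb m"
  by (simp add: Hd_def Hb_def sum_subtractf scaleR_diff_right)

lemma order_Hd: "moment_order M (1/2) (Hd e)"
proof (rule moment_order_dominated)
  have "moment_order M (0 + 0 + 1/2) (\<lambda>m \<omega>. NN e m \<omega> * NN e m \<omega> * norm (d e m \<omega>))"
    by (intro moment_order_mult order_NN moment_order_norm order_d)
  then show "moment_order M (1/2) (\<lambda>m \<omega>. NN e m \<omega> * NN e m \<omega> * norm (d e m \<omega>))" by simp
  show "\<forall>\<^sub>F m in sequentially. Hd e m \<in> borel_measurable M"
    using P_measurable[of e]
  proof eventually_elim
    case (elim m)
    note [measurable] = elim
    show ?case unfolding Hd_def h_def by measurable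
  qed
  show "\<forall>\<^sub>F m in sequentially. \<forall>\<omega>. norm (Hd e m \<omega>) \<le> hK * norm (NN e m \<omega> * NN e m \<omega> * norm (d e m \<omega>))"
    using eventually_gt_at_top[of 0]
  proof eventually_elim
    case (elim m)
    show ?case
    proof
      fix \<omega>
      have "norm (Hd e m \<omega>) \<le> hK * (NN e m \<omega> * NN e m \<omega> * norm (d e m \<omega>))"
        unfolding Hd_def by (rule norm_average_le[OF norm_h_diff elim])
      then show "norm (Hd e m \<omega>) \<le> hK * norm (NN e m \<omega> * NN e m \<omega> * norm (d e m \<omega>))"
        using NN_ge(3)[of e m \<omega>] by simp
    qed
  qed
qed

lemma norm_H:
  assumes "i \<ge> 1"
  shows "norm (H i) \<le> (1 + real CARD('k)) * ((norm \<Psi> + dK) * wK * (norm \<Psi> + dK))"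
proof -
  let ?q = "norm \<Psi> + dK"
  have q: "?q \<ge> 0" using dK_nonneg by simp
  have "norm (H i) \<le> norm (Sg i ** W ** Sg i) + \<bar>trace (Sg i ** W)\<bar> * norm (Sg i)"
    unfolding H_def by (rule order_trans[OF norm_triangle_ineq]) simp
  also have "\<dots> \<le> ?q * wK * ?q + (real CARD('k) * (?q * wK)) * ?q"
  proof (intro add_mono mult_mono)
    show "norm (Sg i ** W ** Sg i) \<le> ?q * wK * ?q"
      by (intro norm_mult3_le norm_Sg norm_W assms)
    show "\<bar>trace (Sg i ** W)\<bar> \<le> real CARD('k) * (?q * wK)"
      by (rule order_trans[OF abs_trace_le mult_left_mono[OF norm_mult2_le[OF norm_Sg[OF assms] norm_W]]]) simp
  qed (use q wK_nonneg norm_Sg[OF assms] in auto)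
  finally show ?thesis by (simp add: algebra_simps)
qed

lemma order_Hb: "moment_order M 0 (\<lambda>m \<omega>. Hb m)"
proof (rule moment_order_deterministic[OF prob_space_M])
  show "\<forall>\<^sub>F m in sequentially. norm (Hb m) \<le> ((1 + real CARD('k)) * ((norm \<Psi> + dK) * wK * (norm \<Psi> + dK))) * real m powr - 0"
    using eventually_gt_at_top[of 0]
    by eventually_elim (unfold Hb_def, rule order_trans[OF norm_average_le[OF norm_H]], auto)
qed

text \<open>\<open>G3\<close> carries a factor \<open>1/m\<close>, and telescoping replaces the
  estimator by the truth in one factor at a time, each difference having order
  \<open>1/2\<close>.\<close>

lemma order_G3_diff: "moment_order M (3/2) (\<lambda>m \<omega>. G3 D m a (P e m \<omega>) - G3 D m a \<Psi>)"
proof -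
  have 1: "moment_order M (1 + (0 + 1/2 + 0)) (\<lambda>m \<omega>. (1 / real m) *\<^sub>R (D a ** V e a m \<omega> ** Hd e m \<omega> ** V e a m \<omega> ** D a))"
    by (intro moment_order_scaleR2 order_inverse_m order_const_right order_matrix_mult order_const_left order_V order_Hd a)
  have 2: "moment_order M (1 + (1/2 + 0 + 0)) (\<lambda>m \<omega>. (1 / real m) *\<^sub>R (D a ** (V e a m \<omega> - W) ** Hb m ** V e a m \<omega> ** D a))"
    by (intro moment_order_scaleR2 order_inverse_m order_const_right order_matrix_mult order_const_left order_V order_Hb order_V_W a)
  have 3: "moment_order M (1 + (0 + 1/2)) (\<lambda>m \<omega>. (1 / real m) *\<^sub>R (Lf ** Hb m ** (V e a m \<omega> - W) ** D a))"
    by (intro moment_order_scaleR2 order_inverse_m order_const_right order_matrix_mult order_const_left order_Hb order_V_W)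
  have eq: "G3 D m a (P e m \<omega>) - G3 D m a \<Psi> =
      (1 / real m) *\<^sub>R (D a ** V e a m \<omega> ** Hd e m \<omega> ** V e a m \<omega> ** D a)
    + (1 / real m) *\<^sub>R (D a ** (V e a m \<omega> - W) ** Hb m ** V e a m \<omega> ** D a)
    + (1 / real m) *\<^sub>R (Lf ** Hb m ** (V e a m \<omega> - W) ** D a)" for m \<omega>
  proof -
    have "G3 D m a \<Psi> = (1 / real m) *\<^sub>R (D a ** W ** Hb m ** W ** D a)"
      unfolding G3_eq h_Psi by (simp add: Hb_def W_def Sg_def)
    moreover have "G3 D m a (P e m \<omega>) = (1 / real m) *\<^sub>R (D a ** V e a m \<omega> ** (Hd e m \<omega> + Hb m) ** V e a m \<omega> ** D a)"
      unfolding G3_eq Hb_Hd by (simp add: V_def)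
    ultimately show ?thesis
      by (simp add: scaleR_add_right[symmetric] scaleR_diff_right[symmetric] Lf_def matrix_mult_algebra)
  qed
  show ?thesis unfolding eq by (intro moment_order_add) (use 1 2 3 in simp_all)
qed

text \<open>\<open>G3\<close> sums over all areas, \<open>A\<close> over all but \<open>a\<close>;
  the single summand of area \<open>a\<close> is the whole discrepancy.\<close>

lemma G3_Psi:
  assumes "m \<ge> a"
  shows "G3 D m a \<Psi> - Lf ** (\<integral>\<omega>. A m \<omega> ** W ** A m \<omega> \<partial>M) ** Rt = (1 / (real m)\<^sup>2) *\<^sub>R (Lf ** H a ** Rt)"
proof -
  have "G3 D m a \<Psi> = (1 / (real m)\<^sup>2) *\<^sub>R (Lf ** (\<Sum>i\<in>{1..m}. H i) ** Rt)"
    unfolding G3_eq h_Psi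
    by (simp add: Lf_def Rt_def W_def Sg_def matrix_mult_algebra matrix_mul_assoc power2_eq_square)
  also have "(\<Sum>i\<in>{1..m}. H i) = H a + (\<Sum>i\<in>{1..m} - {a}. H i)"
    using a assms by (intro sum.remove) auto
  finally show ?thesis
    unfolding integral_A_W_A(2) by (simp add: matrix_mult_algebra scaleR_add_right)
qed

lemma order_bias_diff: "moment_order M (3/2) (\<lambda>m \<omega>. bias e X D m (P e m \<omega>) - bias e X D m \<Psi>)"
proof (cases e)
  case Est0
  have "moment_order M (1 + 1/2) (\<lambda>m \<omega>. lin m (d e m \<omega>))" by (rule order_lin[OF order_d])
  then show ?thesis using Est0 by (simp add: bias0_diff d_def)
next
  case Est1
  then show ?thesis by (simp add: moment_order_0[OF prob_space_M])
qed

lemma order_bias_Psi: "moment_order M 1 (\<lambda>m \<omega>. bias e X D m \<Psi>)"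
  by (cases e) (simp_all add: order_bias0_Psi moment_order_0[OF prob_space_M])

lemma order_G4_diff: "moment_order M (3/2) (\<lambda>m \<omega>. G4 e X D m a (P e m \<omega>) - G4 e X D m a \<Psi>)"
proof -
  let ?B = "\<lambda>m. bias e X D m \<Psi>" and ?b = "\<lambda>m \<omega>. bias e X D m (P e m \<omega>) - bias e X D m \<Psi>"
  have 1: "moment_order M (0 + 3/2 + 0) (\<lambda>m \<omega>. D a ** V e a m \<omega> ** ?b m \<omega> ** V e a m \<omega> ** D a)"
    by (intro order_const_right order_matrix_mult order_const_left order_V order_bias_diff a)
  have 2: "moment_order M (1/2 + 1 + 0) (\<lambda>m \<omega>. D a ** (V e a m \<omega> - W) ** ?B m ** V e a m \<omega> ** D a)"
    by (intro order_const_right order_matrix_mult order_const_left order_V order_bias_Psi order_V_W a)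
  have 3: "moment_order M (1 + 1/2) (\<lambda>m \<omega>. Lf ** ?B m ** (V e a m \<omega> - W) ** D a)"
    by (intro order_const_right order_matrix_mult order_const_left order_bias_Psi order_V_W)
  have eq: "G4 e X D m a (P e m \<omega>) - G4 e X D m a \<Psi> = - (D a ** V e a m \<omega> ** ?b m \<omega> ** V e a m \<omega> ** D a
     + D a ** (V e a m \<omega> - W) ** ?B m ** V e a m \<omega> ** D a + Lf ** ?B m ** (V e a m \<omega> - W) ** D a)" for m \<omega>
    by (simp add: G4_def V_def[symmetric] Sg_def[symmetric] W_def[symmetric] Lf_def matrix_mult_algebra)
  show ?thesis unfolding eq by (intro moment_order_uminus moment_order_add) (use 1 2 3 in simp_all)
qed

subsection \<open>The first expectation\<close>

definition G134 :: "estimator \<Rightarrow> nat \<Rightarrow> 'w \<Rightarrow> real^'k^'k" where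
  "G134 e m \<omega> = G1 D a (P e m \<omega>) + G3 D m a (P e m \<omega>) + G4 e X D m a (P e m \<omega>)"

definition rem134 :: "estimator \<Rightarrow> nat \<Rightarrow> 'w \<Rightarrow> real^'k^'k" where
  "rem134 e m \<omega> = rem1 e m \<omega> + (G3 D m a (P e m \<omega>) - G3 D m a \<Psi>) + (G4 e X D m a (P e m \<omega>) - G4 e X D m a \<Psi>)"

lemma order_rem134: "moment_order M (3/2) (rem134 e)"
  unfolding rem134_def[abs_def] by (intro moment_order_add order_rem1 order_G3_diff order_G4_diff)

lemma G134_expand: "G134 e m \<omega> = G1 D a \<Psi> + Lf ** d e m \<omega> ** Rt - Lf ** (A m \<omega> ** W ** A m \<omega>) ** Rt
    + G3 D m a \<Psi> + G4 e X D m a \<Psi> + rem134 e m \<omega>"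
  using G1_expand[of e m \<omega>] by (simp add: G134_def rem134_def algebra_simps)

text \<open>In expectation the linear term leaves the bias, which \<open>G4\<close> cancels at the
  truth, and the quadratic term cancels against \<open>G3\<close>. What remains is the error in the
  mean of \<open>d\<close>, the summand of area \<open>a\<close> and the remainder.\<close>

lemma G134_integrable: "\<forall>\<^sub>F m in sequentially. integrable M (G134 e m)"
  and G134_expectation:
    "(\<lambda>m. norm ((\<integral>\<omega>. G134 e m \<omega> \<partial>M) - G1 D a \<Psi>)) \<in> O(\<lambda>m. real m powr (-3/2))"
proof -
  note ev = moment_order_integrable[OF order_d[of e]] moment_order_integrable[OF order_rem134[of e]]
    eventually_ge_at_top[of a]
  have both: "\<forall>\<^sub>F m in sequentially. integrable M (G134 e m) \<and> (\<integral>\<omega>. G134 e m \<omega> \<partial>M) - G1 D a \<Psi>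
     = Lf ** ((\<integral>\<omega>. d e m \<omega> \<partial>M) - bias e X D m \<Psi>) ** Rt + (1 / (real m)\<^sup>2) *\<^sub>R (Lf ** H a ** Rt)
       + (\<integral>\<omega>. rem134 e m \<omega> \<partial>M)"
    using ev
  proof eventually_elim
    case (elim m)
    note s = integral_sandwich[OF elim(1), of Lf Rt] integral_sandwich[OF integral_A_W_A(1), of Lf m Rt]
    have "integrable M (G134 e m)"
      unfolding G134_expand[abs_def] using s elim(2) by simp
    moreover have "(\<integral>\<omega>. G134 e m \<omega> \<partial>M) = G1 D a \<Psi> + Lf ** (\<integral>\<omega>. d e m \<omega> \<partial>M) ** Rt
      - Lf ** (\<integral>\<omega>. A m \<omega> ** W ** A m \<omega> \<partial>M) ** Rt + G3 D m a \<Psi> + G4 e X D m a \<Psi> + (\<integral>\<omega>. rem134 e m \<omega> \<partial>M)"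
      unfolding G134_expand using s elim(2) by (simp add: prob_space)
    moreover have "G4 e X D m a \<Psi> = - (Lf ** bias e X D m \<Psi> ** Rt)"
      by (simp add: G4_def Lf_def Rt_def W_def Sg_def matrix_mul_assoc)
    ultimately show ?case
      using G3_Psi[OF elim(3)] by (simp add: matrix_mult_algebra algebra_simps)
  qed
  then show "\<forall>\<^sub>F m in sequentially. integrable M (G134 e m)" by eventually_elim simp
  have "(\<lambda>m. norm (Lf ** ((\<integral>\<omega>. d e m \<omega> \<partial>M) - bias e X D m \<Psi>) ** Rt + (1 / (real m)\<^sup>2) *\<^sub>R (Lf ** H a ** Rt)
       + (\<integral>\<omega>. rem134 e m \<omega> \<partial>M))) \<in> O(\<lambda>m. real m powr (-3/2))"
    using moment_order_expectation[OF order_rem134[of e]]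
    by (intro O_norm_add O_norm_sandwich d_mean O_norm_inverse_square) simp
  moreover have "\<forall>\<^sub>F m in sequentially. norm ((\<integral>\<omega>. G134 e m \<omega> \<partial>M) - G1 D a \<Psi>)
     = norm (Lf ** ((\<integral>\<omega>. d e m \<omega> \<partial>M) - bias e X D m \<Psi>) ** Rt + (1 / (real m)\<^sup>2) *\<^sub>R (Lf ** H a ** Rt)
       + (\<integral>\<omega>. rem134 e m \<omega> \<partial>M))"
    using both by eventually_elim simp
  ultimately show "(\<lambda>m. norm ((\<integral>\<omega>. G134 e m \<omega> \<partial>M) - G1 D a \<Psi>)) \<in> O(\<lambda>m. real m powr (-3/2))"
    by (rule O_cong_eventually)
qed

subsection \<open>The generalized least squares estimator\<close>

lemma order_m: "moment_order M (-1) (\<lambda>m \<omega>. real m)"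
  by (rule moment_order_deterministic[OF prob_space_M, where C=1]) simp

definition U :: "nat \<Rightarrow> real^'k^'k" where "U i = matrix_inv (Sg i)"

lemma norm_U: "i \<ge> 1 \<Longrightarrow> norm (U i) \<le> wK"
  unfolding U_def by (rule norm_inv_Sg)

text \<open>Two steps of the resolvent identity suffice for generalized least squares, whose error
  is needed only up to order 1.\<close>

lemma V_expand2:
  assumes "i \<ge> 1"
  shows "V e i m \<omega> - U i = - (U i ** d e m \<omega> ** U i) + V e i m \<omega> ** d e m \<omega> ** U i ** d e m \<omega> ** U i"
proof -
  have 1: "V e i m \<omega> = U i - V e i m \<omega> ** d e m \<omega> ** U i"
    using V_diff[OF assms, of e m \<omega>] by (simp add: U_def algebra_simps)
  have 2: "V e i m \<omega> ** F = U i ** F - V e i m \<omega> ** d e m \<omega> ** U i ** F" for F :: "real^'k^'k"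
    by (subst 1) (simp add: matrix_mult_algebra)
  have 3: "V e i m \<omega> - U i = - (V e i m \<omega> ** d e m \<omega> ** U i)"
    using V_diff[OF assms] by (simp add: U_def)
  have 4: "V e i m \<omega> ** d e m \<omega> ** U i = U i ** d e m \<omega> ** U i - V e i m \<omega> ** d e m \<omega> ** U i ** d e m \<omega> ** U i"
    using 2[of "d e m \<omega> ** U i"] by (simp add: matrix_mul_assoc)
  have "F = - x \<Longrightarrow> x = p - r \<Longrightarrow> F = - p + r" for F x p r :: "real^'k^'k" by simp
  from this[OF 3 4] show ?thesis .
qed

definition Iv :: "estimator \<Rightarrow> nat \<Rightarrow> 'w \<Rightarrow> real^'s^'s" where
  "Iv e m \<omega> = matrix_inv (gls_info X D m (P e m \<omega>))"

definition I0 :: "nat \<Rightarrow> real^'s^'s" where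
  "I0 m = matrix_inv (gls_info X D m \<Psi>)"

definition J :: "estimator \<Rightarrow> nat \<Rightarrow> 'w \<Rightarrow> real^'s^'s" where
  "J e m \<omega> = gls_info X D m (P e m \<omega>) - gls_info X D m \<Psi>"

lemma gls_info_measurable:
  assumes "F \<in> borel_measurable N"
  shows "(\<lambda>\<omega>. gls_info X D m (F \<omega>)) \<in> borel_measurable N"
proof -
  note [measurable] = assms
  show ?thesis unfolding gls_info_def by measurable
qed

lemma iK_nonneg: "0 \<le> iK" using dl cG by (simp add: iK_def)

lemma order_Iv: "moment_order M 1 (Iv e)"
proof (rule moment_order_dominated)
  have "moment_order M (1 + 0 + 0) (\<lambda>m \<omega>. 1 / real m * NN e m \<omega> * NN e m \<omega>)"
    by (intro moment_order_mult order_NN order_inverse_m)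
  then show "moment_order M 1 (\<lambda>m \<omega>. 1 / real m * NN e m \<omega> * NN e m \<omega>)" by simp
  show "\<forall>\<^sub>F m in sequentially. Iv e m \<in> borel_measurable M"
    using P_measurable[of e]
  proof eventually_elim
    case (elim m)
    note [measurable] = gls_info_measurable[OF elim]
    show ?case unfolding Iv_def by measurable
  qed
  show "\<forall>\<^sub>F m in sequentially. \<forall>\<omega>. norm (Iv e m \<omega>) \<le> iK * norm (1 / real m * NN e m \<omega> * NN e m \<omega>)"
    using gls_info_inverse
  proof eventually_elim
    case (elim m)
    show ?case
    proof
      fix \<omega>
      have "norm (Iv e m \<omega>) \<le> iK * (norm (P e m \<omega>) + dK + 1)\<^sup>2 / real m"
        using elim P_psd by (auto simp: Iv_def)
      also have "\<dots> \<le> iK * (NN e m \<omega>)\<^sup>2 / real m"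
        using NN_ge(4)[of e m \<omega>] dK_nonneg iK_nonneg
        by (intro divide_right_mono mult_left_mono power_mono) auto
      finally show "norm (Iv e m \<omega>) \<le> iK * norm (1 / real m * NN e m \<omega> * NN e m \<omega>)"
        using NN_ge(3)[of e m \<omega>] by (simp add: power2_eq_square)
    qed
  qed
qed

lemma order_I0: "moment_order M 1 (\<lambda>m \<omega>. I0 m)"
proof (rule moment_order_deterministic[OF prob_space_M])
  show "\<forall>\<^sub>F m in sequentially. norm (I0 m) \<le> iK * (norm \<Psi> + dK + 1)\<^sup>2 * real m powr - 1"
    using gls_info_inverse eventually_gt_at_top[of 0]
    by eventually_elim (use Psi_psd in \<open>simp add: I0_def powr_minus1\<close>)
qed

lemma norm_congruence_le:
  fixes F :: "real^'k^'k"
  assumes "norm F \<le> c"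
  shows "norm (transpose (X i) ** F ** X i) \<le> (norm (X i))\<^sup>2 * c"
proof -
  have "norm (transpose (X i) ** F ** X i) \<le> norm (transpose (X i) ** F) * norm (X i)"
    by (rule norm_matrix_mult_le)
  also have "\<dots> \<le> (norm (X i) * norm F) * norm (X i)"
    using norm_matrix_mult_le[of "transpose (X i)" F] by (intro mult_right_mono) (auto simp: norm_transpose)
  also have "\<dots> \<le> (norm (X i) * c) * norm (X i)"
    using assms by (intro mult_right_mono mult_left_mono) auto
  finally show ?thesis by (simp add: power2_eq_square mult_ac)
qed

lemma order_J: "moment_order M (-1/2) (J e)"
proof (rule moment_order_dominated)
  have "moment_order M (-1 + 1/2) (\<lambda>m \<omega>. real m * norm (d e m \<omega>))"
    by (intro moment_order_mult order_m moment_order_norm order_d)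
  then show "moment_order M (-1/2) (\<lambda>m \<omega>. real m * norm (d e m \<omega>))" by simp
  show "\<forall>\<^sub>F m in sequentially. J e m \<in> borel_measurable M"
    using P_measurable[of e]
  proof eventually_elim
    case (elim m)
    note [measurable] = gls_info_measurable[OF elim]
    show ?case unfolding J_def by measurable
  qed
  show "\<forall>\<^sub>F m in sequentially. \<forall>\<omega>. norm (J e m \<omega>) \<le> (KG * (wK * wK)) * norm (real m * norm (d e m \<omega>))"
    using sum_norm_X_sq
  proof eventually_elim
    case (elim m)
    show ?case
    proof
      fix \<omega>
      have "J e m \<omega> = (\<Sum>i\<in>{1..m}. transpose (X i) ** (V e i m \<omega> - matrix_inv (Sg i)) ** X i)"
        by (simp add: J_def gls_info_def V_def Sg_def matrix_mult_algebra sum_subtractf)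
      also have "norm \<dots> \<le> (\<Sum>i\<in>{1..m}. (norm (X i))\<^sup>2 * (wK * norm (d e m \<omega>) * wK))"
        by (rule sum_norm_le, rule norm_congruence_le, rule norm_V_diff) simp
      also have "\<dots> \<le> KG * real m * (wK * norm (d e m \<omega>) * wK)"
        unfolding sum_distrib_right[symmetric] using elim wK_nonneg by (intro mult_right_mono) auto
      finally show "norm (J e m \<omega>) \<le> (KG * (wK * wK)) * norm (real m * norm (d e m \<omega>))"
        by (simp add: mult_ac)
    qed
  qed
qed

text \<open>By the resolvent identity the orders 1, \<open>-1/2\<close> and 1 of the three factors
  add up to \<open>3/2\<close>.\<close>

lemma order_Iv_diff: "moment_order M (3/2) (\<lambda>m \<omega>. Iv e m \<omega> - I0 m)"
proof (rule moment_order_cong)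
  have "moment_order M (1 + (-1/2) + 1) (\<lambda>m \<omega>. - (Iv e m \<omega> ** J e m \<omega> ** I0 m))"
    by (intro moment_order_uminus order_matrix_mult order_Iv order_J order_I0)
  then show "moment_order M (3/2) (\<lambda>m \<omega>. - (Iv e m \<omega> ** J e m \<omega> ** I0 m))" by simp
  show "\<forall>\<^sub>F m in sequentially. \<forall>\<omega>. Iv e m \<omega> - I0 m = - (Iv e m \<omega> ** J e m \<omega> ** I0 m)"
    using gls_info_inverse
  proof eventually_elim
    case (elim m)
    then show ?case using P_psd Psi_psd by (simp add: Iv_def I0_def J_def matrix_inv_diff)
  qed
qed

definition G2P :: "estimator \<Rightarrow> nat \<Rightarrow> 'w \<Rightarrow> real^'k^'k" where
  "G2P e m \<omega> = G2 X D m a (P e m \<omega>)"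

text \<open>\<open>G2\<close> has order 1 already, so exchanging the estimator for the truth in any
  one factor gains the missing half order.\<close>

lemma order_G2_diff: "moment_order M (3/2) (\<lambda>m \<omega>. G2P e m \<omega> - G2 X D m a \<Psi>)"
proof -
  have 1: "moment_order M (1/2 + 1 + 0) (\<lambda>m \<omega>. D a ** (V e a m \<omega> - W) ** X a ** Iv e m \<omega> ** transpose (X a) ** V e a m \<omega> ** D a)"
    by (intro order_const_right order_matrix_mult order_const_left order_V order_V_W order_Iv a)
  have 2: "moment_order M (3/2 + 0) (\<lambda>m \<omega>. Lf ** X a ** (Iv e m \<omega> - I0 m) ** transpose (X a) ** V e a m \<omega> ** D a)"
    by (intro order_const_right order_matrix_mult order_const_left order_V order_Iv_diff a)
  have 3: "moment_order M (1 + 1/2) (\<lambda>m \<omega>. Lf ** X a ** I0 m ** transpose (X a) ** (V e a m \<omega> - W) ** D a)"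
    by (intro order_const_right order_matrix_mult order_const_left order_V_W order_I0)
  have eq: "G2P e m \<omega> - G2 X D m a \<Psi> =
      D a ** (V e a m \<omega> - W) ** X a ** Iv e m \<omega> ** transpose (X a) ** V e a m \<omega> ** D a
    + Lf ** X a ** (Iv e m \<omega> - I0 m) ** transpose (X a) ** V e a m \<omega> ** D a
    + Lf ** X a ** I0 m ** transpose (X a) ** (V e a m \<omega> - W) ** D a" for m \<omega>
    by (simp add: G2P_def G2_def V_def[symmetric] Sg_def[symmetric] W_def[symmetric] Lf_def
        Iv_def[symmetric] I0_def[symmetric] matrix_mult_algebra)
  show ?thesis unfolding eq by (intro moment_order_add) (use 1 2 3 in simp_all)
qed

lemma G2_Psi: "G2 X D m a \<Psi> = Lf ** X a ** I0 m ** transpose (X a) ** Rt"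
  by (simp add: G2_def Lf_def Rt_def W_def Sg_def I0_def matrix_mul_assoc)

section \<open>The weighted score at the estimated covariance\<close>

definition S0 :: "nat \<Rightarrow> 'w \<Rightarrow> real^'s" where
  "S0 m \<omega> = (\<Sum>i\<in>{1..m}. (transpose (X i) ** U i) *v u i \<omega>)"

definition SP :: "estimator \<Rightarrow> nat \<Rightarrow> 'w \<Rightarrow> real^'s" where
  "SP e m \<omega> = (\<Sum>i\<in>{1..m}. (transpose (X i) ** V e i m \<omega>) *v u i \<omega>)"

text \<open>The argument \<open>F\<close> stands for \<open>d\<close>. It is kept separate so that
  fixed matrices can be inserted, for which the weights are deterministic.\<close>

definition S1 :: "nat \<Rightarrow> 'w \<Rightarrow> real^'k^'k \<Rightarrow> real^'s" where
  "S1 m \<omega> F = (\<Sum>i\<in>{1..m}. (transpose (X i) ** U i ** F ** U i) *v u i \<omega>)"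

definition S2 :: "estimator \<Rightarrow> nat \<Rightarrow> 'w \<Rightarrow> real^'s" where
  "S2 e m \<omega> = (\<Sum>i\<in>{1..m}. (transpose (X i) ** (V e i m \<omega> ** d e m \<omega> ** U i ** d e m \<omega> ** U i)) *v u i \<omega>)"

text \<open>The weights \<open>V e i m\<close> depend on the errors of all areas, so the moment
  bounds for independent summands do not apply to \<open>SP\<close> itself. The expansion isolates a
  part linear in \<open>d\<close> and a part quadratic in \<open>d\<close>.\<close>

lemma SP_split: "SP e m \<omega> - S0 m \<omega> = S2 e m \<omega> - S1 m \<omega> (d e m \<omega>)"
  unfolding SP_def S0_def S1_def S2_def sum_subtractf[symmetric]
proof (intro sum.cong refl)
  fix i assume "i \<in> {1..m}"
  then have "i \<ge> 1" by simp
  from V_expand2[OF this, of e m \<omega>]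
  have "transpose (X i) ** (V e i m \<omega> - U i) = transpose (X i) **
    (- (U i ** d e m \<omega> ** U i) + V e i m \<omega> ** d e m \<omega> ** U i ** d e m \<omega> ** U i)" by simp
  then have "transpose (X i) ** V e i m \<omega> - transpose (X i) ** U i
     = transpose (X i) ** (V e i m \<omega> ** d e m \<omega> ** U i ** d e m \<omega> ** U i) - transpose (X i) ** U i ** d e m \<omega> ** U i"
    by (simp add: matrix_mult_algebra matrix_mul_assoc)
  then show "(transpose (X i) ** V e i m \<omega>) *v u i \<omega> - (transpose (X i) ** U i) *v u i \<omega>
    = (transpose (X i) ** (V e i m \<omega> ** d e m \<omega> ** U i ** d e m \<omega> ** U i)) *v u i \<omega>
      - (transpose (X i) ** U i ** d e m \<omega> ** U i) *v u i \<omega>"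
    by (simp only: matrix_vector_mult_diff_rdistrib[symmetric])
qed

lemma order_linear_form_X:
  fixes B :: "nat \<Rightarrow> real^'k^'s"
  assumes "c \<ge> 0" "\<And>i. i \<ge> 1 \<Longrightarrow> norm (B i) \<le> c * norm (X i)"
  shows "moment_order M (-1/2) (\<lambda>m \<omega>. \<Sum>i\<in>{1..m}. B i *v u i \<omega>)"
proof (rule order_linear_form)
  have "\<forall>\<^sub>F m in sequentially. \<forall>i\<in>{1..m}. norm (B i) \<le> c * real m powr 0 * norm (X i)"
    using eventually_gt_at_top[of 0] by eventually_elim (use assms(2) in auto)
  from sum_weighted_X_sq[OF assms(1) this, of "-1/2"]
  show "\<forall>\<^sub>F m in sequentially. (\<Sum>i\<in>{1..m}. (norm (B i))\<^sup>2) \<le> (c\<^sup>2 * KG) * (real m powr - (-1/2))\<^sup>2"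
    by simp
qed auto

lemma norm_XU: "i \<ge> 1 \<Longrightarrow> norm (transpose (X i) ** U i) \<le> wK * norm (X i)"
  using norm_matrix_mult_le[of "transpose (X i)" "U i"] mult_left_mono[OF norm_U[of i] norm_ge_zero[of "X i"]]
  by (simp add: norm_transpose mult.commute)

lemma order_S0: "moment_order M (-1/2) S0"
  unfolding S0_def[abs_def]
  by (rule order_linear_form_X[OF wK_nonneg norm_XU])

lemma linear_S1: "linear (S1 m \<omega>)"
  unfolding S1_def[abs_def]
  by (rule linearI)
     (simp_all add: matrix_mult_algebra matrix_vector_mult_add_rdistrib sum.distrib scaleR_sum_right
       scaleR_matrix_vector_assoc[symmetric])

text \<open>Expanding \<open>d\<close> in matrix units moves its entries out of the sum. The
  remaining linear forms have fixed weights and order \<open>-1/2\<close>, which the order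
  \<open>1/2\<close> of \<open>d\<close> compensates; bounding summand by summand would lose half an
  order.\<close>

lemma order_S1_d: "moment_order M 0 (\<lambda>m \<omega>. S1 m \<omega> (d e m \<omega>))"
proof -
  let ?E = "\<lambda>b c. outer (axis b 1) (axis c 1) :: real^'k^'k"
  have 1: "moment_order M (-1/2) (\<lambda>m \<omega>. S1 m \<omega> (?E b c))" for b c
    unfolding S1_def
  proof (rule order_linear_form_X[of "wK * wK"])
    fix i :: nat assume i: "i \<ge> 1"
    have "norm (?E b c) = 1" by (simp add: norm_outer norm_axis_1)
    then have "norm (transpose (X i) ** U i ** ?E b c) \<le> wK * norm (X i)"
      using norm_matrix_mult_le[of "transpose (X i) ** U i" "?E b c"] norm_XU[OF i] by simp
    then have "norm (transpose (X i) ** U i ** ?E b c) * norm (U i) \<le> (wK * norm (X i)) * wK"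
      using norm_U[OF i] wK_nonneg by (intro mult_mono) auto
    then show "norm (transpose (X i) ** U i ** ?E b c ** U i) \<le> wK * wK * norm (X i)"
      using norm_matrix_mult_le[of "transpose (X i) ** U i ** ?E b c" "U i"] by (simp add: mult_ac)
  qed (simp add: wK_nonneg)
  have "moment_order M (1/2 + -1/2) (\<lambda>m \<omega>. \<Sum>b\<in>UNIV. \<Sum>c\<in>UNIV. d e m \<omega> $ b $ c *\<^sub>R S1 m \<omega> (?E b c))"
    by (intro moment_order_sum[OF prob_space_M] moment_order_scaleR2
        moment_order_linear[OF bounded_linear_matrix_entry order_d] 1)
  moreover have "S1 m \<omega> F = (\<Sum>b\<in>UNIV. \<Sum>c\<in>UNIV. F $ b $ c *\<^sub>R S1 m \<omega> (?E b c))" for m \<omega> F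
    by (subst matrix_unit_expansion[of F])
       (simp only: linear_sum[OF linear_S1] linear_scale[OF linear_S1])
  then have "(\<lambda>m \<omega>. S1 m \<omega> (d e m \<omega>))
      = (\<lambda>m \<omega>. \<Sum>b\<in>UNIV. \<Sum>c\<in>UNIV. d e m \<omega> $ b $ c *\<^sub>R S1 m \<omega> (?E b c))"
    by (intro ext)
  ultimately show ?thesis by simp
qed

definition q :: "nat \<Rightarrow> 'w \<Rightarrow> real" where
  "q m \<omega> = 1 / real m * (\<Sum>i\<in>{1..m}. (norm (u i \<omega>))\<^sup>2)"

text \<open>The squared norm of \<open>u i\<close> is the trace of \<open>Z i + Sg i\<close>, so up
  to the summand of area \<open>a\<close> the centered part is the trace of
  \<open>A\<close>.\<close>

lemma order_q: "moment_order M 0 q"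
proof (rule moment_order_cong)
  have 1: "moment_order M 0 (\<lambda>m \<omega>. trace (A m \<omega>))"
    by (rule moment_order_linear[OF bounded_linear_trace moment_order_weaken[OF order_A]]) simp
  have 2: "moment_order M 0 (\<lambda>m \<omega>. 1 / real m * trace (Z a \<omega>))"
    by (rule moment_order_weaken[OF moment_order_mult[OF order_inverse_m moment_order_linear[OF bounded_linear_trace order_Z[OF a]]]]) simp
  have 3: "moment_order M 0 (\<lambda>m \<omega>. (1 / real m) *\<^sub>R (\<Sum>i\<in>{1..m}. trace (Sg i)))"
  proof (rule moment_order_deterministic[OF prob_space_M])
    show "\<forall>\<^sub>F m in sequentially. norm ((1 / real m) *\<^sub>R (\<Sum>i\<in>{1..m}. trace (Sg i)))
        \<le> (real CARD('k) * (norm \<Psi> + dK)) * real m powr - 0"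
      using eventually_gt_at_top[of 0]
    proof eventually_elim
      case (elim m)
      have "norm ((1 / real m) *\<^sub>R (\<Sum>i\<in>{1..m}. trace (Sg i))) \<le> real CARD('k) * (norm \<Psi> + dK)"
      proof (rule norm_average_le[OF _ elim])
        fix i :: nat assume "i \<ge> 1"
        then show "norm (trace (Sg i)) \<le> real CARD('k) * (norm \<Psi> + dK)"
          unfolding real_norm_def by (intro order_trans[OF abs_trace_le mult_left_mono[OF norm_Sg]]) auto
      qed
      then show ?case using elim by simp
    qed
  qed
  show "moment_order M 0 (\<lambda>m \<omega>. trace (A m \<omega>) + 1 / real m * trace (Z a \<omega>) + (1 / real m) *\<^sub>R (\<Sum>i\<in>{1..m}. trace (Sg i)))"
    by (intro moment_order_add 1 2 3)
  show "\<forall>\<^sub>F m in sequentially. \<forall>\<omega>. q m \<omega> = trace (A m \<omega>) + 1 / real m * trace (Z a \<omega>) + (1 / real m) *\<^sub>R (\<Sum>i\<in>{1..m}. trace (Sg i))"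
    using eventually_ge_at_top[of a]
  proof eventually_elim
    case (elim m)
    show ?case
    proof
      fix \<omega>
      have tr: "(norm (u i \<omega>))\<^sup>2 = trace (Z i \<omega>) + trace (Sg i)" for i
        by (simp add: trace_def Z_entry sum_subtractf power2_norm_eq_inner inner_vec_def)
      have "q m \<omega> = 1 / real m * ((\<Sum>i\<in>{1..m}. trace (Z i \<omega>)) + (\<Sum>i\<in>{1..m}. trace (Sg i)))"
        unfolding q_def tr by (simp add: sum.distrib)
      also have "(\<Sum>i\<in>{1..m}. trace (Z i \<omega>)) = trace (Z a \<omega>) + (\<Sum>i\<in>{1..m} - {a}. trace (Z i \<omega>))"
        using a elim by (intro sum.remove) auto
      also have "(\<Sum>i\<in>{1..m} - {a}. trace (Z i \<omega>)) = trace (\<Sum>i\<in>{1..m} - {a}. Z i \<omega>)"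
        by (simp add: linear_sum[OF bounded_linear.linear[OF bounded_linear_trace]])
      finally show "q m \<omega> = trace (A m \<omega>) + 1 / real m * trace (Z a \<omega>) + (1 / real m) *\<^sub>R (\<Sum>i\<in>{1..m}. trace (Sg i))"
        by (simp add: A_def linear_scale[OF bounded_linear.linear[OF bounded_linear_trace]] distrib_left algebra_simps)
    qed
  qed
qed

text \<open>No cancellation between areas is used: two factors \<open>d\<close> compensate the
  \<open>m\<close> summands. The design controls the \<open>X i\<close> through their squares, hence
  \<open>norm (X i) * norm (u i)\<close> is split into squares.\<close>

lemma order_S2: "moment_order M 0 (S2 e)"
proof (rule moment_order_dominated)
  have "moment_order M (-1 + (1/2 + 1/2) + 0) (\<lambda>m \<omega>. real m * (norm (d e m \<omega>) * norm (d e m \<omega>)) * (\<bar>KG\<bar> + q m \<omega>))"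
    by (intro moment_order_mult order_m moment_order_norm order_d moment_order_add order_const order_q)
  then show "moment_order M 0 (\<lambda>m \<omega>. real m * (norm (d e m \<omega>) * norm (d e m \<omega>)) * (\<bar>KG\<bar> + q m \<omega>))" by simp
  show "\<forall>\<^sub>F m in sequentially. S2 e m \<in> borel_measurable M"
    using V_measurable[of e] d_measurable[of e]
  proof eventually_elim
    case (elim m)
    note [measurable] = elim(1)[rule_format] elim(2)
    show ?case unfolding S2_def
      by (intro borel_measurable_sum borel_measurable_matrix_vector borel_measurable_matrix_mult
          borel_measurable_const elim(2) elim(1)[rule_format] u_measurable) simp
  qed
  show "\<forall>\<^sub>F m in sequentially. \<forall>\<omega>. norm (S2 e m \<omega>)
      \<le> wK ^ 3 * norm (real m * (norm (d e m \<omega>) * norm (d e m \<omega>)) * (\<bar>KG\<bar> + q m \<omega>))"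
    using sum_norm_X_sq eventually_gt_at_top[of 0]
  proof eventually_elim
    case (elim m)
    show ?case
    proof
      fix \<omega>
      let ?n = "norm (d e m \<omega>)"
      have "norm (S2 e m \<omega>) \<le> (\<Sum>i\<in>{1..m}. (wK ^ 3 * ?n * ?n) * ((norm (X i))\<^sup>2 + (norm (u i \<omega>))\<^sup>2))"
        unfolding S2_def
      proof (rule sum_norm_le)
        fix i assume "i \<in> {1..m}"
        then have i: "i \<ge> 1" by simp
        let ?C = "V e i m \<omega> ** d e m \<omega> ** U i ** d e m \<omega> ** U i"
        have C: "norm ?C \<le> wK * ?n * wK * ?n * wK"
          by (intro norm_mult3_le norm_mult2_le order_refl norm_V norm_U i)
        have "norm ((transpose (X i) ** ?C) *v u i \<omega>) \<le> norm (transpose (X i) ** ?C) * norm (u i \<omega>)"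
          by (rule norm_matrix_vector_mult_le)
        also have "\<dots> \<le> (norm (X i) * norm ?C) * norm (u i \<omega>)"
          using norm_matrix_mult_le[of "transpose (X i)" ?C] by (intro mult_right_mono) (auto simp: norm_transpose)
        also have "\<dots> \<le> (norm (X i) * (wK * ?n * wK * ?n * wK)) * norm (u i \<omega>)"
          using C by (intro mult_right_mono mult_left_mono) auto
        also have "\<dots> = (wK ^ 3 * ?n * ?n) * (norm (X i) * norm (u i \<omega>))"
          by (simp add: power3_eq_cube mult_ac)
        also have "\<dots> \<le> (wK ^ 3 * ?n * ?n) * ((norm (X i))\<^sup>2 + (norm (u i \<omega>))\<^sup>2)"
        proof (intro mult_left_mono)
          have "0 \<le> (norm (X i) - norm (u i \<omega>))\<^sup>2 + (norm (X i))\<^sup>2 + (norm (u i \<omega>))\<^sup>2" by simp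
          then show "norm (X i) * norm (u i \<omega>) \<le> (norm (X i))\<^sup>2 + (norm (u i \<omega>))\<^sup>2"
            unfolding power2_diff by simp
        qed (use wK_nonneg in simp)
        finally show "norm ((transpose (X i) ** ?C) *v u i \<omega>) \<le> (wK ^ 3 * ?n * ?n) * ((norm (X i))\<^sup>2 + (norm (u i \<omega>))\<^sup>2)" .
      qed
      also have "\<dots> = (wK ^ 3 * ?n * ?n) * ((\<Sum>i\<in>{1..m}. (norm (X i))\<^sup>2) + real m * q m \<omega>)"
        using elim(2) by (simp add: sum_distrib_left[symmetric] sum.distrib q_def)
      also have "\<dots> \<le> (wK ^ 3 * ?n * ?n) * (\<bar>KG\<bar> * real m + real m * q m \<omega>)"
      proof (intro mult_left_mono add_right_mono)
        have "KG * real m \<le> \<bar>KG\<bar> * real m" by (intro mult_right_mono) auto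
        with elim(1) show "(\<Sum>i\<in>{1..m}. (norm (X i))\<^sup>2) \<le> \<bar>KG\<bar> * real m" by linarith
      qed (use wK_nonneg in simp)
      also have "\<dots> = wK ^ 3 * (real m * (?n * ?n) * (\<bar>KG\<bar> + q m \<omega>))" by (simp add: algebra_simps)
      also have "\<dots> \<le> wK ^ 3 * norm (real m * (?n * ?n) * (\<bar>KG\<bar> + q m \<omega>))"
        using wK_nonneg by (intro mult_left_mono) auto
      finally show "norm (S2 e m \<omega>) \<le> wK ^ 3 * norm (real m * (?n * ?n) * (\<bar>KG\<bar> + q m \<omega>))" .
    qed
  qed
qed

section \<open>Errors of the generalized least squares coefficients\<close>

definition eta0 :: "nat \<Rightarrow> 'w \<Rightarrow> real^'s" where "eta0 m \<omega> = I0 m *v S0 m \<omega>"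
definition etaP :: "estimator \<Rightarrow> nat \<Rightarrow> 'w \<Rightarrow> real^'s" where "etaP e m \<omega> = Iv e m \<omega> *v SP e m \<omega>"

lemma order_eta0: "moment_order M (1/2) eta0"
  using moment_order_matrix_vector[OF order_I0 order_S0] by (simp add: eta0_def[abs_def])

text \<open>Order 1 rests on the cancellation found for \<open>S1\<close>: the change in the score
  has order 0, and the inverse information contributes 1. The change in the information meets the
  score at the truth with orders \<open>3/2\<close> and \<open>-1/2\<close>.\<close>

lemma order_eta_diff: "moment_order M 1 (\<lambda>m \<omega>. etaP e m \<omega> - eta0 m \<omega>)"
proof -
  have 0: "moment_order M 0 (\<lambda>m \<omega>. S2 e m \<omega> - S1 m \<omega> (d e m \<omega>))"
    by (intro moment_order_diff order_S2 order_S1_d)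
  have 1: "moment_order M (1 + 0) (\<lambda>m \<omega>. Iv e m \<omega> *v (S2 e m \<omega> - S1 m \<omega> (d e m \<omega>)))"
    by (intro moment_order_matrix_vector order_Iv 0)
  have 2: "moment_order M (3/2 + -1/2) (\<lambda>m \<omega>. (Iv e m \<omega> - I0 m) *v S0 m \<omega>)"
    by (intro moment_order_matrix_vector order_Iv_diff order_S0)
  have eq: "etaP e m \<omega> - eta0 m \<omega> = Iv e m \<omega> *v (S2 e m \<omega> - S1 m \<omega> (d e m \<omega>)) + (Iv e m \<omega> - I0 m) *v S0 m \<omega>" for m \<omega>
    unfolding SP_split[symmetric]
    by (simp add: etaP_def eta0_def matrix_vector_mult_diff_distrib matrix_vector_mult_diff_rdistrib)
  show ?thesis unfolding eq by (intro moment_order_add) (use 1 2 in simp_all)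
qed

lemma order_etaP: "moment_order M (1/2) (etaP e)"
proof -
  have "moment_order M (1/2) (\<lambda>m \<omega>. (etaP e m \<omega> - eta0 m \<omega>) + eta0 m \<omega>)"
    by (intro moment_order_add order_eta0 moment_order_weaken[OF order_eta_diff]) simp
  then show ?thesis by simp
qed

text \<open>Whatever \<open>P\<close> is, the part of the data coming from \<open>\<beta>\<close> is
  reproduced exactly, and only the errors remain.\<close>

lemma gls_eq: "\<forall>\<^sub>F m in sequentially. \<forall>\<omega>. gls X D m (P e m \<omega>) (Y \<omega>) = \<beta> + etaP e m \<omega>"
  using gls_info_inverse
proof eventually_elim
  case (elim m)
  show ?case
  proof
    fix \<omega>
    have "invertible (gls_info X D m (P e m \<omega>))" using elim P_psd by blast
    then have I: "Iv e m \<omega> ** gls_info X D m (P e m \<omega>) = mat 1"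
      unfolding Iv_def by (rule matrix_inv_left)
    have "(\<Sum>i\<in>{1..m}. transpose (X i) *v (V e i m \<omega> *v y i \<omega>))
        = gls_info X D m (P e m \<omega>) *v \<beta> + SP e m \<omega>"
      unfolding gls_info_def SP_def bounded_bilinear.sum_left[OF bounded_bilinear_matrix_vector_mult] sum.distrib[symmetric]
      by (intro sum.cong refl)
         (simp add: y_eq_u V_def matrix_vector_right_distrib matrix_vector_mul_assoc matrix_mul_assoc del: transpose_matrix_vector)
    then have "gls X D m (P e m \<omega>) (Y \<omega>) = Iv e m \<omega> *v (gls_info X D m (P e m \<omega>) *v \<beta> + SP e m \<omega>)"
      by (simp add: gls_def V_def Iv_def del: transpose_matrix_vector)
    also have "\<dots> = \<beta> + etaP e m \<omega>"
      by (simp add: matrix_vector_right_distrib matrix_vector_mul_assoc I etaP_def)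
    finally show "gls X D m (P e m \<omega>) (Y \<omega>) = \<beta> + etaP e m \<omega>" .
  qed
qed

subsection \<open>Decomposition of the prediction error\<close>

definition err :: "'w \<Rightarrow> real^'k" where "err \<omega> = \<epsilon> a \<omega> - Lf *v u a \<omega>"

definition b :: "estimator \<Rightarrow> nat \<Rightarrow> 'w \<Rightarrow> real^'k" where
  "b e m \<omega> = (D a ** (V e a m \<omega> ** d e m \<omega> ** W)) *v u a \<omega> + (D a ** V e a m \<omega> ** X a) *v etaP e m \<omega>"

text \<open>An exact identity: \<open>D a ** V e a m\<close> is \<open>Lf\<close> minus a term with
  a factor \<open>d\<close>. The first part belongs to \<open>err\<close>, the second and the least
  squares error form \<open>b\<close>.\<close>

lemma prediction_error:
  "\<forall>\<^sub>F m in sequentially. \<forall>\<omega>. theta_EB e X D m a (Y \<omega>) - (X a *v \<beta> + v a \<omega>) = err \<omega> + b e m \<omega>"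
  using gls_eq[of e] Psi_hat_plus_eq[of e]
proof eventually_elim
  case (elim m)
  show ?case
  proof
    fix \<omega>
    let ?V = "V e a m \<omega>"
    have "theta_EB e X D m a (Y \<omega>) = y a \<omega> - D a *v (?V *v (y a \<omega> - X a *v (\<beta> + etaP e m \<omega>)))"
      using elim by (simp add: theta_EB_def theta_hat_def V_def)
    also have "y a \<omega> - X a *v (\<beta> + etaP e m \<omega>) = u a \<omega> - X a *v etaP e m \<omega>"
      using a by (simp add: y_eq_u matrix_vector_right_distrib)
    finally have 1: "theta_EB e X D m a (Y \<omega>) - (X a *v \<beta> + v a \<omega>)
       = \<epsilon> a \<omega> - (D a ** ?V) *v u a \<omega> + (D a ** ?V ** X a) *v etaP e m \<omega>"
      using a by (simp add: y_eq_u u_def matrix_vector_mult_diff_distrib matrix_vector_right_distrib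
          matrix_vector_mul_assoc matrix_mul_assoc)
    have "D a ** ?V = Lf - D a ** (?V ** d e m \<omega> ** W)"
    proof -
      have "?V = W - ?V ** d e m \<omega> ** W"
        using V_diff_W[of e m \<omega>] by (simp add: algebra_simps)
      then have "D a ** ?V = D a ** (W - ?V ** d e m \<omega> ** W)" by (rule arg_cong)
      then show ?thesis by (simp add: Lf_def matrix_mult_algebra)
    qed
    then have 2: "(D a ** ?V) *v u a \<omega> = Lf *v u a \<omega> - (D a ** (?V ** d e m \<omega> ** W)) *v u a \<omega>"
      by (simp add: matrix_vector_mult_diff_rdistrib)
    show "theta_EB e X D m a (Y \<omega>) - (X a *v \<beta> + v a \<omega>) = err \<omega> + b e m \<omega>"
      unfolding 1 2 by (simp add: err_def b_def)
  qed
qed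

definition b1 :: "nat \<Rightarrow> 'w \<Rightarrow> real^'k" where "b1 m \<omega> = (Lf ** A m \<omega> ** W) *v u a \<omega>"
definition b2 :: "nat \<Rightarrow> 'w \<Rightarrow> real^'k" where "b2 m \<omega> = (Lf ** X a) *v eta0 m \<omega>"

lemma order_b1: "moment_order M (1/2) b1"
proof -
  have "moment_order M (1/2 + 0) (\<lambda>m \<omega>. (Lf ** A m \<omega> ** W) *v u a \<omega>)"
    by (intro moment_order_matrix_vector order_const_right order_const_left order_A order_u a)
  then show ?thesis by (simp add: b1_def[abs_def])
qed

lemma order_b2: "moment_order M (1/2) b2"
  unfolding b2_def[abs_def] by (intro order_const_left_vec order_eta0)

text \<open>Telescoping over \<open>V\<close>, \<open>d\<close> and \<open>etaP\<close>; each
  replacement by \<open>W\<close>, \<open>A\<close> or \<open>eta0\<close> gains half an order over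
  the order \<open>1/2\<close> of \<open>b\<close>.\<close>

lemma order_b_diff: "moment_order M 1 (\<lambda>m \<omega>. b e m \<omega> - (b1 m \<omega> + b2 m \<omega>))"
proof -
  have 1: "moment_order M (1/2 + 1/2 + 0) (\<lambda>m \<omega>. (D a ** ((V e a m \<omega> - W) ** d e m \<omega> ** W)) *v u a \<omega>)"
    by (intro moment_order_matrix_vector order_const_left order_const_right order_matrix_mult order_V_W order_d order_u a)
  have 2: "moment_order M (1 + 0) (\<lambda>m \<omega>. (Lf ** (d e m \<omega> - A m \<omega>) ** W) *v u a \<omega>)"
    by (intro moment_order_matrix_vector order_const_left order_const_right order_d_A order_u a)
  have 3: "moment_order M (1/2 + 1/2) (\<lambda>m \<omega>. (D a ** (V e a m \<omega> - W) ** X a) *v etaP e m \<omega>)"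
    by (intro moment_order_matrix_vector order_const_left order_const_right order_V_W order_etaP)
  have 4: "moment_order M 1 (\<lambda>m \<omega>. (Lf ** X a) *v (etaP e m \<omega> - eta0 m \<omega>))"
    by (intro order_const_left_vec order_eta_diff)
  have eq: "b e m \<omega> - (b1 m \<omega> + b2 m \<omega>) = (D a ** ((V e a m \<omega> - W) ** d e m \<omega> ** W)) *v u a \<omega>
     + (Lf ** (d e m \<omega> - A m \<omega>) ** W) *v u a \<omega>
     + (D a ** (V e a m \<omega> - W) ** X a) *v etaP e m \<omega> + (Lf ** X a) *v (etaP e m \<omega> - eta0 m \<omega>)" for m \<omega>
    by (simp add: b_def b1_def b2_def Lf_def matrix_mult_algebra matrix_vector_mult_diff_distrib
        matrix_vector_mult_diff_rdistrib matrix_mul_assoc)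
  show ?thesis unfolding eq by (intro moment_order_add) (use 1 2 3 4 in simp_all)
qed

lemma order_b: "moment_order M (1/2) (b e)"
proof -
  have "moment_order M (1/2) (\<lambda>m \<omega>. (b e m \<omega> - (b1 m \<omega> + b2 m \<omega>)) + (b1 m \<omega> + b2 m \<omega>))"
    by (intro moment_order_add order_b1 order_b2 moment_order_weaken[OF order_b_diff]) simp
  then show ?thesis by simp
qed

lemma order_outer_b_diff:
  "moment_order M (3/2) (\<lambda>m \<omega>. outer (b e m \<omega>) (b e m \<omega>) - outer (b1 m \<omega> + b2 m \<omega>) (b1 m \<omega> + b2 m \<omega>))"
proof -
  let ?c = "\<lambda>m \<omega>. b1 m \<omega> + b2 m \<omega>"
  have 1: "moment_order M (1 + 1/2) (\<lambda>m \<omega>. outer (b e m \<omega> - ?c m \<omega>) (b e m \<omega>))"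
    by (intro moment_order_outer order_b_diff order_b)
  have 2: "moment_order M (1/2 + 1) (\<lambda>m \<omega>. outer (?c m \<omega>) (b e m \<omega> - ?c m \<omega>))"
    by (intro moment_order_outer order_b_diff moment_order_add order_b1 order_b2)
  have eq: "outer (b e m \<omega>) (b e m \<omega>) - outer (?c m \<omega>) (?c m \<omega>)
     = outer (b e m \<omega> - ?c m \<omega>) (b e m \<omega>) + outer (?c m \<omega>) (b e m \<omega> - ?c m \<omega>)" for m \<omega>
    by (simp add: bounded_bilinear.diff_left[OF bounded_bilinear_outer]
        bounded_bilinear.diff_right[OF bounded_bilinear_outer])
  show ?thesis unfolding eq by (intro moment_order_add) (use 1 2 in simp_all)
qed

subsection \<open>Independence of the area of interest from the others\<close>

lemma rest_product:
  fixes f :: "(nat \<Rightarrow> real^'k) \<Rightarrow> real" and g :: "real^'k \<Rightarrow> real"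
  assumes f: "f \<in> borel_measurable (PiM ({1..m} - {a}) (\<lambda>_. borel))" and g: "g \<in> borel_measurable borel"
    and fi: "integrable M (\<lambda>\<omega>. f (\<lambda>i\<in>{1..m} - {a}. u i \<omega>))" and gi: "integrable M (\<lambda>\<omega>. g (u a \<omega>))"
  shows "integrable M (\<lambda>\<omega>. f (\<lambda>i\<in>{1..m} - {a}. u i \<omega>) * g (u a \<omega>))"
    and "expectation (\<lambda>\<omega>. f (\<lambda>i\<in>{1..m} - {a}. u i \<omega>) * g (u a \<omega>))
      = expectation (\<lambda>\<omega>. f (\<lambda>i\<in>{1..m} - {a}. u i \<omega>)) * expectation (\<lambda>\<omega>. g (u a \<omega>))"
proof -
  have [measurable]: "(\<lambda>z. z a) \<in> measurable (PiM {a} (\<lambda>_. borel)) (borel :: (real^'k) measure)"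
    by simp
  have "indep_var borel (\<lambda>\<omega>. f (\<lambda>i\<in>{1..m} - {a}. u i \<omega>)) borel (\<lambda>\<omega>. (\<lambda>z. g (z a)) (\<lambda>i\<in>{a}. u i \<omega>))"
    by (rule indep_vars_disjoint_functions[OF indep_u _ _ _ f])
       (use a g in \<open>auto intro!: measurable_compose[OF _ g]\<close>)
  then have "indep_var borel (\<lambda>\<omega>. f (\<lambda>i\<in>{1..m} - {a}. u i \<omega>)) borel (\<lambda>\<omega>. g (u a \<omega>))" by simp
  from indep_var_integrable[OF this fi gi] indep_var_lebesgue_integral[OF this fi gi]
  show "integrable M (\<lambda>\<omega>. f (\<lambda>i\<in>{1..m} - {a}. u i \<omega>) * g (u a \<omega>))"
    "expectation (\<lambda>\<omega>. f (\<lambda>i\<in>{1..m} - {a}. u i \<omega>) * g (u a \<omega>))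
      = expectation (\<lambda>\<omega>. f (\<lambda>i\<in>{1..m} - {a}. u i \<omega>)) * expectation (\<lambda>\<omega>. g (u a \<omega>))" .
qed

text \<open>\<open>A\<close> as a function of the errors of the other areas, the form in which
  independence from \<open>u a\<close> can be applied.\<close>

definition Am :: "nat \<Rightarrow> (nat \<Rightarrow> real^'k) \<Rightarrow> real^'k^'k" where
  "Am m z = (1 / real m) *\<^sub>R (\<Sum>i\<in>{1..m} - {a}. outer (z i) (z i) - Sg i)"

lemma A_Am: "A m \<omega> = Am m (\<lambda>i\<in>{1..m} - {a}. u i \<omega>)"
  by (simp add: A_def Am_def Z_def)

lemma Am_measurable[measurable]: "Am m \<in> borel_measurable (PiM ({1..m} - {a}) (\<lambda>_. borel))"
  unfolding Am_def[abs_def]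
  by (intro borel_measurable_scaleR borel_measurable_sum borel_measurable_diff borel_measurable_outer
      measurable_component_singleton borel_measurable_const)

lemma A_sym: "transpose (A m \<omega>) = A m \<omega>"
  unfolding A_def transpose_scaleR transpose_sum
  by (intro arg_cong2[of _ _ _ _ scaleR] sum.cong refl) (simp add: Z_def transpose_diff transpose_outer Sg_sym)

lemma transpose_Lf: "transpose Lf = Rt"
  by (simp add: Lf_def Rt_def matrix_transpose_mul W_sym D_sym[OF a])

lemma A_entries_integrable:
  "\<forall>\<^sub>F m in sequentially. \<forall>b p q c. integrable M (\<lambda>\<omega>. A m \<omega> $ b $ p * A m \<omega> $ q $ c)"
proof (intro eventually_all_finite)
  fix b p q c
  have "moment_order M (1/2 + 1/2) (\<lambda>m \<omega>. A m \<omega> $ b $ p * A m \<omega> $ q $ c)"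
    by (rule moment_order_mult[OF moment_order_linear[OF bounded_linear_matrix_entry order_A]
          moment_order_linear[OF bounded_linear_matrix_entry order_A]])
  then show "\<forall>\<^sub>F m in sequentially. integrable M (\<lambda>\<omega>. A m \<omega> $ b $ p * A m \<omega> $ q $ c)"
    by (rule moment_order_integrable)
qed

text \<open>The product is \<open>Lf ** A ** K ** A ** Rt\<close> with
  \<open>K = W ** outer (u a) (u a) ** W\<close>. Since \<open>K\<close> is independent of
  \<open>A\<close> and has mean \<open>W ** Sg a ** W = W\<close>, it may be replaced by
  \<open>W\<close> under the integral.\<close>

lemma integral_b1_b1:
  "\<forall>\<^sub>F m in sequentially. integrable M (\<lambda>\<omega>. outer (b1 m \<omega>) (b1 m \<omega>)) \<and>
     (\<integral>\<omega>. outer (b1 m \<omega>) (b1 m \<omega>) \<partial>M) = Lf ** (\<integral>\<omega>. A m \<omega> ** W ** A m \<omega> \<partial>M) ** Rt"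
  using A_entries_integrable
proof eventually_elim
  case (elim m)
  define K where "K = (\<lambda>z. W ** outer z z ** W)"
  have K[measurable]: "K \<in> borel_measurable borel" unfolding K_def by measurable
  have Ki: "integrable M (\<lambda>\<omega>. K (u a \<omega>))" and KI: "(\<integral>\<omega>. K (u a \<omega>) \<partial>M) = W"
    using integral_sandwich[OF integral_outer_u(1)[OF a a], of W W] integral_outer_u(2)[OF a a]
    by (simp_all add: K_def W_Sg)
  note Ke = integral_matrix_entry[OF Ki, unfolded KI]
  have entry: "(A m \<omega> ** F ** A m \<omega>) $ b $ c = (\<Sum>q\<in>UNIV. \<Sum>p\<in>UNIV. (A m \<omega> $ b $ p * A m \<omega> $ q $ c) * F $ p $ q)"
    for \<omega> b c and F :: "real^'k^'k"
    by (simp add: matrix_matrix_mult_def sum_distrib_left sum_distrib_right mult_ac)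
  \<comment> \<open>Every entry is a product of a function of the other areas and a function of
    \<open>u a\<close>, so that independence can be applied to scalars.\<close>
  have prod: "integrable M (\<lambda>\<omega>. (A m \<omega> $ b $ p * A m \<omega> $ q $ c) * K (u a \<omega>) $ p $ q) \<and>
     expectation (\<lambda>\<omega>. (A m \<omega> $ b $ p * A m \<omega> $ q $ c) * K (u a \<omega>) $ p $ q)
       = expectation (\<lambda>\<omega>. A m \<omega> $ b $ p * A m \<omega> $ q $ c) * W $ p $ q" for b p q c
  proof -
    have f: "(\<lambda>z. Am m z $ b $ p * Am m z $ q $ c) \<in> borel_measurable (PiM ({1..m} - {a}) (\<lambda>_. borel))"
      by measurable
    have g: "(\<lambda>z. K z $ p $ q) \<in> borel_measurable borel" by measurable
    have i: "integrable M (\<lambda>\<omega>. Am m (\<lambda>i\<in>{1..m} - {a}. u i \<omega>) $ b $ p * Am m (\<lambda>i\<in>{1..m} - {a}. u i \<omega>) $ q $ c)"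
      using elim unfolding A_Am by blast
    from rest_product[OF f g i Ke(1)] show ?thesis unfolding A_Am Ke(2) by blast
  qed
  have iK: "integrable M (\<lambda>\<omega>. A m \<omega> ** K (u a \<omega>) ** A m \<omega>)"
    by (rule integrable_matI, unfold entry) (use prod in \<open>intro Bochner_Integration.integrable_sum, blast\<close>)
  have IK: "(\<integral>\<omega>. A m \<omega> ** K (u a \<omega>) ** A m \<omega> \<partial>M) = (\<integral>\<omega>. A m \<omega> ** W ** A m \<omega> \<partial>M)"
    unfolding vec_eq_iff integral_matrix_entry(2)[OF iK] integral_matrix_entry(2)[OF integral_A_W_A(1)]
  proof (intro allI)
    fix b c
    have "expectation (\<lambda>\<omega>. (A m \<omega> ** K (u a \<omega>) ** A m \<omega>) $ b $ c)
       = (\<Sum>q\<in>UNIV. \<Sum>p\<in>UNIV. expectation (\<lambda>\<omega>. A m \<omega> $ b $ p * A m \<omega> $ q $ c) * W $ p $ q)"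
      unfolding entry using prod by simp
    also have "\<dots> = expectation (\<lambda>\<omega>. (A m \<omega> ** W ** A m \<omega>) $ b $ c)"
      unfolding entry using elim by simp
    finally show "expectation (\<lambda>\<omega>. (A m \<omega> ** K (u a \<omega>) ** A m \<omega>) $ b $ c)
      = expectation (\<lambda>\<omega>. (A m \<omega> ** W ** A m \<omega>) $ b $ c)" .
  qed
  have eq: "outer (b1 m \<omega>) (b1 m \<omega>) = Lf ** (A m \<omega> ** K (u a \<omega>) ** A m \<omega>) ** Rt" for \<omega>
    by (simp add: b1_def outer_mult K_def matrix_transpose_mul W_sym A_sym transpose_Lf matrix_mul_assoc)
  show ?case unfolding eq using integral_sandwich[OF iK, of Lf Rt] IK by simp
qed

section \<open>Moments of the least squares part of the plug-in error\<close>

definition L :: "nat \<Rightarrow> nat \<Rightarrow> real^'k^'k" where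
  "L m i = Lf ** X a ** I0 m ** (transpose (X i) ** U i)"

lemma b2_L: "b2 m \<omega> = (\<Sum>i\<in>{1..m}. L m i *v u i \<omega>)"
  by (simp add: b2_def eta0_def S0_def L_def bounded_bilinear.sum_right[OF bounded_bilinear_matrix_vector_mult]
      matrix_vector_mul_assoc matrix_mul_assoc)

definition b2r :: "nat \<Rightarrow> 'w \<Rightarrow> real^'k" where
  "b2r m \<omega> = (\<Sum>i\<in>{1..m} - {a}. L m i *v u i \<omega>)"

lemma b2_split: "m \<ge> a \<Longrightarrow> b2 m \<omega> = L m a *v u a \<omega> + b2r m \<omega>"
  unfolding b2_L b2r_def using a by (intro sum.remove) auto

lemma order_L_u: "moment_order M 1 (\<lambda>m \<omega>. L m a *v u a \<omega>)"
proof -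
  have "moment_order M (1 + 0) (\<lambda>m \<omega>. L m a *v u a \<omega>)"
    unfolding L_def
    by (intro moment_order_matrix_vector order_const_right order_const_left order_I0 order_u a)
  then show ?thesis by simp
qed

lemma order_b2r: "moment_order M (1/2) b2r"
proof (rule moment_order_cong)
  show "moment_order M (1/2) (\<lambda>m \<omega>. b2 m \<omega> - L m a *v u a \<omega>)"
    by (intro moment_order_diff order_b2 moment_order_weaken[OF order_L_u]) simp
  show "\<forall>\<^sub>F m in sequentially. \<forall>\<omega>. b2r m \<omega> = b2 m \<omega> - L m a *v u a \<omega>"
    using eventually_ge_at_top[of a] by eventually_elim (simp add: b2_split)
qed

lemma order_b1_b2r: "moment_order M 1 (\<lambda>m \<omega>. outer (b1 m \<omega>) (b2r m \<omega>))"
  using moment_order_outer[OF order_b1 order_b2r] by simp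

text \<open>\<open>b1\<close> is linear in \<open>u a\<close>, and everything else in the product
  depends on the other areas only, so the vanishing mean of \<open>u a\<close> factors out.\<close>

lemma integral_b1_b2r:
  "\<forall>\<^sub>F m in sequentially. (\<integral>\<omega>. outer (b1 m \<omega>) (b2r m \<omega>) \<partial>M) = 0"
proof -
  have "\<forall>\<^sub>F m in sequentially. \<forall>p q c. integrable M (\<lambda>\<omega>. (Lf ** A m \<omega> ** W) $ p $ c * b2r m \<omega> $ q)"
  proof (intro eventually_all_finite)
    fix p q c
    have "moment_order M (1/2 + 1/2) (\<lambda>m \<omega>. (Lf ** A m \<omega> ** W) $ p $ c * b2r m \<omega> $ q)"
      by (rule moment_order_mult[OF moment_order_linear[OF bounded_linear_matrix_entry
          order_const_right[OF order_const_left[OF order_A]]] moment_order_nth[OF order_b2r]])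
    then show "\<forall>\<^sub>F m in sequentially. integrable M (\<lambda>\<omega>. (Lf ** A m \<omega> ** W) $ p $ c * b2r m \<omega> $ q)"
      by (rule moment_order_integrable)
  qed
  then show ?thesis using moment_order_integrable[OF order_b1_b2r]
  proof eventually_elim
    case (elim m)
    define fr where "fr = (\<lambda>z p q c. (Lf ** Am m z ** W) $ p $ c * (\<Sum>i\<in>{1..m} - {a}. L m i *v z i) $ q)"
    have frm: "(\<lambda>z. fr z p q c) \<in> borel_measurable (PiM ({1..m} - {a}) (\<lambda>_. borel))" for p q c
      unfolding fr_def
      by (intro borel_measurable_times measurable_compose[OF _ borel_measurable_matrix_entry]
          measurable_compose[OF _ borel_measurable_vec_entry] borel_measurable_matrix_mult
          borel_measurable_sum borel_measurable_matrix_vector Am_measurable borel_measurable_const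
          measurable_component_singleton)
    have fr: "fr (\<lambda>i\<in>{1..m} - {a}. u i \<omega>) p q c = (Lf ** A m \<omega> ** W) $ p $ c * b2r m \<omega> $ q" for \<omega> p q c
      by (simp add: fr_def A_Am b2r_def)
    have p: "integrable M (\<lambda>\<omega>. (Lf ** A m \<omega> ** W) $ p $ c * b2r m \<omega> $ q * u a \<omega> $ c) \<and>
       expectation (\<lambda>\<omega>. (Lf ** A m \<omega> ** W) $ p $ c * b2r m \<omega> $ q * u a \<omega> $ c) = 0" for p q c
    proof -
      have i: "integrable M (\<lambda>\<omega>. fr (\<lambda>i\<in>{1..m} - {a}. u i \<omega>) p q c)" unfolding fr using elim by blast
      note r = rest_product[OF frm borel_measurable_vec_entry i u_component_mean(1)[OF a], of c]
      show ?thesis using r u_component_mean(2)[OF a, of c] unfolding fr by simp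
    qed
    have entry: "outer (b1 m \<omega>) (b2r m \<omega>) $ p $ q
       = (\<Sum>c\<in>UNIV. (Lf ** A m \<omega> ** W) $ p $ c * b2r m \<omega> $ q * u a \<omega> $ c)" for \<omega> p q
    proof -
      have "outer (b1 m \<omega>) (b2r m \<omega>) $ p $ q = (\<Sum>c\<in>UNIV. (Lf ** A m \<omega> ** W) $ p $ c * u a \<omega> $ c) * b2r m \<omega> $ q"
        by (simp add: outer_def b1_def matrix_vector_mult_def)
      then show ?thesis by (simp add: sum_distrib_left sum_distrib_right mult_ac)
    qed
    show ?case
      unfolding vec_eq_iff integral_matrix_entry(2)[OF elim(2)] entry using p by simp
  qed
qed

text \<open>The covariances reduce \<open>U i ** Sg i ** U i\<close> to \<open>U i\<close>; the sum
  over the areas is then the information at \<open>\<Psi>\<close>, which cancels one of the two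
  factors \<open>I0\<close>.\<close>

lemma integral_b2_b2:
  "\<forall>\<^sub>F m in sequentially. integrable M (\<lambda>\<omega>. outer (b2 m \<omega>) (b2 m \<omega>)) \<and>
     (\<integral>\<omega>. outer (b2 m \<omega>) (b2 m \<omega>) \<partial>M) = G2 X D m a \<Psi>"
  using gls_info_inverse
proof eventually_elim
  case (elim m)
  have inv: "invertible (gls_info X D m \<Psi>)" using elim Psi_psd by blast
  have I0s: "transpose (I0 m) = I0 m"
    unfolding I0_def by (rule transpose_matrix_inv[OF inv gls_info_sym[OF Psi_psd]])
  note l = integral_outer_linear_forms[of "{1..m}" "{1..m}" "L m" "L m"]
  have "(\<integral>\<omega>. outer (b2 m \<omega>) (b2 m \<omega>) \<partial>M) = (\<Sum>i\<in>{1..m}. L m i ** Sg i ** transpose (L m i))"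
    unfolding b2_L using l(2) by simp
  also have "\<dots> = (\<Sum>i\<in>{1..m}. (Lf ** X a ** I0 m) ** (transpose (X i) ** U i ** X i) ** (I0 m ** transpose (X a) ** Rt))"
  proof (intro sum.cong refl)
    fix i assume "i \<in> {1..m}"
    then have i: "i \<ge> 1" by simp
    have Us: "transpose (U i) = U i" unfolding U_def by (rule inv_Sg_sym[OF i])
    have UU: "F ** U i ** Sg i = F" for F :: "real^'k^'k"
      using matrix_inv_left[OF Sg_invertible[OF i]] by (simp add: U_def matrix_mul_assoc[symmetric])
    show "L m i ** Sg i ** transpose (L m i)
      = (Lf ** X a ** I0 m) ** (transpose (X i) ** U i ** X i) ** (I0 m ** transpose (X a) ** Rt)"
      by (simp add: L_def matrix_transpose_mul Us I0s transpose_Lf matrix_mul_assoc UU)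
  qed
  also have "\<dots> = (Lf ** X a ** I0 m) ** gls_info X D m \<Psi> ** (I0 m ** transpose (X a) ** Rt)"
    by (simp add: gls_info_def matrix_mult_sum_left matrix_mult_sum_right U_def Sg_def)
  also have "\<dots> = Lf ** X a ** (I0 m ** gls_info X D m \<Psi>) ** I0 m ** transpose (X a) ** Rt"
    by (simp add: matrix_mul_assoc)
  also have "I0 m ** gls_info X D m \<Psi> = mat 1"
    unfolding I0_def by (rule matrix_inv_left[OF inv])
  finally have "(\<integral>\<omega>. outer (b2 m \<omega>) (b2 m \<omega>) \<partial>M) = G2 X D m a \<Psi>"
    by (simp add: G2_Psi)
  moreover have "integrable M (\<lambda>\<omega>. outer (b2 m \<omega>) (b2 m \<omega>))"
    unfolding b2_L using l(1) by simp
  ultimately show ?case by simp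
qed

text \<open>In the mixed moment only the summand of area \<open>a\<close> in \<open>b2\<close>
  survives. It has order 1, and together with the order \<open>1/2\<close> of \<open>b1\<close> it
  is negligible.\<close>

lemma integral_outer_b0:
  "(\<lambda>m. norm ((\<integral>\<omega>. outer (b1 m \<omega> + b2 m \<omega>) (b1 m \<omega> + b2 m \<omega>) \<partial>M)
      - (Lf ** (\<integral>\<omega>. A m \<omega> ** W ** A m \<omega> \<partial>M) ** Rt + G2 X D m a \<Psi>))) \<in> O(\<lambda>m. real m powr (-3/2))"
proof -
  let ?c = "\<lambda>m \<omega>. outer (b1 m \<omega>) (L m a *v u a \<omega>)"
  have oc: "moment_order M (3/2) ?c" using moment_order_outer[OF order_b1 order_L_u] by simp
  have "\<forall>\<^sub>F m in sequentially. norm ((\<integral>\<omega>. outer (b1 m \<omega> + b2 m \<omega>) (b1 m \<omega> + b2 m \<omega>) \<partial>M)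
      - (Lf ** (\<integral>\<omega>. A m \<omega> ** W ** A m \<omega> \<partial>M) ** Rt + G2 X D m a \<Psi>))
      = norm ((\<integral>\<omega>. ?c m \<omega> \<partial>M) + transpose (\<integral>\<omega>. ?c m \<omega> \<partial>M))"
    using integral_b1_b1 integral_b2_b2 integral_b1_b2r moment_order_integrable[OF order_b1_b2r]
      moment_order_integrable[OF oc] eventually_ge_at_top[of a]
  proof eventually_elim
    case (elim m)
    have i12: "integrable M (\<lambda>\<omega>. outer (b1 m \<omega>) (b2 m \<omega>))"
      and I12: "(\<integral>\<omega>. outer (b1 m \<omega>) (b2 m \<omega>) \<partial>M) = (\<integral>\<omega>. ?c m \<omega> \<partial>M)"
      using elim by (simp_all add: b2_split bounded_bilinear.add_right[OF bounded_bilinear_outer])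
    have tr: "transpose (outer (b1 m \<omega>) (b2 m \<omega>)) = outer (b2 m \<omega>) (b1 m \<omega>)" for \<omega>
      by (rule transpose_outer)
    note t = integrable_bounded_linear_image[OF bounded_linear_transpose i12, unfolded tr]
    have "outer (b1 m \<omega> + b2 m \<omega>) (b1 m \<omega> + b2 m \<omega>) = outer (b1 m \<omega>) (b1 m \<omega>) + outer (b2 m \<omega>) (b2 m \<omega>)
        + (outer (b1 m \<omega>) (b2 m \<omega>) + outer (b2 m \<omega>) (b1 m \<omega>))" for \<omega>
      by (simp add: bounded_bilinear.add_right[OF bounded_bilinear_outer]
          bounded_bilinear.add_left[OF bounded_bilinear_outer])
    then have "(\<integral>\<omega>. outer (b1 m \<omega> + b2 m \<omega>) (b1 m \<omega> + b2 m \<omega>) \<partial>M)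
      = (\<integral>\<omega>. outer (b1 m \<omega>) (b1 m \<omega>) \<partial>M) + (\<integral>\<omega>. outer (b2 m \<omega>) (b2 m \<omega>) \<partial>M)
       + ((\<integral>\<omega>. outer (b1 m \<omega>) (b2 m \<omega>) \<partial>M) + (\<integral>\<omega>. outer (b2 m \<omega>) (b1 m \<omega>) \<partial>M))"
      using elim(1,2) i12 t(1) by simp
    then show ?case using elim(1,2) I12 t(2) by simp
  qed
  moreover have "(\<lambda>m. norm ((\<integral>\<omega>. ?c m \<omega> \<partial>M) + transpose (\<integral>\<omega>. ?c m \<omega> \<partial>M))) \<in> O(\<lambda>m. real m powr (-3/2))"
    using moment_order_expectation[OF oc] by (intro O_norm_add) (simp_all add: norm_transpose)
  ultimately show ?thesis by (rule O_cong_eventually[rotated])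
qed

subsection \<open>The error of the Bayes predictor\<close>

lemma integral_outer_centered_normal:
  fixes ZZ :: "'w \<Rightarrow> real^'k"
  assumes Z: "\<And>c. centered_normal M (\<lambda>\<omega>. c \<bullet> ZZ \<omega>) (c \<bullet> (S *v c))" and S: "transpose S = S"
  shows "integrable M (\<lambda>\<omega>. outer (ZZ \<omega>) (ZZ \<omega>))" "(\<integral>\<omega>. outer (ZZ \<omega>) (ZZ \<omega>) \<partial>M) = S"
proof -
  have e: "integrable M (\<lambda>\<omega>. ZZ \<omega> $ i * ZZ \<omega> $ j)" "expectation (\<lambda>\<omega>. ZZ \<omega> $ i * ZZ \<omega> $ j) = S $ i $ j" for i j
    using centered_normal_covariance[OF Z S, of "axis i 1" "axis j 1"]
    by (simp_all add: inner_axis' matrix_vector_mult_basis column_def)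
  show i: "integrable M (\<lambda>\<omega>. outer (ZZ \<omega>) (ZZ \<omega>))"
    by (rule integrable_matI) (use e in \<open>simp add: outer_def\<close>)
  show "(\<integral>\<omega>. outer (ZZ \<omega>) (ZZ \<omega>) \<partial>M) = S"
    unfolding vec_eq_iff integral_matrix_entry(2)[OF i] using e by (simp add: outer_def)
qed

lemma integral_outer_eps_v:
  shows "integrable M (\<lambda>\<omega>. outer (\<epsilon> a \<omega>) (v a \<omega>))" "(\<integral>\<omega>. outer (\<epsilon> a \<omega>) (v a \<omega>) \<partial>M) = 0"
proof -
  have e: "integrable M (\<lambda>\<omega>. \<epsilon> a \<omega> $ i * v a \<omega> $ j) \<and> expectation (\<lambda>\<omega>. \<epsilon> a \<omega> $ i * v a \<omega> $ j) = 0" for i j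
  proof -
    have nv: "centered_normal M (\<lambda>\<omega>. axis j 1 \<bullet> v a \<omega>) (axis j 1 \<bullet> (\<Psi> *v axis j 1))"
      by (rule multivariate_normal_imp_centered_normal[OF v_normal[OF a]])
    have ne: "centered_normal M (\<lambda>\<omega>. axis i 1 \<bullet> \<epsilon> a \<omega>) (axis i 1 \<bullet> (D a *v axis i 1))"
      by (rule multivariate_normal_imp_centered_normal[OF eps_normal[OF a]])
    note mv = centered_normal_moments(2)[OF nv, of 1] centered_normal_moments(3)[OF nv]
    note me = centered_normal_moments(2)[OF ne, of 1] centered_normal_moments(3)[OF ne]
    have "indep_var borel ((\<lambda>z. z $ j) \<circ> v a) borel ((\<lambda>z. z $ i) \<circ> \<epsilon> a)"
      by (rule indep_var_compose[OF indep_v_eps[OF a]]) measurable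
    then have ind: "indep_var borel (\<lambda>\<omega>. v a \<omega> $ j) borel (\<lambda>\<omega>. \<epsilon> a \<omega> $ i)" by (simp add: comp_def)
    show ?thesis
      using indep_var_integrable[OF ind] indep_var_lebesgue_integral[OF ind] mv me
      by (simp add: inner_axis' mult.commute)
  qed
  show i: "integrable M (\<lambda>\<omega>. outer (\<epsilon> a \<omega>) (v a \<omega>))"
    by (rule integrable_matI) (use e in \<open>simp add: outer_def\<close>)
  show "(\<integral>\<omega>. outer (\<epsilon> a \<omega>) (v a \<omega>) \<partial>M) = 0"
    unfolding vec_eq_iff integral_matrix_entry(2)[OF i] using e by (simp add: outer_def)
qed

text \<open>In terms of the independent \<open>\<epsilon> a\<close> and \<open>v a\<close> the
  second moment is \<open>(mat 1 - Lf) ** D a ** (mat 1 - Rt) + Lf ** \<Psi> ** Rt\<close>; the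
  identity \<open>Sg a ** Rt = D a\<close> reduces it to \<open>D a - Lf ** D a\<close>.\<close>

lemma integral_err_err:
  "integrable M (\<lambda>\<omega>. outer (err \<omega>) (err \<omega>))" "(\<integral>\<omega>. outer (err \<omega>) (err \<omega>) \<partial>M) = G1 D a \<Psi>"
proof -
  let ?N = "mat 1 - Lf" and ?Nt = "mat 1 - Rt"
  have Nt: "transpose ?N = ?Nt" by (simp add: transpose_diff transpose_mat transpose_Lf)
  have err: "err \<omega> = ?N *v \<epsilon> a \<omega> - Lf *v v a \<omega>" for \<omega>
    by (simp add: err_def u_def matrix_vector_mult_diff_rdistrib matrix_vector_right_distrib)
  have tr: "transpose (?N ** outer (\<epsilon> a \<omega>) (v a \<omega>) ** Rt) = Lf ** outer (v a \<omega>) (\<epsilon> a \<omega>) ** ?Nt" for \<omega>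
    by (simp add: matrix_transpose_mul transpose_outer Nt transpose_Lf[symmetric] matrix_mul_assoc)
  have eq: "outer (err \<omega>) (err \<omega>) = ?N ** outer (\<epsilon> a \<omega>) (\<epsilon> a \<omega>) ** ?Nt + Lf ** outer (v a \<omega>) (v a \<omega>) ** Rt
     - (?N ** outer (\<epsilon> a \<omega>) (v a \<omega>) ** Rt + transpose (?N ** outer (\<epsilon> a \<omega>) (v a \<omega>) ** Rt))" for \<omega>
    unfolding err outer_diff_square outer_mult tr by (simp add: Nt transpose_Lf)
  note ee = integral_outer_centered_normal[OF multivariate_normal_imp_centered_normal[OF eps_normal[OF a]] D_sym[OF a]]
  note vv = integral_outer_centered_normal[OF multivariate_normal_imp_centered_normal[OF v_normal[OF a]] Psi_sym]
  note s1 = integral_sandwich[OF ee(1), of ?N ?Nt] and s2 = integral_sandwich[OF vv(1), of Lf Rt]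
    and s3 = integral_sandwich[OF integral_outer_eps_v(1), of ?N Rt]
  note s4 = integrable_bounded_linear_image[OF bounded_linear_transpose s3(1)]
  show "integrable M (\<lambda>\<omega>. outer (err \<omega>) (err \<omega>))"
    unfolding eq using s1 s2 s3 s4 by simp
  have "(\<integral>\<omega>. outer (err \<omega>) (err \<omega>) \<partial>M) = ?N ** D a ** ?Nt + Lf ** \<Psi> ** Rt"
    unfolding eq using s1 s2 s3 s4 ee(2) vv(2) integral_outer_eps_v(2)
    by (simp add: matrix_mult_zero_left matrix_mult_zero_right transpose_def vec_eq_iff)
  also have "\<dots> = D a - Lf ** D a - D a ** Rt + Lf ** (Sg a ** Rt)"
    by (simp add: Sg_def matrix_mult_algebra matrix_mul_assoc algebra_simps)
  also have "Sg a ** Rt = D a"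
    unfolding Rt_def by (simp add: matrix_mul_assoc W_Sg)
  also have "D a ** Rt = Lf ** D a" by (simp add: Lf_def Rt_def matrix_mul_assoc)
  finally show "(\<integral>\<omega>. outer (err \<omega>) (err \<omega>) \<partial>M) = G1 D a \<Psi>"
    by (simp add: G1_eq[OF Psi_psd] Lf_def W_def Sg_def)
qed

subsection \<open>Orthogonality of the Bayes error and functions of the data\<close>

text \<open>The coefficients of \<open>v i\<close> and \<open>\<epsilon> i\<close> are kept apart
  because the Bayes error weights the two differently. The characteristic function is a product of
  real numbers, so the sine has mean zero.\<close>

lemma linear_combination_char:
  fixes p r :: "nat \<Rightarrow> real^'k" and m :: nat
  defines "l \<equiv> \<lambda>\<omega>. \<Sum>i\<in>{1..m}. p i \<bullet> v i \<omega> + r i \<bullet> \<epsilon> i \<omega>"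
    and "s \<equiv> \<Sum>i\<in>{1..m}. p i \<bullet> (\<Psi> *v p i) + r i \<bullet> (D i *v r i)"
  shows "expectation (\<lambda>\<omega>. cos (l \<omega>)) = exp (- s / 2)" "expectation (\<lambda>\<omega>. sin (l \<omega>)) = 0"
    "l \<in> borel_measurable M"
proof -
  let ?I = "{1..m} <+> {1..m}"
  define F where "F = (\<lambda>j \<omega>. case_sum p r j \<bullet> case_sum v \<epsilon> j \<omega>)"
  define t where "t = case_sum (\<lambda>i. p i \<bullet> (\<Psi> *v p i)) (\<lambda>i. r i \<bullet> (D i *v r i))"
  have "indep_vars (\<lambda>_. borel) (case_sum v \<epsilon>) ?I"
    by (rule indep_vars_subset[OF indep]) auto
  then have ind: "indep_vars (\<lambda>_. borel) F ?I"
    unfolding F_def by (rule indep_vars_compose2) measurable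
  have n: "centered_normal M (F j) (t j)" if j: "j \<in> ?I" for j
  proof (cases j)
    case (Inl i)
    then have "i \<ge> 1" using j by auto
    from multivariate_normal_imp_centered_normal[OF v_normal[OF this]] show ?thesis
      using Inl by (simp add: F_def t_def)
  next
    case (Inr i)
    then have "i \<ge> 1" using j by auto
    from multivariate_normal_imp_centered_normal[OF eps_normal[OF this]] show ?thesis
      using Inr by (simp add: F_def t_def)
  qed
  have l: "l \<omega> = (\<Sum>j\<in>?I. F j \<omega>)" for \<omega>
    by (simp add: l_def F_def sum.Plus sum.distrib)
  have ts: "(\<Sum>j\<in>?I. t j) = s"
    by (simp add: s_def t_def sum.Plus sum.distrib)
  have "F j \<in> borel_measurable M" if "j \<in> ?I" for j using n[OF that] by (simp add: centered_normal_def)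
  then show lm[measurable]: "l \<in> borel_measurable M"
    unfolding l[abs_def] by (intro borel_measurable_sum) auto
  have "char (distr M borel l) 1 = (\<Prod>j\<in>?I. char (distr M borel (F j)) 1)"
    unfolding l[abs_def] by (rule char_distr_sum[OF ind])
  also have "\<dots> = (\<Prod>j\<in>?I. complex_of_real (exp (- t j / 2)))"
    by (intro prod.cong refl centered_normal_char n)
  also have "\<dots> = complex_of_real (\<Prod>j\<in>?I. exp (- t j / 2))" by simp
  also have "(\<Prod>j\<in>?I. exp (- t j / 2)) = exp (\<Sum>j\<in>?I. - t j / 2)"
    by (rule exp_sum[symmetric]) simp
  also have "(\<Sum>j\<in>?I. - t j / 2) = - s / 2"
    unfolding ts[symmetric] by (simp add: sum_negf sum_divide_distrib)
  finally have c: "(CLINT \<omega>|M. iexp (l \<omega>)) = complex_of_real (exp (- s / 2))"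
    by (simp add: char_def integral_distr)
  have i: "complex_integrable M (\<lambda>\<omega>. iexp (l \<omega>))"
    by (rule integrable_const_bound[of _ 1]) auto
  have "expectation (\<lambda>\<omega>. cos (l \<omega>)) = Re (CLINT \<omega>|M. iexp (l \<omega>))"
    by (subst integral_Re[OF i, symmetric]) (simp add: Re_exp)
  then show "expectation (\<lambda>\<omega>. cos (l \<omega>)) = exp (- s / 2)" unfolding c by simp
  have "expectation (\<lambda>\<omega>. sin (l \<omega>)) = Im (CLINT \<omega>|M. iexp (l \<omega>))"
    by (subst integral_Im[OF i, symmetric]) (simp add: Im_exp)
  then show "expectation (\<lambda>\<omega>. sin (l \<omega>)) = 0" unfolding c by simp
qed

text \<open>Product-to-sum formulas reduce both claims to \<open>Ls s\<close>, the linear form in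
  the \<open>u i\<close> plus \<open>s\<close> times a component of \<open>err\<close>. The sines
  have mean zero. The cosines have equal means at \<open>t\<close> and \<open>- t\<close> because
  the variance \<open>Q\<close> is even: its mixed term is the covariance of \<open>err\<close> with
  \<open>u a\<close>, which vanishes.\<close>

lemma err_component_orthogonal:
  fixes dv :: "nat \<Rightarrow> real^'k"
  assumes m: "m \<ge> a"
  shows "expectation (\<lambda>\<omega>. sin (t * (err \<omega> $ x)) * cos (\<Sum>i\<in>{1..m}. dv i \<bullet> u i \<omega>)) = 0"
    and "expectation (\<lambda>\<omega>. sin (t * (err \<omega> $ x)) * sin (\<Sum>i\<in>{1..m}. dv i \<bullet> u i \<omega>)) = 0"
proof -
  define c :: "real^'k" where "c = axis x 1"
  define r where "r = Rt *v c"
  let ?dl = "\<lambda>i. if i = a then (1::real) else 0"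
  define p where "p s i = dv i - (s * ?dl i) *\<^sub>R r" for s i
  define w where "w s i = dv i + (s * ?dl i) *\<^sub>R (c - r)" for s i
  define Ls where "Ls s \<omega> = (\<Sum>i\<in>{1..m}. p s i \<bullet> v i \<omega> + w s i \<bullet> \<epsilon> i \<omega>)" for s \<omega>
  define Q where "Q s = (\<Sum>i\<in>{1..m}. p s i \<bullet> (\<Psi> *v p s i) + w s i \<bullet> (D i *v w s i))" for s
  note ch = linear_combination_char[where m=m and p="p s" and r="w s" for s, folded Ls_def Q_def]
  have err: "err \<omega> $ x = (c - r) \<bullet> \<epsilon> a \<omega> - r \<bullet> v a \<omega>" for \<omega>
  proof -
    have "err \<omega> $ x = c \<bullet> err \<omega>" by (simp add: c_def inner_axis')
    also have "\<dots> = c \<bullet> \<epsilon> a \<omega> - r \<bullet> u a \<omega>"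
      unfolding err_def r_def inner_diff_right transpose_Lf[symmetric]
      using inner_transpose_mult[of "u a \<omega>" Lf c] by (simp add: inner_commute del: transpose_matrix_vector)
    finally show ?thesis by (simp add: u_def inner_add_right inner_diff_left)
  qed
  have L: "Ls s \<omega> = (\<Sum>i\<in>{1..m}. dv i \<bullet> u i \<omega>) + s * (err \<omega> $ x)" for s \<omega>
  proof -
    have "Ls s \<omega> = (\<Sum>i\<in>{1..m}. dv i \<bullet> u i \<omega> + (if i = a then s * ((c - r) \<bullet> \<epsilon> a \<omega> - r \<bullet> v a \<omega>) else 0))"
      unfolding Ls_def
      by (intro sum.cong refl) (auto simp: p_def w_def u_def inner_add_left inner_diff_left inner_add_right algebra_simps)
    also have "\<dots> = (\<Sum>i\<in>{1..m}. dv i \<bullet> u i \<omega>) + s * (err \<omega> $ x)"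
      using m a by (simp add: sum.distrib err)
    finally show ?thesis .
  qed
  have Q: "Q (- t) = Q t"
  proof -
    have "p (- t) i \<bullet> (\<Psi> *v p (- t) i) + w (- t) i \<bullet> (D i *v w (- t) i)
        = p t i \<bullet> (\<Psi> *v p t i) + w t i \<bullet> (D i *v w t i)" if "i \<in> {1..m}" for i
    proof (cases "i = a")
      case True
      have symP: "g \<bullet> (\<Psi> *v f) = f \<bullet> (\<Psi> *v g)" for f g
        using inner_transpose_mult[of g \<Psi> f] Psi_sym by (simp add: inner_commute)
      have symD: "g \<bullet> (D a *v f) = f \<bullet> (D a *v g)" for f g
        using inner_transpose_mult[of g "D a" f] D_sym[OF a] by (simp add: inner_commute)
      \<comment> \<open>The weights of the Bayes predictor solve this normal equation; it makes the
        mixed contributions through \<open>v a\<close> and \<open>\<epsilon> a\<close> cancel, so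
        the sign of \<open>s\<close> no longer matters.\<close>
      have "Sg a *v r = D a *v c"
        unfolding r_def Rt_def by (simp add: matrix_vector_mul_assoc matrix_mul_assoc W_Sg)
      then have "\<Psi> *v r = D a *v (c - r)"
        by (simp add: Sg_def matrix_vector_mult_add_rdistrib matrix_vector_mult_diff_distrib algebra_simps)
      then have key: "dv a \<bullet> (D a *v (c - r)) = dv a \<bullet> (\<Psi> *v r)" by simp
      have qP: "(dv a - s *\<^sub>R r) \<bullet> (\<Psi> *v (dv a - s *\<^sub>R r))
          = dv a \<bullet> (\<Psi> *v dv a) - 2 * (s * (dv a \<bullet> (\<Psi> *v r))) + s\<^sup>2 * (r \<bullet> (\<Psi> *v r))" for s
        unfolding matrix_vector_mult_diff_distrib matrix_vector_mult_scaleR inner_diff_left inner_diff_right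
          inner_scaleR_left inner_scaleR_right symP[of r "dv a"]
        by (simp add: power2_eq_square algebra_simps)
      have qD: "(dv a + s *\<^sub>R z) \<bullet> (D a *v (dv a + s *\<^sub>R z))
          = dv a \<bullet> (D a *v dv a) + 2 * (s * (dv a \<bullet> (D a *v z))) + s\<^sup>2 * (z \<bullet> (D a *v z))" for s z
        unfolding matrix_vector_right_distrib matrix_vector_mult_scaleR inner_add_left inner_add_right
          inner_scaleR_left inner_scaleR_right symD[of z "dv a"]
        by (simp add: power2_eq_square algebra_simps)
      show ?thesis
        unfolding p_def w_def True qP qD key by simp
    qed (simp add: p_def w_def)
    then show ?thesis unfolding Q_def by (rule sum.cong[OF refl])
  qed
  have [measurable]: "Ls s \<in> borel_measurable M" for s by (rule ch(3))
  have ic: "integrable M (\<lambda>\<omega>. cos (Ls s \<omega>))" "integrable M (\<lambda>\<omega>. sin (Ls s \<omega>))" for s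
    by (rule integrable_const_bound[of _ 1]; simp)+
  have e1: "sin (t * (err \<omega> $ x)) * cos (\<Sum>i\<in>{1..m}. dv i \<bullet> u i \<omega>) = 1/2 * (sin (Ls t \<omega>) - sin (Ls (- t) \<omega>))" for \<omega>
    unfolding L by (simp add: sin_add sin_diff)
  show "expectation (\<lambda>\<omega>. sin (t * (err \<omega> $ x)) * cos (\<Sum>i\<in>{1..m}. dv i \<bullet> u i \<omega>)) = 0"
    unfolding e1 using ic ch(2) by simp
  have e2: "sin (t * (err \<omega> $ x)) * sin (\<Sum>i\<in>{1..m}. dv i \<bullet> u i \<omega>) = 1/2 * (cos (Ls (- t) \<omega>) - cos (Ls t \<omega>))" for \<omega>
    unfolding L by (simp add: cos_add cos_diff)
  show "expectation (\<lambda>\<omega>. sin (t * (err \<omega> $ x)) * sin (\<Sum>i\<in>{1..m}. dv i \<bullet> u i \<omega>)) = 0"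
    unfolding e2 using ic ch(1) Q by simp
qed

text \<open>Solving the error decomposition for \<open>b\<close> gives an expression in the data,
  with \<open>\<beta>\<close> and \<open>\<Psi>\<close> as constants. The projection stands in for
  \<open>nnd_part\<close> because it is measurable.\<close>

definition bfun :: "estimator \<Rightarrow> nat \<Rightarrow> (nat \<Rightarrow> real^'k) \<Rightarrow> real^'k" where
  "bfun e m z = Lf *v (z a - X a *v \<beta>) - z a
     + theta_hat X D m a (closest_point {B. pos_semidef B} (Psi_hat e X D m z)) z"

text \<open>Restricting the family of errors to a finite index set changes its values outside
  \<open>1..m\<close>, which must not affect \<open>b\<close>.\<close>

lemma bfun_cong:
  assumes "m \<ge> a" "\<And>i. i \<in> {1..m} \<Longrightarrow> z i = z' i"
  shows "bfun e m z = bfun e m z'"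
proof -
  have a': "z a = z' a" using assms a by simp
  have o: "ols X m z = ols X m z'"
    unfolding ols_def using assms(2) by (intro arg_cong2[of _ _ _ _ "(*v)"] sum.cong refl) simp
  have "Psi0_hat X D m z = Psi0_hat X D m z'"
    unfolding Psi0_hat_def o using assms(2) by (intro arg_cong2[of _ _ _ _ scaleR] sum.cong refl) simp
  then have "Psi_hat e X D m z = Psi_hat e X D m z'"
    by (cases e) (simp_all add: Psi1_hat_def)
  moreover have "gls X D m F z = gls X D m F z'" for F
    unfolding gls_def using assms(2) by (intro arg_cong2[of _ _ _ _ "(*v)"] sum.cong refl) simp
  ultimately show ?thesis by (simp add: bfun_def theta_hat_def a')
qed

lemma bfun_measurable:
  assumes z: "\<And>i. i \<in> {1..m} \<Longrightarrow> (\<lambda>\<omega>. z \<omega> i) \<in> borel_measurable N" and m: "m \<ge> a"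
  shows "(\<lambda>\<omega>. bfun e m (z \<omega>)) \<in> borel_measurable N"
proof -
  have za[measurable]: "(\<lambda>\<omega>. z \<omega> a) \<in> borel_measurable N" using z[of a] m a by simp
  have [measurable]: "(\<lambda>\<omega>. ols X m (z \<omega>)) \<in> borel_measurable N"
    unfolding ols_def
    by (intro borel_measurable_matrix_vector borel_measurable_const borel_measurable_sum z)
  have 0[measurable]: "(\<lambda>\<omega>. Psi0_hat X D m (z \<omega>)) \<in> borel_measurable N"
    unfolding Psi0_hat_def
  proof (intro borel_measurable_scaleR borel_measurable_const borel_measurable_sum borel_measurable_diff)
    fix i assume "i \<in> {1..m}"
    note [measurable] = z[OF this]
    show "(\<lambda>\<omega>. outer (z \<omega> i - X i *v ols X m (z \<omega>)) (z \<omega> i - X i *v ols X m (z \<omega>))) \<in> borel_measurable N"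
      by measurable
  qed
  have "(\<lambda>\<omega>. Psi_hat e X D m (z \<omega>)) \<in> borel_measurable N"
    by (cases e) (simp_all add: Psi1_hat_def 0 borel_measurable_diff[OF 0 bias0_measurable[OF 0]])
  then have [measurable]: "(\<lambda>\<omega>. closest_point {B. pos_semidef B} (Psi_hat e X D m (z \<omega>))) \<in> borel_measurable N"
    by (rule measurable_compose[OF _ borel_measurable_closest_point_pos_semidef])
  define F where "F \<omega> = closest_point {B. pos_semidef B} (Psi_hat e X D m (z \<omega>))" for \<omega>
  have F[measurable]: "F \<in> borel_measurable N" unfolding F_def by measurable
  note [measurable] = gls_info_measurable[OF F]
  have s: "(\<lambda>\<omega>. \<Sum>i\<in>{1..m}. transpose (X i) *v (matrix_inv (F \<omega> + D i) *v z \<omega> i)) \<in> borel_measurable N"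
  proof (intro borel_measurable_sum)
    fix i assume "i \<in> {1..m}"
    note [measurable] = z[OF this]
    show "(\<lambda>\<omega>. transpose (X i) *v (matrix_inv (F \<omega> + D i) *v z \<omega> i)) \<in> borel_measurable N"
      by measurable
  qed
  have [measurable]: "(\<lambda>\<omega>. gls X D m (F \<omega>) (z \<omega>)) \<in> borel_measurable N"
    unfolding gls_def
    by (rule borel_measurable_matrix_vector[OF measurable_compose[OF gls_info_measurable[OF F] borel_measurable_matrix_inv] s])
  show ?thesis
    unfolding bfun_def theta_hat_def F_def[symmetric] by measurable
qed

lemma b_bfun: "\<forall>\<^sub>F m in sequentially. \<forall>\<omega>. b e m \<omega> = bfun e m (Y \<omega>)"
  using prediction_error[of e] Psi_hat_plus_eq[of e] gram_inverse eventually_ge_at_top[of a]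
proof eventually_elim
  case (elim m)
  show ?case
  proof
    fix \<omega>
    have "closest_point {B. pos_semidef B} (Psi_hat e X D m (Y \<omega>)) = P e m \<omega>"
      using Psi_hat_eq[of m e \<omega>] elim by (simp add: P_def)
    then have t: "theta_EB e X D m a (Y \<omega>)
        = theta_hat X D m a (closest_point {B. pos_semidef B} (Psi_hat e X D m (Y \<omega>))) (Y \<omega>)"
      using elim by (simp add: theta_EB_def)
    have "b e m \<omega> = theta_EB e X D m a (Y \<omega>) - (X a *v \<beta> + v a \<omega>) - err \<omega>"
      using elim(1) by simp
    then show "b e m \<omega> = bfun e m (Y \<omega>)"
      unfolding bfun_def t[symmetric] by (simp add: err_def y_eq_u[OF a] u_def algebra_simps)
  qed
qed

lemma order_err: "moment_order M 0 (\<lambda>m. err)"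
proof -
  have "moment_order M 0 (\<lambda>m. \<epsilon> a)"
  proof (rule moment_order_vec[OF prob_space_M], rule moment_order_fixed)
    fix i
    have n: "centered_normal M (\<lambda>\<omega>. \<epsilon> a \<omega> $ i) (axis i 1 \<bullet> (D a *v axis i 1))"
      using multivariate_normal_imp_centered_normal[OF eps_normal[OF a], of "axis i 1"] by (simp add: inner_axis')
    then show "(\<lambda>\<omega>. \<epsilon> a \<omega> $ i) \<in> borel_measurable M" by (simp add: centered_normal_def)
    show "integrable M (\<lambda>\<omega>. norm (\<epsilon> a \<omega> $ i) ^ p)" for p
      using centered_normal_moments(1)[OF n] by simp
  qed
  then show ?thesis
    unfolding err_def[abs_def] by (intro moment_order_diff order_const_left_vec order_u a)
qed

text \<open>The Bayes error is independent of all \<open>u i\<close>, and \<open>b\<close> is a function of them; this replaces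
  the usual argument through the location invariance of the estimators.\<close>

lemma integral_err_b:
  "\<forall>\<^sub>F m in sequentially. integrable M (\<lambda>\<omega>. outer (err \<omega>) (b e m \<omega>)) \<and> (\<integral>\<omega>. outer (err \<omega>) (b e m \<omega>) \<partial>M) = 0"
  using b_bfun[of e] moment_order_integrable[OF order_b[of e]]
    moment_order_integrable[OF moment_order_outer[OF order_err order_b[of e]]] eventually_ge_at_top[of a]
proof eventually_elim
  case (elim m)
  \<comment> \<open>The index set consists of pairs of area and component, as the Fourier criterion
    is stated for real coordinates.\<close>
  let ?J = "{1..m} \<times> (UNIV :: 'k set)"
  let ?U = "\<lambda>(i, c) \<omega>. u i \<omega> $ c"
  let ?z = "\<lambda>f i. X i *v \<beta> + (\<chi> c. f (i, c))"
  have bz: "b e m \<omega> = bfun e m (?z (\<lambda>j\<in>?J. ?U j \<omega>))" for \<omega>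
  proof -
    have "b e m \<omega> = bfun e m (Y \<omega>)" using elim(1) by simp
    also have "\<dots> = bfun e m (?z (\<lambda>j\<in>?J. ?U j \<omega>))"
      by (rule bfun_cong[OF elim(4)]) (simp add: y_eq_u vec_eq_iff)
    finally show ?thesis .
  qed
  have meas: "(\<lambda>f. bfun e m (?z f)) \<in> borel_measurable (PiM ?J (\<lambda>_. borel))"
  proof (rule bfun_measurable[OF _ elim(4)])
    fix i assume i: "i \<in> {1..m}"
    have "(\<lambda>f. \<chi> c. f (i, c)) \<in> borel_measurable (PiM ?J (\<lambda>_. borel :: real measure))"
      by (intro borel_measurable_euclidean_space[THEN iffD2])
         (use i in \<open>auto simp: Basis_vec_def inner_axis\<close>)
    then show "(\<lambda>f. ?z f i) \<in> borel_measurable (PiM ?J (\<lambda>_. borel))" by simp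
  qed
  have errm: "err \<in> borel_measurable M"
    using moment_order_measurable[OF order_err] by simp
  have "expectation (\<lambda>\<omega>. err \<omega> $ x * b e m \<omega> $ x') = 0" for x x'
  proof -
    define f where "f = (\<lambda>z. bfun e m (?z z) $ x')"
    have bf: "b e m \<omega> $ x' = f (\<lambda>j\<in>?J. ?U j \<omega>)" for \<omega> by (simp add: f_def bz)
    have dsum: "(\<Sum>j\<in>?J. dd j * ?U j \<omega>) = (\<Sum>i\<in>{1..m}. (\<chi> c. dd (i, c)) \<bullet> u i \<omega>)" for dd \<omega>
    proof -
      have "(\<Sum>j\<in>?J. dd j * ?U j \<omega>) = (\<Sum>(i, c)\<in>?J. dd (i, c) * u i \<omega> $ c)"
        by (intro sum.cong refl) auto
      also have "\<dots> = (\<Sum>i\<in>{1..m}. \<Sum>c\<in>UNIV. dd (i, c) * u i \<omega> $ c)"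
        by (rule sum.cartesian_product[symmetric])
      finally show ?thesis by (simp add: inner_vec_def)
    qed
    have "expectation (\<lambda>\<omega>. err \<omega> $ x * f (\<lambda>j\<in>?J. ?U j \<omega>)) = 0"
    proof (rule fourier_orthogonal)
      show "(\<lambda>\<omega>. err \<omega> $ x) \<in> borel_measurable M" using errm by measurable
      show "?U j \<in> borel_measurable M" if "j \<in> ?J" for j
        using that u_measurable by (cases j) (auto intro!: measurable_compose[OF _ borel_measurable_vec_entry])
      show "f \<in> borel_measurable (PiM ?J (\<lambda>_. borel))"
        unfolding f_def by (rule measurable_compose[OF meas borel_measurable_vec_entry])
      show "expectation (\<lambda>\<omega>. sin (t * (err \<omega> $ x)) * cos (\<Sum>j\<in>?J. dd j * ?U j \<omega>)) = 0"
        "expectation (\<lambda>\<omega>. sin (t * (err \<omega> $ x)) * sin (\<Sum>j\<in>?J. dd j * ?U j \<omega>)) = 0" for t dd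
        unfolding dsum by (rule err_component_orthogonal[OF elim(4)])+
      show "integrable M (\<lambda>\<omega>. f (\<lambda>j\<in>?J. ?U j \<omega>))"
        unfolding bf[symmetric] by (rule integrable_bounded_linear_image(1)[OF bounded_linear_vec_nth elim(2)])
      show "integrable M (\<lambda>\<omega>. err \<omega> $ x * f (\<lambda>j\<in>?J. ?U j \<omega>))"
        unfolding bf[symmetric] using integral_matrix_entry(1)[OF elim(3), of x x'] by (simp add: outer_def)
    qed simp
    then show ?thesis by (simp only: bf)
  qed
  then show ?case
    using elim(3) unfolding vec_eq_iff integral_matrix_entry(2)[OF elim(3)] by (simp add: outer_def)
qed

subsection \<open>The mean squared error\<close>

definition SE :: "estimator \<Rightarrow> nat \<Rightarrow> 'w \<Rightarrow> real^'k^'k" where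
  "SE e m \<omega> = outer (theta_EB e X D m a (Y \<omega>) - (X a *v \<beta> + v a \<omega>)) (theta_EB e X D m a (Y \<omega>) - (X a *v \<beta> + v a \<omega>))"

lemma SE_expectation:
  "\<forall>\<^sub>F m in sequentially. integrable M (SE e m) \<and> (\<integral>\<omega>. SE e m \<omega> \<partial>M) = G1 D a \<Psi> + (\<integral>\<omega>. outer (b e m \<omega>) (b e m \<omega>) \<partial>M)"
proof -
  have "moment_order M (1/2 + 1/2) (\<lambda>m \<omega>. outer (b e m \<omega>) (b e m \<omega>))"
    by (intro moment_order_outer order_b)
  from prediction_error[of e] integral_err_b[of e] moment_order_integrable[OF this]
  show ?thesis
  proof eventually_elim
    case (elim m)
    have eb: "integrable M (\<lambda>\<omega>. outer (err \<omega>) (b e m \<omega>))" using elim by simp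
    note t = integrable_bounded_linear_image[OF bounded_linear_transpose eb, unfolded transpose_outer]
    have SE: "SE e m \<omega> = outer (err \<omega>) (err \<omega>) + (outer (err \<omega>) (b e m \<omega>) + outer (b e m \<omega>) (err \<omega>)) + outer (b e m \<omega>) (b e m \<omega>)" for \<omega>
      using elim(1) by (simp add: SE_def bounded_bilinear.add_right[OF bounded_bilinear_outer]
          bounded_bilinear.add_left[OF bounded_bilinear_outer])
    have z: "(\<integral>\<omega>. outer (b e m \<omega>) (err \<omega>) \<partial>M) = 0"
      using t(2) elim(2) by (simp add: transpose_def vec_eq_iff)
    show ?case
      unfolding SE[abs_def] using eb t(1) elim(2,3) integral_err_err z by simp
  qed
qed

text \<open>The term \<open>Lf ** H a ** Rt\<close> divided by \<open>m\<^sup>2\<close> is the price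
  for leaving area \<open>a\<close> out of \<open>A\<close> in the second moment of
  \<open>b1\<close>.\<close>

lemma SE_expansion:
  "(\<lambda>m. norm ((\<integral>\<omega>. SE e m \<omega> \<partial>M) - (G1 D a \<Psi> + G3 D m a \<Psi> + G2 X D m a \<Psi>))) \<in> O(\<lambda>m. real m powr (-3/2))"
proof -
  let ?b0 = "\<lambda>m \<omega>. outer (b1 m \<omega> + b2 m \<omega>) (b1 m \<omega> + b2 m \<omega>)"
  let ?r = "\<lambda>m \<omega>. outer (b e m \<omega>) (b e m \<omega>) - ?b0 m \<omega>"
  let ?E = "\<lambda>m. (\<integral>\<omega>. ?b0 m \<omega> \<partial>M) - (Lf ** (\<integral>\<omega>. A m \<omega> ** W ** A m \<omega> \<partial>M) ** Rt + G2 X D m a \<Psi>)"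
  have o: "moment_order M (1/2 + 1/2) ?b0"
    by (intro moment_order_outer moment_order_add order_b1 order_b2)
  have "(\<lambda>m. norm (((\<integral>\<omega>. ?r m \<omega> \<partial>M) + ?E m) + (1 / (real m)\<^sup>2) *\<^sub>R (- (Lf ** H a ** Rt)))) \<in> O(\<lambda>m. real m powr (-3/2))"
    using moment_order_expectation[OF order_outer_b_diff[of e]]
    by (intro O_norm_add integral_outer_b0 O_norm_inverse_square) simp
  moreover have "\<forall>\<^sub>F m in sequentially. norm ((\<integral>\<omega>. SE e m \<omega> \<partial>M) - (G1 D a \<Psi> + G3 D m a \<Psi> + G2 X D m a \<Psi>))
     = norm (((\<integral>\<omega>. ?r m \<omega> \<partial>M) + ?E m) + (1 / (real m)\<^sup>2) *\<^sub>R (- (Lf ** H a ** Rt)))"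
    using SE_expectation[of e] moment_order_integrable[OF o]
      moment_order_integrable[OF order_outer_b_diff[of e]] eventually_ge_at_top[of a]
  proof eventually_elim
    case (elim m)
    have "(\<integral>\<omega>. outer (b e m \<omega>) (b e m \<omega>) \<partial>M) = (\<integral>\<omega>. ?r m \<omega> + ?b0 m \<omega> \<partial>M)" by simp
    also have "\<dots> = (\<integral>\<omega>. ?r m \<omega> \<partial>M) + (\<integral>\<omega>. ?b0 m \<omega> \<partial>M)"
      by (rule Bochner_Integration.integral_add[OF elim(3,2)])
    finally have 1: "(\<integral>\<omega>. outer (b e m \<omega>) (b e m \<omega>) \<partial>M) = (\<integral>\<omega>. ?r m \<omega> \<partial>M) + (\<integral>\<omega>. ?b0 m \<omega> \<partial>M)" .
    have 2: "G3 D m a \<Psi> = Lf ** (\<integral>\<omega>. A m \<omega> ** W ** A m \<omega> \<partial>M) ** Rt + (1 / (real m)\<^sup>2) *\<^sub>R (Lf ** H a ** Rt)"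
      using G3_Psi[OF elim(4)] by (simp add: algebra_simps)
    have 3: "g1 + (x + y') - (g1 + (w + h') + g2) = x + (y' - (w + g2)) + - h'" for g1 x y' w h' g2 :: "real^'k^'k"
      by (simp add: algebra_simps)
    show ?case
      unfolding elim(1)[THEN conjunct2] 1 2 scaleR_minus_right 3 ..
  qed
  ultimately show ?thesis by (rule O_cong_eventually)
qed

text \<open>A regrouping of \<open>msem\<close>: one \<open>G3\<close> goes with the first claim,
  the other is left to match the second moment of \<open>b1\<close>.\<close>

definition MS :: "estimator \<Rightarrow> nat \<Rightarrow> 'w \<Rightarrow> real^'k^'k" where
  "MS e m \<omega> = G134 e m \<omega> + G2P e m \<omega> + G3 D m a (P e m \<omega>)"

lemma integral_split_const:
  fixes F :: "nat \<Rightarrow> 'w \<Rightarrow> real^'k^'k"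
  assumes "moment_order M r (\<lambda>m \<omega>. F m \<omega> - c m)"
  shows "\<forall>\<^sub>F m in sequentially. integrable M (F m) \<and> (\<integral>\<omega>. F m \<omega> \<partial>M) = (\<integral>\<omega>. F m \<omega> - c m \<partial>M) + c m"
  using moment_order_integrable[OF assms]
proof eventually_elim
  case (elim m)
  have i: "integrable M (\<lambda>\<omega>. (F m \<omega> - c m) + c m)" using elim by (intro Bochner_Integration.integrable_add) auto
  then have i': "integrable M (F m)" by simp
  then show ?case by (simp add: prob_space)
qed

text \<open>The first claim reduces the mean of \<open>G134\<close> to \<open>G1 D a \<Psi>\<close>.
  As \<open>G2\<close> and the second \<open>G3\<close> may be evaluated at the truth, the sum is
  exactly the expansion of the mean squared error.\<close>

lemma MS_expectation:
  "\<forall>\<^sub>F m in sequentially. integrable M (MS e m)"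
  "(\<lambda>m. norm ((\<integral>\<omega>. MS e m \<omega> \<partial>M) - (\<integral>\<omega>. SE e m \<omega> \<partial>M))) \<in> O(\<lambda>m. real m powr (-3/2))"
proof -
  define d2 where "d2 m = (\<integral>\<omega>. G2P e m \<omega> - G2 X D m a \<Psi> \<partial>M)" for m
  define d3 where "d3 m = (\<integral>\<omega>. G3 D m a (P e m \<omega>) - G3 D m a \<Psi> \<partial>M)" for m
  note ev = integral_split_const[OF order_G2_diff[of e], folded d2_def]
    integral_split_const[OF order_G3_diff[of e], folded d3_def] G134_integrable[of e]
  have both: "\<forall>\<^sub>F m in sequentially. integrable M (MS e m) \<and> (\<integral>\<omega>. MS e m \<omega> \<partial>M)
     = (\<integral>\<omega>. G134 e m \<omega> \<partial>M) + (d2 m + G2 X D m a \<Psi>) + (d3 m + G3 D m a \<Psi>)"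
    using ev
  proof eventually_elim
    case (elim m)
    have "integrable M (MS e m)" unfolding MS_def[abs_def] using elim by simp
    moreover have "(\<integral>\<omega>. MS e m \<omega> \<partial>M) = (\<integral>\<omega>. G134 e m \<omega> \<partial>M) + (\<integral>\<omega>. G2P e m \<omega> \<partial>M) + (\<integral>\<omega>. G3 D m a (P e m \<omega>) \<partial>M)"
      unfolding MS_def using elim by simp
    ultimately show ?case using elim by simp
  qed
  then show "\<forall>\<^sub>F m in sequentially. integrable M (MS e m)" by eventually_elim simp
  let ?s = "\<lambda>m. (\<integral>\<omega>. SE e m \<omega> \<partial>M) - (G1 D a \<Psi> + G3 D m a \<Psi> + G2 X D m a \<Psi>)"
  have "(\<lambda>m. norm (- ?s m)) \<in> O(\<lambda>m. real m powr (-3/2))"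
    unfolding norm_minus_cancel by (rule SE_expansion)
  then have "(\<lambda>m. norm (((\<integral>\<omega>. G134 e m \<omega> \<partial>M) - G1 D a \<Psi>) + (d2 m + (d3 m + - ?s m)))) \<in> O(\<lambda>m. real m powr (-3/2))"
    using moment_order_expectation[OF order_G2_diff[of e], folded d2_def]
      moment_order_expectation[OF order_G3_diff[of e], folded d3_def]
    by (intro O_norm_add G134_expectation) simp_all
  moreover have "\<forall>\<^sub>F m in sequentially. norm ((\<integral>\<omega>. MS e m \<omega> \<partial>M) - (\<integral>\<omega>. SE e m \<omega> \<partial>M))
     = norm (((\<integral>\<omega>. G134 e m \<omega> \<partial>M) - G1 D a \<Psi>) + (d2 m + (d3 m + - ?s m)))"
    using both by eventually_elim (simp add: algebra_simps)
  ultimately show "(\<lambda>m. norm ((\<integral>\<omega>. MS e m \<omega> \<partial>M) - (\<integral>\<omega>. SE e m \<omega> \<partial>M))) \<in> O(\<lambda>m. real m powr (-3/2))"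
    by (rule O_cong_eventually)
qed

lemma msem_MS: "\<forall>\<^sub>F m in sequentially. \<forall>\<omega>. msem e X D m a (Y \<omega>) = MS e m \<omega>"
  using Psi_hat_plus_eq[of e]
  by eventually_elim (simp add: msem_def MS_def G134_def G2P_def Let_def scaleR_2)

end

text \<open>Integrability is part of the conclusion because the integral of a nonintegrable function
  is zero by convention, and the two error bounds would not express statements about expectations
  without it. Orders are taken of Frobenius norms, which in fixed dimension is the same as
  entrywise.\<close>

theorem theorem3:
  fixes M :: "'w measure"
    and X :: "nat \<Rightarrow> real^'s^'k" and D :: "nat \<Rightarrow> real^'k^'k"
    and \<beta> :: "real^'s" and \<Psi> :: "real^'k^'k" and Q :: "real^'s^'s"
    and v \<epsilon> y :: "nat \<Rightarrow> 'w \<Rightarrow> real^'k" and \<theta> :: "'w \<Rightarrow> real^'k"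
    and dl du :: real and a :: nat and e :: estimator
  assumes prob: "prob_space M"
    and Psi: "pos_semidef \<Psi>" "invertible \<Psi>"
    and D: "\<And>i. i \<ge> 1 \<Longrightarrow> pos_semidef (D i)"
    and v: "\<And>i. i \<ge> 1 \<Longrightarrow> multivariate_normal M (v i) 0 \<Psi>"
    and eps: "\<And>i. i \<ge> 1 \<Longrightarrow> multivariate_normal M (\<epsilon> i) 0 (D i)"
    and indep: "prob_space.indep_vars M (\<lambda>_. borel) (case_sum v \<epsilon>) ({1..} <+> {1..})"
    and y: "\<And>i \<omega>. i \<ge> 1 \<Longrightarrow> y i \<omega> = X i *v \<beta> + v i \<omega> + \<epsilon> i \<omega>"
    and D_bounds: "0 < dl" "0 < du"
      "\<And>i. i \<ge> 1 \<Longrightarrow> loewner_le (dl *\<^sub>R mat 1) (D i) \<and> loewner_le (D i) (du *\<^sub>R mat 1)"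
    and X_nonsing: "\<forall>\<^sub>F m in sequentially. invertible (gram X m)"
    and X_lim: "(\<lambda>m. (1 / real m) *\<^sub>R gram X m) \<longlonglongrightarrow> Q" "pos_def Q"
    and a: "a \<ge> 1"
    and theta: "\<And>\<omega>. \<theta> \<omega> = X a *v \<beta> + v a \<omega>"
  defines "Y \<equiv> \<lambda>\<omega> i. y i \<omega>"
  defines "G134 \<equiv> \<lambda>m \<omega>. let P = Psi_hat_plus e X D m (Y \<omega>) in
      G1 D a P + G3 D m a P + G4 e X D m a P"
    and "SE \<equiv> \<lambda>m \<omega>. outer (theta_EB e X D m a (Y \<omega>) - \<theta> \<omega>) (theta_EB e X D m a (Y \<omega>) - \<theta> \<omega>)"
  shows "(\<forall>\<^sub>F m in sequentially. integrable M (G134 m) \<and> integrable M (SE m) \<and>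
            integrable M (\<lambda>\<omega>. msem e X D m a (Y \<omega>))) \<and>
    (\<lambda>m. norm ((\<integral>\<omega>. G134 m \<omega> \<partial>M) - G1 D a \<Psi>)) \<in> O(\<lambda>m. real m powr (-3/2)) \<and>
    (\<lambda>m. norm ((\<integral>\<omega>. msem e X D m a (Y \<omega>) \<partial>M) - (\<integral>\<omega>. SE m \<omega> \<partial>M)))
      \<in> O(\<lambda>m. real m powr (-3/2))"
proof -
  obtain lam where lam: "lam > 0" "\<And>x. lam * (x \<bullet> x) \<le> x \<bullet> (\<Psi> *v x)"
    using pos_def_coercive[OF pos_semidef_invertible_imp_pos_def[OF Psi]] by blast
  obtain cQ where cQ: "cQ > 0" "\<And>x. cQ * (x \<bullet> x) \<le> x \<bullet> (Q *v x)"
    using pos_def_coercive[OF X_lim(2)] by blast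
  define Gm where "Gm m = (1 / real m) *\<^sub>R gram X m" for m
  have Glim: "Gm \<longlonglongrightarrow> Q" using X_lim(1) by (simp add: Gm_def[abs_def])
  have gram: "gram X m = real m *\<^sub>R Gm m" if "m > 0" for m using that by (simp add: Gm_def)
  \<comment> \<open>A perturbation of \<open>Q\<close> of norm below \<open>cQ / 2\<close> keeps
    half of the coercivity constant.\<close>
  have close: "\<forall>\<^sub>F m in sequentially. norm (Gm m - Q) < cQ / 2"
    using tendstoD[OF Glim, of "cQ / 2"] cQ(1) by (simp add: dist_norm)
  \<comment> \<open>The trace of the Gram matrix is the sum of the squared norms of the
    \<open>X i\<close>; the 1 leaves room around the limit.\<close>
  have tr: "\<forall>\<^sub>F m in sequentially. trace (Gm m) < trace Q + 1"
    using order_tendstoD(2)[OF bounded_linear.tendsto[OF bounded_linear_trace Glim], of "trace Q + 1"] by simp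
  have design: "\<forall>\<^sub>F m in sequentially. (\<forall>x. cQ / 2 * real m * (x \<bullet> x) \<le> x \<bullet> (gram X m *v x)) \<and>
        (\<Sum>i\<in>{1..m}. (norm (X i))\<^sup>2) \<le> (trace Q + 1) * real m"
    using close tr eventually_gt_at_top[of 0]
  proof eventually_elim
    case (elim m)
    have "cQ / 2 * real m * (x \<bullet> x) \<le> x \<bullet> (gram X m *v x)" for x
    proof -
      have "\<bar>x \<bullet> ((Gm m - Q) *v x)\<bar> \<le> norm x * (norm (Gm m - Q) * norm x)"
        by (rule order_trans[OF Cauchy_Schwarz_ineq2 mult_left_mono[OF norm_matrix_vector_mult_le]]) simp
      also have "\<dots> \<le> norm x * (cQ / 2 * norm x)"
        using elim(1) by (intro mult_left_mono mult_right_mono) auto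
      also have "\<dots> = cQ / 2 * (x \<bullet> x)" by (simp add: power2_norm_eq_inner[symmetric] power2_eq_square)
      finally have "cQ / 2 * (x \<bullet> x) \<le> x \<bullet> (Gm m *v x)"
        using cQ(2)[of x] unfolding matrix_vector_mult_diff_rdistrib inner_diff_right by linarith
      then have "real m * (cQ / 2 * (x \<bullet> x)) \<le> real m * (x \<bullet> (Gm m *v x))"
        by (intro mult_left_mono) auto
      then show ?thesis
        using elim(3) by (simp add: gram scaleR_matrix_vector_assoc[symmetric] mult_ac)
    qed
    moreover have "(\<Sum>i\<in>{1..m}. (norm (X i))\<^sup>2) \<le> (trace Q + 1) * real m"
    proof -
      have "(norm (X i))\<^sup>2 = trace (transpose (X i) ** X i)" for i
        unfolding power2_norm_eq_inner inner_vec_def trace_def matrix_matrix_mult_def transpose_def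
        by simp (rule sum.swap)
      then have "(\<Sum>i\<in>{1..m}. (norm (X i))\<^sup>2) = trace (gram X m)"
        by (simp add: gram_def linear_sum[OF bounded_linear.linear[OF bounded_linear_trace]])
      also have "\<dots> = real m * trace (Gm m)"
        using elim(3) by (simp add: gram linear_scale[OF bounded_linear.linear[OF bounded_linear_trace]])
      also have "\<dots> \<le> real m * (trace Q + 1)" using elim(2) by (intro mult_left_mono) auto
      finally show ?thesis by (simp add: mult.commute)
    qed
    ultimately show ?case by blast
  qed
  have D_low: "dl * (x \<bullet> x) \<le> x \<bullet> (D i *v x)" if "i \<ge> 1" for i x
    using D_bounds(3)[OF that]
    by (simp add: loewner_le_def pos_semidef_def matrix_vector_mult_diff_rdistrib inner_diff_right
        scaleR_matrix_vector_assoc[symmetric])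
  have D_norm: "norm (D i) \<le> (real CARD('k))\<^sup>2 * du" if "i \<ge> 1" for i
    using D_bounds that by (intro pos_semidef_norm_le D) auto
  interpret fh: fay_herriot M X D \<beta> \<Psi> v \<epsilon> y a lam dl "(real CARD('k))\<^sup>2 * du" "cQ / 2" "trace Q + 1"
  proof (intro fay_herriot.intro fay_herriot_axioms.intro)
    show "transpose \<Psi> = \<Psi>" using Psi(1) by (simp add: pos_semidef_def)
    show "transpose (D i) = D i" if "i \<ge> 1" for i using D[OF that] by (simp add: pos_semidef_def)
  qed (use prob lam D_bounds(1) D_low D_norm v eps indep y cQ(1) design a in auto)
  have G: "\<forall>\<^sub>F m in sequentially. G134 m = fh.G134 e m"
    using fh.Psi_hat_plus_eq[of e]
    by eventually_elim (auto simp: G134_def fh.G134_def Y_def Let_def)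
  have S: "SE m = fh.SE e m" for m
    by (simp add: SE_def fh.SE_def Y_def theta fun_eq_iff)
  have E: "\<forall>\<^sub>F m in sequentially. (\<lambda>\<omega>. msem e X D m a (Y \<omega>)) = fh.MS e m"
    using fh.msem_MS[of e] by eventually_elim (auto simp: Y_def)
  show ?thesis
  proof (intro conjI)
    show "\<forall>\<^sub>F m in sequentially. integrable M (G134 m) \<and> integrable M (SE m) \<and>
        integrable M (\<lambda>\<omega>. msem e X D m a (Y \<omega>))"
      using fh.G134_integrable[of e] fh.SE_expectation[of e] fh.MS_expectation(1)[of e] G E
      by eventually_elim (simp add: S)
    show "(\<lambda>m. norm ((\<integral>\<omega>. G134 m \<omega> \<partial>M) - G1 D a \<Psi>)) \<in> O(\<lambda>m. real m powr (-3/2))"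
      by (rule O_cong_eventually[OF fh.G134_expectation[of e]]) (use G in \<open>eventually_elim, simp\<close>)
    show "(\<lambda>m. norm ((\<integral>\<omega>. msem e X D m a (Y \<omega>) \<partial>M) - (\<integral>\<omega>. SE m \<omega> \<partial>M))) \<in> O(\<lambda>m. real m powr (-3/2))"
      by (rule O_cong_eventually[OF fh.MS_expectation(2)[of e]]) (use E in \<open>eventually_elim, simp add: S\<close>)
  qed
qed

end
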